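(* Let $m_1,m_2\in\mathbb{N}$ and let $R_L(z)$ be an $m_2\times m_1$ strictly proper rational matrix function which is contractive on $\mathbb{R}$ and has no poles on $\mathbb{C}_+$. Then $R_L(z)$ is the reflection coefficient of a self-adjoint Dirac system $$y'(x,z)=\mathrm{i}\big(zj+jV(x)\big)y(x,z),\quad x\ge 0,\qquad j=\begin{bmatrix} I_{m_1}&0\\0&-I_{m_2}\end{bmatrix},\quad V=\begin{bmatrix}0&v\\ v^*&0\end{bmatrix},$$ whose potential $V$ is recovered in the following way. Choose a minimal realization $$R_L(z)=\mathcal{C}(zI_n-\mathcal{A})^{-1}\mathcal{B}$$ of $R_L$. Then there is a strictly positive solution $X>0$ of the Riccati equation $$X\mathcal{C}^*\mathcal{C}X-\mathrm{i}(\mathcal{A}X-X\mathcal{A}^* )+\mathcal{B}\mathcal{B}^*=0.$$ Put $$A=\mathcal{A}+\mathrm{i}\mathcal{B}\mathcal{B}^*X^{-1},\quad S(0)=X,\quad \vartheta_1=\mathcal{B},\quad \vartheta_2=-\mathrm{i}X\mathcal{C}^*.$$ The matrix function $v$ which determines the potential $V$ is given by $$v(x)=-2\mathrm{i}\,\vartheta_1^*\mathrm{e}^{\mathrm{i}xA^*}S(x)^{-1}\mathrm{e}^{\mathrm{i}xA}\vartheta_2,$$ where $$S(x)=S(0)+\int_0^x\Lambda(t)\Lambda(t)^*dt,\qquad \Lambda(x)=\begin{bmatrix}\mathrm{e}^{-\mathrm{i}xA}\vartheta_1&\mathrm{e}^{\mathrm{i}xA}\vartheta_2\end{bmatrix}.$$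 Moreover, this $v$ satisfies $v\in L^2_{m_1\times m_2}(\mathbb{R}_+)$ and $v(x)\to 0$ as $x\to\infty$, and the Weyl function $\varphi(z)$ of the corresponding Dirac system coincides with $R_L(z)$ on $\mathbb{C}_+$.
   Context: $\mathbb{R}_+=[0,\infty)$; $\mathbb{C}_+$ is the open upper half-plane; $m=m_1+m_2$; $y'=\frac{d}{dx}y$; $I_k$ is the $k\times k$ identity matrix. $L^2_{m_1\times m_2}(\mathbb{R}_+)$ is the set of $m_1\times m_2$ matrix functions with square-integrable entries on $\mathbb{R}_+$. A rational matrix function $R$ is strictly proper if $R(z)\to0$ as $z\to\infty$; it is contractive at $z$ if $R(z)^*R(z)\le I_{m_1}$. Every strictly proper rational $m_2\times m_1$ matrix function admits a realization $\mathcal{C}(zI_n-\mathcal{A})^{-1}\mathcal{B}$ with $\mathcal{A}$ of size $n\times n$, $\mathcal{C}$ of size $m_2\times n$, $\mathcal{B}$ of size $n\times m_1$ (complex matrices); the realization is minimal if $n$ is the smallest possible among all realizations. Here the entries of $V$ need not be summable on $\mathbb{R}_+$. Jost solution: for $z\in\mathbb{R}$, $F_L(x,z)$ is the fundamental ($m\times m$ matrix) solution of the Dirac system such that $F_L(x,z)=\mathrm{e}^{\mathrm{i}xzj}(I_m+o(1))$ as $x\to\infty$ (unique when it exists). Put $Y(x,z)=\begin{bmatrix}Y_1(x,z)\\ Y_2(x,z)\end{bmatrix}:=F_L(x,z)\begin{bmatrix}I_{m_1}\\0\end{bmatrix}$, where $Y_1$ is $m_1\times m_1$ and $Y_2$ is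 $m_2\times m_1$. The reflection coefficient is $Y_2(0,z)Y_1(0,z)^{-1}$ for $z\in\mathbb{R}$ where this is defined. That a rational function $R_L$ is the reflection coefficient of the system means that for all $z\in\mathbb{R}$ outside a finite set the Jost solution exists, $Y_1(0,z)$ is invertible and $R_L(z)=Y_2(0,z)Y_1(0,z)^{-1}$. Weyl function: let $u(x,z)$ be the fundamental solution of the Dirac system with $u(0,z)=I_m$. The Weyl function of the self-adjoint Dirac system on $[0,\infty)$ (with locally summable $V$) is the $m_2\times m_1$ matrix function $\varphi$ on $\mathbb{C}_+$ such that $$\int_0^\infty\begin{bmatrix}I_{m_1}&\varphi(z)^*\end{bmatrix}u(x,z)^*u(x,z)\begin{bmatrix}I_{m_1}\\ \varphi(z)\end{bmatrix}dx<\infty,\qquad z\in\mathbb{C}_+.$$ It is known that in the self-adjoint case such $\varphi$ exists, is unique, holomorphic and contractive on $\mathbb{C}_+$. *)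

theory Defs
  imports
    "HOL-Analysis.Analysis"
    "HOL-Complex_Analysis.Complex_Singularities"
    "HOL-Computational_Algebra.Computational_Algebra"
    "Jordan_Normal_Form.Schur_Decomposition"
    "Jordan_Normal_Form.Gauss_Jordan_Elimination"
begin

text \<open>
  All matrices are those of \<open>Jordan_Normal_Form\<close>, so sizes are natural numbers carried by
  \<open>carrier_mat\<close>.  In particular the size \<open>n\<close> of a realization may be compared with the size of
  other realizations, and may be \<open>0\<close> (the minimal realization of the zero function).
  Limits, derivatives and integrals of matrix functions are taken entrywise.
\<close>

section \<open>Matrices\<close>

text \<open>Unspecified for singular matrices; only used where invertibility is known or assumed.\<close>
definition mat_inv :: "complex mat \<Rightarrow> complex mat" where
  "mat_inv M = the (mat_inverse M)"

definition mat_exp :: "complex mat \<Rightarrow> complex mat" where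
  "mat_exp M = Matrix.mat (dim_row M) (dim_row M)
     (\<lambda>(i, j). \<Sum>k. (M ^\<^sub>m k) $$ (i, j) / fact k)"

definition mat_pos_def :: "nat \<Rightarrow> complex mat \<Rightarrow> bool" where
  "mat_pos_def n M \<longleftrightarrow> M \<in> carrier_mat n n \<and> mat_adjoint M = M \<and>
     (\<forall>w \<in> carrier_vec n. w \<noteq> 0\<^sub>v n \<longrightarrow> 0 < Re ((M *\<^sub>v w) \<bullet>c w))"

definition mat_pos_semidef :: "nat \<Rightarrow> complex mat \<Rightarrow> bool" where
  "mat_pos_semidef n M \<longleftrightarrow> M \<in> carrier_mat n n \<and> mat_adjoint M = M \<and>
     (\<forall>w \<in> carrier_vec n. 0 \<le> Re ((M *\<^sub>v w) \<bullet>c w))"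

definition append_cols :: "complex mat \<Rightarrow> complex mat \<Rightarrow> complex mat" where
  "append_cols M N = four_block_mat M N (0\<^sub>m 0 (dim_col M)) (0\<^sub>m 0 (dim_col N))"

definition upper_block :: "nat \<Rightarrow> complex mat \<Rightarrow> complex mat" where
  "upper_block m1 Y = Matrix.mat m1 (dim_col Y) (\<lambda>(i, j). Y $$ (i, j))"

definition lower_block :: "nat \<Rightarrow> complex mat \<Rightarrow> complex mat" where
  "lower_block m1 Y = Matrix.mat (dim_row Y - m1) (dim_col Y) (\<lambda>(i, j). Y $$ (i + m1, j))"

section \<open>Rational matrix functions and realizations\<close>

text \<open>
  Every entry is a quotient of coprime polynomials.  Coprimality makes the entry continuous away
  from its genuine poles; at a pole it has the junk value \<open>0\<close>, but it is unbounded
  nearby, so the pole is still seen by \<^const>\<open>is_pole\<close>.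
\<close>
definition rational_mat_fun :: "nat \<Rightarrow> nat \<Rightarrow> (complex \<Rightarrow> complex mat) \<Rightarrow> bool" where
  "rational_mat_fun r c R \<longleftrightarrow> (\<forall>z. R z \<in> carrier_mat r c) \<and>
     (\<forall>i<r. \<forall>j<c. \<exists>p q. q \<noteq> 0 \<and> coprime p q \<and>
        (\<forall>z. R z $$ (i, j) = poly p z / poly q z))"

definition mat_fun_pole :: "nat \<Rightarrow> nat \<Rightarrow> (complex \<Rightarrow> complex mat) \<Rightarrow> complex \<Rightarrow> bool" where
  "mat_fun_pole r c R z \<longleftrightarrow> (\<exists>i<r. \<exists>j<c. is_pole (\<lambda>w. R w $$ (i, j)) z)"

definition strictly_proper :: "nat \<Rightarrow> nat \<Rightarrow> (complex \<Rightarrow> complex mat) \<Rightarrow> bool" where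
  "strictly_proper r c R \<longleftrightarrow> (\<forall>i<r. \<forall>j<c. ((\<lambda>z. R z $$ (i, j)) \<longlongrightarrow> 0) at_infinity)"

definition contractive_at :: "nat \<Rightarrow> (complex \<Rightarrow> complex mat) \<Rightarrow> complex \<Rightarrow> bool" where
  "contractive_at c R z \<longleftrightarrow> mat_pos_semidef c (1\<^sub>m c - mat_adjoint (R z) * R z)"

text \<open>The identity is one of rational functions: it is required wherever the right-hand side is
  defined, which excludes only the eigenvalues of \<open>A\<close>.\<close>
definition realization ::
  "nat \<Rightarrow> nat \<Rightarrow> (complex \<Rightarrow> complex mat) \<Rightarrow> nat \<Rightarrow> complex mat \<Rightarrow> complex mat \<Rightarrow> complex mat \<Rightarrow> bool"
where
  "realization r c R n A B C \<longleftrightarrow>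
     A \<in> carrier_mat n n \<and> B \<in> carrier_mat n c \<and> C \<in> carrier_mat r n \<and>
     (\<forall>z. invertible_mat (z \<cdot>\<^sub>m 1\<^sub>m n - A) \<longrightarrow>
        R z = C * mat_inv (z \<cdot>\<^sub>m 1\<^sub>m n - A) * B)"

definition minimal_realization ::
  "nat \<Rightarrow> nat \<Rightarrow> (complex \<Rightarrow> complex mat) \<Rightarrow> nat \<Rightarrow> complex mat \<Rightarrow> complex mat \<Rightarrow> complex mat \<Rightarrow> bool"
where
  "minimal_realization r c R n A B C \<longleftrightarrow> realization r c R n A B C \<and>
     (\<forall>n' A' B' C'. realization r c R n' A' B' C' \<longrightarrow> n \<le> n')"

section \<open>Self-adjoint Dirac systems\<close>

definition dirac_j :: "nat \<Rightarrow> nat \<Rightarrow> complex mat" where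
  "dirac_j m1 m2 = four_block_mat (1\<^sub>m m1) (0\<^sub>m m1 m2) (0\<^sub>m m2 m1) (- 1\<^sub>m m2)"

definition dirac_V :: "nat \<Rightarrow> nat \<Rightarrow> complex mat \<Rightarrow> complex mat" where
  "dirac_V m1 m2 v = four_block_mat (0\<^sub>m m1 m1) v (mat_adjoint v) (0\<^sub>m m2 m2)"

text \<open>
  Classical \<open>(m1 + m2) \<times> k\<close> matrix solutions on \<open>[0, \<infinity>)\<close> (one-sided derivative at \<open>0\<close>), which is the
  right notion for continuous potentials.
\<close>
definition dirac_solution ::
  "nat \<Rightarrow> nat \<Rightarrow> (real \<Rightarrow> complex mat) \<Rightarrow> complex \<Rightarrow> nat \<Rightarrow> (real \<Rightarrow> complex mat) \<Rightarrow> bool"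
where
  "dirac_solution m1 m2 v z k y \<longleftrightarrow>
     (\<forall>x\<ge>0. y x \<in> carrier_mat (m1 + m2) k) \<and>
     (\<forall>x\<ge>0. \<forall>i<m1 + m2. \<forall>l<k.
        ((\<lambda>t. y t $$ (i, l)) has_vector_derivative
           (\<i> \<cdot>\<^sub>m ((z \<cdot>\<^sub>m dirac_j m1 m2 + dirac_j m1 m2 * dirac_V m1 m2 (v x)) * y x)) $$ (i, l))
        (at x within {0..}))"

text \<open>\<open>D\<close> is the \<open>o(1)\<close> term of the normalization at infinity.\<close>
definition jost_solution ::
  "nat \<Rightarrow> nat \<Rightarrow> (real \<Rightarrow> complex mat) \<Rightarrow> real \<Rightarrow> (real \<Rightarrow> complex mat) \<Rightarrow> bool"
where
  "jost_solution m1 m2 v z F \<longleftrightarrow>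
     dirac_solution m1 m2 v (of_real z) (m1 + m2) F \<and>
     (\<forall>x\<ge>0. invertible_mat (F x)) \<and>
     (\<exists>D. (\<forall>x. D x \<in> carrier_mat (m1 + m2) (m1 + m2)) \<and>
        (\<forall>i<m1 + m2. \<forall>l<m1 + m2. ((\<lambda>x. D x $$ (i, l)) \<longlongrightarrow> 0) at_top) \<and>
        (\<forall>x\<ge>0. F x = mat_exp ((\<i> * of_real x * of_real z) \<cdot>\<^sub>m dirac_j m1 m2)
                        * (1\<^sub>m (m1 + m2) + D x)))"

definition reflection_coefficient ::
  "nat \<Rightarrow> nat \<Rightarrow> (real \<Rightarrow> complex mat) \<Rightarrow> (complex \<Rightarrow> complex mat) \<Rightarrow> bool"
where
  "reflection_coefficient m1 m2 v R \<longleftrightarrow>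
     (\<exists>Z :: real set. finite Z \<and>
        (\<forall>z. z \<notin> Z \<longrightarrow> (\<exists>F. jost_solution m1 m2 v z F \<and>
           (let Y0 = F 0 * (1\<^sub>m m1 @\<^sub>r 0\<^sub>m m2 m1);
                Y1 = upper_block m1 Y0;
                Y2 = lower_block m1 Y0
            in invertible_mat Y1 \<and> R (of_real z) = Y2 * mat_inv Y1))))"

definition weyl_function ::
  "nat \<Rightarrow> nat \<Rightarrow> (real \<Rightarrow> complex mat) \<Rightarrow> (complex \<Rightarrow> complex mat) \<Rightarrow> bool"
where
  "weyl_function m1 m2 v \<phi> \<longleftrightarrow>
     (\<forall>z. Im z > 0 \<longrightarrow> \<phi> z \<in> carrier_mat m2 m1 \<and>
        (\<exists>u. dirac_solution m1 m2 v z (m1 + m2) u \<and> u 0 = 1\<^sub>m (m1 + m2) \<and>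
           (\<forall>i<m1. \<forall>l<m1. set_integrable lebesgue {0..}
              (\<lambda>x. (mat_adjoint (1\<^sub>m m1 @\<^sub>r \<phi> z) * mat_adjoint (u x)
                     * u x * (1\<^sub>m m1 @\<^sub>r \<phi> z)) $$ (i, l)))))"

definition L2_mat_fun :: "nat \<Rightarrow> nat \<Rightarrow> (real \<Rightarrow> complex mat) \<Rightarrow> bool" where
  "L2_mat_fun r c f \<longleftrightarrow> (\<forall>x\<ge>0. f x \<in> carrier_mat r c) \<and>
     (\<forall>i<r. \<forall>j<c. set_borel_measurable lebesgue {0..} (\<lambda>x. f x $$ (i, j)) \<and>
        set_integrable lebesgue {0..} (\<lambda>x. (cmod (f x $$ (i, j)))\<^sup>2))"

section \<open>The explicit potential\<close>

text \<open>The left-hand side of the Riccati equation.\<close>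
definition riccati :: "complex mat \<Rightarrow> complex mat \<Rightarrow> complex mat \<Rightarrow> complex mat \<Rightarrow> complex mat" where
  "riccati A B C X =
     X * mat_adjoint C * C * X - \<i> \<cdot>\<^sub>m (A * X - X * mat_adjoint A) + B * mat_adjoint B"

definition gbdt_Lambda :: "complex mat \<Rightarrow> complex mat \<Rightarrow> complex mat \<Rightarrow> real \<Rightarrow> complex mat" where
  "gbdt_Lambda A \<theta>1 \<theta>2 x =
     append_cols (mat_exp ((- \<i> * of_real x) \<cdot>\<^sub>m A) * \<theta>1) (mat_exp ((\<i> * of_real x) \<cdot>\<^sub>m A) * \<theta>2)"

definition gbdt_S ::
  "complex mat \<Rightarrow> complex mat \<Rightarrow> complex mat \<Rightarrow> complex mat \<Rightarrow> real \<Rightarrow> complex mat"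
where
  "gbdt_S A S0 \<theta>1 \<theta>2 x = S0 + Matrix.mat (dim_row S0) (dim_col S0)
     (\<lambda>(i, j). integral {0..x}
        (\<lambda>t. (gbdt_Lambda A \<theta>1 \<theta>2 t * mat_adjoint (gbdt_Lambda A \<theta>1 \<theta>2 t)) $$ (i, j)))"

definition gbdt_v ::
  "complex mat \<Rightarrow> complex mat \<Rightarrow> complex mat \<Rightarrow> complex mat \<Rightarrow> real \<Rightarrow> complex mat"
where
  "gbdt_v A S0 \<theta>1 \<theta>2 x = (- 2 * \<i>) \<cdot>\<^sub>m
     (mat_adjoint \<theta>1 * mat_exp ((\<i> * of_real x) \<cdot>\<^sub>m mat_adjoint A) * mat_inv (gbdt_S A S0 \<theta>1 \<theta>2 x)
        * mat_exp ((\<i> * of_real x) \<cdot>\<^sub>m A) * \<theta>2)"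

end

theory Submission
  imports
    Defs
    "HOL-Real_Asymp.Real_Asymp"
    "Jordan_Normal_Form.Spectral_Radius"
begin

text \<open>
  Let \<open>S(x)\<close> be as in the statement and \<open>\<Lambda> = [L1, L2]\<close>.  The Riccati equation is the identity
  \<open>A S - S A\<^sup>* = i (L1 L1\<^sup>* - L2 L2\<^sup>*)\<close> at \<open>x = 0\<close>, and the identity is preserved in \<open>x\<close>.  It follows that,
  whenever \<open>(z - A) L = \<theta>1 G\<close>, the Dirac system is solved by \<open>e\<^sup>i\<^sup>x\<^sup>z [G + i \<theta>1\<^sup>* \<Pi> L; - i E\<^sup>* L]\<close>, where
  \<open>\<Pi> = (e\<^sup>-\<^sup>i\<^sup>x\<^sup>A)\<^sup>* S\<^sup>-\<^sup>1 e\<^sup>-\<^sup>i\<^sup>x\<^sup>A\<close>, \<open>E = (e\<^sup>-\<^sup>i\<^sup>x\<^sup>A)\<^sup>* S\<^sup>-\<^sup>1 L2\<close> and \<open>v = - 2 i \<theta>1\<^sup>* E\<close>.  Since \<open>\<Pi>' = - 2 E E\<^sup>*\<close>, the positive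
  matrix \<open>\<Pi>\<close> decreases to a limit, \<open>E\<close> is square integrable, and \<open>E' = 2 i A\<^sup>* E - 2 \<Pi> \<theta>1 \<theta>1\<^sup>* E\<close> being
  controlled by \<open>E\<close> gives \<open>E \<rightarrow> 0\<close>; in particular \<open>v\<close> is square integrable and tends to \<open>0\<close>.
  Hence the explicit solutions are Jost solutions for real \<open>z\<close> and decay for \<open>z\<close> in the upper
  half-plane, and their values at \<open>x = 0\<close> give \<open>R\<close> as reflection coefficient and as Weyl function.
  The Weyl function is unique because \<open>y\<^sup>* j y\<close> does not increase along solutions.

  The matrix \<open>X\<close> comes from the bounded real lemma: minimality makes the eigenvalues of the state
  matrix poles of \<open>R\<close>, so they lie in the open lower half-plane, and the stable invariant subspace
  of the Hamiltonian matrix yields \<open>X\<close>.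
\<close>

section \<open>Matrices of all sizes as one normed algebra\<close>

text \<open>The entries of \<open>v\<close> need not be summable, so the Volterra equation that
  usually defines Jost solutions is out of reach and every solution has to be written down
  explicitly. The formula is a Darboux-type transform: a solution \<open>q\<close> of the system
  with zero potential, together with \<open>l\<close> subject to
  \<open>(z - A) l = L1 q1 + L2 q2\<close>, is mapped to a solution of the full system. There is no
  control over the spectrum of \<open>A\<close>, and \<open>S(x)\<close> may grow exponentially.
  Only after conjugation by the exponential does its inverse become monotone; this is why
  \<open>Pi\<close> and not \<open>S\<close> is followed to infinity. The shape of \<open>A\<close>
  is state feedback. It differs from the given state matrix \<open>a\<close> by \<open>B\<close>
  times another factor, so the single vector \<open>L = (z - a)^-1 B\<close> serves both matrices,
  and the explicit solution starts at \<open>[I; R(z)]\<close>. Contractivity of \<open>R\<close> is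
  not strict. The Hamiltonian matrix of \<open>R\<close> itself may have real eigenvalues and then
  does not split into a stable and an antistable half; hence the Riccati equation is solved for a
  shrunken \<open>C\<close> first and a limit is taken.\<close>

text \<open>Matrices are padded with zeros, so that sums and products need no size conditions; the size
  is the predicate \<open>carr\<close> below, and \<open>idm n\<close> is only a local unit.\<close>

typedef pmat = "{f :: nat \<Rightarrow> nat \<Rightarrow> complex. \<exists>N. \<forall>i j. N \<le> i \<or> N \<le> j \<longrightarrow> f i j = 0}"
  morphisms ent Pmat
  by (rule exI[of _ "\<lambda>_ _. 0"]) auto

setup_lifting type_definition_pmat

lemma pmat_eqI: "(\<And>i j. ent A i j = ent B i j) \<Longrightarrow> A = B"
  by (metis ent_inject ext)

text \<open>One bound for rows and columns alike: such bounds are upward closed, so finitely many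
  matrices always share one.\<close>

definition bnd :: "pmat \<Rightarrow> nat \<Rightarrow> bool" where
  "bnd A N \<longleftrightarrow> (\<forall>i j. N \<le> i \<or> N \<le> j \<longrightarrow> ent A i j = 0)"

lemma bnd_ex: "\<exists>N. bnd A N"
  using ent[of A] by (auto simp: bnd_def)

lemma bnd_mono: "bnd A N \<Longrightarrow> N \<le> M \<Longrightarrow> bnd A M"
  unfolding bnd_def by (meson le_trans)

lemma bnd_ex2: "\<exists>N. bnd A N \<and> bnd B N"
  by (metis bnd_ex bnd_mono nat_le_linear)

lemma bnd_ex3: "\<exists>N. bnd A N \<and> bnd B N \<and> bnd C N"
  by (metis bnd_ex bnd_ex2 bnd_mono nat_le_linear)

lift_definition cscale :: "complex \<Rightarrow> pmat \<Rightarrow> pmat" (infixr "*\<^sub>c" 75) is "\<lambda>c f i j. c * f i j"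
  by auto

lift_definition adj :: "pmat \<Rightarrow> pmat" is "\<lambda>f i j. cnj (f j i)"
  by auto

lift_definition idm :: "nat \<Rightarrow> pmat" is "\<lambda>n i j. if i = j \<and> i < n then 1 else 0"
proof -
  fix n :: nat
  show "\<exists>N. \<forall>i j. N \<le> i \<or> N \<le> j \<longrightarrow> (if i = j \<and> i < n then 1 else 0 :: complex) = 0"
    by (rule exI[of _ n]) auto
qed

lift_definition unit_pmat :: "nat \<Rightarrow> nat \<Rightarrow> pmat" is "\<lambda>a b i j. if i = a \<and> j = b then 1 else 0"
proof -
  fix a b :: nat
  show "\<exists>N. \<forall>i j. N \<le> i \<or> N \<le> j \<longrightarrow> (if i = a \<and> j = b then 1 else 0 :: complex) = 0"
    by (rule exI[of _ "Suc (max a b)"]) auto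
qed

lift_definition trunc :: "nat \<Rightarrow> nat \<Rightarrow> (nat \<Rightarrow> nat \<Rightarrow> complex) \<Rightarrow> pmat" is
  "\<lambda>r c f i j. if i < r \<and> j < c then f i j else 0"
proof -
  fix r c :: nat and f :: "nat \<Rightarrow> nat \<Rightarrow> complex"
  show "\<exists>N. \<forall>i j. N \<le> i \<or> N \<le> j \<longrightarrow> (if i < r \<and> j < c then f i j else 0) = 0"
    by (rule exI[of _ "max r c"]) auto
qed

instantiation pmat :: real_vector
begin
lift_definition zero_pmat :: pmat is "\<lambda>_ _. 0" by auto
lift_definition plus_pmat :: "pmat \<Rightarrow> pmat \<Rightarrow> pmat" is "\<lambda>f g i j. f i j + g i j"
proof -
  fix f g :: "nat \<Rightarrow> nat \<Rightarrow> complex"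
  assume "\<exists>N. \<forall>i j. N \<le> i \<or> N \<le> j \<longrightarrow> f i j = 0" "\<exists>N. \<forall>i j. N \<le> i \<or> N \<le> j \<longrightarrow> g i j = 0"
  then obtain N M where "\<forall>i j. N \<le> i \<or> N \<le> j \<longrightarrow> f i j = 0" "\<forall>i j. M \<le> i \<or> M \<le> j \<longrightarrow> g i j = 0"
    by auto
  then show "\<exists>N. \<forall>i j. N \<le> i \<or> N \<le> j \<longrightarrow> f i j + g i j = 0"
    by (intro exI[of _ "max N M"]) auto
qed
lift_definition uminus_pmat :: "pmat \<Rightarrow> pmat" is "\<lambda>f i j. - f i j" by auto
definition minus_pmat :: "pmat \<Rightarrow> pmat \<Rightarrow> pmat" where "minus_pmat A B = A + (- B)"
lift_definition scaleR_pmat :: "real \<Rightarrow> pmat \<Rightarrow> pmat" is "\<lambda>c f i j. c *\<^sub>R f i j" by auto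
instance
proof
qed (auto intro!: pmat_eqI simp: minus_pmat_def plus_pmat.rep_eq uminus_pmat.rep_eq zero_pmat.rep_eq
      scaleR_pmat.rep_eq algebra_simps)
end

lemma ent_0 [simp]: "ent 0 i j = 0" by (rule zero_pmat.rep_eq[THEN fun_cong, THEN fun_cong])
lemma ent_add [simp]: "ent (A + B) i j = ent A i j + ent B i j" by (simp add: plus_pmat.rep_eq)
lemma ent_minus [simp]: "ent (- A) i j = - ent A i j" by (simp add: uminus_pmat.rep_eq)
lemma ent_diff [simp]: "ent (A - B) i j = ent A i j - ent B i j"
  unfolding minus_pmat_def ent_add by simp
lemma ent_scaleR [simp]: "ent (c *\<^sub>R A) i j = c *\<^sub>R ent A i j" by (simp add: scaleR_pmat.rep_eq)
lemma ent_cscale [simp]: "ent (c *\<^sub>c A) i j = c * ent A i j" by (simp add: cscale.rep_eq)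
lemma ent_adj [simp]: "ent (adj A) i j = cnj (ent A j i)" by (simp add: adj.rep_eq)
lemma ent_sum [simp]: "ent (sum F I) i j = (\<Sum>k\<in>I. ent (F k) i j)"
  by (induction I rule: infinite_finite_induct) auto

text \<open>The entrywise sum norm. It is submultiplicative, invariant under \<open>adj\<close>, and
  dominates every single entry. Summing over the support avoids a choice of size.\<close>

definition pnorm :: "pmat \<Rightarrow> real" where
  "pnorm A = (\<Sum>p\<in>{p. ent A (fst p) (snd p) \<noteq> 0}. cmod (ent A (fst p) (snd p)))"

lemma pnorm_eq: assumes "bnd A N" shows "pnorm A = (\<Sum>i<N. \<Sum>j<N. cmod (ent A i j))"
proof -
  have "pnorm A = (\<Sum>p\<in>{..<N} \<times> {..<N}. cmod (ent A (fst p) (snd p)))"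
    unfolding pnorm_def using assms
    by (intro sum.mono_neutral_left) (auto simp: bnd_def, (meson not_le)+)
  then show ?thesis by (simp add: sum.cartesian_product case_prod_unfold)
qed

instantiation pmat :: real_normed_vector
begin
definition norm_pmat :: "pmat \<Rightarrow> real" where "norm_pmat = pnorm"
definition dist_pmat :: "pmat \<Rightarrow> pmat \<Rightarrow> real" where "dist_pmat x y = norm (x - y)"
definition sgn_pmat :: "pmat \<Rightarrow> pmat" where "sgn_pmat x = inverse (norm x) *\<^sub>R x"
definition uniformity_pmat :: "(pmat \<times> pmat) filter" where
  "uniformity_pmat = (INF e\<in>{0 <..}. principal {(x, y). dist x y < e})"
definition open_pmat :: "pmat set \<Rightarrow> bool" where
  "open_pmat U \<longleftrightarrow> (\<forall>x\<in>U. \<forall>\<^sub>F (x', y) in uniformity. x' = x \<longrightarrow> y \<in> U)"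
instance
proof
  fix A B :: pmat and c :: real
  obtain N where N: "bnd A N" "bnd B N" using bnd_ex2 by blast
  then have N': "bnd (A + B) N" "bnd (c *\<^sub>R A) N" by (auto simp: bnd_def)
  have eq: "norm A = 0 \<longleftrightarrow> (\<forall>i<N. \<forall>j<N. ent A i j = 0)"
    by (simp add: norm_pmat_def pnorm_eq[OF N(1)] sum_nonneg_eq_0_iff sum_nonneg Ball_def)
  show "norm A = 0 \<longleftrightarrow> A = 0"
  proof
    assume "norm A = 0"
    then show "A = 0" using eq N(1) by (intro pmat_eqI) (auto simp: bnd_def, meson not_le)
  qed (use eq in simp)
  show "norm (A + B) \<le> norm A + norm B"
    unfolding norm_pmat_def pnorm_eq[OF N(1)] pnorm_eq[OF N(2)] pnorm_eq[OF N'(1)]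
      sum.distrib[symmetric] ent_add by (intro sum_mono norm_triangle_ineq)
  show "norm (c *\<^sub>R A) = \<bar>c\<bar> * norm A"
    unfolding norm_pmat_def pnorm_eq[OF N(1)] pnorm_eq[OF N'(2)]
    by (simp only: ent_scaleR norm_scaleR sum_distrib_left)
qed (rule dist_pmat_def sgn_pmat_def uniformity_pmat_def open_pmat_def)+
end

lemma norm_pmat_eq: "bnd A N \<Longrightarrow> norm A = (\<Sum>i<N. \<Sum>j<N. cmod (ent A i j))"
  by (simp add: norm_pmat_def pnorm_eq)

lemma norm_ent_le: "cmod (ent A i j) \<le> norm A"
proof -
  obtain N0 where N0: "bnd A N0" using bnd_ex by blast
  define N where "N = Suc (max N0 (max i j))"
  have N: "bnd A N" "i < N" "j < N" using bnd_mono[OF N0] by (auto simp: N_def)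
  have "cmod (ent A i j) \<le> (\<Sum>j<N. cmod (ent A i j))"
    using N by (intro member_le_sum) auto
  also have "\<dots> \<le> (\<Sum>i<N. \<Sum>j<N. cmod (ent A i j))"
    using N by (intro member_le_sum[of i _ "\<lambda>i. \<Sum>j<N. cmod (ent A i j)"]) (auto intro: sum_nonneg)
  finally show ?thesis by (simp add: norm_pmat_eq[OF N(1)])
qed

instantiation pmat :: real_normed_algebra
begin
text \<open>The support of a row of the left factor is finite, so the product needs no common inner
  dimension.\<close>

lift_definition times_pmat :: "pmat \<Rightarrow> pmat \<Rightarrow> pmat" is
  "\<lambda>f g i j. \<Sum>k\<in>{k. f i k \<noteq> 0}. f i k * g k j"
proof -
  fix f g :: "nat \<Rightarrow> nat \<Rightarrow> complex"
  assume "\<exists>N. \<forall>i j. N \<le> i \<or> N \<le> j \<longrightarrow> f i j = 0" "\<exists>N. \<forall>i j. N \<le> i \<or> N \<le> j \<longrightarrow> g i j = 0"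
  then obtain N M where "\<forall>i j. N \<le> i \<or> N \<le> j \<longrightarrow> f i j = 0" "\<forall>i j. M \<le> i \<or> M \<le> j \<longrightarrow> g i j = 0"
    by auto
  then show "\<exists>N. \<forall>i j. N \<le> i \<or> N \<le> j \<longrightarrow> (\<Sum>k\<in>{k. f i k \<noteq> 0}. f i k * g k j) = 0"
    by (intro exI[of _ "max N M"]) (auto intro!: sum.neutral)
qed

text \<open>It is enough that one of the two factors vanishes from \<open>N\<close> on; a bound on
  the columns of the left or on the rows of the right factor will do.\<close>

lemma ent_times: assumes "\<And>k. N \<le> k \<Longrightarrow> ent A i k = 0 \<or> ent B k j = 0"
  shows "ent (A * B) i j = (\<Sum>k<N. ent A i k * ent B k j)"
proof -
  obtain M where M: "bnd A M" using bnd_ex by blast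
  have "ent (A * B) i j = (\<Sum>k<max N M. ent A i k * ent B k j)"
    unfolding times_pmat.rep_eq
  proof (rule sum.mono_neutral_left)
    show "{k. ent A i k \<noteq> 0} \<subseteq> {..<max N M}"
      using M by (force simp: bnd_def not_le[symmetric])
  qed auto
  also have "\<dots> = (\<Sum>k<N. ent A i k * ent B k j)"
    using assms by (intro sum.mono_neutral_right) auto
  finally show ?thesis .
qed

instance
proof
  fix A B C :: pmat and c :: real
  obtain N where N: "bnd A N" "bnd B N" "bnd C N" using bnd_ex3 by blast
  have N': "bnd (A * B) N" "bnd (B * C) N" "bnd (A + B) N" "bnd (B + C) N" "bnd (c *\<^sub>R A) N"
    using N by (auto simp: bnd_def ent_times[where N=N])
  have E: "ent (X * Y) i j = (\<Sum>k<N. ent X i k * ent Y k j)" if "bnd X N" for X Y i j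
    using that by (intro ent_times) (auto simp: bnd_def)
  show "A * B * C = A * (B * C)"
  proof (rule pmat_eqI)
    fix i j
    have "ent (A * B * C) i j = (\<Sum>k<N. \<Sum>l<N. ent A i l * ent B l k * ent C k j)"
      by (simp add: E N N' sum_distrib_right)
    also have "\<dots> = (\<Sum>l<N. \<Sum>k<N. ent A i l * ent B l k * ent C k j)" by (rule sum.swap)
    also have "\<dots> = ent (A * (B * C)) i j" by (simp add: E N N' sum_distrib_left mult.assoc)
    finally show "ent (A * B * C) i j = ent (A * (B * C)) i j" .
  qed
  show "(A + B) * C = A * C + B * C"
    by (rule pmat_eqI) (simp add: E N N' sum.distrib distrib_right)
  show "A * (B + C) = A * B + A * C"
    by (rule pmat_eqI) (simp add: E N N' sum.distrib distrib_left)
  show "(c *\<^sub>R A) * B = c *\<^sub>R (A * B)"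
    by (rule pmat_eqI) (simp add: E N N' scaleR_sum_right)
  show "A * (c *\<^sub>R B) = c *\<^sub>R (A * B)"
    by (rule pmat_eqI) (simp add: E N N' scaleR_sum_right)
  have "norm (A * B) \<le> (\<Sum>i<N. \<Sum>j<N. \<Sum>k<N. cmod (ent A i k) * cmod (ent B k j))"
    unfolding norm_pmat_eq[OF N'(1)] E[OF N(1)]
    by (intro sum_mono order.trans[OF norm_sum]) (simp add: norm_mult)
  also have "\<dots> = (\<Sum>i<N. \<Sum>k<N. cmod (ent A i k) * (\<Sum>j<N. cmod (ent B k j)))"
    by (subst sum.swap) (simp add: sum_distrib_left)
  also have "\<dots> \<le> (\<Sum>i<N. \<Sum>k<N. cmod (ent A i k) * norm B)"
    unfolding norm_pmat_eq[OF N(2)]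
    by (intro sum_mono mult_left_mono member_le_sum[of _ _ "\<lambda>k. \<Sum>j<N. cmod (ent B k j)"])
       (auto intro: sum_nonneg)
  also have "\<dots> = norm A * norm B"
    unfolding norm_pmat_eq[OF N(1)] by (simp add: sum_distrib_right)
  finally show "norm (A * B) \<le> norm A * norm B" .
qed
end

lemma cscale_mult_left [simp]: "(c *\<^sub>c A) * B = c *\<^sub>c (A * B)"
  and cscale_mult_right [simp]: "A * (c *\<^sub>c B) = c *\<^sub>c (A * B)"
proof -
  obtain N where N: "bnd A N" using bnd_ex by blast
  have E: "ent (X * Y) i j = (\<Sum>k<N. ent X i k * ent Y k j)" if "bnd X N" for X Y i j
    using that by (intro ent_times) (auto simp: bnd_def)
  have N': "bnd (c *\<^sub>c A) N" using N by (auto simp: bnd_def)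
  show "(c *\<^sub>c A) * B = c *\<^sub>c (A * B)" "A * (c *\<^sub>c B) = c *\<^sub>c (A * B)"
    by (rule pmat_eqI, simp add: E N N' sum_distrib_left mult_ac)+
qed

lemma cscale_cscale [simp]: "c *\<^sub>c d *\<^sub>c A = (c * d) *\<^sub>c A" by (rule pmat_eqI) simp
lemma cscale_add: "c *\<^sub>c (A + B) = c *\<^sub>c A + c *\<^sub>c B" by (rule pmat_eqI) (simp add: algebra_simps)
lemma cscale_diff: "c *\<^sub>c (A - B) = c *\<^sub>c A - c *\<^sub>c B" by (rule pmat_eqI) (simp add: algebra_simps)
lemma cscale_minus [simp]: "c *\<^sub>c (- A) = (- c) *\<^sub>c A" by (rule pmat_eqI) simp
lemma cscale_uminus: "(- c) *\<^sub>c A = - (c *\<^sub>c A)" by (rule pmat_eqI) simp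
lemma cscale_add_left: "(c + d) *\<^sub>c A = c *\<^sub>c A + d *\<^sub>c A" by (rule pmat_eqI) (simp add: algebra_simps)
lemma cscale_diff_left: "(c - d) *\<^sub>c A = c *\<^sub>c A - d *\<^sub>c A" by (rule pmat_eqI) (simp add: algebra_simps)
lemma cscale_one [simp]: "1 *\<^sub>c A = A" by (rule pmat_eqI) simp
lemma cscale_zero [simp]: "0 *\<^sub>c A = 0" "c *\<^sub>c 0 = 0" by (rule pmat_eqI, simp)+
lemma cscale_eq_0_iff [simp]: "c *\<^sub>c A = 0 \<longleftrightarrow> c = 0 \<or> A = 0"
  by (metis cscale_cscale cscale_one cscale_zero left_inverse)
lemma cscale_sum: "c *\<^sub>c sum f I = (\<Sum>i\<in>I. c *\<^sub>c f i)" by (rule pmat_eqI) (simp add: sum_distrib_left)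
lemma scaleR_cscale: "r *\<^sub>R A = complex_of_real r *\<^sub>c A" by (rule pmat_eqI) (simp add: scaleR_conv_of_real)
lemma norm_cscale [simp]: "norm (c *\<^sub>c A) = cmod c * norm A"
proof -
  obtain N where N: "bnd A N" using bnd_ex by blast
  then have "bnd (c *\<^sub>c A) N" by (auto simp: bnd_def)
  with N show ?thesis by (simp add: norm_pmat_eq norm_mult sum_distrib_left)
qed

lemmas cscale_distribs = cscale_add cscale_diff cscale_add_left cscale_diff_left cscale_uminus

lemma adj_adj [simp]: "adj (adj A) = A" by (rule pmat_eqI) simp
lemma adj_add [simp]: "adj (A + B) = adj A + adj B" by (rule pmat_eqI) simp
lemma adj_diff [simp]: "adj (A - B) = adj A - adj B" by (rule pmat_eqI) simp
lemma adj_minus [simp]: "adj (- A) = - adj A" by (rule pmat_eqI) simp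
lemma adj_0 [simp]: "adj 0 = 0" by (rule pmat_eqI) simp
lemma adj_cscale [simp]: "adj (c *\<^sub>c A) = cnj c *\<^sub>c adj A" by (rule pmat_eqI) simp
lemma adj_scaleR [simp]: "adj (c *\<^sub>R A) = c *\<^sub>R adj A" by (rule pmat_eqI) simp
lemma adj_idm [simp]: "adj (idm n) = idm n" by (rule pmat_eqI) (simp add: idm.rep_eq)
lemma adj_eq_0_iff [simp]: "adj A = 0 \<longleftrightarrow> A = 0" by (metis adj_adj adj_0)

lemma adj_mult [simp]: "adj (A * B) = adj B * adj A"
proof -
  obtain N where N: "bnd A N" "bnd B N" using bnd_ex2 by blast
  have E: "ent (X * Y) i j = (\<Sum>k<N. ent X i k * ent Y k j)" if "bnd X N" for X Y i j
    using that by (intro ent_times) (auto simp: bnd_def)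
  have "bnd (adj B) N" using N by (auto simp: bnd_def)
  then show ?thesis by (intro pmat_eqI) (simp add: E N mult.commute)
qed

lemma norm_adj [simp]: "norm (adj A) = norm A"
proof -
  obtain N where N: "bnd A N" using bnd_ex by blast
  then have "bnd (adj A) N" by (auto simp: bnd_def)
  with N show ?thesis by (simp add: norm_pmat_eq) (rule sum.swap)
qed

lemma bounded_linear_ent: "bounded_linear (\<lambda>A. ent A i j)"
  by (intro bounded_linear_intro[of _ 1]) (auto simp: norm_ent_le)

lemma bounded_linear_adj: "bounded_linear adj"
  by (intro bounded_linear_intro[of _ 1]) auto

lemma bounded_bilinear_cscale: "bounded_bilinear cscale"
proof
  show "\<exists>K. \<forall>a b. norm (a *\<^sub>c b) \<le> norm a * norm b * K" by (rule exI[of _ 1]) auto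
qed (rule pmat_eqI, simp add: algebra_simps)+

text \<open>Only an upper bound for the size: \<open>carr r c\<close> grows with \<open>r\<close>
  and \<open>c\<close>, so a block in the upper left corner is literally an element of the larger
  matrix space.\<close>

definition carr :: "nat \<Rightarrow> nat \<Rightarrow> pmat set" where
  "carr r c = {A. \<forall>i j. r \<le> i \<or> c \<le> j \<longrightarrow> ent A i j = 0}"

lemma carrD: "A \<in> carr r c \<Longrightarrow> r \<le> i \<or> c \<le> j \<Longrightarrow> ent A i j = 0"
  by (auto simp: carr_def)

lemma carr_eqI: "A \<in> carr r c \<Longrightarrow> B \<in> carr r c \<Longrightarrow> (\<And>i j. i < r \<Longrightarrow> j < c \<Longrightarrow> ent A i j = ent B i j) \<Longrightarrow> A = B"
  by (rule pmat_eqI) (metis carrD not_le)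

lemma carr_simps [simp]:
  "0 \<in> carr r c"
  "A \<in> carr r c \<Longrightarrow> B \<in> carr r c \<Longrightarrow> A + B \<in> carr r c"
  "A \<in> carr r c \<Longrightarrow> B \<in> carr r c \<Longrightarrow> A - B \<in> carr r c"
  "A \<in> carr r c \<Longrightarrow> - A \<in> carr r c"
  "A \<in> carr r c \<Longrightarrow> z *\<^sub>c A \<in> carr r c"
  "A \<in> carr r c \<Longrightarrow> x *\<^sub>R A \<in> carr r c"
  "A \<in> carr r c \<Longrightarrow> adj A \<in> carr c r"
  "idm n \<in> carr n n"
  "trunc r c f \<in> carr r c"
  by (auto simp: carr_def idm.rep_eq trunc.rep_eq)

lemma ent_times_carr: assumes "A \<in> carr r c \<or> B \<in> carr c d"
  shows "ent (A * B) i j = (\<Sum>k<c. ent A i k * ent B k j)"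
  using assms by (intro ent_times) (auto simp: carr_def)

lemma carr_mult [simp]: assumes "A \<in> carr r c" "B \<in> carr c d" shows "A * B \<in> carr r d"
  using assms by (auto simp: carr_def[of r d] ent_times_carr[of A r c B d] carrD)

lemma carr_sum [simp]: "(\<And>i. i \<in> I \<Longrightarrow> f i \<in> carr r c) \<Longrightarrow> sum f I \<in> carr r c"
  by (auto simp: carr_def)

lemma idm_mult [simp]: assumes "A \<in> carr r c" shows "idm r * A = A"
proof (rule pmat_eqI)
  fix i j
  have "ent (idm r * A) i j = (\<Sum>k<r. if i = k then ent A k j else 0)"
    unfolding ent_times_carr[OF disjI2[OF assms]] by (intro sum.cong) (auto simp: idm.rep_eq)
  then show "ent (idm r * A) i j = ent A i j" using carrD[OF assms] by auto
qed

lemma mult_idm [simp]: "A \<in> carr r c \<Longrightarrow> A * idm c = A"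
  by (metis adj_adj adj_idm adj_mult carr_simps(7) idm_mult)

lemma idm_mult' [simp]: "A \<in> carr r c \<Longrightarrow> idm r * (A * B) = A * B"
  by (metis idm_mult mult.assoc)
lemma mult_idm' [simp]: "A \<in> carr r c \<Longrightarrow> (B * A) * idm c = B * A"
  by (metis mult_idm mult.assoc)
lemma mult_idm_mult [simp]: "A \<in> carr r c \<Longrightarrow> A * (idm c * B) = A * B"
  by (metis mult_idm mult.assoc)

text \<open>A finite expansion in matrix units with bounded size; it carries entrywise limits and
  derivatives over to the norm.\<close>

lemma carr_expand: assumes "A \<in> carr r c"
  shows "A = (\<Sum>i<r. \<Sum>j<c. ent A i j *\<^sub>c unit_pmat i j)"
proof (rule pmat_eqI)
  fix a b
  have "(\<Sum>i<r. \<Sum>j<c. ent A i j * (if a = i \<and> b = j then 1 else 0)) =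
     (\<Sum>i<r. if a = i then \<Sum>j<c. if b = j then ent A i j else 0 else 0)"
    by (intro sum.cong refl) (simp add: if_distrib[of "times _"] cong: if_cong)
  also have "\<dots> = ent A a b" using carrD[OF assms] by auto
  finally show "ent A a b = ent (\<Sum>i<r. \<Sum>j<c. ent A i j *\<^sub>c unit_pmat i j) a b"
    by (simp add: unit_pmat.rep_eq)
qed

section \<open>Entrywise limits, derivatives and compactness\<close>

lemma tendsto_pmat:
  assumes "\<And>x. f x \<in> carr r c" "l \<in> carr r c"
    and "\<And>i j. i < r \<Longrightarrow> j < c \<Longrightarrow> ((\<lambda>x. ent (f x) i j) \<longlongrightarrow> ent l i j) F"
  shows "(f \<longlongrightarrow> l) F"
proof -
  have "((\<lambda>x. \<Sum>i<r. \<Sum>j<c. ent (f x) i j *\<^sub>c unit_pmat i j) \<longlongrightarrow> (\<Sum>i<r. \<Sum>j<c. ent l i j *\<^sub>c unit_pmat i j)) F"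
    using assms(3) by (intro tendsto_sum bounded_bilinear.tendsto[OF bounded_bilinear_cscale] tendsto_const) auto
  then show ?thesis using carr_expand[OF assms(1)] carr_expand[OF assms(2)] by simp
qed

lemma has_vector_derivative_pmat:
  assumes "\<And>x. f x \<in> carr r c" "f' \<in> carr r c"
    and "\<And>i j. i < r \<Longrightarrow> j < c \<Longrightarrow> ((\<lambda>x. ent (f x) i j) has_vector_derivative ent f' i j) (at x within S)"
  shows "(f has_vector_derivative f') (at x within S)"
proof -
  have "((\<lambda>x. \<Sum>i<r. \<Sum>j<c. ent (f x) i j *\<^sub>c unit_pmat i j) has_vector_derivative
      (\<Sum>i<r. \<Sum>j<c. ent f' i j *\<^sub>c unit_pmat i j)) (at x within S)"
    using assms(3) by (intro has_vector_derivative_sum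
      bounded_linear.has_vector_derivative[OF bounded_bilinear.bounded_linear_left[OF bounded_bilinear_cscale]]) auto
  then show ?thesis using carr_expand[OF assms(1)] carr_expand[OF assms(2)] by simp
qed

lemma tendsto_ent: "(f \<longlongrightarrow> l) F \<Longrightarrow> ((\<lambda>x. ent (f x) i j) \<longlongrightarrow> ent l i j) F"
  by (rule bounded_linear.tendsto[OF bounded_linear_ent])
lemma tendsto_adj [tendsto_intros]: "(f \<longlongrightarrow> l) F \<Longrightarrow> ((\<lambda>x. adj (f x)) \<longlongrightarrow> adj l) F"
  by (rule bounded_linear.tendsto[OF bounded_linear_adj])
lemmas tendsto_cscale [tendsto_intros] = bounded_bilinear.tendsto[OF bounded_bilinear_cscale]
lemma ent_has_vector_derivative:
  "(f has_vector_derivative f') F \<Longrightarrow> ((\<lambda>x. ent (f x) i j) has_vector_derivative ent f' i j) F"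
  by (rule bounded_linear.has_vector_derivative[OF bounded_linear_ent])
lemma adj_has_vector_derivative [derivative_intros]:
  "(f has_vector_derivative f') F \<Longrightarrow> ((\<lambda>x. adj (f x)) has_vector_derivative adj f') F"
  by (rule bounded_linear.has_vector_derivative[OF bounded_linear_adj])
lemma cscale_has_vector_derivative [derivative_intros]:
  assumes "(f has_vector_derivative f') (at x within S)"
  shows "((\<lambda>x. c *\<^sub>c f x) has_vector_derivative c *\<^sub>c f') (at x within S)"
  by (rule bounded_linear.has_vector_derivative[OF bounded_bilinear.bounded_linear_right[OF bounded_bilinear_cscale] assms])

text \<open>Bolzano-Weierstrass, passing to a further subsequence for one entry after another. The
  whole space \<open>pmat\<close> is infinite-dimensional, so the fixed size is essential
  here.\<close>

lemma carr_compact: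
  assumes "\<And>k. f k \<in> carr r c" "\<And>k. norm (f k) \<le> K"
  shows "\<exists>l g. strict_mono (g :: nat \<Rightarrow> nat) \<and> l \<in> carr r c \<and> (f \<circ> g) \<longlonglongrightarrow> l"
proof -
  have "\<exists>g::nat \<Rightarrow> nat. strict_mono g \<and> (\<forall>p\<in>I. convergent (\<lambda>k. ent (f (g k)) (fst p) (snd p)))"
    if "finite I" for I :: "(nat \<times> nat) set"
    using that
  proof induction
    case empty
    show ?case by (auto intro: exI[of _ id] simp: strict_mono_def)
  next
    case (insert p I)
    then obtain g :: "nat \<Rightarrow> nat" where g: "strict_mono g" "\<And>p. p \<in> I \<Longrightarrow> convergent (\<lambda>k. ent (f (g k)) (fst p) (snd p))"
      by auto
    have "bounded (range (\<lambda>k. ent (f (g k)) (fst p) (snd p)))"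
      unfolding bounded_iff using order.trans[OF norm_ent_le assms(2)] by (auto intro!: exI[of _ K])
    then obtain l h where h: "strict_mono h" "((\<lambda>k. ent (f (g k)) (fst p) (snd p)) \<circ> h) \<longlonglongrightarrow> l"
      using bounded_imp_convergent_subsequence by blast
    have "convergent (\<lambda>k. ent (f (g (h k))) (fst q) (snd q))" if "q \<in> insert p I" for q
    proof (cases "q = p")
      case True
      then show ?thesis using h(2) by (auto simp: convergent_def o_def)
    next
      case False
      then have "convergent ((\<lambda>k. ent (f (g k)) (fst q) (snd q)) \<circ> h)"
        using g(2) that h(1) by (intro convergent_subseq_convergent) auto
      then show ?thesis by (simp add: o_def)
    qed
    then show ?case using g(1) h(1) by (intro exI[of _ "g \<circ> h"]) (auto simp: strict_mono_def)
  qed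
  from this[of "{..<r} \<times> {..<c}"] obtain g :: "nat \<Rightarrow> nat" where g: "strict_mono g"
    "\<And>i j. i < r \<Longrightarrow> j < c \<Longrightarrow> convergent (\<lambda>k. ent (f (g k)) i j)" by auto
  define l where "l = trunc r c (\<lambda>i j. lim (\<lambda>k. ent (f (g k)) i j))"
  have "(\<lambda>k. f (g k)) \<longlonglongrightarrow> l"
    using g(2) assms(1) by (intro tendsto_pmat[of _ r c]) (auto simp: l_def trunc.rep_eq convergent_LIMSEQ_iff)
  moreover have "l \<in> carr r c" by (simp add: l_def)
  ultimately show ?thesis using g(1) unfolding o_def by blast
qed

section \<open>Translation between sized and padded matrices\<close>

definition emb :: "complex mat \<Rightarrow> pmat" where
  "emb M = trunc (dim_row M) (dim_col M) (\<lambda>i j. M $$ (i, j))"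

definition unemb :: "nat \<Rightarrow> nat \<Rightarrow> pmat \<Rightarrow> complex mat" where
  "unemb r c A = Matrix.mat r c (\<lambda>(i, j). ent A i j)"

lemma ent_emb: "ent (emb M) i j = (if i < dim_row M \<and> j < dim_col M then M $$ (i, j) else 0)"
  by (simp add: emb_def trunc.rep_eq)

lemma ent_emb_carrier [simp]: "M \<in> carrier_mat r c \<Longrightarrow> i < r \<Longrightarrow> j < c \<Longrightarrow> ent (emb M) i j = M $$ (i, j)"
  by (auto simp: ent_emb)

lemma emb_carr [simp]: "M \<in> carrier_mat r c \<Longrightarrow> emb M \<in> carr r c"
  by (auto simp: ent_emb carr_def)

lemma unemb_carrier [simp]: "unemb r c A \<in> carrier_mat r c"
  "dim_row (unemb r c A) = r" "dim_col (unemb r c A) = c"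
  by (auto simp: unemb_def)

lemma index_unemb [simp]: "i < r \<Longrightarrow> j < c \<Longrightarrow> unemb r c A $$ (i, j) = ent A i j"
  by (simp add: unemb_def)

lemma emb_unemb [simp]: "A \<in> carr r c \<Longrightarrow> emb (unemb r c A) = A"
  by (rule carr_eqI[of _ r c]) (auto simp: ent_emb)

lemma unemb_emb [simp]: "M \<in> carrier_mat r c \<Longrightarrow> unemb r c (emb M) = M"
  by (rule eq_matI) auto

lemma emb_inj: "M \<in> carrier_mat r c \<Longrightarrow> N \<in> carrier_mat r c \<Longrightarrow> emb M = emb N \<Longrightarrow> M = N"
  by (metis unemb_emb)

lemma emb_mult: assumes "M \<in> carrier_mat r c" "N \<in> carrier_mat c d" shows "emb (M * N) = emb M * emb N"
proof (rule carr_eqI[of _ r d])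
  fix i j assume ij: "i < r" "j < d"
  have "ent (emb M * emb N) i j = (\<Sum>k<c. ent (emb M) i k * ent (emb N) k j)"
    using assms(1) by (intro ent_times_carr[of _ r]) auto
  also have "\<dots> = (\<Sum>k<c. M $$ (i, k) * N $$ (k, j))"
    using assms ij by (intro sum.cong) auto
  also have "\<dots> = (M * N) $$ (i, j)"
    using assms ij by (auto simp: times_mat_def scalar_prod_def lessThan_atLeast0)
  finally show "ent (emb (M * N)) i j = ent (emb M * emb N) i j"
    using assms ij by (simp add: ent_emb_carrier[of "M * N" r d])
qed (auto intro: emb_carr carr_mult[OF emb_carr[OF assms(1)] emb_carr[OF assms(2)]] mult_carrier_mat[OF assms])

lemma emb_add: "M \<in> carrier_mat r c \<Longrightarrow> N \<in> carrier_mat r c \<Longrightarrow> emb (M + N) = emb M + emb N"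
  by (rule carr_eqI[of _ r c]) (auto simp: ent_emb)
lemma emb_diff: "M \<in> carrier_mat r c \<Longrightarrow> N \<in> carrier_mat r c \<Longrightarrow> emb (M - N) = emb M - emb N"
  by (rule carr_eqI[of _ r c]) (auto simp: ent_emb intro!: emb_carr minus_carrier_mat)
lemma emb_smult [simp]: "emb (z \<cdot>\<^sub>m M) = z *\<^sub>c emb M"
  by (rule pmat_eqI) (auto simp: ent_emb)
lemma emb_uminus [simp]: "emb (- M) = - emb M"
  by (rule pmat_eqI) (auto simp: ent_emb)
lemma emb_one [simp]: "emb (1\<^sub>m n) = idm n"
  by (rule pmat_eqI) (auto simp: ent_emb idm.rep_eq)
lemma emb_zero [simp]: "emb (0\<^sub>m r c) = 0"
  by (rule pmat_eqI) (auto simp: ent_emb)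

lemma mat_adjoint_carrier [simp]: "mat_adjoint M \<in> carrier_mat (dim_col M) (dim_row M)"
  by (auto simp: mat_adjoint_def)
lemma mat_adjoint_carrier' [simp]: "M \<in> carrier_mat r c \<Longrightarrow> mat_adjoint M \<in> carrier_mat c r"
  by (auto simp: mat_adjoint_def)
lemma index_mat_adjoint: "i < dim_col M \<Longrightarrow> j < dim_row M \<Longrightarrow> mat_adjoint M $$ (i, j) = cnj (M $$ (j, i))"
  by (simp add: mat_adjoint_def mat_of_rows_index)
lemma emb_adjoint [simp]: "emb (mat_adjoint M) = adj (emb M)"
proof (rule carr_eqI[of _ "dim_col M" "dim_row M"])
  fix i j assume "i < dim_col M" "j < dim_row M"
  then show "ent (emb (mat_adjoint M)) i j = ent (adj (emb M)) i j"
    by (simp add: ent_emb_carrier[OF mat_adjoint_carrier] index_mat_adjoint ent_emb[of M])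
qed (auto intro: carr_simps)

text \<open>Two-sided inverses inside the corner \<open>carr n n\<close>, whose unit is \<open>idm n\<close>.\<close>
definition inv_of :: "nat \<Rightarrow> pmat \<Rightarrow> pmat \<Rightarrow> bool" where
  "inv_of n A B \<longleftrightarrow> A \<in> carr n n \<and> B \<in> carr n n \<and> A * B = idm n \<and> B * A = idm n"

lemma inv_ofD: assumes "inv_of n A B"
  shows "A \<in> carr n n" "B \<in> carr n n" "A * B = idm n" "B * A = idm n"
  using assms by (auto simp: inv_of_def)

lemma inv_of_cancel:
  assumes "inv_of n A B" "C \<in> carr n k"
  shows "A * (B * C) = C" "B * (A * C) = C"
  using assms by (simp_all add: inv_of_def mult.assoc[symmetric])

lemma inv_of_sym: "inv_of n A B \<Longrightarrow> inv_of n B A"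
  by (auto simp: inv_of_def)

lemma inv_of_unique: "inv_of n A B \<Longrightarrow> inv_of n A C \<Longrightarrow> B = C"
  using inv_of_cancel(2)[of n A B C n] inv_ofD[of n A B] inv_ofD[of n A C] by simp

lemma inv_of_adj: "inv_of n A B \<Longrightarrow> inv_of n (adj A) (adj B)"
  unfolding inv_of_def by (metis adj_idm adj_mult carr_simps(7))

lemma inv_of_mult: assumes "inv_of n A B" "inv_of n C D" shows "inv_of n (A * C) (D * B)"
proof -
  note i = inv_ofD[OF assms(1)] inv_ofD[OF assms(2)]
  have "A * C * (D * B) = A * (C * D) * B" "D * B * (A * C) = D * (B * A) * C" by (simp_all add: mult.assoc)
  then show ?thesis using i by (simp add: inv_of_def)
qed

section \<open>Column vectors, eigenvalues and inverses\<close>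

lemma ent_mult_mat_vec: assumes "M \<in> carrier_mat r c" "v \<in> carrier_vec c" "i < r"
  shows "(M *\<^sub>v v) $ i = (\<Sum>k<c. ent (emb M) i k * v $ k)"
  using assms by (auto simp: mult_mat_vec_def scalar_prod_def lessThan_atLeast0 intro!: sum.cong)

abbreviation colv :: "nat \<Rightarrow> pmat set" where "colv n \<equiv> carr n (Suc 0)"

definition vemb :: "nat \<Rightarrow> complex Matrix.vec \<Rightarrow> pmat" where
  "vemb n v = trunc n (Suc 0) (\<lambda>i _. v $ i)"

lemma vemb_carr [simp]: "vemb n v \<in> colv n"
  by (simp add: vemb_def)
lemma ent_vemb [simp]: "i < n \<Longrightarrow> ent (vemb n v) i 0 = v $ i"
  by (simp add: vemb_def trunc.rep_eq)
lemma vemb_eq_iff: "v \<in> carrier_vec n \<Longrightarrow> w \<in> carrier_vec n \<Longrightarrow> vemb n v = vemb n w \<longleftrightarrow> v = w"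
  by (metis ent_vemb eq_vecI carrier_vecD)
lemma vemb_zero [simp]: "vemb n (0\<^sub>v n) = 0"
  by (rule carr_eqI[of _ n "Suc 0"]) (auto simp: vemb_def trunc.rep_eq)
lemma vemb_surj: "w \<in> colv n \<Longrightarrow> vemb n (Matrix.vec n (\<lambda>i. ent w i 0)) = w"
  by (rule carr_eqI[of _ n "Suc 0"]) (auto simp: vemb_def trunc.rep_eq)
lemma vemb_mult: assumes "M \<in> carrier_mat r c" "v \<in> carrier_vec c"
  shows "vemb r (M *\<^sub>v v) = emb M * vemb c v"
proof (rule carr_eqI[of _ r "Suc 0"])
  fix i j :: nat assume "i < r" "j < Suc 0"
  moreover from this have "ent (vemb r (M *\<^sub>v v)) i 0 = (M *\<^sub>v v) $ i" by (simp only: ent_vemb)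
  ultimately show "ent (vemb r (M *\<^sub>v v)) i j = ent (emb M * vemb c v) i j"
    using ent_times_carr[of "emb M" r c "vemb c v" "Suc 0"] ent_mult_mat_vec[OF assms] by simp
qed (use assms in \<open>auto intro: carr_mult[OF emb_carr]\<close>)
lemma vemb_smult: assumes "v \<in> carrier_vec n" shows "vemb n (z \<cdot>\<^sub>v v) = z *\<^sub>c vemb n v"
  using assms by (intro carr_eqI[of _ n "Suc 0"]) (auto simp: vemb_def trunc.rep_eq)

lemma emb_mat_inv:
  assumes "M \<in> carrier_mat n n" "invertible_mat M"
  shows "mat_inv M \<in> carrier_mat n n" "inv_of n (emb M) (emb (mat_inv M))"
proof -
  from assms(2) obtain B where B: "M * B = 1\<^sub>m (dim_row M)" "B * M = 1\<^sub>m (dim_row B)"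
    by (auto simp: invertible_mat_def inverts_mat_def)
  have "B \<in> carrier_mat n n"
    using B assms(1) by (metis carrier_matD carrier_matI index_mult_mat(2,3) index_one_mat(2,3))
  with B assms(1) have "M \<in> Units (ring_mat TYPE(complex) n undefined)"
    by (auto simp: Units_def ring_mat_def)
  then obtain C where C: "mat_inverse M = Some C"
    using mat_inverse(1)[OF assms(1)] by fastforce
  with mat_inverse(2)[OF assms(1) C] show "mat_inv M \<in> carrier_mat n n"
    "inv_of n (emb M) (emb (mat_inv M))"
    using assms(1) emb_mult[of M n n C n] emb_mult[of C n n M n] by (auto simp: mat_inv_def inv_of_def)
qed

lemma inv_of_imp_invertible_mat:
  assumes "M \<in> carrier_mat n n" "inv_of n (emb M) B" shows "invertible_mat M"
proof -
  note i = inv_ofD[OF assms(2)]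
  have "M * unemb n n B = 1\<^sub>m n" "unemb n n B * M = 1\<^sub>m n"
    using assms(1) i by (intro emb_inj[of _ n n] mult_carrier_mat[of _ n n] one_carrier_mat; simp add: emb_mult[of _ n n _ n])+
  then show ?thesis using assms(1)
    by (auto simp: invertible_mat_def inverts_mat_def intro!: exI[of _ "unemb n n B"])
qed

lemma invertible_mat_iff:
  assumes "M \<in> carrier_mat n n" shows "invertible_mat M \<longleftrightarrow> (\<exists>B. inv_of n (emb M) B)"
  using emb_mat_inv[OF assms] inv_of_imp_invertible_mat[OF assms] by blast

lemma emb_mat_inv_eq:
  assumes "M \<in> carrier_mat n n" "inv_of n (emb M) B" shows "emb (mat_inv M) = B" "mat_inv M \<in> carrier_mat n n"
  using emb_mat_inv[OF assms(1) inv_of_imp_invertible_mat[OF assms]] inv_of_unique assms(2) by blast+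

text \<open>Finite dimension: a trivial kernel makes the determinant nonzero, and this gives an
  inverse on both sides.\<close>

lemma inv_of_exists:
  assumes A: "A \<in> carr n n" and inj: "\<And>w. w \<in> colv n \<Longrightarrow> A * w = 0 \<Longrightarrow> w = 0"
  shows "\<exists>B. inv_of n A B"
proof -
  let ?M = "unemb n n A"
  have "det ?M \<noteq> 0"
  proof
    assume "det ?M = 0"
    then obtain v where v: "v \<in> carrier_vec n" "v \<noteq> 0\<^sub>v n" "?M *\<^sub>v v = 0\<^sub>v n"
      using det_0_iff_vec_prod_zero[of ?M n] by auto
    have "A * vemb n v = 0"
      using vemb_mult[of ?M n n v] v A by simp
    then have "vemb n v = 0" by (rule inj[OF vemb_carr])
    then show False using v vemb_eq_iff[of v n "0\<^sub>v n"] by auto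
  qed
  then have "?M \<in> Units (ring_mat TYPE(complex) n undefined)"
    by (rule det_non_zero_imp_unit[rotated]) simp
  then obtain N where N: "N \<in> carrier_mat n n" "N * ?M = 1\<^sub>m n" "?M * N = 1\<^sub>m n"
    by (auto simp: Units_def ring_mat_def)
  then have "inv_of n A (emb N)"
    using A emb_mult[of N n n ?M n] emb_mult[of ?M n n N n] by (simp add: inv_of_def)
  then show ?thesis ..
qed

lemma eigen_or_inv:
  assumes A: "A \<in> carr n n"
  shows "(\<exists>B. inv_of n (z *\<^sub>c idm n - A) B) \<or> (\<exists>w\<in>colv n. w \<noteq> 0 \<and> A * w = z *\<^sub>c w)"
proof (cases "\<exists>w\<in>colv n. w \<noteq> 0 \<and> A * w = z *\<^sub>c w")
  case False
  have "\<exists>B. inv_of n (z *\<^sub>c idm n - A) B"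
  proof (rule inv_of_exists)
    fix w assume w: "w \<in> colv n" "(z *\<^sub>c idm n - A) * w = 0"
    have "(z *\<^sub>c idm n - A) * w = z *\<^sub>c w - A * w"
      using w(1) by (simp add: left_diff_distrib)
    then have "A * w = z *\<^sub>c w" using w(2) by simp
    then show "w = 0" using False w(1) by blast
  qed (use A in auto)
  then show ?thesis ..
qed simp

lemma inv_no_eigen:
  assumes "inv_of n (z *\<^sub>c idm n - A) B" "w \<in> colv n" "A * w = z *\<^sub>c w" shows "w = 0"
  using inv_of_cancel(2)[OF assms(1,2)] assms by (simp add: left_diff_distrib)

text \<open>A point without resolvent is an eigenvalue. Later limit arguments only have to avoid
  this finite set.\<close>

lemma finite_not_inv:
  assumes A: "A \<in> carr n n" shows "finite {z. \<not> (\<exists>B. inv_of n (z *\<^sub>c idm n - A) B)}"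
proof (rule finite_subset)
  let ?M = "unemb n n A"
  show "{z. \<not> (\<exists>B. inv_of n (z *\<^sub>c idm n - A) B)} \<subseteq> spectrum ?M"
  proof
    fix z assume "z \<in> {z. \<not> (\<exists>B. inv_of n (z *\<^sub>c idm n - A) B)}"
    then obtain w where w: "w \<in> colv n" "w \<noteq> 0" "A * w = z *\<^sub>c w"
      using eigen_or_inv[OF A] by blast
    define v where "v = Matrix.vec n (\<lambda>i. ent w i 0)"
    have v: "v \<in> carrier_vec n" "vemb n v = w" using vemb_surj[OF w(1)] by (auto simp: v_def)
    have "v \<noteq> 0\<^sub>v n" using v w by auto
    moreover have "?M *\<^sub>v v = z \<cdot>\<^sub>v v"
      using v A w vemb_mult[of ?M n n v] vemb_smult[of v n z]
      by (subst vemb_eq_iff[of _ n, symmetric]) (auto intro: mult_mat_vec_carrier[of _ n n])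
    ultimately show "z \<in> spectrum ?M"
      using v by (auto simp: spectrum_def eigenvalue_def eigenvector_def)
  qed
  show "finite (spectrum ?M)" using card_finite_spectrum[of ?M n] by auto
qed

text \<open>From \<open>g - b = - g (f - a) b\<close> and \<open>norm (f - a) * norm b < 1/2\<close>
  one first gets \<open>norm g \<le> 2 * norm b\<close>; inserting this bound into the same identity
  gives convergence. No continuity of \<open>g\<close> is presupposed.\<close>

lemma tendsto_inv_of:
  assumes lim: "(f \<longlongrightarrow> a) F" and inv: "\<forall>\<^sub>F x in F. inv_of n (f x) (g x)" and a: "inv_of n a b"
  shows "(g \<longlongrightarrow> b) F"
proof -
  have "((\<lambda>x. norm (f x - a) * norm b) \<longlongrightarrow> 0 * norm b) F"
    by (intro tendsto_intros) (use lim in \<open>simp add: Lim_null[symmetric] tendsto_norm_zero_iff\<close>)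
  then have lim0: "((\<lambda>x. norm (f x - a) * norm b) \<longlongrightarrow> 0) F" by simp
  then have small: "\<forall>\<^sub>F x in F. norm (f x - a) * norm b < 1/2"
    by (rule order_tendstoD) simp
  have "\<forall>\<^sub>F x in F. norm (g x - b) \<le> 2 * norm b * (norm (f x - a) * norm b)"
    using small inv
  proof eventually_elim
    case (elim x)
    note i = inv_ofD[OF elim(2)] inv_ofD[OF a]
    have "- (g x * (f x - a) * b) = g x * (a * b) - (g x * f x) * b"
      by (simp add: algebra_simps)
    then have eq: "g x - b = - (g x * (f x - a) * b)"
      using i by simp
    have le: "norm (g x - b) \<le> norm (g x) * (norm (f x - a) * norm b)"
      unfolding eq norm_minus_cancel mult.assoc
      using norm_mult_ineq[of "g x" "(f x - a) * b"]
        mult_left_mono[OF norm_mult_ineq[of "f x - a" b] norm_ge_zero[of "g x"]] by linarith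
    have "norm (g x) \<le> norm (g x - b) + norm b" using norm_triangle_sub[of "g x" b] by simp
    also have "\<dots> \<le> norm (g x) * (1/2) + norm b"
      using le mult_left_mono[OF less_imp_le[OF elim(1)] norm_ge_zero[of "g x"]] by linarith
    finally have "norm (g x) \<le> 2 * norm b" by simp
    then have "norm (g x) * (norm (f x - a) * norm b) \<le> 2 * norm b * (norm (f x - a) * norm b)"
      by (rule mult_right_mono) simp
    with le show ?case by linarith
  qed
  moreover have "((\<lambda>x. 2 * norm b * (norm (f x - a) * norm b)) \<longlongrightarrow> 0) F"
    using tendsto_mult_left[OF lim0, of "2 * norm b"] by simp
  ultimately have "((\<lambda>x. g x - b) \<longlongrightarrow> 0) F" by (rule Lim_null_comparison)
  then show ?thesis by (simp add: Lim_null[symmetric])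
qed

lemma has_vector_derivative_iff_quotient:
  fixes f :: "real \<Rightarrow> 'a::real_normed_vector"
  shows "(f has_vector_derivative f') (at x within S) \<longleftrightarrow>
    ((\<lambda>y. (f y - f x) /\<^sub>R (y - x)) \<longlongrightarrow> f') (at x within S)"
proof -
  have "norm (f y - f x - (y - x) *\<^sub>R f') / norm (y - x) = norm ((f y - f x) /\<^sub>R (y - x) - f')"
    if "y \<noteq> x" for y
  proof -
    have "(f y - f x) /\<^sub>R (y - x) - f' = (f y - f x - (y - x) *\<^sub>R f') /\<^sub>R (y - x)"
      using that by (simp add: scaleR_diff_right)
    then show ?thesis by (simp add: divide_inverse mult.commute)
  qed
  then have "((\<lambda>y. norm (f y - f x - (y - x) *\<^sub>R f') / norm (y - x)) \<longlongrightarrow> 0) (at x within S) \<longleftrightarrow>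
      ((\<lambda>y. norm ((f y - f x) /\<^sub>R (y - x) - f')) \<longlongrightarrow> 0) (at x within S)"
    by (intro Lim_cong_within) auto
  also have "\<dots> \<longleftrightarrow> ((\<lambda>y. (f y - f x) /\<^sub>R (y - x)) \<longlongrightarrow> f') (at x within S)"
    by (simp add: Lim_null[of _ f'] tendsto_norm_zero_iff)
  finally show ?thesis
    by (simp add: has_vector_derivative_def has_derivative_iff_norm bounded_linear_scaleR_left)
qed

text \<open>The difference quotient of the inverse equals \<open>- g y\<close> times the quotient of
  \<open>f\<close> times \<open>g x\<close> exactly, so only the continuity of inversion is left to
  use.\<close>

lemma has_vector_derivative_inv_of:
  assumes f: "(f has_vector_derivative f') (at x within S)" and x: "x \<in> S"
    and inv: "\<And>y. y \<in> S \<Longrightarrow> inv_of n (f y) (g y)"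
  shows "(g has_vector_derivative - (g x * f' * g x)) (at x within S)"
proof -
  have ev: "\<forall>\<^sub>F y in at x within S. y \<in> S" by (simp add: eventually_at_filter)
  have "(f \<longlongrightarrow> f x) (at x within S)"
    using has_vector_derivative_continuous[OF f] by (simp add: continuous_within)
  then have g: "(g \<longlongrightarrow> g x) (at x within S)"
    by (rule tendsto_inv_of[where n=n]) (use inv x ev in \<open>auto elim: eventually_mono\<close>)
  have "((\<lambda>y. - (g y * ((f y - f x) /\<^sub>R (y - x)) * g x)) \<longlongrightarrow> - (g x * f' * g x)) (at x within S)"
    using f by (intro tendsto_intros g) (simp add: has_vector_derivative_iff_quotient)
  then show ?thesis unfolding has_vector_derivative_iff_quotient
  proof (rule Lim_transform_eventually)
    show "\<forall>\<^sub>F y in at x within S. - (g y * ((f y - f x) /\<^sub>R (y - x)) * g x) = (g y - g x) /\<^sub>R (y - x)"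
      using ev
    proof eventually_elim
      case (elim y)
      note i = inv_ofD[OF inv[OF elim]] inv_ofD[OF inv[OF x]]
      have "- (g y * (f y - f x) * g x) = g y * (f x * g x) - (g y * f y) * g x"
        by (simp add: algebra_simps)
      also have "\<dots> = g y - g x" using i by simp
      finally have "- (g y * (f y - f x) * g x) = g y - g x" .
      then show ?case by (metis mult_scaleR_left mult_scaleR_right scaleR_minus_right)
    qed
  qed
qed

section \<open>The Hermitian form and positive matrices\<close>

definition ip :: "pmat \<Rightarrow> pmat \<Rightarrow> complex" where
  "ip w u = ent (adj w * u) 0 0"

lemma ip_simps [simp]:
  "ip w 0 = 0" "ip 0 w = 0"
  "ip w (u + v) = ip w u + ip w v" "ip (w + u) v = ip w v + ip u v"
  "ip w (u - v) = ip w u - ip w v" "ip (w - u) v = ip w v - ip u v"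
  "ip w (- u) = - ip w u" "ip (- w) u = - ip w u"
  "ip w (z *\<^sub>c u) = z * ip w u" "ip (z *\<^sub>c w) u = cnj z * ip w u"
  by (simp_all add: ip_def distrib_left distrib_right left_diff_distrib right_diff_distrib)

lemma ip_adj: "ip (A * w) u = ip w (adj A * u)"
  by (simp add: ip_def mult.assoc)
lemma ip_adj': "ip w (A * u) = ip (adj A * w) u"
  by (simp add: ip_adj)
lemma cnj_ip: "cnj (ip w u) = ip u w"
proof -
  have "cnj (ip w u) = ent (adj (adj w * u)) 0 0" by (simp only: ip_def ent_adj)
  then show ?thesis by (simp add: ip_def)
qed

lemma unit_colv: "i < n \<Longrightarrow> unit_pmat i 0 \<in> colv n"
  by (auto simp: carr_def unit_pmat.rep_eq)

lemma ent_mult_unit: "A \<in> carr r c \<Longrightarrow> j < c \<Longrightarrow> ent (A * unit_pmat j 0) i 0 = ent A i j"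
  by (subst ent_times_carr[of _ r c]) (auto simp: unit_pmat.rep_eq if_distrib[of "times _"] cong: if_cong)

lemma ip_unit:
  assumes P: "P \<in> carr n n" and ij: "i < n" "j < n"
  shows "ip (unit_pmat i 0) (P * unit_pmat j 0) = ent P i j"
proof -
  have "ip (unit_pmat i 0) (P * unit_pmat j 0) = (\<Sum>l<n. cnj (ent (unit_pmat i 0) l 0) * ent (P * unit_pmat j 0) l 0)"
    unfolding ip_def using unit_colv ij by (subst ent_times_carr[of _ "Suc 0" n]) auto
  also have "\<dots> = (\<Sum>l<n. if l = i then ent P i j else 0)"
    by (intro sum.cong) (auto simp: ent_mult_unit[OF P ij(2)] unit_pmat.rep_eq)
  finally show ?thesis using ij by simp
qed

lemma ip_self: assumes "w \<in> colv n"
  shows "ip w w = of_real (\<Sum>i<n. (cmod (ent w i 0))\<^sup>2)"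
proof -
  have "ip w w = (\<Sum>i<n. cnj (ent w i 0) * ent w i 0)"
    using ent_times_carr[of "adj w" "Suc 0" n w "Suc 0" 0 0] assms by (simp add: ip_def)
  also have "\<dots> = (\<Sum>i<n. of_real ((cmod (ent w i 0))\<^sup>2))"
    by (intro sum.cong refl) (metis complex_norm_square mult.commute)
  finally show ?thesis by simp
qed

lemma ip_self_nonneg: "w \<in> colv n \<Longrightarrow> 0 \<le> Re (ip w w)"
  by (simp add: ip_self sum_nonneg)

lemma ip_self_eq_0: assumes "w \<in> colv n" "Re (ip w w) = 0" shows "w = 0"
proof (rule carr_eqI[of _ n "Suc 0"])
  fix i j :: nat assume "i < n" "j < Suc 0"
  have "(\<Sum>i<n. (cmod (ent w i 0))\<^sup>2) = 0" using assms by (simp add: ip_self)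
  then have "\<forall>i\<in>{..<n}. (cmod (ent w i 0))\<^sup>2 = 0"
    by (subst (asm) sum_nonneg_eq_0_iff) auto
  then show "ent w i j = ent 0 i j" using \<open>i < n\<close> \<open>j < Suc 0\<close> by simp
qed (use assms in auto)

lemma ip_self_le_0: assumes "w \<in> colv n" "Re (ip w w) \<le> 0" shows "w = 0"
  using ip_self_eq_0[OF assms(1)] ip_self_nonneg[OF assms(1)] assms(2) by linarith

lemma norm_ip_le: "cmod (ip w u) \<le> norm w * norm u"
proof -
  have "cmod (ip w u) \<le> norm (adj w * u)" unfolding ip_def by (rule norm_ent_le)
  also have "\<dots> \<le> norm (adj w) * norm u" by (rule norm_mult_ineq)
  finally show ?thesis by simp
qed

definition psd :: "nat \<Rightarrow> pmat \<Rightarrow> bool" where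
  "psd n P \<longleftrightarrow> P \<in> carr n n \<and> adj P = P \<and> (\<forall>w\<in>colv n. 0 \<le> Re (ip w (P * w)))"

definition pd :: "nat \<Rightarrow> pmat \<Rightarrow> bool" where
  "pd n P \<longleftrightarrow> P \<in> carr n n \<and> adj P = P \<and> (\<forall>w\<in>colv n. w \<noteq> 0 \<longrightarrow> 0 < Re (ip w (P * w)))"

lemma psdD: assumes "psd n P" shows "P \<in> carr n n" "adj P = P" "w \<in> colv n \<Longrightarrow> 0 \<le> Re (ip w (P * w))"
  using assms by (auto simp: psd_def)

lemma pdD: assumes "pd n P" shows "P \<in> carr n n" "adj P = P" "w \<in> colv n \<Longrightarrow> w \<noteq> 0 \<Longrightarrow> 0 < Re (ip w (P * w))"
  using assms by (auto simp: pd_def)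

lemma pd_imp_psd: "pd n P \<Longrightarrow> psd n P"
  unfolding pd_def psd_def by (metis ip_simps(1) less_eq_real_def mult_zero_right zero_complex.simps(1))

text \<open>Moving from \<open>w\<close> in the direction \<open>u = P w\<close> changes the form by
  \<open>t^2 a + 2 t b\<close> with \<open>b\<close> the squared length of \<open>P w\<close>. If
  this is never negative, the linear coefficient must vanish.\<close>

lemma psd_kernel:
  assumes P: "psd n P" and w: "w \<in> colv n" "Re (ip w (P * w)) = 0"
  shows "P * w = 0"
proof -
  note i = psdD[OF P]
  define u where "u = P * w"
  have u: "u \<in> colv n" using i w by (auto simp: u_def intro: carr_mult)
  define a b where "a = Re (ip u (P * u))" and "b = Re (ip u u)"
  have ipu: "ip w (P * u) = ip u u" using i(2) by (simp add: ip_adj' u_def)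
  have *: "0 \<le> t\<^sup>2 * a + 2 * t * b" for t :: real
  proof -
    have "0 \<le> Re (ip (w + complex_of_real t *\<^sub>c u) (P * (w + complex_of_real t *\<^sub>c u)))"
      using i w u by (intro i(3)) auto
    also have "\<dots> = t\<^sup>2 * a + 2 * t * b"
      using w ipu by (simp add: distrib_left a_def b_def u_def[symmetric] power2_eq_square algebra_simps)
    finally show ?thesis .
  qed
  have a: "0 \<le> a" using i(3) u by (simp add: a_def)
  have b: "0 \<le> b" using ip_self_nonneg[OF u] by (simp add: b_def)
  have "b = 0"
  proof (rule ccontr)
    assume "b \<noteq> 0"
    with b have b0: "b > 0" by simp
    \<comment> \<open>The step is small enough for \<open>t * a \<le> b\<close>; the
      \<open>+ 1\<close> covers \<open>a = 0\<close>. The inequality is then used at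
      \<open>- t\<close>.\<close>
    define t where "t = b / (a + 1)"
    have t: "t > 0" "t * a \<le> b" using a b0 by (simp_all add: t_def field_simps)
    have "0 \<le> t * (t * a - 2 * b)"
      using *[of "- t"] by (simp add: power2_eq_square algebra_simps)
    with t(1) have "0 \<le> t * a - 2 * b" by (simp add: zero_le_mult_iff)
    with t(2) b0 show False by simp
  qed
  then show ?thesis using ip_self_eq_0[OF u] by (simp add: b_def u_def)
qed

lemma psd_no_kernel_imp_pd:
  assumes P: "psd n P" and ker: "\<And>w. w \<in> colv n \<Longrightarrow> P * w = 0 \<Longrightarrow> w = 0" shows "pd n P"
  unfolding pd_def
proof (intro conjI ballI impI)
  fix w assume w: "w \<in> colv n" "w \<noteq> 0"
  then have "P * w \<noteq> 0" using ker by blast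
  then have "Re (ip w (P * w)) \<noteq> 0" using psd_kernel[OF P w(1)] by blast
  then show "0 < Re (ip w (P * w))" using psdD(3)[OF P w(1)] by linarith
qed (use psdD[OF P] in auto)

lemma pd_inv_of_exists: assumes P: "pd n P" shows "\<exists>X. inv_of n P X"
proof (rule inv_of_exists)
  fix w assume w: "w \<in> colv n" "P * w = 0"
  then show "w = 0" using pdD(3)[OF P w(1)] by fastforce
qed (use pdD[OF P] in auto)

lemma inv_of_pd: assumes P: "pd n P" and X: "inv_of n P X" shows "pd n X"
  unfolding pd_def
proof (intro conjI ballI impI)
  note i = inv_ofD[OF X]
  show "X \<in> carr n n" by (rule i)
  have "inv_of n P (adj X)" using inv_of_adj[OF X] pdD(2)[OF P] by simp
  then show "adj X = X" by (rule inv_of_unique[OF _ X])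
  fix w assume w: "w \<in> colv n" "w \<noteq> 0"
  have Xw: "X * w \<in> colv n" using i w by (auto intro: carr_mult)
  have eq: "P * (X * w) = w" by (rule inv_of_cancel[OF X w(1)])
  then have "X * w \<noteq> 0" using w by force
  then have "0 < Re (ip (X * w) (P * (X * w)))" by (rule pdD(3)[OF P Xw])
  then have "0 < Re (ip (X * w) w)" using eq by simp
  then show "0 < Re (ip w (X * w))" using cnj_ip[of "X * w" w] by (metis cnj.sel(1))
qed

section \<open>Eigenvectors in invariant kernels\<close>

abbreviation papply :: "pmat \<Rightarrow> nat \<Rightarrow> pmat \<Rightarrow> pmat" where
  "papply T k v \<equiv> (((*) T) ^^ k) v"

lemma papply_carr: "T \<in> carr n n \<Longrightarrow> v \<in> colv n \<Longrightarrow> papply T k v \<in> colv n"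
  by (induction k) (auto intro: carr_mult)

text \<open>This is \<open>p(T) v\<close>, formed from the orbit of \<open>v\<close>: the algebra
  has no unit that could serve as \<open>T^0\<close>.\<close>

definition poly_act :: "complex poly \<Rightarrow> pmat \<Rightarrow> pmat \<Rightarrow> pmat" where
  "poly_act p T v = (\<Sum>k\<le>degree p. coeff p k *\<^sub>c papply T k v)"

lemma poly_act_eq: assumes "degree p \<le> N" shows "poly_act p T v = (\<Sum>k\<le>N. coeff p k *\<^sub>c papply T k v)"
  unfolding poly_act_def using assms by (intro sum.mono_neutral_left) (auto simp: coeff_eq_0)

lemma poly_act_linear_factor:
  assumes "v \<in> colv n"
  shows "poly_act ([:- z, 1:] * q) T v = T * poly_act q T v - z *\<^sub>c poly_act q T v"
proof -
  define N where "N = degree q"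
  have c: "coeff ([:- z, 1:] * q) k = coeff (pCons 0 q) k - z * coeff q k" for k by simp
  have d: "degree ([:- z, 1:] * q) \<le> Suc N"
    using degree_mult_le[of "[:- z, 1:]" q] by (simp add: N_def)
  have "poly_act ([:- z, 1:] * q) T v = (\<Sum>k\<le>Suc N. coeff (pCons 0 q) k *\<^sub>c papply T k v)
      - (\<Sum>k\<le>Suc N. (z * coeff q k) *\<^sub>c papply T k v)"
    by (simp only: poly_act_eq[OF d] c cscale_diff_left sum_subtractf)
  also have "(\<Sum>k\<le>Suc N. coeff (pCons 0 q) k *\<^sub>c papply T k v) = T * poly_act q T v"
    by (subst sum.atMost_Suc_shift) (simp add: poly_act_def N_def sum_distrib_left)
  also have "(\<Sum>k\<le>Suc N. (z * coeff q k) *\<^sub>c papply T k v) = z *\<^sub>c poly_act q T v"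
    by (subst poly_act_eq[of q "Suc N"]) (auto simp: N_def cscale_sum simp del: sum.atMost_Suc)
  finally show ?thesis .
qed

text \<open>The \<open>n + 1\<close> vectors \<open>T^k v\<close> are the columns of an
  \<open>n\<close> by \<open>n + 1\<close> matrix \<open>K\<close>. Read as a square matrix of size
  \<open>n + 1\<close> it has a zero last row, so it is singular, and the entries of a kernel vector
  are the coefficients of \<open>p\<close>.\<close>

lemma annihilating_poly:
  assumes T: "T \<in> carr n n" and v: "v \<in> colv n"
  shows "\<exists>p. p \<noteq> 0 \<and> poly_act p T v = 0"
proof -
  define K where "K = trunc n (Suc n) (\<lambda>i k. ent (papply T k v) i 0)"
  have K: "K \<in> carr n (Suc n)" by (simp add: K_def)
  then have K': "K \<in> carr (Suc n) (Suc n)" by (auto simp: carr_def)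
  have "\<not> (\<exists>B. inv_of (Suc n) K B)"
  proof
    assume "\<exists>B. inv_of (Suc n) K B"
    then obtain B where B: "inv_of (Suc n) K B" ..
    have "ent (K * B) n n = 0"
      using carr_mult[OF K inv_ofD(2)[OF B]] carrD by blast
    then show False using inv_ofD(3)[OF B] by (simp add: idm.rep_eq)
  qed
  then obtain c where c: "c \<in> colv (Suc n)" "c \<noteq> 0" "K * c = 0"
    using inv_of_exists[OF K'] by blast
  define p where "p = (\<Sum>k\<le>n. monom (ent c k 0) k)"
  have cp: "coeff p k = (if k \<le> n then ent c k 0 else 0)" for k
    by (simp add: p_def coeff_sum)
  have deg: "degree p \<le> n" by (rule degree_le) (auto simp: cp)
  have "p \<noteq> 0"
  proof
    assume "p = 0"
    then have z: "ent c k 0 = 0" if "k \<le> n" for k using cp[of k] that by simp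
    have "c = 0" using c(1) z by (intro carr_eqI[of _ "Suc n" "Suc 0"]) auto
    then show False using c by simp
  qed
  moreover have "poly_act p T v = 0"
  proof (rule carr_eqI[of _ n "Suc 0"])
    fix i j :: nat assume ij: "i < n" "j < Suc 0"
    have "ent (poly_act p T v) i j = (\<Sum>k\<le>n. ent c k 0 * ent (papply T k v) i 0)"
      using ij by (simp add: poly_act_eq[OF deg] cp)
    also have "\<dots> = (\<Sum>k<Suc n. ent K i k * ent c k 0)"
      using ij by (intro sum.cong) (auto simp: K_def trunc.rep_eq)
    also have "\<dots> = ent (K * c) i 0" by (rule ent_times_carr[symmetric]) (use K in auto)
    finally show "ent (poly_act p T v) i j = ent 0 i j" using c by simp
  qed (auto simp: poly_act_def intro!: carr_sum carr_simps papply_carr T v)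
  ultimately show ?thesis by blast
qed

text \<open>No basis of the kernel is needed. Linear factors are split off an annihilating
  polynomial of \<open>v\<close> until the remaining factor \<open>q\<close> no longer kills
  \<open>v\<close>; then \<open>q(T) v\<close> is an eigenvector, and it stays in the kernel because
  the kernel is invariant.\<close>

lemma eigenvector_in_kernel:
  assumes T: "T \<in> carr n n"
    and inv: "\<And>w. w \<in> colv n \<Longrightarrow> U * w = 0 \<Longrightarrow> U * (T * w) = 0"
    and v: "v \<in> colv n" "v \<noteq> 0" "U * v = 0"
  shows "\<exists>z w. w \<in> colv n \<and> w \<noteq> 0 \<and> U * w = 0 \<and> T * w = z *\<^sub>c w"
proof -
  have pow: "papply T k v \<in> colv n \<and> U * papply T k v = 0" for k
    by (induction k) (use v T inv in \<open>auto intro: carr_mult\<close>)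
  have act: "poly_act p T v \<in> colv n \<and> U * poly_act p T v = 0" for p
    using pow by (auto simp: poly_act_def sum_distrib_left intro!: carr_sum carr_simps sum.neutral)
  have "\<exists>z w. w \<in> colv n \<and> w \<noteq> 0 \<and> U * w = 0 \<and> T * w = z *\<^sub>c w"
    if "p \<noteq> 0" "poly_act p T v = 0" for p
    using that
  proof (induction "degree p" arbitrary: p)
    case 0
    then have "coeff p 0 \<noteq> 0" by (metis leading_coeff_0_iff)
    then show ?case using 0 v by (simp add: poly_act_def)
  next
    case (Suc d)
    then obtain z where "poly p z = 0"
      by (metis constant_degree fundamental_theorem_of_algebra nat.distinct(1))
    then obtain q where q: "p = [:- z, 1:] * q" by (metis dvdE poly_eq_0_iff_dvd)
    with Suc have q0: "q \<noteq> 0" by auto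
    have dq: "d = degree q" using Suc(2) q0 unfolding q by (subst (asm) degree_mult_eq) auto
    show ?case
    proof (cases "poly_act q T v = 0")
      case True
      then show ?thesis using Suc(1) dq q0 by blast
    next
      case False
      have "T * poly_act q T v = z *\<^sub>c poly_act q T v"
        using Suc(4) poly_act_linear_factor[OF v(1), of z q T] q by simp
      then show ?thesis using False act by blast
    qed
  qed
  then show ?thesis using annihilating_poly[OF T v(1)] by blast
qed

section \<open>Lyapunov's theorem\<close>

text \<open>A spectral radius below 1 bounds the powers. This is applied to \<open>A / r\<close>
  with \<open>r\<close> halfway between the spectral radius of \<open>A\<close> and 1, which leaves
  room for the decaying factor \<open>r^k\<close>.\<close>

lemma papply_tendsto_0:
  assumes A: "A \<in> carr n n" and w: "w \<in> colv n"
    and ev: "\<And>z w. w \<in> colv n \<Longrightarrow> w \<noteq> 0 \<Longrightarrow> A * w = z *\<^sub>c w \<Longrightarrow> cmod z < 1"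
  shows "(\<lambda>k. papply A k w) \<longlonglongrightarrow> 0"
proof (cases "n = 0")
  \<comment> \<open>For \<open>n = 0\<close> the spectrum is empty and the spectral radius is not an
    attained maximum.\<close>
  case True
  then have "papply A k w = 0" for k
    using papply_carr[OF A w, of k] by (intro pmat_eqI) (auto simp: carr_def)
  then show ?thesis by simp
next
  case False
  define M where "M = unemb n n A"
  have M: "M \<in> carrier_mat n n" "emb M = A" using A by (auto simp: M_def)
  have eigen: "cmod z < 1" if "z \<in> spectrum M" for z
  proof -
    from that obtain x where x: "x \<in> carrier_vec n" "x \<noteq> 0\<^sub>v n" "M *\<^sub>v x = z \<cdot>\<^sub>v x"
      using M by (auto simp: spectrum_def eigenvalue_def eigenvector_def)
    then have "A * vemb n x = z *\<^sub>c vemb n x"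
      using vemb_mult[OF M(1) x(1)] vemb_smult[OF x(1)] M by simp
    moreover have "vemb n x \<noteq> 0" using vemb_eq_iff[of x n "0\<^sub>v n"] x by auto
    ultimately show ?thesis using ev vemb_carr by blast
  qed
  define s where "s = spectral_radius M"
  have s: "s < 1" "0 \<le> s"
    using spectral_radius_mem_max(1)[OF M(1)] False eigen by (auto simp: s_def)
  define r where "r = (1 + s) / 2"
  have r: "0 < r" "r < 1" "s < r" using s by (auto simp: r_def)
  define M' where "M' = complex_of_real (1 / r) \<cdot>\<^sub>m M"
  have M': "M' \<in> carrier_mat n n" using M by (simp add: M'_def)
  have "spectral_radius M' < 1"
  proof -
    obtain z where z: "z \<in> spectrum M'" "spectral_radius M' = cmod z"
      using spectral_radius_mem_max(1)[OF M'] False by auto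
    then obtain x where x: "x \<in> carrier_vec n" "x \<noteq> 0\<^sub>v n" "M' *\<^sub>v x = z \<cdot>\<^sub>v x"
      using M' by (auto simp: spectrum_def eigenvalue_def eigenvector_def)
    have "M *\<^sub>v x = (complex_of_real r * z) \<cdot>\<^sub>v x"
    proof -
      have "vemb n (M' *\<^sub>v x) = complex_of_real (1 / r) *\<^sub>c (A * vemb n x)"
        using vemb_mult[OF M' x(1)] M by (simp add: M'_def)
      then have "z *\<^sub>c vemb n x = complex_of_real (1 / r) *\<^sub>c (A * vemb n x)"
        using x vemb_smult[of x n z] by simp
      then have "(complex_of_real r * z) *\<^sub>c vemb n x =
          complex_of_real r *\<^sub>c complex_of_real (1 / r) *\<^sub>c (A * vemb n x)"
        by (metis cscale_cscale)
      also have "\<dots> = A * vemb n x" using r by (simp flip: of_real_mult)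
      finally have "vemb n (M *\<^sub>v x) = vemb n ((complex_of_real r * z) \<cdot>\<^sub>v x)"
        using vemb_mult[OF M(1) x(1)] vemb_smult[OF x(1), of "complex_of_real r * z"] M by simp
      then show ?thesis using M x by (subst (asm) vemb_eq_iff) (auto intro: mult_mat_vec_carrier[of _ n n])
    qed
    then have "complex_of_real r * z \<in> spectrum M"
      using M x by (auto simp: spectrum_def eigenvalue_def eigenvector_def)
    then have "cmod (complex_of_real r * z) \<le> s"
      using spectral_radius_mem_max(2)[OF M(1)] False by (auto simp: s_def)
    then have "r * cmod z \<le> s" using r by (simp add: norm_mult)
    also have "s < r * 1" using r by simp
    finally have "cmod z < 1" using r by (metis mult_less_cancel_left_pos)
    then show ?thesis using z by simp
  qed
  then obtain c where c: "\<And>k. norm_bound (M' ^\<^sub>m k) c"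
    using spectral_radius_jnf_norm_bound_less_1_upper_triangular[OF M'] by blast
  have car: "M' ^\<^sub>m k \<in> carrier_mat n n" for k using M' by simp
  have pow: "emb (M' ^\<^sub>m k) * u = complex_of_real (1 / r) ^ k *\<^sub>c papply A k u" if "u \<in> colv n" for k u
    using that
  proof (induction k arbitrary: u)
    case 0
    then show ?case using M' by simp
  next
    case (Suc k)
    have "emb (M' ^\<^sub>m Suc k) * u = emb (M' ^\<^sub>m k) * (complex_of_real (1 / r) *\<^sub>c (A * u))"
      using emb_mult[OF car M'] M by (simp add: mult.assoc M'_def)
    also have "\<dots> = complex_of_real (1 / r) *\<^sub>c complex_of_real (1 / r) ^ k *\<^sub>c papply A k (A * u)"
      using Suc.IH[of "A * u"] Suc.prems A by (simp add: carr_mult[of _ n n])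
    finally show ?case by (simp add: funpow_swap1)
  qed
  have bound: "norm (papply A k w) \<le> r ^ k * (real n * (real n * c) * norm w)" for k
  proof -
    have cb: "cmod ((M' ^\<^sub>m k) $$ (i, j)) \<le> c" if "i < n" "j < n" for i j
      using c[of k, unfolded norm_bound_def] carrier_matD[OF car[of k]] that by metis
    have "norm (emb (M' ^\<^sub>m k)) = (\<Sum>i<n. \<Sum>j<n. cmod (ent (emb (M' ^\<^sub>m k)) i j))"
      using emb_carr[OF car[of k]] by (intro norm_pmat_eq) (auto simp: bnd_def carr_def)
    also have "\<dots> \<le> (\<Sum>i<n. \<Sum>j<n. c)"
      using cb by (intro sum_mono) (simp add: ent_emb_carrier[OF car])
    finally have nb: "norm (emb (M' ^\<^sub>m k)) \<le> real n * (real n * c)" by simp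
    have "complex_of_real r ^ k *\<^sub>c (emb (M' ^\<^sub>m k) * w) = papply A k w"
      using pow[OF w, of k] r by (simp flip: power_mult_distrib of_real_mult)
    then have "norm (papply A k w) = r ^ k * norm (emb (M' ^\<^sub>m k) * w)"
      using r by (metis norm_cscale norm_power norm_of_real abs_of_pos)
    also have "\<dots> \<le> r ^ k * (norm (emb (M' ^\<^sub>m k)) * norm w)"
      using r by (intro mult_left_mono norm_mult_ineq) auto
    also have "\<dots> \<le> r ^ k * (real n * (real n * c) * norm w)"
      using nb r by (intro mult_left_mono mult_right_mono) auto
    finally show ?thesis .
  qed
  have "(\<lambda>k. r ^ k * (real n * (real n * c) * norm w)) \<longlonglongrightarrow> 0"
    using tendsto_mult_left_zero[OF LIMSEQ_realpow_zero[of r]] r by (auto intro: tendsto_mult_left_zero)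
  then show ?thesis
    by (rule Lim_null_comparison[rotated]) (use bound in auto)
qed

text \<open>The Cayley transform \<open>E = (a + i) (a - i)\<^sup>-\<^sup>1\<close> turns the Lyapunov inequality into
  \<open>P \<ge> E\<^sup>* P E\<close>, and its powers tend to \<open>0\<close>.\<close>
lemma lyapunov_psd:
  assumes a: "a \<in> carr n n" and P: "P \<in> carr n n" "adj P = P"
    and ev: "\<And>z w. w \<in> colv n \<Longrightarrow> w \<noteq> 0 \<Longrightarrow> a * w = z *\<^sub>c w \<Longrightarrow> Im z < 0"
    and Q: "\<And>w. w \<in> colv n \<Longrightarrow> 0 \<le> Re (ip w (\<i> *\<^sub>c (P * a - adj a * P) * w))"
  shows "psd n P"
proof -
  define Am where "Am = a - \<i> *\<^sub>c idm n"
  define Ap where "Ap = a + \<i> *\<^sub>c idm n"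
  have car: "Am \<in> carr n n" "Ap \<in> carr n n" using a by (auto simp: Am_def Ap_def)
  have "\<exists>B. inv_of n (\<i> *\<^sub>c idm n - a) B"
    using eigen_or_inv[OF a, of \<i>] ev by fastforce
  then obtain B where B: "inv_of n (\<i> *\<^sub>c idm n - a) B" ..
  define G where "G = - B"
  have "Am = - (\<i> *\<^sub>c idm n - a)" by (simp add: Am_def)
  then have "Am * G = (\<i> *\<^sub>c idm n - a) * B" "G * Am = B * (\<i> *\<^sub>c idm n - a)"
    by (simp_all add: G_def del: minus_diff_eq)
  then have G: "inv_of n Am G" using B car unfolding inv_of_def G_def by simp
  note g = inv_ofD[OF G]
  define E where "E = Ap * G"
  have E: "E \<in> carr n n" using car g by (auto simp: E_def intro: carr_mult)
  have key: "adj Am * P * Am - adj Ap * P * Ap = 2 *\<^sub>c (\<i> *\<^sub>c (P * a - adj a * P))"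
  proof -
    have "adj Am * P * Am = adj a * P * a - \<i> *\<^sub>c (adj a * P) + \<i> *\<^sub>c (P * a) + P"
      using a P by (simp add: Am_def algebra_simps cscale_distribs)
    moreover have "adj Ap * P * Ap = adj a * P * a + \<i> *\<^sub>c (adj a * P) - \<i> *\<^sub>c (P * a) + P"
      using a P by (simp add: Ap_def algebra_simps cscale_distribs)
    ultimately have "adj Am * P * Am - adj Ap * P * Ap =
        (adj a * P * a - \<i> *\<^sub>c (adj a * P) + \<i> *\<^sub>c (P * a) + P) -
        (adj a * P * a + \<i> *\<^sub>c (adj a * P) - \<i> *\<^sub>c (P * a) + P)"
      by (rule arg_cong2)
    also have "\<dots> = 2 *\<^sub>c (\<i> *\<^sub>c (P * a - adj a * P))"
      by (intro pmat_eqI) (simp add: algebra_simps)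
    finally show ?thesis .
  qed
  \<comment> \<open>An eigenvector of \<open>E\<close> yields one of \<open>a\<close>, with
    eigenvalue \<open>l\<close> and \<open>z = (l + i) / (l - i)\<close>. Since
    \<open>Im l < 0\<close>, the point \<open>l\<close> is closer to \<open>- i\<close> than to
    \<open>i\<close>.\<close>
  have evE: "cmod z < 1" if w: "w \<in> colv n" "w \<noteq> 0" "E * w = z *\<^sub>c w" for z w
  proof -
    define y where "y = G * w"
    have y: "y \<in> colv n" "Am * y = w" using g w inv_of_cancel[OF G w(1)] by (auto simp: y_def intro: carr_mult)
    then have "y \<noteq> 0" using w by force
    have "Ap * y = z *\<^sub>c (Am * y)" using w y by (simp add: E_def y_def mult.assoc)
    then have eq: "(1 - z) *\<^sub>c (a * y) = (- \<i> * (1 + z)) *\<^sub>c y"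
      using y(1) by (simp add: Ap_def Am_def algebra_simps cscale_distribs)
    have "z \<noteq> 1"
    proof
      assume "z = 1"
      with eq have "(- \<i> * 2) *\<^sub>c y = 0" by simp
      then show False using \<open>y \<noteq> 0\<close> by simp
    qed
    define l where "l = - \<i> * (1 + z) / (1 - z)"
    have "a * y = (1 / (1 - z)) *\<^sub>c ((1 - z) *\<^sub>c (a * y))" using \<open>z \<noteq> 1\<close> by simp
    also have "\<dots> = l *\<^sub>c y" unfolding eq by (simp add: l_def)
    finally have "Im l < 0" using ev[OF y(1) \<open>y \<noteq> 0\<close>] by blast
    have l: "l * (1 - z) = - \<i> * (1 + z)" using \<open>z \<noteq> 1\<close> by (simp add: l_def)
    then have "z * (l - \<i>) = l + \<i>" by (simp add: algebra_simps)
    then have "cmod z * cmod (l - \<i>) = cmod (l + \<i>)" by (metis norm_mult)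
    moreover have "cmod (l + \<i>) < cmod (l - \<i>)"
    proof -
      have "(cmod (l + \<i>))\<^sup>2 < (cmod (l - \<i>))\<^sup>2"
        unfolding cmod_power2 using \<open>Im l < 0\<close> by (simp add: power2_eq_square algebra_simps)
      then show ?thesis by (meson norm_ge_zero power2_less_imp_less)
    qed
    ultimately show ?thesis
      by (metis linorder_not_le mult_le_cancel_right1 mult.commute norm_ge_zero mult_left_mono mult.right_neutral)
  qed
  have step: "Re (ip (E * w) (P * (E * w))) \<le> Re (ip w (P * w))" if w: "w \<in> colv n" for w
  proof -
    define y where "y = G * w"
    have y: "y \<in> colv n" "Am * y = w" using g w inv_of_cancel[OF G w(1)] by (auto simp: y_def intro: carr_mult)
    have "ip w (P * w) - ip (E * w) (P * (E * w)) = ip y ((adj Am * P * Am - adj Ap * P * Ap) * y)"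
      using y(2) by (simp add: E_def mult.assoc y_def[symmetric] ip_adj left_diff_distrib)
        (simp add: y(2)[symmetric] ip_adj mult.assoc)
    also have "\<dots> = 2 * ip y (\<i> *\<^sub>c (P * a - adj a * P) * y)" unfolding key by simp
    finally have "Re (ip w (P * w) - ip (E * w) (P * (E * w))) =
        Re (2 * ip y (\<i> *\<^sub>c (P * a - adj a * P) * y))" by (rule arg_cong)
    then have "Re (ip w (P * w)) - Re (ip (E * w) (P * (E * w))) =
        2 * Re (ip y (\<i> *\<^sub>c (P * a - adj a * P) * y))"
      by simp
    then show ?thesis using Q[OF y(1)] by linarith
  qed
  have "0 \<le> Re (ip w (P * w))" if w: "w \<in> colv n" for w
  proof -
    have le: "Re (ip (papply E k w) (P * papply E k w)) \<le> Re (ip w (P * w))" for k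
      by (induction k) (use step[OF papply_carr[OF E w]] in \<open>auto intro: order.trans\<close>)
    have "(\<lambda>k. papply E k w) \<longlonglongrightarrow> 0" by (rule papply_tendsto_0[OF E w evE])
    then have "(\<lambda>k. Re (ip (papply E k w) (P * papply E k w))) \<longlonglongrightarrow> Re (ip 0 (P * 0))"
      unfolding ip_def by (intro tendsto_intros tendsto_ent)
    then show ?thesis using le by (intro LIMSEQ_le_const2[of _ 0]) auto
  qed
  then show ?thesis using P by (auto simp: psd_def)
qed

lemmas carr_intros = carr_simps carr_mult

lemma idm_adj [simp]:
  assumes "A \<in> carr r c"
  shows "idm c * adj A = adj A" "adj A * idm r = adj A"
    "idm c * (adj A * B) = adj A * B" "adj A * (idm r * B) = adj A * B" "B * adj A * idm r = B * adj A"
  using carr_simps(7)[OF assms] by auto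

section \<open>The Riccati equation\<close>

text \<open>Otherwise \<open>A\<close> would have a resolvent at the conjugate point, and its
  adjoint would be a resolvent of \<open>adj A\<close> at \<open>z\<close>.\<close>

lemma eigen_adj:
  assumes A: "A \<in> carr n n" and w: "w \<in> colv n" "w \<noteq> 0" "adj A * w = z *\<^sub>c w"
  shows "\<exists>u. u \<in> colv n \<and> u \<noteq> 0 \<and> A * u = cnj z *\<^sub>c u"
proof (rule ccontr)
  assume "\<not> ?thesis"
  then obtain B where "inv_of n (cnj z *\<^sub>c idm n - A) B"
    using eigen_or_inv[OF A, of "cnj z"] by blast
  then have "inv_of n (z *\<^sub>c idm n - adj A) (adj B)" using inv_of_adj by fastforce
  then show False using inv_no_eigen w by blast
qed

text \<open>In the row of the last nonzero entry of \<open>w\<close> only the diagonal term of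
  \<open>T * w\<close> survives.\<close>

lemma upper_triangular_eigen:
  assumes T: "T \<in> carr n n" and ut: "\<And>i j. j < i \<Longrightarrow> ent T i j = 0"
    and w: "w \<in> colv n" "w \<noteq> 0" "T * w = z *\<^sub>c w"
  shows "\<exists>i<n. z = ent T i i"
proof -
  define I where "I = {i. ent w i 0 \<noteq> 0}"
  have I: "I \<subseteq> {..<n}" using w(1) by (auto simp: I_def carr_def) (meson not_le)
  then have fin: "finite I" using finite_subset by blast
  have "I \<noteq> {}"
  proof
    assume "I = {}"
    then have "w = 0" using w(1) by (intro carr_eqI[of _ n "Suc 0"]) (auto simp: I_def)
    then show False using w by simp
  qed
  define i where "i = Max I"
  have i: "i \<in> I" "\<And>k. k \<in> I \<Longrightarrow> k \<le> i" using fin \<open>I \<noteq> {}\<close> by (auto simp: i_def)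
  then have "i < n" using I by auto
  have "ent (T * w) i 0 = (\<Sum>k<n. ent T i k * ent w k 0)"
    by (rule ent_times_carr) (use w in auto)
  also have "\<dots> = (\<Sum>k<n. if k = i then ent T i i * ent w i 0 else 0)"
  proof (intro sum.cong refl)
    fix k
    consider "k < i" | "k = i" | "k \<notin> I" using i(2) by force
    then show "ent T i k * ent w k 0 = (if k = i then ent T i i * ent w i 0 else 0)"
      using ut i(1) by cases (auto simp: I_def)
  qed
  also have "\<dots> = ent T i i * ent w i 0" using \<open>i < n\<close> by simp
  finally have "z * ent w i 0 = ent T i i * ent w i 0" using w by simp
  then show ?thesis using i(1) \<open>i < n\<close> by (auto simp: I_def)
qed

text \<open>The Schur form takes the eigenvalues in any prescribed order \<open>es\<close>. The
  first \<open>n\<close> columns of the change of basis span an invariant subspace on which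
  \<open>H\<close> acts by the leading block; listing the stable eigenvalues first selects the
  stable subspace.\<close>

lemma schur_invariant:
  assumes H: "H \<in> carr N N" and cp: "char_poly (unemb N N H) = (\<Prod>x\<leftarrow>es. [:- x, 1:])" and nN: "n \<le> N"
  shows "\<exists>Z T. Z \<in> carr N n \<and> T \<in> carr n n \<and> H * Z = Z * T \<and> (\<forall>v\<in>colv n. Z * v = 0 \<longrightarrow> v = 0) \<and>
     (\<forall>i j. j < i \<longrightarrow> ent T i j = 0) \<and> (\<forall>i<n. ent T i i = es ! i)"
proof -
  let ?M = "unemb N N H"
  obtain B P Q where sd: "schur_decomposition ?M es = (B, P, Q)" by (cases "schur_decomposition ?M es") auto
  from schur_decomposition[OF _ cp sd, of N] have s: "similar_mat_wit ?M B P Q" "upper_triangular B" "diag_mat B = es"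
    by auto
  from s(1) have car: "B \<in> carrier_mat N N" "P \<in> carrier_mat N N" "Q \<in> carrier_mat N N"
    and eq: "P * Q = 1\<^sub>m N" "Q * P = 1\<^sub>m N" "?M = P * B * Q"
    by (auto simp: similar_mat_wit_def Let_def)
  have "emb ?M = emb (P * B) * emb Q" unfolding eq(3) by (rule emb_mult) (use car in auto)
  then have HPBQ: "H = emb P * emb B * emb Q" using car H by (simp add: emb_mult[OF car(2) car(1)])
  have QP: "emb Q * emb P = idm N" using eq car emb_mult[OF car(3) car(2)] by simp
  have HP: "H * emb P = emb P * emb B"
    unfolding HPBQ using QP mult_idm[OF emb_carr[OF car(1)]] by (simp add: mult.assoc)
  define T where "T = idm n * (emb B * idm n)"
  define Z where "Z = emb P * idm n"
  have idmN: "idm n \<in> carr N n" "idm n \<in> carr n N" using nN by (auto simp: carr_def idm.rep_eq)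
  have ZT: "Z \<in> carr N n" "T \<in> carr n n"
    using idmN emb_carr[OF car(1)] emb_carr[OF car(2)] by (auto simp: Z_def T_def intro: carr_mult)
  have entB: "ent (emb B * idm n) i j = (if j < n then ent (emb B) i j else 0)" for i j
  proof -
    have "ent (emb B * idm n) i j = (\<Sum>k<N. ent (emb B) i k * ent (idm n) k j)"
      by (rule ent_times_carr[of _ N N _ n]) (use idmN in auto)
    also have "\<dots> = (\<Sum>k<N. if k = j then (if j < n then ent (emb B) i j else 0) else 0)"
      by (intro sum.cong) (auto simp: idm.rep_eq)
    finally show ?thesis using nN by auto
  qed
  have ut: "ent (emb B) i j = 0" if "j < i" for i j
    using upper_triangularD[OF s(2) that] car(1) by (auto simp: ent_emb)
  have entT: "ent T i j = (if i < n \<and> j < n then ent (emb B) i j else 0)" for i j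
  proof -
    have "ent T i j = (\<Sum>k<n. ent (idm n) i k * ent (emb B * idm n) k j)"
      unfolding T_def by (rule ent_times_carr[of _ n n _ N]) (auto)
    also have "\<dots> = (\<Sum>k<n. if k = i then (if j < n then ent (emb B) i j else 0) else 0)"
      by (intro sum.cong) (auto simp: idm.rep_eq entB)
    finally show ?thesis by auto
  qed
  \<comment> \<open>Triangularity: the first \<open>n\<close> columns of \<open>B\<close> vanish
    below row \<open>n\<close>.\<close>
  have "emb B * idm n = idm n * T"
  proof -
    have "emb B * idm n = T"
      by (rule pmat_eqI) (auto simp: entB entT ut)
    then show ?thesis using ZT by simp
  qed
  then have "H * Z = Z * T" unfolding Z_def by (simp add: mult.assoc[symmetric] HP) (simp add: mult.assoc)
  moreover have "v = 0" if v: "v \<in> colv n" "Z * v = 0" for v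
  proof -
    have vN: "v \<in> colv N" using v(1) nN by (auto simp: carr_def)
    have "emb P * v = 0" using v by (simp add: Z_def mult.assoc)
    then have "emb Q * (emb P * v) = 0" by simp
    then show ?thesis using vN by (simp add: mult.assoc[symmetric] QP)
  qed
  moreover have "ent T i i = es ! i" if "i < n" for i
    using that nN s(3)[symmetric] car(1) by (simp add: entT diag_mat_def)
  ultimately show ?thesis using ZT entT ut by (intro exI[of _ Z] exI[of _ T]) auto
qed

lemma linear_factors_mset_eq:
  fixes xs ys :: "complex list"
  assumes "(\<Prod>x\<leftarrow>xs. [:- x, 1:]) = (\<Prod>x\<leftarrow>ys. [:- x, 1:])"
  shows "mset xs = mset ys"
proof -
  have "proots (\<Prod>x\<leftarrow>zs. [:- x, 1:]) = mset zs" for zs :: "complex list"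
  proof (induction zs)
    case (Cons z zs)
    have "(\<Prod>x\<leftarrow>zs. [:- x, 1:]) \<noteq> (0 :: complex poly)" by (auto simp: prod_list_zero_iff)
    then have "proots ([:- z, 1:] * (\<Prod>x\<leftarrow>zs. [:- x, 1:])) = {#z#} + mset zs"
      using Cons by (subst proots_mult) auto
    then show ?case by simp
  qed auto
  then show ?thesis using assms by metis
qed

interpretation cnj_hom: comm_ring_hom cnj
  by unfold_locales auto

text \<open>The first \<open>p\<close> coordinates of \<open>\<complex>\<^sup>p\<^sup>+\<^sup>n\<close> are the range of \<open>idm p\<close>, the last \<open>n\<close> the range of this isometry.\<close>
lift_definition shift :: "nat \<Rightarrow> nat \<Rightarrow> pmat" is "\<lambda>p n i j. if i = p + j \<and> j < n then 1 else 0"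
proof -
  fix p n :: nat
  show "\<exists>N. \<forall>i j. N \<le> i \<or> N \<le> j \<longrightarrow> (if i = p + j \<and> j < n then 1 else 0 :: complex) = 0"
    by (rule exI[of _ "p + n"]) auto
qed

lemma shift_carr: "shift p n \<in> carr (p + n) n"
  by (auto simp: carr_def shift.rep_eq)

lemma idm_mult_shift: "idm p * shift p n = 0"
proof (rule pmat_eqI)
  fix i j
  show "ent (idm p * shift p n) i j = ent 0 i j"
    by (subst ent_times_carr[of _ p p _ n]) (auto simp: idm.rep_eq shift.rep_eq intro!: sum.neutral)
qed

lemma adj_shift_mult_shift: "adj (shift p n) * shift p n = idm n"
proof (rule pmat_eqI)
  fix i j
  have "ent (adj (shift p n) * shift p n) i j = (\<Sum>k<p+n. cnj (ent (shift p n) k i) * ent (shift p n) k j)"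
    using shift_carr by (subst ent_times_carr[of _ n "p+n" _ n]) auto
  also have "\<dots> = (\<Sum>k<p+n. if k = p + i then (if i = j \<and> i < n then 1 else 0) else 0)"
    by (intro sum.cong) (auto simp: shift.rep_eq)
  also have "\<dots> = ent (idm n) i j" by (auto simp: idm.rep_eq)
  finally show "ent (adj (shift p n) * shift p n) i j = ent (idm n) i j" .
qed

lemma shift_mult_adj_shift: "idm p + shift p n * adj (shift p n) = idm (p + n)"
proof (rule pmat_eqI)
  fix i j
  have "ent (shift p n * adj (shift p n)) i j = (\<Sum>k<n. ent (shift p n) i k * cnj (ent (shift p n) j k))"
    using shift_carr by (subst ent_times_carr[of _ "p+n" n _ "p+n"]) auto
  also have "\<dots> = (\<Sum>k<n. if k = i - p then (if i = j \<and> p \<le> i \<and> i < p + n then 1 else 0) else 0)"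
    by (intro sum.cong) (auto simp: shift.rep_eq)
  also have "\<dots> = (if i = j \<and> p \<le> i \<and> i < p + n then 1 else 0)" by auto
  finally show "ent (idm p + shift p n * adj (shift p n)) i j = ent (idm (p + n)) i j"
    by (auto simp: idm.rep_eq)
qed

lemma mult_shift: "A \<in> carr r p \<Longrightarrow> A * shift p n = 0"
  by (metis idm_mult_shift mult.assoc mult_idm mult_zero_right)

lemma shift_mult: "A \<in> carr p r \<Longrightarrow> adj (shift p n) * A = 0"
  by (metis adj_0 adj_mult carr_simps(7) adj_adj mult_shift)

lemma shift_projections:
  fixes p q :: nat
  defines "Q \<equiv> shift p q * adj (shift p q)"
  shows "idm p * idm p = idm p" "idm p * Q = 0" "Q * idm p = 0" "Q * Q = Q" "idm p + Q = idm (p + q)"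
proof -
  have as: "adj (shift p q) * idm p = 0" by (rule shift_mult[OF carr_simps(8)])
  show "idm p * idm p = idm p" by (rule idm_mult[OF carr_simps(8)])
  show "idm p * Q = 0" by (simp add: Q_def mult.assoc[symmetric] idm_mult_shift)
  show "Q * idm p = 0" by (simp add: Q_def mult.assoc as)
  have "Q * Q = shift p q * (adj (shift p q) * shift p q) * adj (shift p q)" by (simp only: Q_def mult.assoc)
  then show "Q * Q = Q" using mult_idm[OF shift_carr, of p q] by (simp only: adj_shift_mult_shift Q_def)
  show "idm p + Q = idm (p + q)" unfolding Q_def by (rule shift_mult_adj_shift)
qed

lemma shift_carr_2: "shift n n \<in> carr (2 * n) n"
  using shift_carr[of n n] by (simp add: mult_2)

text \<open>The hypothesis \<open>strict\<close> says that the transfer function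
  \<open>c (x - a)^-1 b\<close> is strictly contractive on the real axis, phrased through the state
  equation. With \<open>b = 0\<close> it holds as soon as \<open>a\<close> has no real eigenvalue,
  and the Riccati equation becomes a Lyapunov equation; the same locale thus produces
  Gramians.\<close>

locale hamiltonian =
  fixes n m k :: nat and a b c :: pmat
  assumes a: "a \<in> carr n n" and b: "b \<in> carr n m" and c: "c \<in> carr k n"
    and ev: "\<And>z w. w \<in> colv n \<Longrightarrow> w \<noteq> 0 \<Longrightarrow> a * w = z *\<^sub>c w \<Longrightarrow> Im z < 0"
    and strict: "\<And>(x::real) u g. g \<in> colv m \<Longrightarrow> u \<in> colv n \<Longrightarrow>
       complex_of_real x *\<^sub>c u - a * u = b * g \<Longrightarrow> g \<noteq> 0 \<Longrightarrow> Re (ip (c * u) (c * u)) < Re (ip g g)"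
begin

text \<open>The block matrix with rows \<open>a\<close>, \<open>i b (adj b)\<close> and
  \<open>- i (adj c) c\<close>, \<open>adj a\<close>. The range of \<open>[I; P]\<close> is
  invariant under it exactly when \<open>P\<close> solves the Riccati equation.\<close>

definition H :: pmat where
  "H = a + \<i> *\<^sub>c (b * adj b * adj (shift n n)) - \<i> *\<^sub>c (shift n n * adj c * c) + shift n n * adj a * adj (shift n n)"

lemma aux_carr: "A \<in> carr n n \<Longrightarrow> A \<in> carr (2 * n) (2 * n)"
  by (auto simp: carr_def)

lemma car: "b * adj b \<in> carr n n" "adj c * c \<in> carr n n" "adj a \<in> carr n n" "adj (shift n n) \<in> carr n (2*n)"
  by (blast intro: carr_intros a b c shift_carr_2)+

lemma H_carr: "H \<in> carr (2 * n) (2 * n)"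
proof -
  have "b * adj b * adj (shift n n) \<in> carr n (2*n)" "shift n n * adj c * c \<in> carr (2*n) n"
    "shift n n * adj a * adj (shift n n) \<in> carr (2*n) (2*n)"
    by (blast intro: carr_intros a b c shift_carr_2)+
  then have "b * adj b * adj (shift n n) \<in> carr (2*n) (2*n)" "shift n n * adj c * c \<in> carr (2*n) (2*n)"
    "shift n n * adj a * adj (shift n n) \<in> carr (2*n) (2*n)" by (auto simp: carr_def)
  then show ?thesis using a aux_carr by (simp add: H_def)
qed

lemma upper_H: "idm n * H = a + \<i> *\<^sub>c (b * adj b * adj (shift n n))"
  using a b by (simp add: H_def distrib_left right_diff_distrib mult.assoc[of b]
      mult.assoc[of "shift n n"]) (simp add: mult.assoc[symmetric] idm_mult_shift)

lemma lower_H: "adj (shift n n) * H = - (\<i> *\<^sub>c (adj c * c)) + adj a * adj (shift n n)"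
  using a b c shift_mult[OF a] shift_mult[OF b]
  by (simp add: H_def distrib_left right_diff_distrib mult.assoc[symmetric] adj_shift_mult_shift)

lemma split: "Z \<in> carr (2*n) r \<Longrightarrow> Z = idm n * Z + shift n n * (adj (shift n n) * Z)"
  using shift_mult_adj_shift[of n n, folded mult_2] by (metis distrib_right idm_mult mult.assoc)

lemma H_mult:
  assumes Z: "Z \<in> carr (2*n) r"
  shows "idm n * (H * Z) = a * (idm n * Z) + \<i> *\<^sub>c (b * (adj b * (adj (shift n n) * Z)))"
    "adj (shift n n) * (H * Z) = adj a * (adj (shift n n) * Z) - \<i> *\<^sub>c (adj c * (c * (idm n * Z)))"
proof -
  show "idm n * (H * Z) = a * (idm n * Z) + \<i> *\<^sub>c (b * (adj b * (adj (shift n n) * Z)))"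
    unfolding mult.assoc[symmetric] upper_H using a by (simp add: distrib_right)
  show "adj (shift n n) * (H * Z) = adj a * (adj (shift n n) * Z) - \<i> *\<^sub>c (adj c * (c * (idm n * Z)))"
    unfolding mult.assoc[symmetric] lower_H using c
    by (simp add: distrib_right left_diff_distrib mult.assoc)
qed

text \<open>Pair the two block rows with each other. As \<open>x\<close> is real it drops out, and
  the input \<open>g = i (adj b) p\<close> has the same energy as the output \<open>c u\<close>.
  Strictness forces \<open>g = 0\<close>, after which \<open>u\<close> and \<open>p\<close> could
  only be eigenvectors of \<open>a\<close> and \<open>adj a\<close> for a real eigenvalue.\<close>

lemma no_real_eigen:
  assumes w: "w \<in> colv (2*n)" "H * w = complex_of_real x *\<^sub>c w"
  shows "w = 0"
proof -
  define u where "u = idm n * w"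
  define p where "p = adj (shift n n) * w"
  have idmN: "idm n \<in> carr n (2*n)" by (auto simp: carr_def idm.rep_eq)
  have up: "u \<in> colv n" "p \<in> colv n"
    using w idmN car(4) by (auto simp: u_def p_def intro: carr_mult)
  have 1: "complex_of_real x *\<^sub>c u - a * u = b * (\<i> *\<^sub>c (adj b * p))"
    and 2: "complex_of_real x *\<^sub>c p - adj a * p = - (\<i> *\<^sub>c (adj c * (c * u)))"
    using H_mult[OF w(1)] w(2) by (simp_all add: u_def p_def algebra_simps)
  define g where "g = \<i> *\<^sub>c (adj b * p)"
  have g: "g \<in> colv m" unfolding g_def by (blast intro: carr_intros up b)
  have "ip g g = ip g (\<i> *\<^sub>c (adj b * p))" by (simp add: g_def)
  also have "\<dots> = \<i> * ip (b * g) p" by (simp add: ip_adj)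
  also have "ip (b * g) p = ip (complex_of_real x *\<^sub>c u - a * u) p" using 1 by (simp add: g_def)
  also have "\<dots> = ip u (complex_of_real x *\<^sub>c p - adj a * p)" by (simp add: ip_adj)
  also have "\<dots> = - \<i> * ip (c * u) (c * u)" unfolding 2 by (simp add: ip_adj)
  finally have "Re (ip g g) = Re (ip (c * u) (c * u))" by simp
  then have g0: "g = 0" using strict[OF g up(1), of x] 1 by (force simp: g_def)
  have u0: "u = 0"
  proof (rule ccontr)
    assume "u \<noteq> 0"
    moreover have "a * u = complex_of_real x *\<^sub>c u" using 1 g0 by (simp add: g_def)
    ultimately show False using ev[OF up(1)] by force
  qed
  have "p = 0"
  proof (rule ccontr)
    assume "p \<noteq> 0"
    moreover have "adj a * p = complex_of_real x *\<^sub>c p" using 2 u0 by simp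
    ultimately obtain q where "q \<in> colv n" "q \<noteq> 0" "a * q = complex_of_real x *\<^sub>c q"
      using eigen_adj[OF a up(2), of "complex_of_real x"] by auto
    then show False using ev by force
  qed
  with u0 show "w = 0" using split[OF w(1)] by (simp add: u_def p_def)
qed

text \<open>Symmetry of \<open>H\<close> with respect to the skew form \<open>adj s - s\<close>,
  where \<open>s\<close> is the shift: in blocks this form has rows \<open>0, I\<close> and
  \<open>- I, 0\<close>. It is the source of the symmetry of the spectrum about the real
  axis.\<close>

lemma H_symmetric: "adj H * (adj (shift n n) - shift n n) = (adj (shift n n) - shift n n) * H"
proof -
  have 1: "adj (shift n n) * H = - (\<i> *\<^sub>c (adj c * c)) + adj a * adj (shift n n)" by (rule lower_H)
  have 2: "shift n n * H = shift n n * a + \<i> *\<^sub>c (shift n n * b * adj b * adj (shift n n))"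
  proof -
    have "shift n n * H = shift n n * (idm n * H)" using shift_carr_2[of n] by simp
    then show ?thesis unfolding upper_H by (simp add: distrib_left mult.assoc)
  qed
  have 3: "adj H * adj (shift n n) = adj a * adj (shift n n) - \<i> *\<^sub>c (shift n n * b * adj b * adj (shift n n))"
    using arg_cong[OF 2, of adj] by (simp add: mult.assoc cscale_uminus)
  have 4: "adj H * shift n n = \<i> *\<^sub>c (adj c * c) + shift n n * a"
    using arg_cong[OF 1, of adj] by (simp add: cscale_uminus)
  show ?thesis unfolding right_diff_distrib left_diff_distrib 1 2 3 4 by (simp add: algebra_simps)
qed

text \<open>The skew form makes \<open>adj H\<close> similar to \<open>H\<close>, so the
  characteristic polynomial is fixed under conjugation and the list of its roots agrees with the
  conjugated list as a multiset. No root is real, hence exactly half of the \<open>2 n\<close> roots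
  lie below the axis; they are moved to the front.\<close>

lemma eigenvalues_split:
  "\<exists>es. char_poly (unemb (2*n) (2*n) H) = (\<Prod>x\<leftarrow>es. [:- x, 1:]) \<and> (\<forall>i<n. Im (es ! i) < 0) \<and> n \<le> length es"
proof -
  let ?N = "2 * n"
  let ?M = "unemb ?N ?N H"
  have M: "?M \<in> carrier_mat ?N ?N" by simp
  obtain es where es: "char_poly ?M = (\<Prod>x\<leftarrow>es. [:- x, 1:])" "length es = ?N"
    using char_poly_factorized[OF M] by blast
  have real: "Im x \<noteq> 0" if "x \<in> set es" for x
  proof
    assume "Im x = 0"
    then have x: "x = complex_of_real (Re x)" by (simp add: complex_eq_iff)
    have "poly (char_poly ?M) x = 0" using that unfolding es(1) by (rule linear_poly_root)
    then obtain v where v: "v \<in> carrier_vec ?N" "v \<noteq> 0\<^sub>v ?N" "?M *\<^sub>v v = x \<cdot>\<^sub>v v"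
      using eigenvalue_root_char_poly[OF M] by (auto simp: eigenvalue_def eigenvector_def)
    have "H * vemb ?N v = x *\<^sub>c vemb ?N v"
      using vemb_mult[OF M v(1)] vemb_smult[OF v(1)] v(3) H_carr by simp
    then have "vemb ?N v = 0" using no_real_eigen[OF vemb_carr] x by metis
    then show False using vemb_eq_iff[of v ?N "0\<^sub>v ?N"] v by auto
  qed
  define J where "J = adj (shift n n) - shift n n"
  have J: "J * (- J) = idm ?N" "(- J) * J = idm ?N" "J \<in> carr ?N ?N"
  proof -
    have 0: "shift n n * shift n n = 0"
      using mult_shift[of "shift n n" "2 * n" n n] shift_carr_2 by blast
    then have "adj (shift n n) * adj (shift n n) = 0" by (metis adj_0 adj_mult)
    with 0 show "J * (- J) = idm ?N" "(- J) * J = idm ?N"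
      using shift_mult_adj_shift[of n n, folded mult_2] by (simp_all add: J_def algebra_simps adj_shift_mult_shift)
    show "J \<in> carr ?N ?N" using shift_carr_2[of n] by (auto simp: J_def carr_def)
  qed
  have adjH: "adj H = J * H * (- J)"
  proof -
    have "adj H = adj H * (J * (- J))" using J H_carr by simp
    also have "\<dots> = J * H * (- J)" using H_symmetric by (simp add: J_def mult.assoc[symmetric])
    finally show ?thesis .
  qed
  have "similar_mat_wit (unemb ?N ?N (adj H)) ?M (unemb ?N ?N J) (unemb ?N ?N (- J))"
    unfolding similar_mat_wit_def Let_def
  proof (intro conjI)
    have [simp]: "emb (unemb ?N ?N X * unemb ?N ?N Y) = X * Y" if "X \<in> carr ?N ?N" "Y \<in> carr ?N ?N" for X Y
      using that emb_mult[of "unemb ?N ?N X" ?N ?N "unemb ?N ?N Y" ?N] by simp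
    have U: "unemb ?N ?N X * unemb ?N ?N Y = unemb ?N ?N (X * Y)" if "X \<in> carr ?N ?N" "Y \<in> carr ?N ?N" for X Y
      using that by (intro emb_inj[of _ ?N ?N] mult_carrier_mat[of _ ?N ?N]) (auto intro: carr_intros)
    have one: "unemb ?N ?N (idm ?N) = 1\<^sub>m ?N" using unemb_emb[of "1\<^sub>m ?N" ?N ?N] by simp
    show "unemb ?N ?N J * unemb ?N ?N (- J) = 1\<^sub>m (dim_row (unemb ?N ?N (adj H)))"
      "unemb ?N ?N (- J) * unemb ?N ?N J = 1\<^sub>m (dim_row (unemb ?N ?N (adj H)))"
      using J one by (simp_all only: U carr_simps unemb_carrier)
    have "J * H \<in> carr ?N ?N" "- J \<in> carr ?N ?N" using J H_carr by (auto intro: carr_intros)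
    then show "unemb ?N ?N (adj H) = unemb ?N ?N J * ?M * unemb ?N ?N (- J)"
      unfolding adjH U[OF J(3) H_carr] by (rule U[symmetric])
  qed simp
  then have "char_poly (unemb ?N ?N (adj H)) = char_poly ?M"
    by (intro char_poly_similar) (auto simp: similar_mat_def)
  moreover have "unemb ?N ?N (adj H) = transpose_mat (map_mat cnj ?M)"
    by (rule eq_matI) auto
  ultimately have "char_poly (map_mat cnj ?M) = char_poly ?M"
    by (simp add: char_poly_transpose_mat[of _ ?N])
  then have "map_poly cnj (char_poly ?M) = char_poly ?M"
    by (simp add: cnj_hom.char_poly_hom[OF M])
  moreover have "map_poly cnj (\<Prod>x\<leftarrow>xs. [:- x, 1:]) = (\<Prod>x\<leftarrow>map cnj xs. [:- x, 1:])" for xs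
  proof -
    interpret cnj_poly: map_poly_comm_ring_hom cnj ..
    have "map_poly cnj [:- x, 1:] = [:- cnj x, 1:]" for x by (simp add: map_poly_pCons)
    then show ?thesis by (induction xs) (simp_all only: list.map prod_list.Nil prod_list.Cons cnj_poly.hom_mult cnj_poly.hom_one)
  qed
  ultimately have ms: "mset (map cnj es) = mset es"
    using es(1) by (intro linear_factors_mset_eq) metis
  define P where "P = (\<lambda>x. Im x < 0)"
  have "length (filter P es) = size (filter_mset P (mset (map cnj es)))"
    by (simp only: ms mset_filter[symmetric] size_mset)
  also have "\<dots> = size (filter_mset (\<lambda>x. P (cnj x)) (mset es))"
    by (simp add: filter_mset_image_mset)
  also have "\<dots> = length (filter (\<lambda>x. P (cnj x)) es)" by (metis mset_filter size_mset)
  also have "\<dots> = length (filter (\<lambda>x. \<not> P x) es)"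
    using real by (intro arg_cong[of _ _ length] filter_cong) (auto simp: P_def, force)
  finally have len: "length (filter P es) = n"
    using sum_length_filter_compl[of P es] es(2) by simp
  define fs where "fs = filter P es @ filter (\<lambda>x. \<not> P x) es"
  have "mset fs = mset es" by (simp add: fs_def)
  then have "(\<Prod>x\<leftarrow>fs. [:- x, 1:]) = (\<Prod>x\<leftarrow>es. [:- x, 1:])"
    by (metis mset_map prod_mset_prod_list)
  moreover have "Im (fs ! i) < 0" if "i < n" for i
    using that len nth_mem[of i "filter P es"] by (auto simp: fs_def nth_append P_def)
  ultimately show ?thesis using es len by (intro exI[of _ fs]) (auto simp: fs_def)
qed

text \<open>Write the stable invariant subspace as the range of \<open>[U; W]\<close>, so that
  \<open>P = W U^-1\<close> is the candidate. Three things are to be shown: \<open>(adj U) W\<close>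
  is Hermitian, which makes \<open>P\<close> Hermitian; \<open>U\<close> is invertible; and
  \<open>P\<close> is positive semidefinite, which is Lyapunov's theorem because the Riccati
  equation makes \<open>i (P a - (adj a) P)\<close> a sum of squares.\<close>

theorem exists_stabilizing:
  "\<exists>P. psd n P \<and> P * b * adj b * P + adj c * c = \<i> *\<^sub>c (P * a - adj a * P)"
proof -
  obtain es where es: "char_poly (unemb (2*n) (2*n) H) = (\<Prod>x\<leftarrow>es. [:- x, 1:])" "\<forall>i<n. Im (es ! i) < 0"
    using eigenvalues_split by blast
  obtain Z T where Z: "Z \<in> carr (2*n) n" and T: "T \<in> carr n n" and HZ: "H * Z = Z * T"
    and Zinj: "\<And>v. v \<in> colv n \<Longrightarrow> Z * v = 0 \<Longrightarrow> v = 0" and ut: "\<And>i j. j < i \<Longrightarrow> ent T i j = 0"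
    and diag: "\<And>i. i < n \<Longrightarrow> ent T i i = es ! i"
    using schur_invariant[OF H_carr es(1), of n] by auto
  have evT: "Im z < 0" if "w \<in> colv n" "w \<noteq> 0" "T * w = z *\<^sub>c w" for z w
    using upper_triangular_eigen[OF T ut that] diag es(2) by auto
  have evaT: "Im z > 0" if "w \<in> colv n" "w \<noteq> 0" "adj T * w = z *\<^sub>c w" for z w
    using eigen_adj[OF T that] evT by fastforce
  have evaa: "Im z > 0" if "w \<in> colv n" "w \<noteq> 0" "adj a * w = z *\<^sub>c w" for z w
    using eigen_adj[OF a that] ev by fastforce
  define U where "U = idm n * Z"
  define W where "W = adj (shift n n) * Z"
  have idmN: "idm n \<in> carr n (2*n)" by (auto simp: carr_def idm.rep_eq)
  have U: "U \<in> carr n n" unfolding U_def by (blast intro: carr_intros idmN Z)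
  have W: "W \<in> carr n n" unfolding W_def by (blast intro: carr_intros shift_carr_2 Z)
  have e1: "U * T = a * U + \<i> *\<^sub>c (b * (adj b * W))"
    using H_mult(1)[OF Z] by (simp add: HZ U_def W_def mult.assoc)
  have e2: "W * T = adj a * W - \<i> *\<^sub>c (adj c * (c * U))"
    using H_mult(2)[OF Z] by (simp add: HZ U_def W_def mult.assoc)
  have a1: "adj T * adj U = adj U * adj a - \<i> *\<^sub>c (adj W * (b * adj b))"
    using arg_cong[OF e1, of adj] by (simp add: mult.assoc cscale_uminus)
  have a2: "adj T * adj W = adj W * a + \<i> *\<^sub>c (adj U * (adj c * c))"
    using arg_cong[OF e2, of adj] by (simp add: mult.assoc cscale_uminus)
  define Om where "Om = adj U * W - adj W * U"
  have Om: "Om \<in> carr n n" unfolding Om_def by (blast intro: carr_intros U W)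
  have comm: "Om * T = adj T * Om"
  proof -
    have "Om * T = adj U * (W * T) - adj W * (U * T)" by (simp add: Om_def left_diff_distrib mult.assoc)
    also have "\<dots> = (adj T * adj U) * W - (adj T * adj W) * U"
      unfolding e1 e2 a1 a2 by (simp add: algebra_simps)
    finally show ?thesis by (simp add: Om_def right_diff_distrib mult.assoc)
  qed
  \<comment> \<open>As \<open>T\<close> is upper triangular, once the earlier columns of
    \<open>Om\<close> vanish, column \<open>j\<close> of \<open>Om T = (adj T) Om\<close> is an
    eigenvector equation of \<open>adj T\<close> for the \<open>j\<close>-th diagonal entry of
    \<open>T\<close>. That entry lies in the lower half-plane, the spectrum of \<open>adj T\<close>
    in the upper one.\<close>
  have col: "Om * unit_pmat j 0 = 0" if "j < n" for j
    using that
  proof (induction j rule: less_induct)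
    case (less j)
    have "T * unit_pmat j 0 = (\<Sum>k<n. ent T k j *\<^sub>c unit_pmat k 0)"
    proof (rule carr_eqI[of _ n "Suc 0"])
      fix i l :: nat assume il: "i < n" "l < Suc 0"
      have "ent (T * unit_pmat j 0) i l = ent T i j" using ent_mult_unit[OF T less.prems] il by simp
      also have "\<dots> = ent (\<Sum>k<n. ent T k j *\<^sub>c unit_pmat k 0) i l"
        using il by (simp add: unit_pmat.rep_eq if_distrib[of "times _"] cong: if_cong)
      finally show "ent (T * unit_pmat j 0) i l = ent (\<Sum>k<n. ent T k j *\<^sub>c unit_pmat k 0) i l" .
    qed (use T unit_colv less.prems in \<open>auto intro!: carr_sum carr_simps intro: carr_mult\<close>)
    then have "Om * (T * unit_pmat j 0) = (\<Sum>k<n. ent T k j *\<^sub>c (Om * unit_pmat k 0))"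
      by (simp add: sum_distrib_left)
    also have "\<dots> = (\<Sum>k<n. if k = j then ent T j j *\<^sub>c (Om * unit_pmat j 0) else 0)"
    proof (intro sum.cong refl)
      fix k assume "k \<in> {..<n}"
      then show "ent T k j *\<^sub>c (Om * unit_pmat k 0) = (if k = j then ent T j j *\<^sub>c (Om * unit_pmat j 0) else 0)"
        using less.IH[of k] ut[of j k] by (cases k j rule: linorder_cases) auto
    qed
    also have "\<dots> = ent T j j *\<^sub>c (Om * unit_pmat j 0)" using less.prems by simp
    finally have "adj T * (Om * unit_pmat j 0) = ent T j j *\<^sub>c (Om * unit_pmat j 0)"
      using comm by (simp add: mult.assoc[symmetric])
    moreover have "Im (ent T j j) < 0" using diag es(2) less.prems by simp
    moreover have "Om * unit_pmat j 0 \<in> colv n" by (blast intro: carr_intros Om unit_colv less.prems)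
    ultimately show ?case using evaT by fastforce
  qed
  have "Om = 0"
  proof (rule carr_eqI[OF Om])
    fix i j assume ij: "i < n" "j < n"
    show "ent Om i j = ent 0 i j" using col[OF ij(2)] ent_mult_unit[OF Om ij(2), of i] by simp
  qed simp
  then have sym: "adj U * W = adj W * U" by (simp add: Om_def)
  \<comment> \<open>Pair the first block equation with \<open>W v\<close>: the symmetry of
    \<open>(adj U) W\<close> turns one side into a pairing with \<open>U v = 0\<close>, the other
    side is \<open>i\<close> times the squared length of \<open>(adj b) W v\<close>.\<close>
  have Uker: "U * (T * v) = 0 \<and> adj b * (W * v) = 0" if v: "v \<in> colv n" "U * v = 0" for v
  proof -
    have UTv: "U * (T * v) = \<i> *\<^sub>c (b * (adj b * (W * v)))"
      using arg_cong[OF e1, of "\<lambda>X. X * v"] v by (simp add: distrib_right mult.assoc)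
    have "\<i> * ip (adj b * (W * v)) (adj b * (W * v)) = ip (W * v) (U * (T * v))"
      unfolding UTv by (simp add: ip_adj)
    also have "\<dots> = ip (adj U * W * v) (T * v)" by (simp add: ip_adj mult.assoc)
    also have "\<dots> = 0" unfolding sym using v by (simp add: mult.assoc)
    finally have "ip (adj b * (W * v)) (adj b * (W * v)) = 0" by simp
    moreover have "adj b * (W * v) \<in> colv m" by (blast intro: carr_intros b W v)
    ultimately have "adj b * (W * v) = 0" using ip_self_eq_0 by simp
    then show ?thesis using UTv by simp
  qed
  have "\<exists>Y. inv_of n U Y"
  proof (rule inv_of_exists[OF U], rule ccontr)
    fix v assume v: "v \<in> colv n" "U * v = 0" "v \<noteq> 0"
    obtain z w where w: "w \<in> colv n" "w \<noteq> 0" "U * w = 0" "T * w = z *\<^sub>c w"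
      using eigenvector_in_kernel[OF T, of U v] Uker v by blast
    \<comment> \<open>On the kernel of \<open>U\<close> the second block equation makes
      \<open>W w\<close> an eigenvector of \<open>adj a\<close> for an eigenvalue of
      \<open>T\<close>. The two spectra lie in opposite half-planes, so \<open>W w = 0\<close> and
      then \<open>Z w = 0\<close>.\<close>
    have "adj a * (W * w) = W * (T * w)"
      using arg_cong[OF e2, of "\<lambda>X. X * w"] w(3) by (simp add: left_diff_distrib mult.assoc)
    then have "adj a * (W * w) = z *\<^sub>c (W * w)" using w(4) by simp
    moreover have "W * w \<in> colv n" by (blast intro: carr_intros W w)
    ultimately have "W * w = 0" using evaa evT[OF w(1,2,4)] by fastforce
    then have "Z * w = 0" using split[OF Z] w(3)
      by (simp add: U_def W_def) (metis distrib_right mult.assoc mult_zero_right add_0)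
    then show False using Zinj w by blast
  qed
  then obtain Y where Y: "inv_of n U Y" ..
  note y = inv_ofD[OF Y]
  define P where "P = W * Y"
  have P: "P \<in> carr n n" unfolding P_def by (blast intro: carr_intros W y)
  have aYU: "adj Y * adj U = idm n" using y(3) by (metis adj_idm adj_mult)
  have "adj P = adj Y * (adj W * (U * Y))" using y W by (simp add: P_def)
  also have "\<dots> = adj Y * (adj U * W) * Y" by (simp add: sym mult.assoc)
  also have "\<dots> = P" using W by (simp add: mult.assoc[symmetric] aYU P_def)
  finally have Padj: "adj P = P" .
  have PU: "P * U = W" using y W by (simp add: P_def mult.assoc)
  have f1: "U * T * Y = a + \<i> *\<^sub>c (b * (adj b * P))"
    unfolding e1 using y a by (simp add: distrib_right mult.assoc P_def)
  have f2: "W * T * Y = adj a * P - \<i> *\<^sub>c (adj c * c)"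
    unfolding e2 using y c by (simp add: left_diff_distrib mult.assoc P_def)
  have "P * (U * T * Y) = W * T * Y" by (simp add: mult.assoc[symmetric] PU)
  then have eq: "P * a + \<i> *\<^sub>c (P * (b * (adj b * P))) = adj a * P - \<i> *\<^sub>c (adj c * c)"
    unfolding f1 f2 by (simp add: distrib_left)
  have ric: "P * b * adj b * P + adj c * c = \<i> *\<^sub>c (P * a - adj a * P)"
  proof -
    have "P * a - adj a * P = - (\<i> *\<^sub>c (P * (b * (adj b * P)))) - \<i> *\<^sub>c (adj c * c)"
      using eq by (simp add: algebra_simps)
    then show ?thesis by (simp add: mult.assoc cscale_distribs)
  qed
  have "psd n P"
  proof (rule lyapunov_psd[OF a P Padj ev])
    fix w assume w: "w \<in> colv n"
    have bw: "adj b * (P * w) \<in> colv m" "c * w \<in> colv k" by (blast intro: carr_intros b c P w)+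
    have "ip w (\<i> *\<^sub>c (P * a - adj a * P) * w) = ip w ((P * b * adj b * P + adj c * c) * w)" by (simp only: ric)
    also have "\<dots> = ip (adj b * (P * w)) (adj b * (P * w)) + ip (c * w) (c * w)"
      using Padj by (simp add: ip_adj distrib_right mult.assoc)
    finally show "0 \<le> Re (ip w (\<i> *\<^sub>c (P * a - adj a * P) * w))"
      using ip_self_nonneg[OF bw(1)] ip_self_nonneg[OF bw(2)] by simp
  qed
  with ric show ?thesis by blast
qed

end

text \<open>By the equation the kernel of \<open>P\<close> is invariant under \<open>a\<close> and
  contained in the kernel of \<open>c\<close>; observability leaves no eigenvector there.\<close>

lemma riccati_pd:
  assumes a: "a \<in> carr n n" and b: "b \<in> carr n m" and c: "c \<in> carr k n"
    and obs: "\<And>z w. w \<in> colv n \<Longrightarrow> a * w = z *\<^sub>c w \<Longrightarrow> c * w = 0 \<Longrightarrow> w = 0"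
    and P: "psd n P" and ric: "P * b * adj b * P + adj c * c = \<i> *\<^sub>c (P * a - adj a * P)"
  shows "pd n P"
proof (rule psd_no_kernel_imp_pd[OF P], rule ccontr)
  fix v assume v: "v \<in> colv n" "P * v = 0" "v \<noteq> 0"
  note p = psdD[OF P]
  have ker: "c * w = 0 \<and> P * (a * w) = 0" if w: "w \<in> colv n" "P * w = 0" for w
  proof -
    have e: "P * (b * (adj b * (P * w))) + adj c * (c * w) = \<i> *\<^sub>c (P * (a * w)) - \<i> *\<^sub>c (adj a * (P * w))"
      using arg_cong[OF ric, of "\<lambda>X. X * w"]
      by (simp add: distrib_right left_diff_distrib mult.assoc cscale_distribs)
    then have e: "adj c * (c * w) = \<i> *\<^sub>c (P * (a * w))" using w by simp
    have "ip (c * w) (c * w) = ip w (adj c * (c * w))" by (simp add: ip_adj)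
    also have "\<dots> = \<i> * ip (P * w) (a * w)" unfolding e using p(2) by (simp add: ip_adj)
    finally have "ip (c * w) (c * w) = 0" using w by simp
    moreover have "c * w \<in> colv k" by (blast intro: carr_intros c w)
    ultimately have "c * w = 0" using ip_self_eq_0 by simp
    then show ?thesis using e by simp
  qed
  obtain z w where "w \<in> colv n" "w \<noteq> 0" "P * w = 0" "a * w = z *\<^sub>c w"
    using eigenvector_in_kernel[OF a, of P v] ker v by blast
  then show False using obs ker by blast
qed

text \<open>The diagonal controls everything: testing on \<open>e_i + l e_j\<close>, with the phase
  \<open>l\<close> that turns the entry \<open>(i, j)\<close> into minus its modulus, bounds twice
  this modulus by the sum of two diagonal entries.\<close>

lemma psd_norm_le:
  assumes P: "psd n P" and K: "\<And>i. i < n \<Longrightarrow> Re (ent P i i) \<le> K"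
  shows "norm P \<le> real n * (real n * K)"
proof -
  note p = psdD[OF P]
  note e = unit_colv and ipe = ip_unit[OF p(1)]
  have le: "cmod (ent P i j) \<le> K" if ij: "i < n" "j < n" for i j
  proof (cases "ent P i j = 0")
    case True
    have "0 \<le> Re (ent P i i)" using p(3)[OF e[OF ij(1)]] ipe ij by simp
    then show ?thesis using K[OF ij(1)] True by simp
  next
    case False
    define l where "l = - cnj (ent P i j) / cmod (ent P i j)"
    have l: "cmod l = 1" "l * ent P i j = - cmod (ent P i j)"
      using False by (auto simp: l_def norm_divide complex_norm_square[symmetric] power2_eq_square divide_simps mult.commute)
    have ll: "cnj l * l = 1" using l(1) by (simp add: complex_norm_square[symmetric] mult.commute)
    let ?w = "unit_pmat i 0 + l *\<^sub>c unit_pmat j 0"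
    have "0 \<le> Re (ip ?w (P * ?w))" using e ij by (intro p(3)) auto
    also have "ip ?w (P * ?w) = ent P i i + l * ent P i j + cnj (l * ent P i j) + cnj l * l * ent P j j"
    proof -
      have "ent P j i = cnj (ent P i j)" using p(2) by (metis ent_adj)
      then show ?thesis using ij by (simp add: distrib_left ipe algebra_simps)
    qed
    also have "\<dots> = ent P i i + ent P j j - 2 * cmod (ent P i j)" unfolding l(2) ll by simp
    finally have "2 * cmod (ent P i j) \<le> Re (ent P i i) + Re (ent P j j)" by simp
    then show ?thesis using K[OF ij(1)] K[OF ij(2)] by simp
  qed
  have "norm P = (\<Sum>i<n. \<Sum>j<n. cmod (ent P i j))"
    using p(1) by (intro norm_pmat_eq) (auto simp: bnd_def carr_def)
  also have "\<dots> \<le> (\<Sum>i<n. \<Sum>j<n. K)" by (intro sum_mono le) auto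
  finally show ?thesis by simp
qed

text \<open>Multiplication by \<open>X = P^-1\<close> from both sides exchanges the quadratic and
  the constant term and gives the equation in the form of the theorem.\<close>

lemma riccati_inverse:
  assumes a: "a \<in> carr n n" and b: "b \<in> carr n m" and c: "c \<in> carr k n" and X: "inv_of n P X"
    and ric: "P * b * adj b * P + adj c * c = \<i> *\<^sub>c (P * a - adj a * P)"
  shows "X * adj c * c * X + b * adj b = \<i> *\<^sub>c (a * X - X * adj a)"
proof -
  note x = inv_ofD[OF X]
  have bb: "b * adj b \<in> carr n n" "a * X \<in> carr n n" "X * adj a \<in> carr n n" by (blast intro: carr_intros a b x)+
  have "X * (P * b * adj b * P + adj c * c) * X = X * P * (b * adj b) * (P * X) + X * adj c * c * X"
    by (simp add: algebra_simps)
  also have "\<dots> = b * adj b + X * adj c * c * X" using x bb by simp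
  also have "X * (P * b * adj b * P + adj c * c) * X = \<i> *\<^sub>c (X * P * (a * X) - X * adj a * (P * X))"
    unfolding ric by (simp add: algebra_simps)
  also have "\<dots> = \<i> *\<^sub>c (a * X - X * adj a)" using x bb by simp
  finally show ?thesis by (simp add: add.commute)
qed

text \<open>The bounded real lemma. For \<open>\<rho> C\<close> with \<open>\<rho> < 1\<close> the Hamiltonian has no real eigenvalue and
  its stable invariant subspace gives \<open>P\<^sub>\<rho>\<close>; comparison with the Gramian \<open>X\<^sub>0 \<le> P\<^sub>\<rho>\<^sup>-\<^sup>1\<close> keeps
  \<open>P\<^sub>\<rho>\<close> bounded as \<open>\<rho> \<rightarrow> 1\<close>.\<close>
lemma riccati_exists:
  assumes a: "a \<in> carr n n" and b: "b \<in> carr n m" and c: "c \<in> carr k n"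
    and ev: "\<And>z w. w \<in> colv n \<Longrightarrow> w \<noteq> 0 \<Longrightarrow> a * w = z *\<^sub>c w \<Longrightarrow> Im z < 0"
    and contr: "\<And>(x::real) u g. g \<in> colv m \<Longrightarrow> u \<in> colv n \<Longrightarrow>
       complex_of_real x *\<^sub>c u - a * u = b * g \<Longrightarrow> Re (ip (c * u) (c * u)) \<le> Re (ip g g)"
    and obs: "\<And>z w. w \<in> colv n \<Longrightarrow> a * w = z *\<^sub>c w \<Longrightarrow> c * w = 0 \<Longrightarrow> w = 0"
    and con: "\<And>z w. w \<in> colv n \<Longrightarrow> adj a * w = z *\<^sub>c w \<Longrightarrow> adj b * w = 0 \<Longrightarrow> w = 0"
  shows "\<exists>X. pd n X \<and> X * adj c * c * X + b * adj b = \<i> *\<^sub>c (a * X - X * adj a)"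
proof -
  have evaa: "Im z > 0" if "w \<in> colv n" "w \<noteq> 0" "adj a * w = z *\<^sub>c w" for z w
    using eigen_adj[OF a that] ev by fastforce
  have evma: "Im z < 0" if w: "w \<in> colv n" "w \<noteq> 0" "(- adj a) * w = z *\<^sub>c w" for z w
  proof -
    have "adj a * w = (- z) *\<^sub>c w" using w(3) by (metis cscale_uminus minus_mult_left minus_minus)
    then show ?thesis using evaa[OF w(1,2)] by fastforce
  qed
  \<comment> \<open>With zero input matrix and data \<open>- adj a\<close>, \<open>adj b\<close> the
    Riccati equation is the Lyapunov equation of the controllability Gramian
    \<open>X0\<close>.\<close>
  interpret G: hamiltonian n "Suc 0" m "- adj a" 0 "adj b"
  proof
    fix x :: real and u g :: pmat
    assume g: "g \<in> colv (Suc 0)" "g \<noteq> 0" and u: "u \<in> colv n" "complex_of_real x *\<^sub>c u - (- adj a) * u = 0 * g"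
    have "(- adj a) * u = complex_of_real x *\<^sub>c u" using u(2) by (simp add: add_eq_0_iff)
    then have "u = 0" using evma[OF u(1)] by fastforce
    moreover have "Re (ip g g) > 0" using g ip_self_le_0[OF g(1)] by force
    ultimately show "Re (ip (adj b * u) (adj b * u)) < Re (ip g g)" by simp
  qed (use a b evma in auto)
  obtain X0 where X0: "psd n X0" "X0 * 0 * adj 0 * X0 + adj (adj b) * adj b = \<i> *\<^sub>c (X0 * (- adj a) - adj (- adj a) * X0)"
    using G.exists_stabilizing by blast
  have "pd n X0"
  proof (rule riccati_pd[OF _ _ _ _ X0])
    fix z w assume w: "w \<in> colv n" "(- adj a) * w = z *\<^sub>c w" "adj b * w = 0"
    have "adj a * w = (- z) *\<^sub>c w" using w(2) by (metis cscale_uminus minus_mult_left minus_minus)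
    then show "w = 0" using con w by blast
  qed (blast intro: carr_intros a b)+
  then obtain Y0 where Y0: "inv_of n X0 Y0" using pd_inv_of_exists by blast
  note x0 = psdD[OF X0(1)] and y0 = inv_ofD[OF Y0]
  have L0: "b * adj b = \<i> *\<^sub>c (a * X0 - X0 * adj a)" using X0(2) by simp
  \<comment> \<open>Any sequence in the open unit interval tending to 1 would serve; the shift by 2
    keeps \<open>rho 0\<close> positive.\<close>
  define rho where "rho = (\<lambda>i. 1 - 1 / (real i + 2))"
  have rho: "0 < rho i" "rho i < 1" for i by (auto simp: rho_def field_simps)
  define ci where "ci = (\<lambda>i. rho i *\<^sub>R c)"
  have ci: "ci i \<in> carr k n" for i using c by (simp add: ci_def)
  have "\<exists>P. psd n P \<and> P * b * adj b * P + adj (ci i) * ci i = \<i> *\<^sub>c (P * a - adj a * P)" for i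
  proof -
    interpret hamiltonian n m k a b "ci i"
    proof
      fix x :: real and u g :: pmat
      assume g: "g \<in> colv m" "g \<noteq> 0" and u: "u \<in> colv n" "complex_of_real x *\<^sub>c u - a * u = b * g"
      have "Re (ip g g) > 0" using g ip_self_le_0[OF g(1)] by force
      moreover have "Re (ip (ci i * u) (ci i * u)) = rho i * rho i * Re (ip (c * u) (c * u))"
        by (simp add: ci_def scaleR_cscale)
      moreover have "\<dots> \<le> rho i * rho i * Re (ip g g)"
        using contr[OF g(1) u] by (intro mult_left_mono) auto
      moreover have "rho i * rho i < 1" using rho[of i] by (metis mult_strict_mono' less_eq_real_def mult_1)
      ultimately show "Re (ip (ci i * u) (ci i * u)) < Re (ip g g)"
        by (smt (verit) mult_less_cancel_right2)
    qed (use a b ci ev in auto)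
    show ?thesis by (rule exists_stabilizing)
  qed
  then obtain P where P: "\<And>i. psd n (P i)"
    and ric: "\<And>i. P i * b * adj b * P i + adj (ci i) * ci i = \<i> *\<^sub>c (P i * a - adj a * P i)"
    by metis
  have Ple: "Re (ip w (P i * w)) \<le> Re (ip w (Y0 * w))" if w: "w \<in> colv n" for i w
  proof -
    have Ppd: "pd n (P i)"
    proof (rule riccati_pd[OF a b ci _ P ric])
      fix z w assume w: "w \<in> colv n" "a * w = z *\<^sub>c w" "ci i * w = 0"
      then have "c * w = 0" using rho(1)[of i] by (simp add: ci_def)
      then show "w = 0" using obs w by blast
    qed
    then obtain X where X: "inv_of n (P i) X" using pd_inv_of_exists by blast
    note x = inv_ofD[OF X] pdD[OF inv_of_pd[OF Ppd X]]
    \<comment> \<open>Both \<open>X\<close> and \<open>X0\<close> have the same term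
      \<open>b (adj b)\<close>. In the difference of their equations only the square
      \<open>X (adj c) c X\<close>, with the shrunken \<open>c\<close>, remains, so Lyapunov's
      theorem applies.\<close>
    have "psd n (X - X0)"
    proof (rule lyapunov_psd[of "- adj a"])
      fix u assume u: "u \<in> colv n"
      have "X * adj (ci i) * ci i * X + b * adj b = \<i> *\<^sub>c (a * X - X * adj a)"
        by (rule riccati_inverse[OF a b ci X ric])
      then have e: "X * adj (ci i) * ci i * X = \<i> *\<^sub>c (a * X - X * adj a) - \<i> *\<^sub>c (a * X0 - X0 * adj a)"
        unfolding L0 by (simp add: eq_diff_eq)
      have "\<i> *\<^sub>c ((X - X0) * (- adj a) - adj (- adj a) * (X - X0)) = X * adj (ci i) * ci i * X"
        unfolding e by (intro pmat_eqI) (simp add: algebra_simps)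
      then have "ip u (\<i> *\<^sub>c ((X - X0) * (- adj a) - adj (- adj a) * (X - X0)) * u) = ip (ci i * (X * u)) (ci i * (X * u))"
        using x(6) by (simp only: mult.assoc ip_adj[of _ "X * u"]) (simp add: ip_adj)
      moreover have "ci i * (X * u) \<in> colv k" by (blast intro: carr_intros ci x u)
      ultimately show "0 \<le> Re (ip u (\<i> *\<^sub>c ((X - X0) * (- adj a) - adj (- adj a) * (X - X0)) * u))"
        using ip_self_nonneg by simp
    qed (use a x x0 evma in auto)
    note d = psdD(3)[OF this]
    \<comment> \<open>Inversion reverses the order: positivity of \<open>X0\<close> is tested on the
      difference of \<open>P w\<close> and \<open>X0^-1 w\<close>, and
      \<open>X0 \<le> X = P^-1\<close> bounds the quadratic term.\<close>
    define u y where "u = P i * w" and "y = Y0 * w"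
    have uy: "u \<in> colv n" "y \<in> colv n" unfolding u_def y_def by (blast intro: carr_intros x y0 w)+
    have Xu: "X * u = w" "X0 * y = w" using inv_of_cancel[OF X w] inv_of_cancel[OF Y0 w] by (auto simp: u_def y_def)
    have X0u: "ip y (X0 * u) = ip w u" using x0(2) Xu(2) by (simp add: ip_adj')
    have "0 \<le> Re (ip (u - y) (X0 * (u - y)))" using uy by (intro x0(3)) auto
    also have "\<dots> = Re (ip u (X0 * u)) - Re (ip u w) - Re (ip w u) + Re (ip y w)"
      by (simp add: right_diff_distrib Xu X0u)
    also have "Re (ip u (X0 * u)) \<le> Re (ip u w)"
      using d[OF uy(1)] by (simp add: left_diff_distrib Xu)
    finally have "Re (ip w u) \<le> Re (ip y w)" by simp
    then show ?thesis using cnj_ip[of y w] by (simp add: u_def y_def) (metis cnj.sel(1))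
  qed
  define K where "K = (\<Sum>i<n. \<bar>Re (ip (unit_pmat i 0) (Y0 * unit_pmat i 0))\<bar>)"
  have "Re (ent (P l) i i) \<le> K" if "i < n" for l i
  proof -
    have e: "unit_pmat i 0 \<in> colv n" by (rule unit_colv[OF that])
    have "Re (ent (P l) i i) = Re (ip (unit_pmat i 0) (P l * unit_pmat i 0))"
      using ip_unit[OF psdD(1)[OF P] that that] by simp
    also have "\<dots> \<le> \<bar>Re (ip (unit_pmat i 0) (Y0 * unit_pmat i 0))\<bar>" using Ple[OF e, of l] by linarith
    also have "\<dots> \<le> K" unfolding K_def using that by (intro member_le_sum) auto
    finally show ?thesis .
  qed
  then have bound: "norm (P l) \<le> real n * (real n * K)" for l by (rule psd_norm_le[OF P])
  obtain Q g where g: "strict_mono (g :: nat \<Rightarrow> nat)" "Q \<in> carr n n" "(P \<circ> g) \<longlonglongrightarrow> Q"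
    using carr_compact[of P n n, OF psdD(1)[OF P] bound] by blast
  have limP: "(\<lambda>i. P (g i)) \<longlonglongrightarrow> Q" using g(3) by (simp add: o_def)
  have "rho \<longlonglongrightarrow> 1" unfolding rho_def by real_asymp
  then have "(\<lambda>i. rho (g i)) \<longlonglongrightarrow> 1" using LIMSEQ_subseq_LIMSEQ[OF _ g(1), of rho 1] by (simp add: o_def)
  then have limc: "(\<lambda>i. ci (g i)) \<longlonglongrightarrow> c" unfolding ci_def using tendsto_scaleR[of "\<lambda>i. rho (g i)" 1 sequentially "\<lambda>_. c" c] by simp
  have Qadj: "adj Q = Q"
    using LIMSEQ_unique[OF tendsto_adj[OF limP]] limP psdD(2)[OF P] by simp
  have "psd n Q" unfolding psd_def
  proof (intro conjI ballI g(2) Qadj)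
    fix w assume w: "w \<in> colv n"
    have "(\<lambda>i. Re (ip w (P (g i) * w))) \<longlonglongrightarrow> Re (ip w (Q * w))"
      unfolding ip_def by (intro tendsto_intros tendsto_ent limP)
    then show "0 \<le> Re (ip w (Q * w))" using psdD(3)[OF P w] by (intro LIMSEQ_le_const) auto
  qed
  have "(\<lambda>i. P (g i) * b * adj b * P (g i) + adj (ci (g i)) * ci (g i)) \<longlonglongrightarrow> Q * b * adj b * Q + adj c * c"
    by (intro tendsto_intros limP limc)
  moreover have "(\<lambda>i. \<i> *\<^sub>c (P (g i) * a - adj a * P (g i))) \<longlonglongrightarrow> \<i> *\<^sub>c (Q * a - adj a * Q)"
    by (intro tendsto_intros limP)
  ultimately have Qric: "Q * b * adj b * Q + adj c * c = \<i> *\<^sub>c (Q * a - adj a * Q)"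
    unfolding ric by (rule LIMSEQ_unique)
  have Qpd: "pd n Q" by (rule riccati_pd[OF a b c obs \<open>psd n Q\<close> Qric])
  then obtain X where X: "inv_of n Q X" using pd_inv_of_exists by blast
  show ?thesis using inv_of_pd[OF Qpd X] riccati_inverse[OF a b c X Qric] by blast
qed

section \<open>Rational matrix functions\<close>

lemma finite_eventually_at: "finite F \<Longrightarrow> \<forall>\<^sub>F z in at (z0::complex). z \<notin> F"
  by (metis islimpt_finite islimpt_iff_eventually)

text \<open>Coprimality: where the denominator vanishes the numerator does not, so the quotient
  tends to infinity.\<close>

lemma rational_cont_or_pole:
  assumes "rational_mat_fun r c R" "i < r" "j < c"
  shows "isCont (\<lambda>z. R z $$ (i, j)) z0 \<or> is_pole (\<lambda>z. R z $$ (i, j)) z0"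
proof -
  obtain p q where pq: "q \<noteq> 0" "coprime p q" "\<And>z. R z $$ (i, j) = poly p z / poly q z"
    using assms unfolding rational_mat_fun_def by blast
  have cont: "isCont (poly p) z0" "isCont (poly q) z0" by simp_all
  show ?thesis
  proof (cases "poly q z0 = 0")
    case False
    then have "isCont (\<lambda>z. poly p z / poly q z) z0" using cont by (intro isCont_divide) auto
    then show ?thesis by (simp add: pq(3))
  next
    case True
    then have p0: "poly p z0 \<noteq> 0" using coprime_poly_0[OF pq(2)] by blast
    have "finite {z. poly q z = 0}" by (rule poly_roots_finite[OF pq(1)])
    then have "\<forall>\<^sub>F z in at z0. z \<notin> {z. poly q z = 0}" by (rule finite_eventually_at)
    then have "\<forall>\<^sub>F z in at z0. poly q z \<noteq> 0" by simp
    moreover have "(poly q \<longlongrightarrow> 0) (at z0)" using cont(2) True by (simp add: isCont_def)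
    ultimately have "filterlim (poly q) (at 0) (at z0)" by (simp add: filterlim_at)
    then have "filterlim (\<lambda>z. poly p z / poly q z) at_infinity (at z0)"
      using cont(1) p0 by (intro filterlim_divide_at_infinity[of _ "poly p z0"]) (auto simp: isCont_def)
    then show ?thesis by (simp add: is_pole_def pq(3))
  qed
qed

lemma rational_isCont:
  assumes R: "rational_mat_fun r c R" and np: "\<not> mat_fun_pole r c R z0"
  shows "((\<lambda>z. emb (R z)) \<longlongrightarrow> emb (R z0)) (at z0)"
proof -
  have car: "R z \<in> carrier_mat r c" for z using R by (simp add: rational_mat_fun_def)
  show ?thesis
  proof (rule tendsto_pmat)
    fix i j assume ij: "i < r" "j < c"
    then have "isCont (\<lambda>z. R z $$ (i, j)) z0"
      using rational_cont_or_pole[OF R ij] np by (auto simp: mat_fun_pole_def)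
    then show "((\<lambda>z. ent (emb (R z)) i j) \<longlongrightarrow> ent (emb (R z0)) i j) (at z0)"
      using ij by (simp add: ent_emb_carrier[OF car] isCont_def)
  qed (use car in auto)
qed

text \<open>A bound along some nontrivial filter finer than \<open>at z0\<close> is enough; on the
  real axis boundedness is known along the axis only.\<close>

lemma bounded_no_pole:
  assumes F: "F \<noteq> bot" "F \<le> at z0" and b: "\<forall>\<^sub>F z in F. cmod (f z) \<le> K"
  shows "\<not> is_pole f z0"
proof
  assume "is_pole f z0"
  then have "filterlim f at_infinity F" using F(2) by (simp add: is_pole_def filterlim_mono)
  then have "\<forall>\<^sub>F z in F. K + 1 \<le> cmod (f z)"
    using filterlim_at_infinity_imp_norm_at_top[of f F] by (simp add: filterlim_at_top)
  with b have "\<forall>\<^sub>F z in F. False" by eventually_elim simp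
  then show False using F(1) by (simp add: trivial_limit_def)
qed

text \<open>Extends an identity that holds near \<open>z0\<close> to \<open>z0\<close> itself: a
  finite limit excludes a pole, and away from poles \<open>R\<close> is continuous.\<close>

lemma rational_eq_limit:
  assumes R: "rational_mat_fun r c R" and lim: "(f \<longlongrightarrow> l) (at z0)"
    and eq: "\<forall>\<^sub>F z in at z0. emb (R z) = f z"
  shows "emb (R z0) = l"
proof -
  have car: "R z \<in> carrier_mat r c" for z using R by (simp add: rational_mat_fun_def)
  have lim': "((\<lambda>z. emb (R z)) \<longlongrightarrow> l) (at z0)"
    using lim eq by (simp add: tendsto_cong)
  have "\<not> mat_fun_pole r c R z0" unfolding mat_fun_pole_def
  proof safe
    fix i j assume ij: "i < r" "j < c" and pole: "is_pole (\<lambda>w. R w $$ (i, j)) z0"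
    have "((\<lambda>w. R w $$ (i, j)) \<longlongrightarrow> ent l i j) (at z0)"
      using tendsto_ent[OF lim', of i j] ij by (simp add: ent_emb_carrier[OF car])
    then show False using pole not_tendsto_and_filterlim_at_infinity[of "at z0"] unfolding is_pole_def by simp
  qed
  then have "((\<lambda>z. emb (R z)) \<longlongrightarrow> emb (R z0)) (at z0)" by (rule rational_isCont[OF R])
  then show ?thesis using lim' by (intro tendsto_unique[of "at z0"]) auto
qed

section \<open>Realizations\<close>

text \<open>The resolvent enters as an arbitrary inverse \<open>G\<close> in the corner, so no
  inverse function has to be carried along.\<close>

definition preal :: "nat \<Rightarrow> nat \<Rightarrow> (complex \<Rightarrow> complex mat) \<Rightarrow> nat \<Rightarrow> pmat \<Rightarrow> pmat \<Rightarrow> pmat \<Rightarrow> bool" where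
  "preal r k R n a b c \<longleftrightarrow> a \<in> carr n n \<and> b \<in> carr n k \<and> c \<in> carr r n \<and>
     (\<forall>z G. inv_of n (z *\<^sub>c idm n - a) G \<longrightarrow> emb (R z) = c * G * b)"

lemma prealD: assumes "preal r k R n a b c"
  shows "a \<in> carr n n" "b \<in> carr n k" "c \<in> carr r n" "inv_of n (z *\<^sub>c idm n - a) G \<Longrightarrow> emb (R z) = c * G * b"
  using assms by (auto simp: preal_def)

lemma emb_resolvent: "A \<in> carrier_mat n n \<Longrightarrow> emb (z \<cdot>\<^sub>m 1\<^sub>m n - A) = z *\<^sub>c idm n - emb A"
  by (subst emb_diff[of _ n n]) auto

lemma realization_iff:
  assumes R: "\<And>z. R z \<in> carrier_mat r k"
  shows "realization r k R n A B C \<longleftrightarrow> A \<in> carrier_mat n n \<and> B \<in> carrier_mat n k \<and> C \<in> carrier_mat r n \<and>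
     preal r k R n (emb A) (emb B) (emb C)"
proof (cases "A \<in> carrier_mat n n \<and> B \<in> carrier_mat n k \<and> C \<in> carrier_mat r n")
  case True
  then have car: "A \<in> carrier_mat n n" "B \<in> carrier_mat n k" "C \<in> carrier_mat r n" by auto
  have "(invertible_mat (z \<cdot>\<^sub>m 1\<^sub>m n - A) \<longrightarrow> R z = C * mat_inv (z \<cdot>\<^sub>m 1\<^sub>m n - A) * B) \<longleftrightarrow>
      (\<forall>G. inv_of n (z *\<^sub>c idm n - emb A) G \<longrightarrow> emb (R z) = emb C * G * emb B)" for z
  proof -
    let ?M = "z \<cdot>\<^sub>m 1\<^sub>m n - A"
    have M: "?M \<in> carrier_mat n n" using car by (intro minus_carrier_mat)
    have e: "emb (C * mat_inv ?M * B) = emb C * G * emb B \<and> C * mat_inv ?M * B \<in> carrier_mat r k"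
      if "inv_of n (z *\<^sub>c idm n - emb A) G" for G
    proof -
      have G: "emb (mat_inv ?M) = G" "mat_inv ?M \<in> carrier_mat n n"
        using emb_mat_inv_eq[OF M] that emb_resolvent[OF car(1)] by auto
      have CG: "C * mat_inv ?M \<in> carrier_mat r n" using car G by (intro mult_carrier_mat)
      show ?thesis using emb_mult[OF CG car(2)] emb_mult[OF car(3) G(2)] G mult_carrier_mat[OF CG car(2)] by simp
    qed
    show ?thesis
      using invertible_mat_iff[OF M] e emb_inj[OF R] inv_of_unique unfolding emb_resolvent[OF car(1)] by metis
  qed
  then show ?thesis using car by (auto simp: realization_def preal_def)
qed (auto simp: realization_def)

lemma resolvent_tendsto:
  assumes a: "a \<in> carr n n" and inv: "\<forall>\<^sub>F z in F. inv_of n (z *\<^sub>c idm n - a) (G z)"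
    and inv0: "inv_of n (z0 *\<^sub>c idm n - a) G0" and F: "F \<le> at z0"
  shows "(G \<longlongrightarrow> G0) F"
proof (rule tendsto_inv_of[OF _ inv inv0])
  have "((\<lambda>z. z) \<longlongrightarrow> z0) F" using F tendsto_ident_at tendsto_mono by blast
  then show "((\<lambda>z. z *\<^sub>c idm n - a) \<longlongrightarrow> z0 *\<^sub>c idm n - a) F" by (intro tendsto_intros)
qed

text \<open>The new realization must reproduce \<open>R\<close> at every point of its own resolvent
  set, including the finitely many points where the old resolvent does not exist. Those points are
  reached by continuity of the new resolvent.\<close>

lemma preal_transfer:
  assumes R: "rational_mat_fun r k R" and re: "preal r k R n a b c"
    and car: "a' \<in> carr n' n'" "b' \<in> carr n' k" "c' \<in> carr r n'"
    and eq: "\<And>z G G'. inv_of n (z *\<^sub>c idm n - a) G \<Longrightarrow> inv_of n' (z *\<^sub>c idm n' - a') G' \<Longrightarrow> c' * G' * b' = c * G * b"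
  shows "preal r k R n' a' b' c'"
  unfolding preal_def
proof (intro conjI car allI impI)
  fix z0 G0 assume G0: "inv_of n' (z0 *\<^sub>c idm n' - a') G0"
  note re = prealD[OF re]
  define g where "g = (\<lambda>z. SOME G. inv_of n' (z *\<^sub>c idm n' - a') G)"
  let ?F = "{z. \<not> (\<exists>B. inv_of n (z *\<^sub>c idm n - a) B)} \<union> {z. \<not> (\<exists>B. inv_of n' (z *\<^sub>c idm n' - a') B)}"
  have "finite ?F" using finite_not_inv[OF re(1)] finite_not_inv[OF car(1)] by simp
  then have ev: "\<forall>\<^sub>F z in at z0. z \<notin> ?F" by (rule finite_eventually_at)
  have g: "inv_of n' (z *\<^sub>c idm n' - a') (g z)" if "z \<notin> ?F" for z
    using someI_ex[of "\<lambda>G. inv_of n' (z *\<^sub>c idm n' - a') G"] that unfolding g_def by blast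
  have "(g \<longlongrightarrow> G0) (at z0)"
    by (rule resolvent_tendsto[OF car(1) _ G0]) (use ev g in \<open>auto elim!: eventually_mono\<close>)
  then have "((\<lambda>z. c' * g z * b') \<longlongrightarrow> c' * G0 * b') (at z0)" by (intro tendsto_intros)
  moreover have "\<forall>\<^sub>F z in at z0. emb (R z) = c' * g z * b'"
    using ev
  proof eventually_elim
    case (elim z)
    then obtain G where G: "inv_of n (z *\<^sub>c idm n - a) G" by auto
    then show ?case using eq[OF G g[OF elim]] re(4)[OF G] by simp
  qed
  ultimately show "emb (R z0) = c' * G0 * b'" by (rule rational_eq_limit[OF R])
qed

text \<open>The quotient of \<open>\<complex>\<^sup>n\<close> by the line through \<open>w\<close>, in coordinates: \<open>p\<close> is the projection and \<open>s\<close> a section.\<close>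
lemma deflation:
  assumes w: "w \<in> colv n" "w \<noteq> 0"
  shows "\<exists>p s h. p \<in> carr (n - 1) n \<and> s \<in> carr n (n - 1) \<and> h \<in> carr (Suc 0) n \<and> s * p = idm n - w * h \<and> p * w = 0"
proof -
  obtain k where k: "k < n" "ent w k 0 \<noteq> 0"
    using w carr_eqI[of w n "Suc 0" 0] by (metis carr_simps(1) ent_0 less_Suc0)
  \<comment> \<open>\<open>sk\<close> enumerates all indices except \<open>k\<close>, a coordinate
    in which \<open>w\<close> does not vanish and which is eliminated.\<close>
  define sk where "sk = (\<lambda>i. if i < k then i else Suc i)"
  define s where "s = trunc n (n - 1) (\<lambda>i j. if i = sk j then 1 else 0)"
  define p where "p = trunc (n - 1) n (\<lambda>i l. (if l = sk i then 1 else 0) - (if l = k then ent w (sk i) 0 / ent w k 0 else 0))"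
  define h where "h = trunc (Suc 0) n (\<lambda>i l. if l = k then 1 / ent w k 0 else 0)"
  have skn: "sk i < n" "sk i \<noteq> k" if "i < n - 1" for i using that k by (auto simp: sk_def)
  have "s * p = idm n - w * h"
  proof (rule carr_eqI[of _ n n])
    fix i l assume il: "i < n" "l < n"
    have wh: "ent (w * h) i l = ent w i 0 * (if l = k then 1 / ent w k 0 else 0)"
      using il by (subst ent_times_carr[of _ n "Suc 0"]) (use w in \<open>auto simp: h_def trunc.rep_eq\<close>)
    have sp: "ent (s * p) i l = (\<Sum>j<n - 1. (if i = sk j then 1 else 0) * ent p j l)"
      using il by (subst ent_times_carr[of _ n "n - 1"]) (auto simp: s_def trunc.rep_eq intro!: sum.cong)
    show "ent (s * p) i l = ent (idm n - w * h) i l"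
    proof (cases "i = k")
      case True
      then have "ent (s * p) i l = 0" unfolding sp using skn by (intro sum.neutral) auto
      then show ?thesis using True k il wh by (auto simp: idm.rep_eq)
    next
      case False
      define j0 where "j0 = (if i < k then i else i - 1)"
      have j0: "j0 < n - 1" "sk j0 = i" using False k il by (auto simp: j0_def sk_def)
      have "ent (s * p) i l = (\<Sum>j<n - 1. if j = j0 then ent p j0 l else 0)"
        unfolding sp using j0 by (intro sum.cong) (auto simp: sk_def split: if_splits)
      also have "\<dots> = ent p j0 l" using j0 by simp
      finally show ?thesis using j0 il by (simp add: p_def trunc.rep_eq wh idm.rep_eq)
    qed
  next
    show "s * p \<in> carr n n" unfolding s_def p_def by (blast intro: carr_intros)
    show "idm n - w * h \<in> carr n n" unfolding h_def by (blast intro: carr_intros w)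
  qed
  moreover have "p * w = 0"
  proof (rule carr_eqI[of _ "n - 1" "Suc 0"])
    fix i j :: nat assume ij: "i < n - 1" "j < Suc 0"
    have "ent (p * w) i j = (\<Sum>l<n. ent p i l * ent w l 0)"
      using ij by (subst ent_times_carr[of _ "n - 1" n]) (auto simp: p_def)
    also have "\<dots> = (\<Sum>l<n. (if l = sk i then ent w (sk i) 0 else 0) - (if l = k then ent w (sk i) 0 else 0))"
      using ij k by (intro sum.cong refl) (auto simp: p_def trunc.rep_eq left_diff_distrib)
    also have "\<dots> = 0" using skn[OF ij(1)] k by (simp add: sum_subtractf)
    finally show "ent (p * w) i j = ent 0 i j" by simp
  qed (auto simp: p_def intro: carr_intros w)
  ultimately show ?thesis by (intro exI[of _ p] exI[of _ s] exI[of _ h]) (auto simp: s_def p_def h_def)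
qed

text \<open>An eigenvector in the kernel of \<open>c\<close> is invisible in the output:
  \<open>a\<close> and \<open>c\<close> descend to the quotient by its line, as
  \<open>a' p = p a\<close> and \<open>c s p = c\<close> express, and the transfer function does not
  change.\<close>

lemma deflate_realization:
  assumes a: "a \<in> carr n n" and b: "b \<in> carr n k" and c: "c \<in> carr r n"
    and w: "w \<in> colv n" "w \<noteq> 0" "a * w = l *\<^sub>c w" "c * w = 0"
  shows "\<exists>a' b' c'. a' \<in> carr (n - 1) (n - 1) \<and> b' \<in> carr (n - 1) k \<and> c' \<in> carr r (n - 1) \<and>
    (\<forall>z G G'. inv_of n (z *\<^sub>c idm n - a) G \<longrightarrow> inv_of (n - 1) (z *\<^sub>c idm (n - 1) - a') G' \<longrightarrow> c' * G' * b' = c * G * b)"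
proof -
  obtain p s h where p: "p \<in> carr (n - 1) n" and s: "s \<in> carr n (n - 1)" and h: "h \<in> carr (Suc 0) n"
    and sp: "s * p = idm n - w * h" and pw: "p * w = 0" using deflation[OF w(1,2)] by blast
  define a' where "a' = p * a * s"
  have a': "a' \<in> carr (n - 1) (n - 1)" unfolding a'_def by (blast intro: carr_intros p a s)
  have ap: "a' * p = p * a"
  proof -
    have "a' * p = p * a * (s * p)" by (simp add: a'_def mult.assoc)
    also have "\<dots> = p * a - p * (a * w) * h" using a unfolding sp by (simp add: right_diff_distrib mult.assoc)
    also have "\<dots> = p * a" using pw by (simp add: w(3))
    finally show ?thesis .
  qed
  have cp: "c * s * p = c"
  proof -
    have "c * s * p = c - (c * w) * h" using c by (simp add: mult.assoc sp right_diff_distrib)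
    then show ?thesis by (simp add: w(4))
  qed
  have "(c * s) * G' * (p * b) = c * G * b"
    if G: "inv_of n (z *\<^sub>c idm n - a) G" and G': "inv_of (n - 1) (z *\<^sub>c idm (n - 1) - a') G'" for z G G'
  proof -
    note i = inv_ofD[OF G]
    have Gb: "p * (G * b) \<in> carr (n - 1) k" by (blast intro: carr_intros i p b)
    have "(z *\<^sub>c idm (n - 1) - a') * (p * (G * b)) = z *\<^sub>c (p * (G * b)) - (a' * p) * (G * b)"
      using idm_mult[OF Gb] by (simp add: left_diff_distrib mult.assoc)
    also have "\<dots> = p * (z *\<^sub>c (idm n * (G * b)) - a * (G * b))"
      using i(2) unfolding ap by (simp add: right_diff_distrib mult.assoc)
    also have "\<dots> = p * ((z *\<^sub>c idm n - a) * (G * b))" by (simp add: left_diff_distrib)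
    also have "\<dots> = p * b" using inv_of_cancel[OF G b] by simp
    finally have "G' * (p * b) = p * (G * b)" using inv_of_cancel(2)[OF G' Gb] by simp
    then have "(c * s) * G' * (p * b) = (c * s * p) * (G * b)" by (simp add: mult.assoc)
    then show ?thesis unfolding cp by (simp add: mult.assoc)
  qed
  moreover have "p * b \<in> carr (n - 1) k" "c * s \<in> carr r (n - 1)" by (blast intro: carr_intros p b c s)+
  ultimately show ?thesis using a' by blast
qed

lemma preal_realization:
  assumes R: "\<And>z. R z \<in> carrier_mat r k" and re: "preal r k R n a b c"
  shows "realization r k R n (unemb n n a) (unemb n k b) (unemb r n c)"
  using re prealD[OF re] by (simp add: realization_iff[OF R])

section \<open>Minimal realizations: observability, controllability, poles\<close>

locale minimal =
  fixes m1 m2 n :: nat and R :: "complex \<Rightarrow> complex mat" and A B C :: "complex mat"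
  assumes rat: "rational_mat_fun m2 m1 R"
    and min: "minimal_realization m2 m1 R n A B C"
begin

lemma Rcar: "R z \<in> carrier_mat m2 m1"
  using rat by (simp add: rational_mat_fun_def)

abbreviation "a \<equiv> emb A"
abbreviation "b \<equiv> emb B"
abbreviation "c \<equiv> emb C"

lemma matcar: "A \<in> carrier_mat n n" "B \<in> carrier_mat n m1" "C \<in> carrier_mat m2 n"
  and re: "preal m2 m1 R n a b c"
  using min realization_iff[OF Rcar] by (auto simp: minimal_realization_def)

lemmas re' = prealD[OF re]

lemma minimal_le: "preal m2 m1 R n' a' b' c' \<Longrightarrow> n \<le> n'"
  using min preal_realization[of R m2 m1, OF Rcar] unfolding minimal_realization_def by blast

text \<open>An eigenvector violating this could be divided out, leaving a realization of size
  \<open>n - 1\<close>.\<close>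

lemma observable:
  assumes "w \<in> colv n" "a * w = z *\<^sub>c w" "c * w = 0" shows "w = 0"
proof (rule ccontr)
  assume w: "w \<noteq> 0"
  then have "n > 0" using assms(1) by (cases n) (auto simp: carr_def intro: pmat_eqI)
  obtain a' b' c' where d: "a' \<in> carr (n - 1) (n - 1)" "b' \<in> carr (n - 1) m1" "c' \<in> carr m2 (n - 1)"
    "\<And>z G G'. inv_of n (z *\<^sub>c idm n - a) G \<Longrightarrow> inv_of (n - 1) (z *\<^sub>c idm (n - 1) - a') G' \<Longrightarrow> c' * G' * b' = c * G * b"
    using deflate_realization[OF re'(1,2,3) assms(1) w assms(2,3)] by blast
  have "preal m2 m1 R (n - 1) a' b' c'" by (rule preal_transfer[OF rat re d])
  then show False using minimal_le \<open>n > 0\<close> by fastforce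
qed

lemma adj_resolvent: "inv_of k (cnj z *\<^sub>c idm k - x) G \<Longrightarrow> inv_of k (z *\<^sub>c idm k - adj x) (adj G)"
  using inv_of_adj by fastforce

text \<open>Dual to observability: the adjoint triple is deflated and the result is turned back by
  taking adjoints, with the resolvent at the conjugate point.\<close>

lemma controllable:
  assumes "w \<in> colv n" "adj a * w = z *\<^sub>c w" "adj b * w = 0" shows "w = 0"
proof (rule ccontr)
  assume w: "w \<noteq> 0"
  then have "n > 0" using assms(1) by (cases n) (auto simp: carr_def intro: pmat_eqI)
  have car: "adj a \<in> carr n n" "adj c \<in> carr n m2" "adj b \<in> carr m1 n" using re' by auto
  obtain a' b' c' where d: "a' \<in> carr (n - 1) (n - 1)" "b' \<in> carr (n - 1) m2" "c' \<in> carr m1 (n - 1)"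
    "\<And>z G G'. inv_of n (z *\<^sub>c idm n - adj a) G \<Longrightarrow> inv_of (n - 1) (z *\<^sub>c idm (n - 1) - a') G' \<Longrightarrow> c' * G' * b' = adj b * G * adj c"
    using deflate_realization[OF car assms(1) w assms(2,3)] by blast
  have "preal m2 m1 R (n - 1) (adj a') (adj c') (adj b')"
  proof (rule preal_transfer[OF rat re])
    fix z G G' assume G: "inv_of n (z *\<^sub>c idm n - a) G" "inv_of (n - 1) (z *\<^sub>c idm (n - 1) - adj a') G'"
    have "c' * adj G' * b' = adj b * adj G * adj c"
      using adj_resolvent[of n "cnj z" a G] adj_resolvent[of "n - 1" "cnj z" "adj a'" G'] G by (intro d(4)) auto
    then have "adj (c' * adj G' * b') = adj (adj b * adj G * adj c)" by simp
    then show "adj b' * G' * adj c' = c * G * b" by (simp add: mult.assoc)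
  qed (use d in auto)
  then show False using minimal_le \<open>n > 0\<close> by fastforce
qed

text \<open>If \<open>z0\<close> were an eigenvalue but no pole of \<open>R\<close>, a limit \<open>N \<noteq> 0\<close> of normalized resolvents
  would satisfy \<open>a N = N a = z0 N\<close> and \<open>c N b = 0\<close>.\<close>
lemma eigenvalue_pole:
  assumes np: "\<not> mat_fun_pole m2 m1 R z0" and w: "w \<in> colv n" "a * w = z0 *\<^sub>c w"
  shows "w = 0"
proof (rule ccontr)
  assume w0: "w \<noteq> 0"
  let ?F = "{z. \<not> (\<exists>B. inv_of n (z *\<^sub>c idm n - a) B)}"
  have "\<forall>\<^sub>F z in at z0. z \<notin> ?F" by (rule finite_eventually_at[OF finite_not_inv[OF re'(1)]])
  moreover have "filterlim (\<lambda>k. z0 + of_real (1 / real (Suc k))) (at z0) sequentially"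
  proof (rule filterlim_atI)
    have "(\<lambda>k. z0 + of_real (1 / real (Suc k))) \<longlonglongrightarrow> z0 + of_real 0"
      by (intro tendsto_intros) (rule LIMSEQ_Suc[OF lim_1_over_n])
    then show "(\<lambda>k. z0 + of_real (1 / real (Suc k))) \<longlonglongrightarrow> z0" by simp
  qed (simp del: of_nat_Suc)
  ultimately have ev: "\<forall>\<^sub>F k in sequentially. z0 + of_real (1 / real (Suc k)) \<notin> ?F"
    and flim: "filterlim (\<lambda>k. z0 + of_real (1 / real (Suc k))) (at z0) sequentially"
    by (auto simp: filterlim_iff)
  from ev obtain K where K: "\<And>k. k \<ge> K \<Longrightarrow> z0 + of_real (1 / real (Suc k)) \<notin> ?F"
    by (auto simp: eventually_sequentially)
  define zz where "zz = (\<lambda>k. z0 + of_real (1 / real (Suc (k + K))))"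
  have zz: "\<exists>B. inv_of n (zz k *\<^sub>c idm n - a) B" for k using K[of "k + K"] by (simp add: zz_def)
  have zlim: "filterlim zz (at z0) sequentially"
    unfolding zz_def using filterlim_compose[OF flim filterlim_add_const_nat_at_top[of K]] by (simp add: o_def)
  obtain G where G: "\<And>k. inv_of n (zz k *\<^sub>c idm n - a) (G k)" using zz by metis
  \<comment> \<open>With this normalization \<open>norm (f k) = 1 - s k\<close>. The limits
    therefore satisfy \<open>norm N = 1 - t\<close>, so that \<open>t = 0\<close> yields
    \<open>N \<noteq> 0\<close>.\<close>
  define s where "s = (\<lambda>k. 1 / (1 + norm (G k)))"
  have s: "0 \<le> s k" "s k \<le> 1" for k
    using le_imp_inverse_le[of 1 "1 + norm (G k)"] by (simp_all add: s_def inverse_eq_divide)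
  define f where "f = (\<lambda>k. s k *\<^sub>R G k)"
  have nf: "norm (f k) = 1 - s k" for k
  proof -
    have "norm (f k) = s k * norm (G k)" using s(1)[of k] by (simp add: f_def)
    also have "\<dots> = norm (G k) / (1 + norm (G k))" by (simp add: s_def)
    also have "\<dots> = 1 - s k"
    proof -
      have "1 + norm (G k) \<noteq> 0" using norm_ge_zero[of "G k"] by linarith
      then show ?thesis unfolding s_def by (metis add_diff_cancel_left' diff_divide_distrib divide_self)
    qed
    finally show ?thesis .
  qed
  have fcar: "f k \<in> carr n n" for k using inv_ofD[OF G] by (simp add: f_def)
  have "norm (f k) \<le> 1" for k using nf s by simp
  then obtain N g where g: "strict_mono (g :: nat \<Rightarrow> nat)" "N \<in> carr n n" "(f \<circ> g) \<longlonglongrightarrow> N"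
    using carr_compact[of f n n 1, OF fcar] by blast
  have fN: "(\<lambda>k. f (g k)) \<longlonglongrightarrow> N" using g(3) by (simp add: o_def)
  have zg: "filterlim (\<lambda>k. zz (g k)) (at z0) sequentially"
    using filterlim_compose[OF zlim filterlim_subseq[OF g(1)]] .
  then have zl: "(\<lambda>k. zz (g k)) \<longlonglongrightarrow> z0" by (simp add: filterlim_at)
  have sl: "(\<lambda>k. s (g k)) \<longlonglongrightarrow> 1 - norm N"
  proof -
    have "(\<lambda>k. 1 - norm (f (g k))) \<longlonglongrightarrow> 1 - norm N" by (intro tendsto_intros fN)
    then show ?thesis by (simp add: nf)
  qed
  define t where "t = 1 - norm N"
  have fG: "(zz k *\<^sub>c idm n - a) * f k = s k *\<^sub>R idm n" "f k * (zz k *\<^sub>c idm n - a) = s k *\<^sub>R idm n" for k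
    using inv_ofD[OF G] by (simp_all add: f_def)
  have "(\<lambda>k. (zz (g k) *\<^sub>c idm n - a) * f (g k)) \<longlonglongrightarrow> (z0 *\<^sub>c idm n - a) * N"
    "(\<lambda>k. f (g k) * (zz (g k) *\<^sub>c idm n - a)) \<longlonglongrightarrow> N * (z0 *\<^sub>c idm n - a)"
    by (intro tendsto_intros fN zl)+
  moreover have "(\<lambda>k. s (g k) *\<^sub>R idm n) \<longlonglongrightarrow> t *\<^sub>R idm n" unfolding t_def by (intro tendsto_intros sl)
  ultimately have lim: "(z0 *\<^sub>c idm n - a) * N = t *\<^sub>R idm n" "N * (z0 *\<^sub>c idm n - a) = t *\<^sub>R idm n"
    unfolding fG using LIMSEQ_unique by blast+
  \<comment> \<open>For \<open>t \<noteq> 0\<close> the matrix \<open>N / t\<close> would invert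
    \<open>z0 - a\<close>, which has the kernel vector \<open>w\<close>.\<close>
  have t0: "t = 0"
  proof (rule ccontr)
    assume "t \<noteq> 0"
    have "(z0 *\<^sub>c idm n - a) * w = 0" using w by (simp add: left_diff_distrib)
    then have "t *\<^sub>R w = 0" using w(1) lim(2) by (metis idm_mult mult.assoc mult_scaleR_left mult_zero_right)
    then show False using \<open>t \<noteq> 0\<close> w0 by simp
  qed
  have aN: "a * N = z0 *\<^sub>c N" "N * a = z0 *\<^sub>c N"
    using lim g(2) by (simp_all add: t0 left_diff_distrib right_diff_distrib)
  have "(\<lambda>k. c * f (g k) * b) \<longlonglongrightarrow> c * N * b" by (intro tendsto_intros fN)
  moreover have "c * f (g k) * b = s (g k) *\<^sub>R emb (R (zz (g k)))" for k
    using re'(4)[OF G] by (simp add: f_def)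
  moreover have "(\<lambda>k. s (g k) *\<^sub>R emb (R (zz (g k)))) \<longlonglongrightarrow> t *\<^sub>R emb (R z0)"
    unfolding t_def using filterlim_compose[OF rational_isCont[OF rat np] zg] by (intro tendsto_intros sl)
  ultimately have cNb: "c * N * b = 0" using LIMSEQ_unique[of _ "c * N * b" "t *\<^sub>R emb (R z0)"] t0 by simp
  have col: "X = 0" if X: "X \<in> carr n q" and ker: "\<And>v. v \<in> colv q \<Longrightarrow> X * v = 0" for X q
  proof (rule carr_eqI[OF X])
    fix i j assume ij: "i < n" "j < q"
    have "unit_pmat j 0 \<in> colv q" by (rule unit_colv[OF ij(2)])
    then have "0 = ent (X * unit_pmat j 0) i 0" by (simp add: ker)
    also have "\<dots> = ent X i j"
      by (rule ent_mult_unit[OF X ij(2)])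
    finally show "ent X i j = ent 0 i j" by simp
  qed simp
  \<comment> \<open>The vectors in the range of \<open>N b\<close> are killed by
    \<open>z0 - a\<close> and by \<open>c\<close>, hence vanish by observability. The same argument
    for \<open>adj N\<close> then uses controllability and contradicts
    \<open>norm N = 1\<close>.\<close>
  have "N * b = 0"
  proof (rule col)
    show "N * b \<in> carr n m1" by (blast intro: carr_intros g re')
    fix v assume v: "v \<in> colv m1"
    have "a * (N * b * v) = z0 *\<^sub>c (N * b * v)" by (simp add: mult.assoc[symmetric] aN)
    moreover have "c * (N * b * v) = 0" using cNb by (simp add: mult.assoc[symmetric])
    moreover have "N * b * v \<in> colv n" by (blast intro: carr_intros g re' v)
    ultimately show "N * b * v = 0" using observable by blast
  qed
  then have bN: "adj b * adj N = 0" by (metis adj_mult adj_0)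
  have "adj N = 0"
  proof (rule col)
    show "adj N \<in> carr n n" using g by simp
    fix v assume v: "v \<in> colv n"
    have "adj a * (adj N * v) = cnj z0 *\<^sub>c (adj N * v)"
      using arg_cong[OF aN(2), of adj] by (simp add: mult.assoc[symmetric])
    moreover have "adj b * (adj N * v) = 0" by (simp add: mult.assoc[symmetric] bN)
    moreover have "adj N * v \<in> colv n" by (blast intro: carr_intros g v)
    ultimately show "adj N * v = 0" using controllable by blast
  qed
  then show False using t0 by (simp add: t_def)
qed

end

text \<open>Multiplying by \<open>q(z) / z^deg q\<close>, which tends to the leading coefficient of
  \<open>q\<close>, shows that \<open>p(z) / z^deg q\<close> tends to 0. Were the degree of
  \<open>p\<close> at least that of \<open>q\<close>, the leading coefficient of \<open>p\<close>
  would be 0.\<close>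

lemma poly_degree_less:
  fixes p q :: "complex poly"
  assumes "p \<noteq> 0" "q \<noteq> 0" and lim: "((\<lambda>z. poly p z / poly q z) \<longlongrightarrow> 0) at_infinity"
  shows "degree p < degree q"
proof (rule ccontr)
  assume "\<not> degree p < degree q"
  then have le: "degree q \<le> degree p" by simp
  let ?h = "\<lambda>z. (poly p z / poly q z) * (poly q z / z ^ degree q)"
  have qlim: "((\<lambda>z. poly q z / z ^ degree q) \<longlongrightarrow> lead_coeff q) at_infinity"
    by (rule poly_divide_tendsto_aux)
  have "(?h \<longlongrightarrow> 0 * lead_coeff q) at_infinity" by (intro tendsto_mult lim qlim)
  then have h: "(?h \<longlongrightarrow> 0) at_infinity" by simp
  have "\<forall>\<^sub>F z in at_infinity. poly q z / z ^ degree q \<noteq> 0"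
    using qlim assms(2) by (intro tendsto_imp_eventually_ne) auto
  moreover have "\<forall>\<^sub>F z :: complex in at_infinity. 1 \<le> norm z" by (rule eventually_at_infinityI[of 1])
  ultimately have "\<forall>\<^sub>F z in at_infinity. norm (poly p z / z ^ degree p) \<le> norm (?h z)"
  proof eventually_elim
    case (elim z)
    have "?h z = poly p z / z ^ degree q" using elim by simp
    moreover have "norm z ^ degree q \<le> norm z ^ degree p" using le elim by (intro power_increasing) auto
    moreover have "0 < norm z" using elim by linarith
    ultimately show ?case
      using elim by (auto simp: norm_divide norm_power intro!: divide_left_mono)
  qed
  then have "((\<lambda>z. poly p z / z ^ degree p) \<longlongrightarrow> 0) at_infinity"
    by (rule Lim_null_comparison) (use tendsto_norm_zero[OF h] in simp)
  then have "lead_coeff p = 0"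
    using poly_divide_tendsto_aux[of p] tendsto_unique trivial_limit_at_infinity by blast
  then show False using assms(1) by simp
qed

text \<open>The index range falls into \<open>N\<close> blocks of length \<open>k\<close>, each with
  exactly one index of residue \<open>j\<close>.\<close>

lemma sum_blocks:
  fixes f :: "nat \<Rightarrow> complex"
  assumes "j < k" shows "(\<Sum>s<N * k. if s mod k = j then f (s div k) else 0) = (\<Sum>l<N. f l)"
proof -
  have "(\<Sum>s<N * k. if s mod k = j then f (s div k) else 0) =
      (\<Sum>l<N. \<Sum>s = l * k..<l * k + k. if s mod k = j then f (s div k) else 0)"
    by (rule sum.nat_group[symmetric])
  also have "\<dots> = (\<Sum>l<N. f l)"
  proof (intro sum.cong refl)
    fix l
    have "(\<Sum>s = l * k..<l * k + k. if s mod k = j then f (s div k) else 0) =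
        (\<Sum>s = l * k..<l * k + k. if s = l * k + j then f l else 0)"
    proof (intro sum.cong refl)
      fix s assume "s \<in> {l * k..<l * k + k}"
      then obtain d where d: "s = l * k + d" "d < k" by (auto simp: le_iff_add)
      then show "(if s mod k = j then f (s div k) else 0) = (if s = l * k + j then f l else 0)"
        using assms by simp
    qed
    also have "\<dots> = f l" using assms by simp
    finally show "(\<Sum>s = l * k..<l * k + k. if s mod k = j then f (s div k) else 0) = f l" .
  qed
  finally show ?thesis .
qed

text \<open>Block companion form of \<open>P / Q\<close> with a common denominator \<open>Q\<close>; the state index
  \<open>s = l k + j\<close> stands for the monomial \<open>z\<^sup>l\<close> in the input channel \<open>j\<close>.\<close>
lemma exists_preal:
  assumes R: "rational_mat_fun r k R" and sp: "strictly_proper r k R" and k: "0 < k"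
  shows "\<exists>n a b c. preal r k R n a b c"
proof -
  have Rcar: "R z \<in> carrier_mat r k" for z using R by (simp add: rational_mat_fun_def)
  have "\<forall>i j. \<exists>p q. i < r \<longrightarrow> j < k \<longrightarrow> q \<noteq> 0 \<and> (\<forall>z. R z $$ (i, j) = poly p z / poly q z)"
    using R unfolding rational_mat_fun_def by blast
  then obtain p q where pq: "\<And>i j. i < r \<Longrightarrow> j < k \<Longrightarrow> q i j \<noteq> 0"
    "\<And>i j z. i < r \<Longrightarrow> j < k \<Longrightarrow> R z $$ (i, j) = poly (p i j) z / poly (q i j) z" by metis
  define Q where "Q = (\<Prod>i<r. \<Prod>j<k. q i j)"
  have Q0: "Q \<noteq> 0" unfolding Q_def using pq(1) by auto
  have dvd: "q i j dvd Q" if "i < r" "j < k" for i j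
  proof -
    have "q i j dvd (\<Prod>j<k. q i j)" using that by (intro dvd_prodI) auto
    also have "\<dots> dvd Q" unfolding Q_def using that by (intro dvd_prodI) auto
    finally show ?thesis .
  qed
  define P where "P = (\<lambda>i j. p i j * (Q div q i j))"
  have PQ: "R z $$ (i, j) = poly (P i j) z / poly Q z" if "i < r" "j < k" "poly Q z \<noteq> 0" for i j z
  proof -
    have "Q = q i j * (Q div q i j)" using dvd that by simp
    then have "poly Q z = poly (q i j) z * poly (Q div q i j) z" by (metis poly_mult)
    then show ?thesis using that pq(2)[of i j z] by (simp add: P_def)
  qed
  define N where "N = degree Q"
  \<comment> \<open>The zero polynomial has degree 0 and is listed apart, since for
    \<open>N = 0\<close> no degree lies below \<open>N\<close>.\<close>
  have degP: "P i j = 0 \<or> degree (P i j) < N" if ij: "i < r" "j < k" for i j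
  proof (cases "p i j = 0")
    case False
    have "((\<lambda>z. poly (p i j) z / poly (q i j) z) \<longlongrightarrow> 0) at_infinity"
      using sp ij pq(2) by (simp add: strictly_proper_def)
    then have "degree (p i j) < degree (q i j)" using False pq(1) ij by (intro poly_degree_less) auto
    moreover have eq: "Q = q i j * (Q div q i j)" using dvd ij by simp
    moreover have "Q div q i j \<noteq> 0" using eq Q0 by force
    ultimately show ?thesis
      using False pq(1)[OF ij] unfolding N_def P_def by (metis degree_mult_eq nat_add_left_cancel_less add.commute)
  qed (simp add: P_def)
  have polyP: "poly (P i j) z = (\<Sum>l<N. coeff (P i j) l * z ^ l)" if ij: "i < r" "j < k" for i j z
  proof -
    have "poly (P i j) z = (\<Sum>l\<le>degree (P i j). coeff (P i j) l * z ^ l)" by (rule poly_altdef)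
    also have "\<dots> = (\<Sum>l<N. coeff (P i j) l * z ^ l)"
    proof (cases "P i j = 0")
      case False
      then show ?thesis using degP[OF ij] by (intro sum.mono_neutral_left) (auto simp: coeff_eq_0)
    qed auto
    finally show ?thesis .
  qed
  define lc where "lc = lead_coeff Q"
  have lc: "lc \<noteq> 0" using Q0 by (simp add: lc_def)
  have polyQ: "poly Q z = lc * z ^ N + (\<Sum>l<N. coeff Q l * z ^ l)" for z
    by (simp add: poly_altdef N_def lc_def lessThan_Suc_atMost[symmetric])
  define n where "n = N * k"
  define a where "a = trunc n n (\<lambda>s t. if s div k + 1 < N then (if t = s + k then 1 else 0)
     else (if t mod k = s mod k then - coeff Q (t div k) / lc else 0))"
  define b where "b = trunc n k (\<lambda>s j. if s div k + 1 = N \<and> s mod k = j then 1 else 0)"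
  define c where "c = trunc r n (\<lambda>i s. coeff (P i (s mod k)) (s div k) / lc)"
  \<comment> \<open>The columns of \<open>V z\<close> hold the monomials. The identity
    \<open>(z - a) V z = (Q(z) / lc) b\<close> shown below says that \<open>(z - a)^-1 b\<close> is
    \<open>V z\<close> times \<open>lc / Q(z)\<close>, and \<open>c\<close> reads the numerators off
    it.\<close>
  define V where "V = (\<lambda>z::complex. trunc n k (\<lambda>s j. if s mod k = j then z ^ (s div k) else 0))"
  have car: "a \<in> carr n n" "b \<in> carr n k" "c \<in> carr r n" "\<And>z. V z \<in> carr n k"
    by (simp_all add: a_def b_def c_def V_def)
  have sdiv: "s div k < N" if "s < n" for s using that k by (simp add: n_def less_mult_imp_div_less)
  have aV: "(z *\<^sub>c idm n - a) * V z = (poly Q z / lc) *\<^sub>c b" for z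
  proof (rule carr_eqI[of _ n k])
    fix s j assume sj: "s < n" "j < k"
    have aVs: "ent (a * V z) s j = (\<Sum>t<n. ent a s t * ent (V z) t j)"
      by (rule ent_times_carr) (use car in auto)
    have "ent (a * V z) s j = z * ent (V z) s j - poly Q z / lc * ent b s j"
    proof (cases "s div k + 1 < N")
      case True
      have "(s + k) div k < N" using True k by simp
      then have sk: "s + k < n" using k by (metis n_def div_less_iff_less_mult)
      have "ent (a * V z) s j = (\<Sum>t<n. if t = s + k then ent (V z) (s + k) j else 0)"
        unfolding aVs using sj True by (intro sum.cong) (auto simp: a_def trunc.rep_eq)
      also have "\<dots> = ent (V z) (s + k) j" using sk by simp
      also have "\<dots> = z * ent (V z) s j - poly Q z / lc * ent b s j"
        using sj sk True k by (simp add: V_def b_def trunc.rep_eq)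
      finally show ?thesis .
    next
      case False
      then have sN: "s div k + 1 = N" using sdiv[OF sj(1)] by simp
      have "ent (a * V z) s j = (\<Sum>t<N * k. if t mod k = j then (if j = s mod k then - coeff Q (t div k) / lc * z ^ (t div k) else 0) else 0)"
        unfolding aVs using sj False by (intro sum.cong) (auto simp: a_def V_def trunc.rep_eq n_def)
      also have "\<dots> = (\<Sum>l<N. if j = s mod k then - coeff Q l / lc * z ^ l else 0)"
        by (rule sum_blocks[OF sj(2)])
      also have "\<dots> = (if j = s mod k then z ^ N - poly Q z / lc else 0)"
      proof -
        have "(\<Sum>l<N. - coeff Q l / lc * z ^ l) = - (\<Sum>l<N. coeff Q l * z ^ l) / lc"
          by (simp add: sum_negf sum_divide_distrib)
        also have "\<dots> = z ^ N - poly Q z / lc" unfolding polyQ using lc by (simp add: field_simps)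
        finally show ?thesis by simp
      qed
      also have "\<dots> = z * ent (V z) s j - poly Q z / lc * ent b s j"
        using sj sN by (auto simp: V_def b_def trunc.rep_eq power_Suc[symmetric] simp del: power_Suc)
      finally show ?thesis .
    qed
    then show "ent ((z *\<^sub>c idm n - a) * V z) s j = ent ((poly Q z / lc) *\<^sub>c b) s j"
      using idm_mult[OF car(4)] by (simp add: left_diff_distrib)
  qed (use car in \<open>auto intro: carr_intros\<close>)
  have cV: "ent (c * V z) i j = poly (P i j) z / lc" if ij: "i < r" "j < k" for i j z
  proof -
    have "ent (c * V z) i j = (\<Sum>s<n. ent c i s * ent (V z) s j)"
      by (rule ent_times_carr) (use car in auto)
    also have "\<dots> = (\<Sum>s<N * k. if s mod k = j then coeff (P i j) (s div k) / lc * z ^ (s div k) else 0)"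
      using ij by (intro sum.cong) (auto simp: c_def V_def trunc.rep_eq n_def)
    also have "\<dots> = (\<Sum>l<N. coeff (P i j) l / lc * z ^ l)" by (rule sum_blocks[OF ij(2)])
    also have "\<dots> = poly (P i j) z / lc" unfolding polyP[OF ij] by (simp add: sum_divide_distrib)
    finally show ?thesis .
  qed
  have "emb (R z) = c * G * b" if G: "inv_of n (z *\<^sub>c idm n - a) G" for z G
  proof -
    have VG: "V z = (poly Q z / lc) *\<^sub>c (G * b)"
      using inv_of_cancel(2)[OF G car(4)[of z]] aV by simp
    \<comment> \<open>A zero of \<open>Q\<close> in the resolvent set would give
      \<open>V z = 0\<close>, although its first entry is \<open>z^0 = 1\<close>.\<close>
    have Qz: "poly Q z \<noteq> 0"
    proof
      assume "poly Q z = 0"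
      then have "V z = 0" using VG by simp
      then have "ent (V z) 0 0 = 0" by simp
      moreover have "N > 0"
        using \<open>poly Q z = 0\<close> polyQ[of z] lc by (cases N) auto
      ultimately show False using k by (simp add: V_def trunc.rep_eq n_def)
    qed
    show ?thesis
    proof (rule carr_eqI[of _ r k])
      fix i j assume ij: "i < r" "j < k"
      have "poly (P i j) z / lc = poly Q z / lc * ent (c * G * b) i j"
        using cV[OF ij, of z] lc unfolding VG by (auto simp: mult.assoc)
      then show "ent (emb (R z)) i j = ent (c * G * b) i j"
        using PQ[OF ij Qz] Qz lc ij by (auto simp: ent_emb_carrier[OF Rcar] field_simps)
    qed (use Rcar car inv_ofD[OF G] in \<open>auto intro: carr_intros\<close>)
  qed
  then show ?thesis using car unfolding preal_def by blast
qed

lemma exists_minimal_realization: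
  assumes R: "rational_mat_fun r k R" and "strictly_proper r k R" and "0 < k"
  shows "\<exists>n A B C. minimal_realization r k R n A B C"
proof -
  have Rcar: "R z \<in> carrier_mat r k" for z using R by (simp add: rational_mat_fun_def)
  define S where "S = (\<lambda>n. \<exists>A B C. realization r k R n A B C)"
  have "\<exists>n. S n" using exists_preal[OF assms] preal_realization[of R r k, OF Rcar] unfolding S_def by blast
  then have "S (LEAST n. S n)" by (metis LeastI)
  moreover have "S n \<Longrightarrow> (LEAST n. S n) \<le> n" for n by (rule Least_le)
  ultimately show ?thesis unfolding minimal_realization_def S_def by blast
qed

section \<open>Solvability of the Riccati equation\<close>

text \<open>\<open>ip\<close> conjugates its first argument, the scalar product of vectors its
  second; hence the exchanged order.\<close>

lemma cscalar_prod_ip: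
  assumes M: "M \<in> carrier_mat n n" and w: "w \<in> carrier_vec n"
  shows "(M *\<^sub>v w) \<bullet>c w = ip (vemb n w) (emb M * vemb n w)"
proof -
  have "ip (vemb n w) (emb M * vemb n w) = (\<Sum>i<n. cnj (ent (vemb n w) i 0) * ent (vemb n (M *\<^sub>v w)) i 0)"
    unfolding ip_def vemb_mult[OF M w, symmetric] by (subst ent_times_carr[of _ "Suc 0" n]) auto
  also have "\<dots> = (\<Sum>i<n. (M *\<^sub>v w) $ i * cnj (w $ i))"
    by (intro sum.cong) (auto simp del: index_mult_mat_vec)
  also have "\<dots> = (M *\<^sub>v w) \<bullet>c w"
    using M w by (simp add: scalar_prod_def lessThan_atLeast0)
  finally show ?thesis ..
qed

lemma mat_pos_def_iff:
  assumes M: "M \<in> carrier_mat n n" shows "mat_pos_def n M \<longleftrightarrow> pd n (emb M)"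
proof -
  have adj: "mat_adjoint M = M \<longleftrightarrow> adj (emb M) = emb M"
    using M emb_inj[of "mat_adjoint M" n n M] by (auto simp flip: emb_adjoint)
  have "(\<forall>w\<in>carrier_vec n. w \<noteq> 0\<^sub>v n \<longrightarrow> 0 < Re ((M *\<^sub>v w) \<bullet>c w)) \<longleftrightarrow>
      (\<forall>w\<in>colv n. w \<noteq> 0 \<longrightarrow> 0 < Re (ip w (emb M * w)))" (is "?L \<longleftrightarrow> ?R")
  proof
    assume L: ?L
    show ?R
    proof safe
      fix w assume w: "w \<in> colv n" "w \<noteq> 0"
      define v where "v = Matrix.vec n (\<lambda>i. ent w i 0)"
      have v: "v \<in> carrier_vec n" "vemb n v = w" using vemb_surj[OF w(1)] by (auto simp: v_def)
      then have "v \<noteq> 0\<^sub>v n" using w by auto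
      then show "0 < Re (ip w (emb M * w))" using L v cscalar_prod_ip[OF M v(1)] by metis
    qed
  next
    assume R: ?R
    show ?L
    proof (intro ballI impI)
      fix w :: "complex Matrix.vec" assume w: "w \<in> carrier_vec n" "w \<noteq> 0\<^sub>v n"
      then have "vemb n w \<noteq> 0" using vemb_eq_iff[of w n "0\<^sub>v n"] by simp
      then show "0 < Re ((M *\<^sub>v w) \<bullet>c w)" using R cscalar_prod_ip[OF M w(1)] vemb_carr by metis
    qed
  qed
  then show ?thesis using M adj by (simp add: mat_pos_def_def pd_def)
qed

lemma contractive_ip:
  assumes R: "R z \<in> carrier_mat r k" and con: "contractive_at k R z" and g: "g \<in> colv k"
  shows "Re (ip (emb (R z) * g) (emb (R z) * g)) \<le> Re (ip g g)"
proof -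
  let ?M = "1\<^sub>m k - mat_adjoint (R z) * R z"
  have RR: "mat_adjoint (R z) * R z \<in> carrier_mat k k" using mult_carrier_mat[OF mat_adjoint_carrier'[OF R] R] .
  then have M: "?M \<in> carrier_mat k k" by (rule minus_carrier_mat)
  define w where "w = Matrix.vec k (\<lambda>i. ent g i 0)"
  have w: "w \<in> carrier_vec k" "vemb k w = g" using vemb_surj[OF g] by (auto simp: w_def)
  have "0 \<le> Re ((?M *\<^sub>v w) \<bullet>c w)" using con w by (simp add: contractive_at_def mat_pos_semidef_def)
  also have "(?M *\<^sub>v w) \<bullet>c w = ip g (emb ?M * g)" using cscalar_prod_ip[OF M w(1)] w by simp
  also have "emb ?M = idm k - adj (emb (R z)) * emb (R z)"
    using emb_diff[OF one_carrier_mat RR] emb_mult[OF mat_adjoint_carrier'[OF R] R] by simp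
  also have "ip g ((idm k - adj (emb (R z)) * emb (R z)) * g) = ip g g - ip (emb (R z) * g) (emb (R z) * g)"
    using g by (simp add: left_diff_distrib mult.assoc ip_adj)
  finally show ?thesis by simp
qed

text \<open>A contraction has columns of length at most 1, so the entries of \<open>R\<close> are
  bounded by 1 on the real axis, and a pole at \<open>x\<close> would already be noticed along the
  axis.\<close>

lemma contractive_no_pole:
  assumes R: "rational_mat_fun r k R" and con: "\<And>x :: real. contractive_at k R (of_real x)"
  shows "\<not> mat_fun_pole r k R (of_real x)"
  unfolding mat_fun_pole_def
proof safe
  fix i j assume ij: "i < r" "j < k" and pole: "is_pole (\<lambda>w. R w $$ (i, j)) (of_real x)"
  have Rcar: "R z \<in> carrier_mat r k" for z using R by (simp add: rational_mat_fun_def)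
  have e: "unit_pmat j 0 \<in> colv k" by (rule unit_colv[OF ij(2)])
  have bound: "cmod (R (of_real y) $$ (i, j)) \<le> 1" for y
  proof -
    let ?M = "emb (R (of_real y))"
    have ent: "ent (?M * unit_pmat j 0) l 0 = ent ?M l j" for l
      by (rule ent_mult_unit[OF emb_carr[OF Rcar] ij(2)])
    have car: "?M * unit_pmat j 0 \<in> colv r" using carr_mult[OF emb_carr[OF Rcar] e] .
    have "(cmod (ent ?M i j))\<^sup>2 \<le> (\<Sum>l<r. (cmod (ent ?M l j))\<^sup>2)"
      using ij by (intro member_le_sum[of i _ "\<lambda>l. (cmod (ent ?M l j))\<^sup>2"]) auto
    also have "\<dots> = Re (ip (?M * unit_pmat j 0) (?M * unit_pmat j 0))"
      using ip_self[OF car] by (simp add: ent)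
    also have "\<dots> \<le> Re (ip (unit_pmat j 0) (unit_pmat j 0))" by (rule contractive_ip[OF Rcar con e])
    also have "\<dots> = (\<Sum>l<k. if l = j then 1 else 0)"
      unfolding ip_self[OF e] Re_complex_of_real by (intro sum.cong) (auto simp: unit_pmat.rep_eq)
    also have "\<dots> = 1" using ij by simp
    finally have "cmod (ent ?M i j) \<le> 1" by (simp add: power_le_one_iff abs_square_le_1)
    then show ?thesis using ij by (simp add: ent_emb_carrier[OF Rcar])
  qed
  have "filtermap complex_of_real (at x) \<noteq> bot" by (simp add: filtermap_bot_iff)
  moreover have "filtermap complex_of_real (at x) \<le> at (of_real x)"
  proof -
    have "filterlim complex_of_real (at (of_real x)) (at x)"
      by (rule filterlim_atI) (auto intro: tendsto_intros simp: eventually_at_filter)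
    then show ?thesis by (simp add: filterlim_def)
  qed
  moreover have "\<forall>\<^sub>F z in filtermap complex_of_real (at x). cmod (R z $$ (i, j)) \<le> 1"
    using bound by (simp add: eventually_filtermap)
  ultimately have "\<not> is_pole (\<lambda>w. R w $$ (i, j)) (of_real x)" by (rule bounded_no_pole)
  then show False using pole by simp
qed

lemma emb_riccati:
  assumes "A \<in> carrier_mat n n" "B \<in> carrier_mat n k" "C \<in> carrier_mat r n" "X \<in> carrier_mat n n"
  shows "emb (riccati A B C X) = emb X * adj (emb C) * emb C * emb X
      - \<i> *\<^sub>c (emb A * emb X - emb X * adj (emb A)) + emb B * adj (emb B)"
    "riccati A B C X \<in> carrier_mat n n"
proof -
  note adj_car = assms(1-3)[THEN mat_adjoint_carrier']
  note m = mult_carrier_mat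
  have 1: "X * mat_adjoint C \<in> carrier_mat n r" "X * mat_adjoint C * C \<in> carrier_mat n n"
    "X * mat_adjoint C * C * X \<in> carrier_mat n n" "A * X \<in> carrier_mat n n"
    "X * mat_adjoint A \<in> carrier_mat n n" "B * mat_adjoint B \<in> carrier_mat n n"
    using assms adj_car by (blast intro: m)+
  then have 2: "\<i> \<cdot>\<^sub>m (A * X - X * mat_adjoint A) \<in> carrier_mat n n" by (intro smult_carrier_mat minus_carrier_mat)
  then have 3: "X * mat_adjoint C * C * X - \<i> \<cdot>\<^sub>m (A * X - X * mat_adjoint A) \<in> carrier_mat n n"
    by (rule minus_carrier_mat)
  show "riccati A B C X \<in> carrier_mat n n" unfolding riccati_def using 1(6) by (rule add_carrier_mat)
  show "emb (riccati A B C X) = emb X * adj (emb C) * emb C * emb X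
      - \<i> *\<^sub>c (emb A * emb X - emb X * adj (emb A)) + emb B * adj (emb B)"
    unfolding riccati_def emb_add[OF 3 1(6)] emb_diff[OF 1(3) 2] emb_smult emb_diff[OF 1(4) 1(5)]
      emb_mult[OF 1(2) assms(4)] emb_mult[OF 1(1) assms(3)] emb_mult[OF assms(4) adj_car(3)]
      emb_mult[OF assms(1) assms(4)] emb_mult[OF assms(4) adj_car(1)] emb_mult[OF assms(2) adj_car(2)] emb_adjoint ..
qed

text \<open>All eigenvalues of the state matrix are poles. The open upper half-plane has none by
  hypothesis and the real axis none by contractivity, so the state matrix is stable in the sense of
  the bounded real lemma. On the real axis the state equation gives \<open>c u = R(x) g\<close>,
  which is how contractivity enters.\<close>

lemma exists_riccati_solution:
  assumes rat: "rational_mat_fun m2 m1 R" and con: "\<And>x :: real. contractive_at m1 R (of_real x)"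
    and np: "\<And>z. Im z > 0 \<Longrightarrow> \<not> mat_fun_pole m2 m1 R z" and min: "minimal_realization m2 m1 R n A B C"
  shows "\<exists>X. mat_pos_def n X \<and> riccati A B C X = 0\<^sub>m n n"
proof -
  interpret minimal m1 m2 n R A B C using rat min by unfold_locales
  have ev: "Im z < 0" if w: "w \<in> colv n" "w \<noteq> 0" "a * w = z *\<^sub>c w" for z w
  proof (rule ccontr)
    assume "\<not> Im z < 0"
    then consider "Im z > 0" | "z = of_real (Re z)" by (auto simp: complex_eq_iff) linarith
    then have "\<not> mat_fun_pole m2 m1 R z"
      using np contractive_no_pole[OF rat con, of "Re z"] by cases auto
    then show False using eigenvalue_pole w by blast
  qed
  have "\<exists>X. pd n X \<and> X * adj c * c * X + b * adj b = \<i> *\<^sub>c (a * X - X * adj a)"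
  proof (rule riccati_exists[OF re'(1,2,3) ev])
    fix x :: real and u g
    assume g: "g \<in> colv m1" and u: "u \<in> colv n" "complex_of_real x *\<^sub>c u - a * u = b * g"
    obtain G where G: "inv_of n (complex_of_real x *\<^sub>c idm n - a) G"
      using eigen_or_inv[OF re'(1), of "complex_of_real x"] ev by fastforce
    have "(complex_of_real x *\<^sub>c idm n - a) * u = b * g" using u by (simp add: left_diff_distrib)
    then have "u = G * (b * g)" using inv_of_cancel(2)[OF G u(1)] by simp
    then have "c * u = emb (R (complex_of_real x)) * g" using re'(4)[OF G] by (simp add: mult.assoc)
    then show "Re (ip (c * u) (c * u)) \<le> Re (ip g g)" using contractive_ip[OF Rcar con g] by simp
  qed (use observable controllable in blast)+
  then obtain X where X: "pd n X" "X * adj c * c * X + b * adj b = \<i> *\<^sub>c (a * X - X * adj a)" by blast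
  let ?X = "unemb n n X"
  have Xc: "X \<in> carr n n" "emb ?X = X" using pdD(1)[OF X(1)] by auto
  have "emb (riccati A B C ?X) = 0"
    unfolding emb_riccati(1)[OF matcar unemb_carrier(1)] Xc(2) using X(2) by (simp add: algebra_simps)
  then have "riccati A B C ?X = 0\<^sub>m n n"
    using emb_riccati(2)[OF matcar unemb_carrier(1)] by (intro emb_inj[of _ n n]) auto
  moreover have "mat_pos_def n ?X" using mat_pos_def_iff[of ?X n] X(1) Xc by simp
  ultimately show ?thesis by blast
qed

section \<open>The matrix exponential\<close>

lemma papply_mult: "papply A k X * Y = papply A k (X * Y)"
  by (induction k) (simp_all add: mult.assoc)

lemma papply_cscale: "papply (s *\<^sub>c A) k X = s ^ k *\<^sub>c papply A k X"
  by (induction k) (simp_all add: mult.commute)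

lemma papply_carr': "A \<in> carr n n \<Longrightarrow> X \<in> carr n m \<Longrightarrow> papply A k X \<in> carr n m"
  by (induction k) (auto intro: carr_mult)

lemma norm_papply: "norm (papply A k X) \<le> norm A ^ k * norm X"
proof (induction k)
  case (Suc k)
  have "norm (papply A (Suc k) X) \<le> norm A * norm (papply A k X)" by (simp add: norm_mult_ineq)
  also have "\<dots> \<le> norm A * (norm A ^ k * norm X)" by (intro mult_left_mono Suc) auto
  finally show ?case by (simp add: mult.assoc)
qed simp

lemma papply_commute:
  assumes "A * B = B * A" shows "B * papply A k X = papply A k (B * X)"
proof (induction k)
  case (Suc k)
  have "B * papply A (Suc k) X = A * (B * papply A k X)" using assms by (simp add: mult.assoc[symmetric])
  then show ?case by (simp add: Suc)
qed simp

text \<open>The exponential within the corner of size \<open>n\<close>: the series starts with the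
  local unit \<open>idm n\<close>, so the size has to be an argument.\<close>

definition pexp :: "nat \<Rightarrow> pmat \<Rightarrow> pmat" where
  "pexp n A = trunc n n (\<lambda>i j. \<Sum>k. ent (papply A k (idm n)) i j / fact k)"

lemma pexp_carr [simp]: "pexp n A \<in> carr n n"
  by (simp add: pexp_def)

lemma pexp_idm [simp]: "pexp n A * idm n = pexp n A" "idm n * pexp n A = pexp n A"
  by (rule mult_idm[OF pexp_carr] idm_mult[OF pexp_carr])+

lemma summable_pexp: "summable (\<lambda>k. cmod (ent (papply A k X) i j / fact k))"
proof (rule summable_comparison_test')
  have "summable (\<lambda>k. inverse (fact k) * norm A ^ k * norm X)"
    by (intro summable_mult2 summable_exp)
  then show "summable (\<lambda>k. norm A ^ k * norm X / fact k)"
    by (simp add: divide_inverse mult_ac)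
  fix k
  have "cmod (ent (papply A k X) i j) \<le> norm A ^ k * norm X"
    using norm_ent_le norm_papply order.trans by blast
  then have "cmod (ent (papply A k X) i j) / fact k \<le> norm A ^ k * norm X / fact k"
    by (rule divide_right_mono) simp
  then show "norm (cmod (ent (papply A k X) i j / fact k)) \<le> norm A ^ k * norm X / fact k"
    by (simp add: norm_divide)
qed

text \<open>The right factor \<open>X\<close> is kept general so that the same expansion gives the
  entries of \<open>exp A\<close>, with \<open>X = idm n\<close>, and of \<open>exp A\<close> times
  \<open>A\<close>, as differentiation requires.\<close>

lemma pexp_sums:
  assumes A: "A \<in> carr n n" and X: "X \<in> carr n m"
  shows "(\<lambda>k. ent (papply A k X) i j / fact k) sums ent (pexp n A * X) i j"
proof (cases "i < n")
  case True
  have s: "(\<lambda>k. ent (papply A k (idm n)) i l / fact k) sums ent (pexp n A) i l" if "l < n" for l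
    using summable_sums[OF summable_norm_cancel[OF summable_pexp]] True that by (simp add: pexp_def trunc.rep_eq)
  have "(\<lambda>k. \<Sum>l<n. ent (papply A k (idm n)) i l / fact k * ent X l j) sums (\<Sum>l<n. ent (pexp n A) i l * ent X l j)"
    by (intro sums_sum sums_mult2 s) auto
  moreover have "(\<Sum>l<n. ent (papply A k (idm n)) i l / fact k * ent X l j) = ent (papply A k X) i j / fact k" for k
  proof -
    have "papply A k X = papply A k (idm n) * X" using X by (simp add: papply_mult)
    also have "ent \<dots> i j = (\<Sum>l<n. ent (papply A k (idm n)) i l * ent X l j)"
      by (rule ent_times_carr) (use X in auto)
    finally show ?thesis by (simp add: sum_divide_distrib)
  qed
  moreover have "(\<Sum>l<n. ent (pexp n A) i l * ent X l j) = ent (pexp n A * X) i j"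
    by (rule ent_times_carr[symmetric]) (use X in auto)
  ultimately show ?thesis by simp
next
  case False
  have "papply A k X \<in> carr n m" for k using A X by (rule papply_carr')
  then have "ent (papply A k X) i j = 0" for k using False by (intro carrD[of _ n m]) auto
  moreover have "pexp n A * X \<in> carr n m" by (blast intro: carr_intros pexp_carr X)
  ultimately show ?thesis using False by (simp add: carrD)
qed

lemma pexp_commute:
  assumes A: "A \<in> carr n n" and B: "B \<in> carr n n" and AB: "A * B = B * A"
  shows "B * pexp n A = pexp n A * B"
proof (rule carr_eqI[of _ n n])
  fix i j assume "i < n" "j < n"
  have "(\<lambda>k. \<Sum>l<n. ent B i l * (ent (papply A k (idm n)) l j / fact k)) sums (\<Sum>l<n. ent B i l * ent (pexp n A * idm n) l j)"
    by (intro sums_sum sums_mult pexp_sums[OF A carr_simps(8)])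
  moreover have "(\<Sum>l<n. ent B i l * (ent (papply A k (idm n)) l j / fact k)) = ent (papply A k B) i j / fact k" for k
  proof -
    have "papply A k B = B * papply A k (idm n)" using papply_commute[OF AB, of k "idm n"] B by simp
    also have "ent \<dots> i j = (\<Sum>l<n. ent B i l * ent (papply A k (idm n)) l j)"
      by (rule ent_times_carr) (use B in auto)
    finally show ?thesis by (simp add: sum_divide_distrib)
  qed
  moreover have "(\<Sum>l<n. ent B i l * ent (pexp n A * idm n) l j) = ent (B * pexp n A) i j"
    by (subst ent_times_carr[of B n n]) (use B in auto)
  ultimately have "(\<lambda>k. ent (papply A k B) i j / fact k) sums ent (B * pexp n A) i j" by simp
  then show "ent (B * pexp n A) i j = ent (pexp n A * B) i j"
    using pexp_sums[OF A B] sums_unique2 by blast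
qed (blast intro: carr_intros pexp_carr B)+

lemma pexp_zero: "pexp n 0 = idm n"
proof (rule carr_eqI[of _ n n])
  fix i j
  have "(\<lambda>k. ent (papply 0 k (idm n)) i j / fact k) sums ent (pexp n 0 * idm n) i j"
    by (rule pexp_sums[of _ _ _ n]) auto
  moreover have "(\<lambda>k. ent (papply 0 k (idm n)) i j / fact k) = (\<lambda>k. if k = 0 then ent (idm n) i j else 0)"
  proof
    fix k show "ent (papply 0 k (idm n)) i j / fact k = (if k = 0 then ent (idm n) i j else 0)"
      by (cases k) auto
  qed
  ultimately have "(\<lambda>k. if k = 0 then ent (idm n) i j else 0) sums ent (pexp n 0) i j"
    by simp
  then show "ent (pexp n 0) i j = ent (idm n) i j"
    using sums_single[of 0 "\<lambda>_. ent (idm n) i j"] sums_unique2 by blast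
qed auto

lemma adj_pexp:
  assumes A: "A \<in> carr n n" shows "adj (pexp n A) = pexp n (adj A)"
proof (rule carr_eqI[of _ n n])
  fix i j
  have pow: "papply (adj A) k (idm n) = adj (papply A k (idm n))" for k
  proof (induction k)
    case (Suc k)
    have "papply (adj A) (Suc k) (idm n) = adj (papply A k (idm n) * A)" by (simp add: Suc)
    also have "papply A k (idm n) * A = A * papply A k (idm n)"
      using papply_commute[of A A k "idm n"] A by (simp add: papply_mult)
    finally show ?case by simp
  qed simp
  have "(\<lambda>k. cnj (ent (papply A k (idm n)) j i / fact k)) sums cnj (ent (pexp n A * idm n) j i)"
    by (simp only: sums_cnj) (rule pexp_sums[OF A carr_simps(8)])
  moreover have "(\<lambda>k. ent (papply (adj A) k (idm n)) i j / fact k) sums ent (pexp n (adj A) * idm n) i j"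
    by (rule pexp_sums[of _ _ _ n]) (use A in auto)
  ultimately show "ent (adj (pexp n A)) i j = ent (pexp n (adj A)) i j"
    using sums_unique2 by (simp add: pow) blast
qed auto

text \<open>Each entry is a power series in a complex parameter \<open>s\<close>, differentiated
  term by term, and the chain rule is applied along \<open>s = c x\<close>.\<close>

lemma pexp_has_vector_derivative:
  assumes A: "A \<in> carr n n"
  shows "((\<lambda>x. pexp n ((c * of_real x) *\<^sub>c A)) has_vector_derivative
      c *\<^sub>c (A * pexp n ((c * of_real x) *\<^sub>c A))) (at x within S)"
proof (rule has_vector_derivative_pmat[of _ n n])
  fix i j assume ij: "i < n" "j < n"
  define q where "q = (\<lambda>k. ent (papply A k (idm n)) i j / fact k)"
  have sA: "s *\<^sub>c A \<in> carr n n" for s using A by simp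
  have qs: "(\<lambda>k. q k * s ^ k) sums ent (pexp n (s *\<^sub>c A)) i j" for s
    using pexp_sums[OF sA[of s], of "idm n" n i j] by (simp add: papply_cscale q_def mult.commute)
  let ?f = "\<lambda>s. ent (pexp n (s *\<^sub>c A)) i j"
  have f_eq: "?f = (\<lambda>s. \<Sum>k. q k * s ^ k)" using qs sums_unique by fast
  have "(?f has_field_derivative (\<Sum>k. diffs q k * s ^ k)) (at s)" for s
    unfolding f_eq using qs by (intro termdiffs_strong_converges_everywhere) (auto simp: sums_iff)
  moreover have "(\<Sum>k. diffs q k * s ^ k) = ent (A * pexp n (s *\<^sub>c A)) i j" for s
  proof -
    have "(\<lambda>k. ent (papply (s *\<^sub>c A) k A) i j / fact k) sums ent (pexp n (s *\<^sub>c A) * A) i j"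
      by (rule pexp_sums[OF sA A])
    moreover have "pexp n (s *\<^sub>c A) * A = A * pexp n (s *\<^sub>c A)"
      by (rule pexp_commute[OF sA A, symmetric]) simp
    moreover have "ent (papply (s *\<^sub>c A) k A) i j / fact k = diffs q k * s ^ k" for k
    proof -
      have "papply A k A = papply A (Suc k) (idm n)" using A by (simp add: funpow_swap1)
      then have "ent (papply (s *\<^sub>c A) k A) i j / fact k = s ^ k * (ent (papply A (Suc k) (idm n)) i j / fact k)"
        by (simp add: papply_cscale)
      also have "\<dots> = diffs q k * s ^ k"
        by (simp add: diffs_def q_def divide_simps mult_ac del: funpow.simps of_nat_Suc)
      finally show ?thesis .
    qed
    ultimately show ?thesis by (simp add: sums_iff)
  qed
  ultimately have d: "(?f has_field_derivative ent (A * pexp n (s *\<^sub>c A)) i j) (at s)" for s by simp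
  have "((\<lambda>x. c * complex_of_real x) has_vector_derivative c * 1) (at x)"
    by (intro has_vector_derivative_mult_right has_vector_derivative_of_real DERIV_ident)
       (auto intro!: derivative_eq_intros)
  from field_vector_diff_chain_at[OF this d]
  have "((\<lambda>x. ent (pexp n ((c * of_real x) *\<^sub>c A)) i j) has_vector_derivative
      ent (c *\<^sub>c (A * pexp n ((c * of_real x) *\<^sub>c A))) i j) (at x)" by (simp add: o_def)
  then show "((\<lambda>x. ent (pexp n ((c * of_real x) *\<^sub>c A)) i j) has_vector_derivative
      ent (c *\<^sub>c (A * pexp n ((c * of_real x) *\<^sub>c A))) i j) (at x within S)"
    by (rule has_vector_derivative_at_within)
qed (blast intro: carr_intros pexp_carr A)+

lemma emb_mat_exp:
  assumes M: "M \<in> carrier_mat n n" shows "emb (mat_exp M) = pexp n (emb M)" "mat_exp M \<in> carrier_mat n n"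
proof -
  show car: "mat_exp M \<in> carrier_mat n n" using M by (auto simp: mat_exp_def)
  have Mk: "M ^\<^sub>m k \<in> carrier_mat n n" for k using M by simp
  have pow: "emb (M ^\<^sub>m k) * X = papply (emb M) k X" if "X \<in> carr n m" for k X m
    using that
  proof (induction k arbitrary: X)
    case 0
    then show ?case using M by simp
  next
    case (Suc k)
    have "emb (M ^\<^sub>m Suc k) * X = emb (M ^\<^sub>m k) * (emb M * X)"
      using emb_mult[OF Mk M] by (simp add: mult.assoc)
    also have "\<dots> = papply (emb M) k (emb M * X)"
      using carr_mult[OF emb_carr[OF M] Suc.prems] by (rule Suc.IH)
    finally show ?case by (simp add: funpow_swap1)
  qed
  show "emb (mat_exp M) = pexp n (emb M)"
  proof (rule carr_eqI[of _ n n])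
    fix i j assume ij: "i < n" "j < n"
    have "ent (emb (mat_exp M)) i j = (\<Sum>k. (M ^\<^sub>m k) $$ (i, j) / fact k)"
      using ij M by (simp add: ent_emb_carrier[OF car]) (simp add: mat_exp_def)
    also have "\<dots> = (\<Sum>k. ent (papply (emb M) k (idm n)) i j / fact k)"
    proof -
      have "(M ^\<^sub>m k) $$ (i, j) = ent (papply (emb M) k (idm n)) i j" for k
        using pow[of "idm n" n k] mult_idm[OF emb_carr[OF Mk]] ent_emb_carrier[OF Mk ij] carr_simps(8) by metis
      then show ?thesis by simp
    qed
    also have "\<dots> = ent (pexp n (emb M)) i j" using ij by (simp add: pexp_def trunc.rep_eq)
    finally show "ent (emb (mat_exp M)) i j = ent (pexp n (emb M)) i j" .
  qed (use car in auto)
qed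

section \<open>Calculus on the half-line\<close>

lemma at_within_atLeast: assumes "(0::real) \<le> x" "x < b" shows "at x within {0..b} = at x within {0..}"
  using assms by (intro at_within_nhd[of _ "{..<b}"]) auto

lemma has_vector_derivative_imp_continuous_on:
  "(\<And>x. 0 \<le> x \<Longrightarrow> (f has_vector_derivative f' x) (at x within {0..})) \<Longrightarrow> continuous_on {0..} f"
  by (auto simp: continuous_on_eq_continuous_within intro: has_vector_derivative_continuous)

lemma nonneg_deriv_mono:
  fixes h :: "real \<Rightarrow> real"
  assumes d: "\<And>x. 0 \<le> x \<Longrightarrow> (h has_vector_derivative h' x) (at x within {0..})"
    and nonneg: "\<And>x. 0 \<le> x \<Longrightarrow> 0 \<le> h' x" and xy: "0 \<le> x" "x \<le> y"
  shows "h x \<le> h y"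
proof (rule DERIV_nonneg_imp_increasing_open[OF xy(2)])
  fix t assume t: "x < t" "t < y"
  then have "(h has_vector_derivative h' t) (at t within {0<..})"
    using d[of t] xy by (auto intro: has_vector_derivative_within_subset)
  then have "(h has_vector_derivative h' t) (at t)" using t xy at_within_open[of t "{0<..}"] by simp
  then show "\<exists>z. DERIV h t :> z \<and> 0 \<le> z"
    using nonneg[of t] t xy by (auto simp: has_real_derivative_iff_has_vector_derivative)
next
  have "continuous_on {0..} h"
    by (rule has_vector_derivative_imp_continuous_on[OF d])
  then show "continuous_on {x..y} h" using xy by (auto intro: continuous_on_subset)
qed

lemma zero_deriv_const:
  fixes h :: "real \<Rightarrow> 'a :: real_normed_vector"
  assumes d: "\<And>x. 0 \<le> x \<Longrightarrow> (h has_vector_derivative 0) (at x within {0..})" and x: "0 \<le> x"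
  shows "h x = h 0"
proof -
  obtain c where "\<And>x. x \<in> {0..} \<Longrightarrow> h x = c"
    using has_vector_derivative_zero_constant[of "{0..}" h] d by auto
  then show ?thesis using x by simp
qed

lemma decreasing_convergent:
  fixes h :: "real \<Rightarrow> real"
  assumes dec: "\<And>x y. 0 \<le> x \<Longrightarrow> x \<le> y \<Longrightarrow> h y \<le> h x" and lb: "\<And>x. 0 \<le> x \<Longrightarrow> K \<le> h x"
  shows "\<exists>l. (h \<longlongrightarrow> l) at_top"
proof -
  define l where "l = Inf (h ` {0..})"
  have bdd: "bdd_below (h ` {0..})" using lb by (auto intro!: bdd_belowI[of _ K])
  have "(h \<longlongrightarrow> l) at_top"
  proof (rule order_tendstoI)
    fix a assume "a < l"
    then have "a < h x" if "0 \<le> x" for x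
      using cInf_lower[OF _ bdd, of "h x"] that by (force simp: l_def)
    then show "\<forall>\<^sub>F x in at_top. a < h x" by (intro eventually_mono[OF eventually_ge_at_top[of 0]])
  next
    fix a assume "l < a"
    then obtain x0 where x0: "0 \<le> x0" "h x0 < a" using cInf_lessD[of "h ` {0..}" a] by (auto simp: l_def)
    show "\<forall>\<^sub>F x in at_top. h x < a"
      using eventually_ge_at_top[of x0] by eventually_elim (use dec x0 in \<open>force\<close>)
  qed
  then show ?thesis ..
qed

text \<open>Monotone convergence: the truncations of \<open>F\<close> to \<open>[0, k]\<close>
  increase, and their integrals \<open>G k - G 0\<close> are bounded because \<open>G\<close>
  converges.\<close>

lemma integrable_of_antiderivative:
  fixes F G :: "real \<Rightarrow> real"
  assumes d: "\<And>x. 0 \<le> x \<Longrightarrow> (G has_vector_derivative F x) (at x within {0..})"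
    and F: "\<And>x. 0 \<le> x \<Longrightarrow> 0 \<le> F x" and lim: "(G \<longlongrightarrow> l) at_top"
  shows "F integrable_on {0..}"
proof -
  define f where "f = (\<lambda>k x. if x \<le> real k then F x else 0)"
  have hi: "(F has_integral G (real k) - G 0) {0..real k}" for k
    by (rule fundamental_theorem_of_calculus) (auto intro!: has_vector_derivative_within_subset[OF d])
  have fi: "(f k has_integral G (real k) - G 0) {0..}" for k
  proof -
    have "((\<lambda>x. if x \<in> {0..real k} then F x else 0) has_integral G (real k) - G 0) {0..}"
      using hi by (subst has_integral_restrict) auto
    then show ?thesis by (rule has_integral_eq[rotated]) (auto simp: f_def)
  qed
  have "(\<lambda>k. G (real k) - G 0) \<longlonglongrightarrow> l - G 0"
    by (intro tendsto_intros filterlim_compose[OF lim filterlim_real_sequentially])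
  then have "bounded (range (\<lambda>k. integral {0..} (f k)))"
    using integral_unique[OF fi] convergent_imp_bounded by auto
  then show ?thesis
  proof (rule conjunct1[OF monotone_convergence_increasing[of f], rotated -1])
    fix x :: real assume x: "x \<in> {0..}"
    have "\<forall>\<^sub>F k in sequentially. f k x = F x"
      using eventually_ge_at_top[of "nat \<lceil>x\<rceil>"] by eventually_elim (auto simp: f_def)
    then show "(\<lambda>k. f k x) \<longlonglongrightarrow> F x" by (rule tendsto_eventually)
  qed (use fi F in \<open>auto simp: f_def integrable_on_def\<close>)
qed

lemma continuous_bound_set_integrable:
  fixes f :: "real \<Rightarrow> 'a :: euclidean_space"
  assumes "continuous_on {0..} f" "g integrable_on {0..}" "\<And>x. 0 \<le> x \<Longrightarrow> norm (f x) \<le> g x"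
  shows "set_integrable lebesgue {0..} f"
  using assms by (intro measurable_bounded_by_integrable_imp_absolutely_integrable[of _ _ g]
      continuous_imp_measurable_on_sets_lebesgue) auto

text \<open>The derivative bound makes \<open>F x exp (c x)\<close> increasing, so \<open>F x\<close> is controlled by the
  increment of \<open>G\<close> over \<open>[x, x + 1]\<close>.\<close>
lemma derivative_tendsto_0:
  fixes F G :: "real \<Rightarrow> real"
  assumes G: "\<And>x. 0 \<le> x \<Longrightarrow> (G has_vector_derivative F x) (at x within {0..})"
    and F: "\<And>x. 0 \<le> x \<Longrightarrow> (F has_vector_derivative F' x) (at x within {0..})"
    and nonneg: "\<And>x. 0 \<le> x \<Longrightarrow> 0 \<le> F x"
    and lb: "\<And>x. 0 \<le> x \<Longrightarrow> - c * F x \<le> F' x" and c: "0 \<le> c" and lim: "(G \<longlongrightarrow> l) at_top"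
  shows "(F \<longlongrightarrow> 0) at_top"
proof -
  have le: "F x * exp (- c) \<le> G (x + 1) - G x" if x: "0 \<le> x" for x
  proof -
    have step: "F x * exp (- c) \<le> F t" if t: "x \<le> t" "t \<le> x + 1" for t
    proof -
      have "F x * exp (c * x) \<le> F t * exp (c * t)"
      proof (rule nonneg_deriv_mono[of "\<lambda>x. F x * exp (c * x)" "\<lambda>x. F x * (c * exp (c * x)) + F' x * exp (c * x)"])
        fix y :: real assume y: "0 \<le> y"
        have "((\<lambda>x. exp (c * x)) has_vector_derivative c * exp (c * y)) (at y within {0..})"
          unfolding has_real_derivative_iff_has_vector_derivative[symmetric]
          by (auto intro!: derivative_eq_intros)
        then show "((\<lambda>x. F x * exp (c * x)) has_vector_derivative F y * (c * exp (c * y)) + F' y * exp (c * y)) (at y within {0..})"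
          by (intro has_vector_derivative_mult F y)
        have "0 \<le> (F' y + c * F y) * exp (c * y)" using lb[OF y] by (intro mult_nonneg_nonneg) auto
        then show "0 \<le> F y * (c * exp (c * y)) + F' y * exp (c * y)" by (simp add: algebra_simps)
      qed (use x t in auto)
      then have "F x * exp (c * x) * exp (- c * t) \<le> F t * exp (c * t) * exp (- c * t)"
        by (rule mult_right_mono) simp
      then have "F x * exp (c * x - c * t) \<le> F t" by (simp add: mult.assoc exp_add[symmetric])
      moreover have "exp (- c) \<le> exp (c * x - c * t)"
        using mult_left_mono[of "t - x" 1 c] t c by (simp add: algebra_simps)
      then have "F x * exp (- c) \<le> F x * exp (c * x - c * t)"
        using nonneg[OF x] by (rule mult_left_mono)
      ultimately show ?thesis by linarith
    qed
    have A: "(F has_integral G (x + 1) - G x) {x..x + 1}"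
      by (rule fundamental_theorem_of_calculus) (use x in \<open>auto intro!: has_vector_derivative_within_subset[OF G]\<close>)
    have B: "((\<lambda>_. F x * exp (- c)) has_integral F x * exp (- c)) {x..x + 1}"
      using has_integral_const_real[of "F x * exp (- c)" x "x + 1"] by simp
    show ?thesis by (rule has_integral_le[OF B A]) (use step in auto)
  qed
  have "filterlim (\<lambda>x::real. x + 1) at_top at_top" by real_asymp
  then have "((\<lambda>x. G (x + 1) - G x) \<longlongrightarrow> l - l) at_top"
    by (intro tendsto_diff lim filterlim_compose[OF lim])
  then have "((\<lambda>x. exp c * (G (x + 1) - G x)) \<longlongrightarrow> exp c * 0) at_top"
    by (intro tendsto_mult tendsto_const) simp
  then have "((\<lambda>x. exp c * (G (x + 1) - G x)) \<longlongrightarrow> 0) at_top" by simp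
  then show ?thesis
  proof (rule Lim_null_comparison[rotated])
    show "\<forall>\<^sub>F x in at_top. norm (F x) \<le> exp c * (G (x + 1) - G x)"
      using eventually_ge_at_top[of 0]
    proof eventually_elim
      case (elim x)
      have "exp c * (F x * exp (- c)) \<le> exp c * (G (x + 1) - G x)" using le[OF elim] by (intro mult_left_mono) auto
      moreover have "exp c * (F x * exp (- c)) = F x" by (simp add: exp_minus)
      ultimately show ?case using nonneg[OF elim] by simp
    qed
  qed
qed

lemma integral_has_vector_derivative_half_line:
  fixes g :: "real \<Rightarrow> complex"
  assumes "continuous_on {0..} g" "0 \<le> x"
  shows "((\<lambda>x. integral {0..x} g) has_vector_derivative g x) (at x within {0..})"
proof -
  have "((\<lambda>x. integral {0..x} g) has_vector_derivative g x) (at x within {0..x + 1})"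
    using assms by (intro integral_has_vector_derivative) (auto intro: continuous_on_subset)
  then show ?thesis using assms by (simp add: at_within_atLeast)
qed

definition primitive :: "nat \<Rightarrow> nat \<Rightarrow> (real \<Rightarrow> pmat) \<Rightarrow> real \<Rightarrow> pmat" where
  "primitive r c f x = trunc r c (\<lambda>i j. integral {0..x} (\<lambda>t. ent (f t) i j))"

lemma primitive_carr [simp]: "primitive r c f x \<in> carr r c"
  by (simp add: primitive_def)

lemma primitive_0 [simp]: "primitive r c f 0 = 0"
  by (rule pmat_eqI) (simp add: primitive_def trunc.rep_eq)

lemma continuous_on_ent: "continuous_on S f \<Longrightarrow> continuous_on S (\<lambda>x. ent (f x) i j)"
  by (rule bounded_linear.continuous_on[OF bounded_linear_ent])

lemma primitive_has_vector_derivative: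
  assumes f: "continuous_on {0..} f" and car: "\<And>x. 0 \<le> x \<Longrightarrow> f x \<in> carr r c" and x: "0 \<le> x"
  shows "(primitive r c f has_vector_derivative f x) (at x within {0..})"
proof (rule has_vector_derivative_pmat[of _ r c])
  fix i j assume ij: "i < r" "j < c"
  have "((\<lambda>x. integral {0..x} (\<lambda>t. ent (f t) i j)) has_vector_derivative ent (f x) i j) (at x within {0..})"
    using f x by (intro integral_has_vector_derivative_half_line continuous_on_ent)
  then show "((\<lambda>x. ent (primitive r c f x) i j) has_vector_derivative ent (f x) i j) (at x within {0..})"
    using ij by (simp add: primitive_def trunc.rep_eq)
qed (use car x in auto)

section \<open>The GBDT identities\<close>

text \<open>Polarization. The form at \<open>e_i + z e_j\<close> determines the real part of
  \<open>z\<close> times the entry \<open>(i, j)\<close>; \<open>z = 1\<close> and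
  \<open>z = - i\<close> give its real and imaginary part.\<close>

lemma quadratic_form_tendsto:
  assumes P: "\<And>x. P x \<in> carr n n" and herm: "\<forall>\<^sub>F x in F. adj (P x) = P x"
    and q: "\<And>w. w \<in> colv n \<Longrightarrow> \<exists>l. ((\<lambda>x. Re (ip w (P x * w))) \<longlongrightarrow> l) F"
  shows "\<exists>l \<in> carr n n. (P \<longlongrightarrow> l) F"
proof -
  have "\<exists>l. ((\<lambda>x. ent (P x) i j) \<longlongrightarrow> l) F" if ij: "i < n" "j < n" for i j
  proof -
    have e: "unit_pmat i 0 \<in> colv n" "unit_pmat j 0 \<in> colv n" using ij unit_colv by auto
    let ?w = "\<lambda>z. unit_pmat i 0 + z *\<^sub>c unit_pmat j 0"
    obtain l where l: "\<And>z. ((\<lambda>x. Re (ip (?w z) (P x * ?w z))) \<longlongrightarrow> l z) F"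
      using q[of "?w _"] e by (metis carr_simps(2,5))
    obtain li lj where lij: "((\<lambda>x. Re (ent (P x) i i)) \<longlongrightarrow> li) F" "((\<lambda>x. Re (ent (P x) j j)) \<longlongrightarrow> lj) F"
      using q[OF e(1)] q[OF e(2)] ip_unit[OF P] ij by auto
    have eq: "Re (ip (?w z) (P x * ?w z)) = Re (ent (P x) i i) + (cmod z)\<^sup>2 * Re (ent (P x) j j) + 2 * Re (z * ent (P x) i j)"
      if "adj (P x) = P x" for x z
    proof -
      have "ent (P x) j i = cnj (ent (P x) i j)" using that by (metis ent_adj)
      then have "ip (?w z) (P x * ?w z) = ent (P x) i i + cnj z * z * ent (P x) j j + (z * ent (P x) i j + cnj (z * ent (P x) i j))"
        using ij by (simp add: distrib_left ip_unit[OF P] algebra_simps)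
      also have "cnj z * z = of_real ((cmod z)\<^sup>2)" using complex_norm_square[of z] by (simp add: mult.commute)
      finally show ?thesis by simp
    qed
    have lim: "((\<lambda>x. Re (z * ent (P x) i j)) \<longlongrightarrow> (l z - li - (cmod z)\<^sup>2 * lj) / 2) F" for z
    proof -
      have "((\<lambda>x. (Re (ip (?w z) (P x * ?w z)) - Re (ent (P x) i i) - (cmod z)\<^sup>2 * Re (ent (P x) j j)) / 2)
          \<longlongrightarrow> (l z - li - (cmod z)\<^sup>2 * lj) / 2) F"
        by (intro tendsto_intros l lij) auto
      moreover have "\<forall>\<^sub>F x in F. (Re (ip (?w z) (P x * ?w z)) - Re (ent (P x) i i) - (cmod z)\<^sup>2 * Re (ent (P x) j j)) / 2
          = Re (z * ent (P x) i j)"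
        using herm by eventually_elim (subst eq, assumption, simp)
      ultimately show ?thesis by (rule Lim_transform_eventually)
    qed
    have "((\<lambda>x. Complex (Re (1 * ent (P x) i j)) (Re (- \<i> * ent (P x) i j))) \<longlongrightarrow>
        Complex ((l 1 - li - (cmod 1)\<^sup>2 * lj) / 2) ((l (- \<i>) - li - (cmod (- \<i>))\<^sup>2 * lj) / 2)) F"
      by (intro tendsto_Complex lim)
    moreover have "Complex (Re (1 * ent (P x) i j)) (Re (- \<i> * ent (P x) i j)) = ent (P x) i j" for x
      by (simp add: complex_eq_iff)
    ultimately show ?thesis by auto
  qed
  then obtain l where l: "\<And>i j. i < n \<Longrightarrow> j < n \<Longrightarrow> ((\<lambda>x. ent (P x) i j) \<longlongrightarrow> l i j) F" by metis
  have "(P \<longlongrightarrow> trunc n n l) F" by (rule tendsto_pmat[of _ n n]) (use P l in \<open>auto simp: trunc.rep_eq\<close>)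
  then show ?thesis by (intro bexI[of _ "trunc n n l"]) auto
qed

text \<open>The data are symmetric under \<open>A \<rightarrow> - A\<close> and exchange of \<open>t1\<close>, \<open>t2\<close>; each fact about the first
  block row therefore yields its counterpart for the second one.\<close>
locale gbdt =
  fixes n k1 k2 :: nat and A t1 t2 :: pmat and S :: "real \<Rightarrow> pmat"
  assumes A: "A \<in> carr n n" and t1: "t1 \<in> carr n k1" and t2: "t2 \<in> carr n k2"
    and S: "\<And>x. S x \<in> carr n n" and S0: "pd n (S 0)"
    and S0_eq: "A * S 0 - S 0 * adj A = \<i> *\<^sub>c (t1 * adj t1 - t2 * adj t2)"
    and S_deriv: "\<And>x. 0 \<le> x \<Longrightarrow> (S has_vector_derivative
      (pexp n ((- \<i> * of_real x) *\<^sub>c A) * t1) * adj (pexp n ((- \<i> * of_real x) *\<^sub>c A) * t1) +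
      (pexp n ((\<i> * of_real x) *\<^sub>c A) * t2) * adj (pexp n ((\<i> * of_real x) *\<^sub>c A) * t2)) (at x within {0..})"
begin

definition e :: "real \<Rightarrow> pmat" where "e x = pexp n ((- \<i> * of_real x) *\<^sub>c A)"
definition L1 :: "real \<Rightarrow> pmat" where "L1 x = pexp n ((- \<i> * of_real x) *\<^sub>c A) * t1"
definition L2 :: "real \<Rightarrow> pmat" where "L2 x = pexp n ((\<i> * of_real x) *\<^sub>c A) * t2"
definition T :: "real \<Rightarrow> pmat" where "T x = (SOME B. inv_of n (S x) B)"
definition Pi :: "real \<Rightarrow> pmat" where "Pi x = adj (e x) * T x * e x"
definition E :: "real \<Rightarrow> pmat" where "E x = adj (e x) * T x * L2 x"
definition v :: "real \<Rightarrow> pmat" where "v x = (- 2 * \<i>) *\<^sub>c (adj (L1 x) * T x * L2 x)"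

lemma L1_e: "L1 x = e x * t1" by (simp add: L1_def e_def)

lemma e_car: "e x \<in> carr n n" by (simp add: e_def)
lemma L1_car: "L1 x \<in> carr n k1" unfolding L1_def by (blast intro: carr_intros pexp_carr t1)
lemma L2_car: "L2 x \<in> carr n k2" unfolding L2_def by (blast intro: carr_intros pexp_carr t2)

lemma e_0: "e 0 = idm n" by (simp add: e_def pexp_zero)
lemma L1_0: "L1 0 = t1" using t1 by (simp add: L1_def pexp_zero)
lemma L2_0: "L2 0 = t2" using t2 by (simp add: L2_def pexp_zero)

lemma e_commute: "A * e x = e x * A"
  unfolding e_def by (rule pexp_commute) (use A in auto)

lemma adj_e_commute: "adj A * adj (e x) = adj (e x) * adj A"
  using arg_cong[OF e_commute[of x], of adj] by simp

lemma e_deriv: "(e has_vector_derivative (- \<i>) *\<^sub>c (A * e x)) (at x within W)"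
  unfolding e_def using pexp_has_vector_derivative[OF A, of "- \<i>" x W] by simp

lemma L1_deriv: "(L1 has_vector_derivative (- \<i>) *\<^sub>c (A * L1 x)) (at x within W)"
proof -
  have "((\<lambda>x. e x * t1) has_vector_derivative e x * 0 + ((- \<i>) *\<^sub>c (A * e x)) * t1) (at x within W)"
    by (intro has_vector_derivative_mult e_deriv has_vector_derivative_const)
  then show ?thesis by (simp add: L1_e[abs_def] mult.assoc)
qed

lemma L2_deriv: "(L2 has_vector_derivative \<i> *\<^sub>c (A * L2 x)) (at x within W)"
proof -
  have "((\<lambda>x. pexp n ((\<i> * of_real x) *\<^sub>c A) * t2) has_vector_derivative
      pexp n ((\<i> * of_real x) *\<^sub>c A) * 0 + (\<i> *\<^sub>c (A * pexp n ((\<i> * of_real x) *\<^sub>c A))) * t2) (at x within W)"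
    by (intro has_vector_derivative_mult pexp_has_vector_derivative A has_vector_derivative_const)
  then show ?thesis by (simp add: L2_def[abs_def] mult.assoc)
qed

definition S' :: "real \<Rightarrow> pmat" where "S' x = L1 x * adj (L1 x) + L2 x * adj (L2 x)"

lemma S'_deriv: "0 \<le> x \<Longrightarrow> (S has_vector_derivative S' x) (at x within {0..})"
  using S_deriv[of x] by (simp add: S'_def L1_def L2_def)

lemma S_eq:
  assumes "0 \<le> x" shows "A * S x - S x * adj A = \<i> *\<^sub>c (L1 x * adj (L1 x) - L2 x * adj (L2 x))"
proof -
  define h where "h = (\<lambda>x. A * S x - S x * adj A - \<i> *\<^sub>c (L1 x * adj (L1 x) - L2 x * adj (L2 x)))"
  have "(h has_vector_derivative 0) (at y within {0..})" if y: "0 \<le> y" for y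
  proof -
    have "(h has_vector_derivative (A * S' y + 0 * S y) - (S y * 0 + S' y * adj A) -
       \<i> *\<^sub>c ((L1 y * adj ((- \<i>) *\<^sub>c (A * L1 y)) + ((- \<i>) *\<^sub>c (A * L1 y)) * adj (L1 y)) -
        (L2 y * adj (\<i> *\<^sub>c (A * L2 y)) + (\<i> *\<^sub>c (A * L2 y)) * adj (L2 y)))) (at y within {0..})"
      unfolding h_def
      by (intro has_vector_derivative_diff has_vector_derivative_mult has_vector_derivative_const
          cscale_has_vector_derivative adj_has_vector_derivative S'_deriv L1_deriv L2_deriv y)
    moreover have "(A * S' y + 0 * S y) - (S y * 0 + S' y * adj A) -
       \<i> *\<^sub>c ((L1 y * adj ((- \<i>) *\<^sub>c (A * L1 y)) + ((- \<i>) *\<^sub>c (A * L1 y)) * adj (L1 y)) -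
        (L2 y * adj (\<i> *\<^sub>c (A * L2 y)) + (\<i> *\<^sub>c (A * L2 y)) * adj (L2 y))) = 0"
      by (simp add: S'_def algebra_simps cscale_distribs)
    ultimately show ?thesis by simp
  qed
  then have "h x = h 0" using assms by (rule zero_deriv_const)
  also have "h 0 = 0" using S0_eq by (simp add: h_def L1_0 L2_0)
  finally show ?thesis by (simp add: h_def)
qed

lemma adj_S: assumes "0 \<le> x" shows "adj (S x) = S x"
proof -
  have "((\<lambda>x. adj (S x) - S x) has_vector_derivative 0) (at y within {0..})" if y: "0 \<le> y" for y
  proof -
    have "((\<lambda>x. adj (S x) - S x) has_vector_derivative adj (S' y) - S' y) (at y within {0..})"
      by (intro has_vector_derivative_diff adj_has_vector_derivative S'_deriv y)
    then show ?thesis by (simp add: S'_def)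
  qed
  then have "adj (S x) - S x = adj (S 0) - S 0" using assms by (rule zero_deriv_const)
  then show ?thesis using pdD(2)[OF S0] by simp
qed

text \<open>The derivative of \<open>S\<close> is a sum of two squares, so its quadratic forms
  increase from their positive values at 0.\<close>

lemma S_pd: assumes "0 \<le> x" shows "pd n (S x)"
  unfolding pd_def
proof (intro conjI ballI impI S adj_S assms)
  fix w assume w: "w \<in> colv n" "w \<noteq> 0"
  let ?h = "\<lambda>x. Re (ip w (S x * w))"
  have "?h 0 \<le> ?h x"
  proof (rule nonneg_deriv_mono[of ?h "\<lambda>x. Re (ip w (S' x * w))"])
    fix y :: real assume y: "0 \<le> y"
    have "((\<lambda>x. adj w * (S x * w)) has_vector_derivative adj w * (S y * 0 + S' y * w) + 0 * (S y * w)) (at y within {0..})"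
      by (intro has_vector_derivative_mult has_vector_derivative_const S'_deriv y)
    then have "((\<lambda>x. ent (adj w * (S x * w)) 0 0) has_vector_derivative ent (adj w * (S' y * w)) 0 0) (at y within {0..})"
      using ent_has_vector_derivative by force
    then show "(?h has_vector_derivative Re (ip w (S' y * w))) (at y within {0..})"
      unfolding ip_def by (rule bounded_linear.has_vector_derivative[OF bounded_linear_Re])
    have c: "adj (L1 y) * w \<in> colv k1" "adj (L2 y) * w \<in> colv k2" by (blast intro: carr_intros L1_car L2_car w)+
    have "ip w (S' y * w) = ip (adj (L1 y) * w) (adj (L1 y) * w) + ip (adj (L2 y) * w) (adj (L2 y) * w)"
      by (simp add: S'_def distrib_right ip_adj mult.assoc)
    then show "0 \<le> Re (ip w (S' y * w))" using ip_self_nonneg[OF c(1)] ip_self_nonneg[OF c(2)] by simp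
  qed (use assms in auto)
  then show "0 < Re (ip w (S x * w))" using pdD(3)[OF S0 w] by simp
qed

lemma T: "0 \<le> x \<Longrightarrow> inv_of n (S x) (T x)"
  unfolding T_def by (rule someI_ex) (rule pd_inv_of_exists[OF S_pd])

lemma T_pd: "0 \<le> x \<Longrightarrow> pd n (T x)" using inv_of_pd[OF S_pd T] .
lemma T_car: "0 \<le> x \<Longrightarrow> T x \<in> carr n n" using inv_ofD(2)[OF T] .
lemma adj_T [simp]: "0 \<le> x \<Longrightarrow> adj (T x) = T x" using pdD(2)[OF T_pd] .

lemma T_deriv: "0 \<le> x \<Longrightarrow> (T has_vector_derivative - (T x * S' x * T x)) (at x within {0..})"
  by (rule has_vector_derivative_inv_of[OF S'_deriv]) (use T in auto)

text \<open>The identity for \<open>S\<close> multiplied by its inverse \<open>T\<close> from both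
  sides: the rule that moves \<open>A\<close> across \<open>T\<close> in all computations
  below.\<close>

lemma TA: assumes "0 \<le> x"
  shows "T x * A = adj A * T x + \<i> *\<^sub>c (T x * (L1 x * adj (L1 x) - L2 x * adj (L2 x)) * T x)"
proof -
  note i = inv_ofD[OF T[OF assms]]
  have "T x * (A * S x - S x * adj A) * T x = T x * A * (S x * T x) - (T x * S x) * adj A * T x"
    by (simp add: algebra_simps)
  also have "\<dots> = T x * A - adj A * T x" using i A by (simp add: mult.assoc)
  finally have "T x * A - adj A * T x = T x * (A * S x - S x * adj A) * T x" by simp
  then show ?thesis unfolding S_eq[OF assms] by (simp add: algebra_simps)
qed

text \<open>The two exponentials contribute \<open>- i (T A - (adj A) T)\<close>, which is
  \<open>T (L1 (adj L1) - L2 (adj L2)) T\<close>. Added to the derivative \<open>- T S' T\<close> of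
  \<open>T\<close>, the \<open>L1\<close> parts cancel and the \<open>L2\<close> parts
  double.\<close>

lemma Pi_deriv: assumes x: "0 \<le> x"
  shows "(Pi has_vector_derivative (- 2) *\<^sub>c (E x * adj (E x))) (at x within {0..})"
proof -
  have "(Pi has_vector_derivative adj (e x) * T x * ((- \<i>) *\<^sub>c (A * e x)) +
     (adj (e x) * - (T x * S' x * T x) + adj ((- \<i>) *\<^sub>c (A * e x)) * T x) * e x) (at x within {0..})"
    unfolding Pi_def[abs_def]
    by (intro has_vector_derivative_mult adj_has_vector_derivative T_deriv e_deriv x)
  moreover have "adj (e x) * T x * ((- \<i>) *\<^sub>c (A * e x)) +
     (adj (e x) * - (T x * S' x * T x) + adj ((- \<i>) *\<^sub>c (A * e x)) * T x) * e x = (- 2) *\<^sub>c (E x * adj (E x))"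
  proof -
    have 1: "adj (e x) * T x * ((- \<i>) *\<^sub>c (A * e x)) = (- \<i>) *\<^sub>c (adj (e x) * (T x * A) * e x)"
      by (simp add: mult.assoc)
    show ?thesis unfolding 1 TA[OF x] S'_def E_def using x
      by (intro pmat_eqI) (simp add: algebra_simps cscale_distribs)
  qed
  ultimately show ?thesis by simp
qed

text \<open>Here \<open>A\<close> acts on \<open>L2\<close> with the opposite sign, so it is now the
  \<open>L2\<close> parts that cancel and the \<open>L1\<close> parts that double. The result is
  linear in \<open>E\<close> with a coefficient controlled by \<open>Pi\<close>.\<close>

lemma E_deriv: assumes x: "0 \<le> x"
  shows "(E has_vector_derivative (2 * \<i>) *\<^sub>c (adj A * E x) - 2 *\<^sub>c (Pi x * t1 * adj t1 * E x)) (at x within {0..})"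
proof -
  have "(E has_vector_derivative adj (e x) * T x * (\<i> *\<^sub>c (A * L2 x)) +
     (adj (e x) * - (T x * S' x * T x) + adj ((- \<i>) *\<^sub>c (A * e x)) * T x) * L2 x) (at x within {0..})"
    unfolding E_def[abs_def]
    by (intro has_vector_derivative_mult adj_has_vector_derivative T_deriv e_deriv L2_deriv x)
  moreover have "adj (e x) * T x * (\<i> *\<^sub>c (A * L2 x)) +
     (adj (e x) * - (T x * S' x * T x) + adj ((- \<i>) *\<^sub>c (A * e x)) * T x) * L2 x =
     (2 * \<i>) *\<^sub>c (adj A * E x) - 2 *\<^sub>c (Pi x * t1 * adj t1 * E x)"
  proof -
    have 1: "adj (e x) * T x * (\<i> *\<^sub>c (A * L2 x)) = \<i> *\<^sub>c (adj (e x) * (T x * A) * L2 x)"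
      by (simp add: mult.assoc)
    have 2: "adj A * E x = adj (e x) * adj A * T x * L2 x"
      unfolding E_def by (simp add: mult.assoc[symmetric] adj_e_commute)
    have 3: "Pi x * t1 * adj t1 * E x = adj (e x) * T x * L1 x * adj (L1 x) * T x * L2 x"
      by (simp add: Pi_def E_def L1_e mult.assoc)
    show ?thesis unfolding 1 2 3 TA[OF x] S'_def
      by (intro pmat_eqI) (simp add: algebra_simps cscale_distribs)
  qed
  ultimately show ?thesis by simp
qed

lemma Pi_car: "0 \<le> x \<Longrightarrow> Pi x \<in> carr n n"
  unfolding Pi_def by (blast intro: carr_intros e_car T_car)
lemma E_car: "0 \<le> x \<Longrightarrow> E x \<in> carr n k2"
  unfolding E_def by (blast intro: carr_intros e_car T_car L2_car)
lemma v_car: "0 \<le> x \<Longrightarrow> v x \<in> carr k1 k2"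
  unfolding v_def by (blast intro: carr_intros L1_car T_car L2_car)
lemma v_E: "v x = (- 2 * \<i>) *\<^sub>c (adj t1 * E x)"
  by (simp add: v_def E_def L1_e mult.assoc)
lemma E_cont: "continuous_on {0..} E" by (rule has_vector_derivative_imp_continuous_on[OF E_deriv])
lemma v_cont: "continuous_on {0..} v"
proof -
  have "continuous_on {0..} (\<lambda>x. (- 2 * \<i>) *\<^sub>c (adj t1 * E x))"
    by (rule bounded_linear.continuous_on[OF bounded_bilinear.bounded_linear_right[OF bounded_bilinear_cscale]])
      (intro continuous_intros E_cont)
  then show ?thesis by (simp add: v_E[abs_def])
qed

lemma Pi_quadratic_decreasing:
  assumes w: "w \<in> colv n" and xy: "0 \<le> x" "x \<le> y"
  shows "Re (ip w (Pi y * w)) \<le> Re (ip w (Pi x * w))"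
proof -
  let ?h = "\<lambda>x. - Re (ip w (Pi x * w))"
  have "?h x \<le> ?h y"
  proof (rule nonneg_deriv_mono[of ?h "\<lambda>x. - Re (ip w (((- 2) *\<^sub>c (E x * adj (E x))) * w))"])
    fix y :: real assume y: "0 \<le> y"
    have "((\<lambda>x. adj w * (Pi x * w)) has_vector_derivative adj w * (Pi y * 0 + ((- 2) *\<^sub>c (E y * adj (E y))) * w) + 0 * (Pi y * w)) (at y within {0..})"
      by (intro has_vector_derivative_mult has_vector_derivative_const Pi_deriv y)
    then have "((\<lambda>x. ent (adj w * (Pi x * w)) 0 0) has_vector_derivative ent (adj w * (((- 2) *\<^sub>c (E y * adj (E y))) * w)) 0 0) (at y within {0..})"
      using ent_has_vector_derivative by force
    then show "(?h has_vector_derivative - Re (ip w (((- 2) *\<^sub>c (E y * adj (E y))) * w))) (at y within {0..})"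
      unfolding ip_def by (intro has_vector_derivative_minus bounded_linear.has_vector_derivative[OF bounded_linear_Re])
    have "adj (E y) * w \<in> colv k2" by (blast intro: carr_intros E_car y w)
    then show "0 \<le> - Re (ip w (((- 2) *\<^sub>c (E y * adj (E y))) * w))"
      using ip_self_nonneg[of "adj (E y) * w"] by (simp add: mult.assoc ip_adj)
  qed (use xy in auto)
  then show ?thesis by simp
qed

lemma Pi_nonneg: assumes "w \<in> colv n" "0 \<le> x" shows "0 \<le> Re (ip w (Pi x * w))"
proof -
  have "e x * w \<in> colv n" by (blast intro: carr_intros e_car assms)
  then have "0 \<le> Re (ip (e x * w) (T x * (e x * w)))" using psdD(3)[OF pd_imp_psd[OF T_pd]] assms by blast
  then show ?thesis by (simp add: Pi_def ip_adj mult.assoc)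
qed

lemma Pi_tendsto: "\<exists>l \<in> carr n n. (Pi \<longlongrightarrow> l) at_top"
proof -
  \<comment> \<open>For negative \<open>x\<close> the inverse \<open>T x\<close> is an arbitrary
    choice, so \<open>Pi\<close> is frozen at its value in 0 there.\<close>
  define P where "P = (\<lambda>x. Pi (max 0 x))"
  have "\<exists>l \<in> carr n n. (P \<longlongrightarrow> l) at_top"
  proof (rule quadratic_form_tendsto)
    show "P x \<in> carr n n" for x by (simp add: P_def Pi_car)
    show "\<forall>\<^sub>F x in at_top. adj (P x) = P x" by (simp add: P_def Pi_def mult.assoc)
    fix w assume w: "w \<in> colv n"
    show "\<exists>l. ((\<lambda>x. Re (ip w (P x * w))) \<longlongrightarrow> l) at_top"
      by (rule decreasing_convergent[where K=0]) (use Pi_quadratic_decreasing[OF w] Pi_nonneg[OF w] in \<open>auto simp: P_def\<close>)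
  qed
  then obtain l where l: "l \<in> carr n n" "(P \<longlongrightarrow> l) at_top" by blast
  have "\<forall>\<^sub>F x in at_top. P x = Pi x" using eventually_ge_at_top[of 0] by eventually_elim (simp add: P_def)
  then show ?thesis using l by (metis tendsto_cong)
qed

end

section \<open>Exchange of the two blocks, explicit solutions and the conserved form\<close>

context gbdt
begin

lemma swap: "gbdt n k2 k1 (- A) t2 t1 S"
proof
  show "(- A) * S 0 - S 0 * adj (- A) = \<i> *\<^sub>c (t2 * adj t2 - t1 * adj t1)"
    using S0_eq by (intro pmat_eqI) (simp add: algebra_simps)
  fix x :: real assume "0 \<le> x"
  then show "(S has_vector_derivative
      (pexp n ((- \<i> * of_real x) *\<^sub>c - A) * t2) * adj (pexp n ((- \<i> * of_real x) *\<^sub>c - A) * t2) +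
      (pexp n ((\<i> * of_real x) *\<^sub>c - A) * t1) * adj (pexp n ((\<i> * of_real x) *\<^sub>c - A) * t1)) (at x within {0..})"
    using S_deriv[of x] by (simp add: add.commute)
qed (use A t1 t2 S S0 in auto)

lemma swap_simps:
  "gbdt.L1 n (- A) t2 x = L2 x" "gbdt.L2 n (- A) t1 x = L1 x"
  "gbdt.v n (- A) t2 t1 S x = - adj (v x)" if "0 \<le> x"
proof -
  interpret sw: gbdt n k2 k1 "- A" t2 t1 S by (rule swap)
  show 1: "gbdt.L1 n (- A) t2 x = L2 x" "gbdt.L2 n (- A) t1 x = L1 x"
    by (simp_all add: sw.L1_def sw.L2_def L1_def L2_def)
  show "gbdt.v n (- A) t2 t1 S x = - adj (v x)"
    using that by (simp add: sw.v_def v_def 1 cscale_uminus mult.assoc)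
qed

text \<open>The Darboux-type transform of \<open>(q1, q2)\<close>, first block row only; the second
  row follows by \<open>swap\<close>. The auxiliary \<open>l\<close> stands for
  \<open>(z - A)^-1 (L1 q1 + L2 q2)\<close> but is characterized by equations, so that
  \<open>z\<close> may be an eigenvalue of \<open>A\<close>.\<close>

lemma solution:
  assumes q1: "\<And>x. 0 \<le> x \<Longrightarrow> (q1 has_vector_derivative (\<i> * z) *\<^sub>c q1 x) (at x within {0..})"
    and l: "\<And>x. 0 \<le> x \<Longrightarrow> (l has_vector_derivative \<i> *\<^sub>c (L1 x * q1 x - L2 x * q2 x)) (at x within {0..})"
    and eq: "\<And>x. 0 \<le> x \<Longrightarrow> z *\<^sub>c l x - A * l x = L1 x * q1 x + L2 x * q2 x"
    and x: "0 \<le> x"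
  shows "((\<lambda>x. q1 x + \<i> *\<^sub>c (adj (L1 x) * T x * l x)) has_vector_derivative
     \<i> *\<^sub>c (z *\<^sub>c (q1 x + \<i> *\<^sub>c (adj (L1 x) * T x * l x)) + v x * (q2 x - \<i> *\<^sub>c (adj (L2 x) * T x * l x))))
     (at x within {0..})"
proof -
  have "((\<lambda>x. q1 x + \<i> *\<^sub>c (adj (L1 x) * T x * l x)) has_vector_derivative
     (\<i> * z) *\<^sub>c q1 x + \<i> *\<^sub>c (adj (L1 x) * T x * (\<i> *\<^sub>c (L1 x * q1 x - L2 x * q2 x)) +
      (adj (L1 x) * - (T x * S' x * T x) + adj ((- \<i>) *\<^sub>c (A * L1 x)) * T x) * l x)) (at x within {0..})"
    by (intro has_vector_derivative_add has_vector_derivative_mult cscale_has_vector_derivative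
        adj_has_vector_derivative T_deriv L1_deriv x q1 l)
  moreover have "(\<i> * z) *\<^sub>c q1 x + \<i> *\<^sub>c (adj (L1 x) * T x * (\<i> *\<^sub>c (L1 x * q1 x - L2 x * q2 x)) +
      (adj (L1 x) * - (T x * S' x * T x) + adj ((- \<i>) *\<^sub>c (A * L1 x)) * T x) * l x) =
     \<i> *\<^sub>c (z *\<^sub>c (q1 x + \<i> *\<^sub>c (adj (L1 x) * T x * l x)) + v x * (q2 x - \<i> *\<^sub>c (adj (L2 x) * T x * l x)))"
  proof -
    have 1: "adj ((- \<i>) *\<^sub>c (A * L1 x)) * T x = \<i> *\<^sub>c (adj (L1 x) * (adj A * T x))" by (simp add: mult.assoc)
    have 2: "adj A * T x = T x * A - \<i> *\<^sub>c (T x * (L1 x * adj (L1 x) - L2 x * adj (L2 x)) * T x)"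
      using TA[OF x] by simp
    have 3: "T x * (A * l x) = z *\<^sub>c (T x * l x) - T x * (L1 x * q1 x) - T x * (L2 x * q2 x)"
      using arg_cong[OF eq[OF x], of "\<lambda>X. T x * X"] by (simp add: algebra_simps)
    show ?thesis unfolding 1 2 S'_def v_def
      by (intro pmat_eqI) (simp add: algebra_simps 3)
  qed
  ultimately show ?thesis by simp
qed

text \<open>Conservation of \<open>y\<^sup>* j y\<close>, stated for two solutions of the above form at one point \<open>x\<close>.\<close>
lemma j_form:
  assumes x: "0 \<le> x"
    and l: "of_real z *\<^sub>c l - A * l = L1 x * q1 + L2 x * q2"
    and m: "of_real z *\<^sub>c m - A * m = L1 x * p1 + L2 x * p2"
  shows "adj (q1 + \<i> *\<^sub>c (adj (L1 x) * T x * l)) * (p1 + \<i> *\<^sub>c (adj (L1 x) * T x * m)) -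
     adj (q2 - \<i> *\<^sub>c (adj (L2 x) * T x * l)) * (p2 - \<i> *\<^sub>c (adj (L2 x) * T x * m)) = adj q1 * p1 - adj q2 * p2"
proof -
  have 1: "\<i> *\<^sub>c (T x * (L1 x * adj (L1 x) - L2 x * adj (L2 x)) * T x) = T x * A - adj A * T x"
    using TA[OF x] by simp
  have "T x * (L1 x * adj (L1 x) - L2 x * adj (L2 x)) * T x =
      (- \<i>) *\<^sub>c \<i> *\<^sub>c (T x * (L1 x * adj (L1 x) - L2 x * adj (L2 x)) * T x)" by simp
  then have 2: "T x * (L1 x * adj (L1 x) - L2 x * adj (L2 x)) * T x = (- \<i>) *\<^sub>c (T x * A - adj A * T x)"
    unfolding 1 .
  have "adj l * (T x * (L1 x * adj (L1 x) - L2 x * adj (L2 x)) * T x) * m =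
      (- \<i>) *\<^sub>c (adj l * T x * (A * m) - adj (A * l) * T x * m)"
    unfolding 2 by (simp add: algebra_simps)
  also have "A * m = of_real z *\<^sub>c m - (L1 x * p1 + L2 x * p2)" using m by (simp add: algebra_simps)
  also have "A * l = of_real z *\<^sub>c l - (L1 x * q1 + L2 x * q2)" using l by (simp add: algebra_simps)
  finally have 3: "adj l * (T x * (L1 x * adj (L1 x) - L2 x * adj (L2 x)) * T x) * m =
      (- \<i>) *\<^sub>c (adj l * T x * (of_real z *\<^sub>c m - (L1 x * p1 + L2 x * p2)) -
         adj (of_real z *\<^sub>c l - (L1 x * q1 + L2 x * q2)) * T x * m)" .
  have "adj (q1 + \<i> *\<^sub>c (adj (L1 x) * T x * l)) * (p1 + \<i> *\<^sub>c (adj (L1 x) * T x * m)) -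
     adj (q2 - \<i> *\<^sub>c (adj (L2 x) * T x * l)) * (p2 - \<i> *\<^sub>c (adj (L2 x) * T x * m)) =
     adj q1 * p1 - adj q2 * p2 + \<i> *\<^sub>c (adj q1 * adj (L1 x) * T x * m + adj q2 * adj (L2 x) * T x * m)
     - \<i> *\<^sub>c (adj l * T x * L1 x * p1 + adj l * T x * L2 x * p2)
     + adj l * (T x * (L1 x * adj (L1 x) - L2 x * adj (L2 x)) * T x) * m"
    using x by (intro pmat_eqI) (simp add: algebra_simps)
  also have "\<dots> = adj q1 * p1 - adj q2 * p2"
    unfolding 3 by (intro pmat_eqI) (simp add: algebra_simps)
  finally show ?thesis .
qed

end

section \<open>Decay and square integrability of the potential\<close>

lemma norm_sq_le: assumes "M \<in> carr r c"
  shows "(norm M)\<^sup>2 \<le> real (r * c) * (\<Sum>i<r. \<Sum>j<c. (cmod (ent M i j))\<^sup>2)"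
proof -
  obtain N where N: "bnd M N" using bnd_ex by blast
  have M: "bnd M (max r c)" using assms by (auto simp: bnd_def carr_def)
  have eq: "norm M = (\<Sum>p\<in>{..<r} \<times> {..<c}. cmod (ent M (fst p) (snd p)))"
  proof -
    have "norm M = (\<Sum>p\<in>{..<max r c} \<times> {..<max r c}. cmod (ent M (fst p) (snd p)))"
      by (simp add: norm_pmat_eq[OF M] sum.cartesian_product case_prod_unfold)
    also have "\<dots> = (\<Sum>p\<in>{..<r} \<times> {..<c}. cmod (ent M (fst p) (snd p)))"
      using assms by (intro sum.mono_neutral_right) (force simp: carr_def not_less[symmetric])+
    finally show ?thesis .
  qed
  have "(norm M)\<^sup>2 \<le> (\<Sum>p\<in>{..<r} \<times> {..<c}. (cmod (ent M (fst p) (snd p)))\<^sup>2) * real (card ({..<r} \<times> {..<c}))"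
    unfolding eq by (rule sum_squared_le_sum_of_squares)
  then show ?thesis by (simp add: sum.cartesian_product case_prod_unfold mult.commute)
qed

lemma ip_lower_bound:
  assumes u: "u \<in> colv n" shows "- (real n * norm K) * Re (ip u u) \<le> Re (ip u (K * u))"
proof -
  have "cmod (ip u (K * u)) \<le> norm u * (norm K * norm u)"
    using norm_ip_le[of u "K * u"] mult_left_mono[OF norm_mult_ineq[of K u] norm_ge_zero[of u]] by linarith
  also have "\<dots> = norm K * (norm u)\<^sup>2" by (simp add: power2_eq_square)
  also have "\<dots> \<le> norm K * (real n * Re (ip u u))"
    using norm_sq_le[OF u] by (intro mult_left_mono) (auto simp: ip_self[OF u])
  finally have "cmod (ip u (K * u)) \<le> real n * norm K * Re (ip u u)" by (simp add: mult_ac)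
  then show ?thesis using abs_Re_le_cmod[of "ip u (K * u)"] by simp
qed

context gbdt
begin

text \<open>The squared Hilbert-Schmidt norm of \<open>E\<close>. It is written by columns because
  every column satisfies the same linear equation as \<open>E\<close>.\<close>

definition energy :: "real \<Rightarrow> real" where
  "energy x = (\<Sum>l<k2. Re (ip (E x * unit_pmat l 0) (E x * unit_pmat l 0)))"

lemma ent_E_unit: "0 \<le> x \<Longrightarrow> l < k2 \<Longrightarrow> ent (E x * unit_pmat l 0) i 0 = ent (E x) i l"
  by (rule ent_mult_unit[OF E_car])

lemma E_unit_car: "0 \<le> x \<Longrightarrow> l < k2 \<Longrightarrow> E x * unit_pmat l 0 \<in> colv n"
  by (blast intro: carr_intros E_car unit_colv)

lemma energy_eq: assumes "0 \<le> x" shows "energy x = (\<Sum>i<n. \<Sum>l<k2. (cmod (ent (E x) i l))\<^sup>2)"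
proof -
  have "energy x = (\<Sum>l<k2. \<Sum>i<n. (cmod (ent (E x) i l))\<^sup>2)"
    unfolding energy_def using assms by (intro sum.cong) (auto simp: ip_self[OF E_unit_car] ent_E_unit)
  also have "\<dots> = (\<Sum>i<n. \<Sum>l<k2. (cmod (ent (E x) i l))\<^sup>2)" by (rule sum.swap)
  finally show ?thesis .
qed

lemma energy_nonneg: "0 \<le> x \<Longrightarrow> 0 \<le> energy x"
  by (simp add: energy_eq sum_nonneg)

lemma norm_E_le: "0 \<le> x \<Longrightarrow> (norm (E x))\<^sup>2 \<le> real (n * k2) * energy x"
  unfolding energy_eq by (rule norm_sq_le[OF E_car])

lemma Pi_psd: "0 \<le> x \<Longrightarrow> psd n (Pi x)"
  unfolding psd_def using Pi_car Pi_nonneg by (simp add: Pi_def mult.assoc)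

lemma Pi_bounded: "\<exists>K. \<forall>x\<ge>0. norm (Pi x) \<le> K"
proof -
  define K where "K = (\<Sum>i<n. \<bar>Re (ent (Pi 0) i i)\<bar>)"
  have "norm (Pi x) \<le> real n * (real n * K)" if x: "0 \<le> x" for x
  proof (rule psd_norm_le[OF Pi_psd[OF x]])
    fix i assume i: "i < n"
    have "Re (ent (Pi x) i i) \<le> Re (ent (Pi 0) i i)"
      using Pi_quadratic_decreasing[OF unit_colv[OF i], of 0 x] x ip_unit[OF Pi_car i i] by simp
    also have "\<dots> \<le> \<bar>Re (ent (Pi 0) i i)\<bar>" by simp
    also have "\<dots> \<le> K" unfolding K_def using i by (intro member_le_sum) auto
    finally show "Re (ent (Pi x) i i) \<le> K" .
  qed
  then show ?thesis by blast
qed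

text \<open>Minus half the trace of \<open>Pi\<close> has derivative \<open>energy\<close>, and it
  converges because \<open>Pi\<close> does.\<close>

lemma energy_antiderivative:
  "\<exists>G l. (\<forall>x\<ge>0. (G has_vector_derivative energy x) (at x within {0..})) \<and> (G \<longlongrightarrow> l) at_top"
proof -
  define G where "G = (\<lambda>x. \<Sum>i<n. - (1/2) * Re (ent (Pi x) i i))"
  obtain P where P: "(Pi \<longlongrightarrow> P) at_top" using Pi_tendsto by blast
  have "(G \<longlongrightarrow> (\<Sum>i<n. - (1/2) * Re (ent P i i))) at_top"
    unfolding G_def by (intro tendsto_intros tendsto_ent P)
  moreover have "(G has_vector_derivative energy x) (at x within {0..})" if x: "0 \<le> x" for x
  proof -
    have "(G has_vector_derivative (\<Sum>i<n. - (1/2) * Re (ent ((- 2) *\<^sub>c (E x * adj (E x))) i i))) (at x within {0..})"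
      unfolding G_def by (intro has_vector_derivative_sum has_vector_derivative_mult_right
        bounded_linear.has_vector_derivative[OF bounded_linear_Re] ent_has_vector_derivative Pi_deriv x)
    moreover have "- (1/2) * Re (ent ((- 2) *\<^sub>c (E x * adj (E x))) i i) = (\<Sum>l<k2. (cmod (ent (E x) i l))\<^sup>2)" for i
    proof -
      have "ent (E x * adj (E x)) i i = (\<Sum>l<k2. ent (E x) i l * cnj (ent (E x) i l))"
        using E_car[OF x] by (subst ent_times_carr[of _ n k2]) auto
      also have "\<dots> = (\<Sum>l<k2. of_real ((cmod (ent (E x) i l))\<^sup>2))"
        by (intro sum.cong refl) (metis complex_norm_square)
      finally have "Re (ent (E x * adj (E x)) i i) = (\<Sum>l<k2. (cmod (ent (E x) i l))\<^sup>2)"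
        by (simp only: of_real_sum[symmetric] Re_complex_of_real)
      then show ?thesis by simp
    qed
    ultimately show ?thesis by (simp add: energy_eq x)
  qed
  ultimately show ?thesis by blast
qed

lemma energy_integrable: "energy integrable_on {0..}"
  using energy_antiderivative integrable_of_antiderivative energy_nonneg by blast

text \<open>An integrable function need not tend to 0, but \<open>energy\<close> cannot drop faster
  than exponentially: each column \<open>u\<close> of \<open>E\<close> satisfies
  \<open>u' = M u\<close> with \<open>M\<close> bounded, so the derivative of \<open>energy\<close>
  is at least \<open>- c * energy\<close>.\<close>

lemma energy_tendsto: "(energy \<longlongrightarrow> 0) at_top"
proof -
  obtain G l where G: "\<And>x. 0 \<le> x \<Longrightarrow> (G has_vector_derivative energy x) (at x within {0..})" "(G \<longlongrightarrow> l) at_top"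
    using energy_antiderivative by blast
  obtain K where K: "\<And>x. 0 \<le> x \<Longrightarrow> norm (Pi x) \<le> K" using Pi_bounded by blast
  define M where "M = (\<lambda>x. (2 * \<i>) *\<^sub>c adj A - 2 *\<^sub>c (Pi x * t1 * adj t1))"
  \<comment> \<open>Twice the factor \<open>n * norm M\<close> of \<open>ip_lower_bound\<close>, the
    2 coming from the derivative of a square and \<open>norm M\<close> being estimated through the
    bound \<open>K\<close> of \<open>Pi\<close>.\<close>
  define c where "c = 2 * (real n * (2 * norm A + 2 * (K * norm t1 * norm t1)))"
  have K0: "0 \<le> K" using K[of 0] norm_ge_zero order.trans by blast
  have M: "norm (M x) \<le> 2 * norm A + 2 * (K * norm t1 * norm t1)" if x: "0 \<le> x" for x
  proof -
    have "norm (Pi x * t1 * adj t1) \<le> norm (Pi x * t1) * norm t1" using norm_mult_ineq[of "Pi x * t1" "adj t1"] by simp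
    also have "\<dots> \<le> K * norm t1 * norm t1"
      using norm_mult_ineq[of "Pi x" t1] mult_right_mono[OF K[OF x] norm_ge_zero[of t1]] by (intro mult_right_mono) auto
    finally show ?thesis unfolding M_def
      using norm_triangle_ineq4[of "(2 * \<i>) *\<^sub>c adj A" "2 *\<^sub>c (Pi x * t1 * adj t1)"] by (simp add: norm_mult)
  qed
  show ?thesis
  proof (rule derivative_tendsto_0[OF G(1) _ energy_nonneg _ _ G(2)])
    show "0 \<le> c" using K0 by (simp add: c_def)
    fix x :: real assume x: "0 \<le> x"
    let ?u = "\<lambda>l x. E x * unit_pmat l 0"
    have E': "(E has_vector_derivative M x * E x) (at x within {0..})"
      using E_deriv[OF x] by (simp add: M_def left_diff_distrib mult.assoc)
    have u': "(?u l has_vector_derivative M x * ?u l x) (at x within {0..})" for l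
    proof -
      have "(?u l has_vector_derivative E x * 0 + (M x * E x) * unit_pmat l 0) (at x within {0..})"
        by (intro has_vector_derivative_mult E' has_vector_derivative_const)
      then show ?thesis by (simp add: mult.assoc)
    qed
    have "((\<lambda>x. Re (ip (?u l x) (?u l x))) has_vector_derivative 2 * Re (ip (?u l x) (M x * ?u l x))) (at x within {0..})" for l
    proof -
      have "((\<lambda>x. adj (?u l x) * ?u l x) has_vector_derivative adj (?u l x) * (M x * ?u l x) + adj (M x * ?u l x) * ?u l x) (at x within {0..})"
        by (intro has_vector_derivative_mult adj_has_vector_derivative u')
      then have "((\<lambda>x. Re (ip (?u l x) (?u l x))) has_vector_derivative
          Re (ip (?u l x) (M x * ?u l x) + ip (M x * ?u l x) (?u l x))) (at x within {0..})"
        unfolding ip_def ent_add[symmetric]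
        by (intro bounded_linear.has_vector_derivative[OF bounded_linear_Re] ent_has_vector_derivative)
      moreover have "Re (ip (M x * ?u l x) (?u l x)) = Re (ip (?u l x) (M x * ?u l x))"
        using cnj_ip[of "M x * ?u l x" "?u l x"] by (metis cnj.sel(1))
      ultimately show ?thesis by simp
    qed
    then show "(energy has_vector_derivative (\<Sum>l<k2. 2 * Re (ip (?u l x) (M x * ?u l x)))) (at x within {0..})"
      unfolding energy_def[abs_def] by (intro has_vector_derivative_sum)
    have "- c * Re (ip (?u l x) (?u l x)) \<le> 2 * Re (ip (?u l x) (M x * ?u l x))" if l: "l < k2" for l
    proof -
      have "2 * (real n * norm (M x)) * Re (ip (?u l x) (?u l x)) \<le> c * Re (ip (?u l x) (?u l x))"
        unfolding c_def using M[OF x] ip_self_nonneg[OF E_unit_car[OF x l]]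
        by (intro mult_right_mono mult_left_mono) auto
      then show ?thesis using ip_lower_bound[OF E_unit_car[OF x l], of "M x"] by simp
    qed
    then show "- c * energy x \<le> (\<Sum>l<k2. 2 * Re (ip (?u l x) (M x * ?u l x)))"
      unfolding energy_def sum_distrib_left by (intro sum_mono) auto
  qed
qed

lemma E_tendsto: "(E \<longlongrightarrow> 0) at_top"
proof -
  have "((\<lambda>x. sqrt (real (n * k2) * energy x)) \<longlongrightarrow> sqrt (real (n * k2) * 0)) at_top"
    by (intro tendsto_intros energy_tendsto)
  then have "((\<lambda>x. sqrt (real (n * k2) * energy x)) \<longlongrightarrow> 0) at_top" by simp
  then show ?thesis
  proof (rule Lim_null_comparison[rotated])
    show "\<forall>\<^sub>F x in at_top. norm (E x) \<le> sqrt (real (n * k2) * energy x)"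
      using eventually_ge_at_top[of 0] by eventually_elim (rule real_le_rsqrt[OF norm_E_le])
  qed
qed

lemma v_tendsto: "(v \<longlongrightarrow> 0) at_top"
proof -
  have "((\<lambda>x. (- 2 * \<i>) *\<^sub>c (adj t1 * E x)) \<longlongrightarrow> (- 2 * \<i>) *\<^sub>c (adj t1 * 0)) at_top"
    by (intro tendsto_intros E_tendsto)
  then show ?thesis by (simp add: v_E[abs_def])
qed

lemma v_square_integrable: "set_integrable lebesgue {0..} (\<lambda>x. (cmod (ent (v x) i j))\<^sup>2)"
proof (rule continuous_bound_set_integrable)
  show "continuous_on {0..} (\<lambda>x. (cmod (ent (v x) i j))\<^sup>2)"
    by (intro continuous_intros continuous_on_ent v_cont)
  show "(\<lambda>x. (2 * norm t1)\<^sup>2 * real (n * k2) * energy x) integrable_on {0..}"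
    using integrable_cmul[OF energy_integrable, of "(2 * norm t1)\<^sup>2 * real (n * k2)"] by simp
  fix x :: real assume x: "0 \<le> x"
  have "norm (v x) \<le> 2 * norm t1 * norm (E x)"
    unfolding v_E using norm_mult_ineq[of "adj t1" "E x"] by (simp add: norm_mult)
  then have "cmod (ent (v x) i j) \<le> 2 * norm t1 * norm (E x)" using norm_ent_le[of "v x"] order.trans by blast
  then have "(cmod (ent (v x) i j))\<^sup>2 \<le> (2 * norm t1 * norm (E x))\<^sup>2" by (rule power_mono) simp
  also have "\<dots> = (2 * norm t1)\<^sup>2 * (norm (E x))\<^sup>2" by (simp add: power_mult_distrib)
  also have "\<dots> \<le> (2 * norm t1)\<^sup>2 * (real (n * k2) * energy x)"
    using norm_E_le[OF x] by (intro mult_left_mono) auto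
  finally show "norm ((cmod (ent (v x) i j))\<^sup>2) \<le> (2 * norm t1)\<^sup>2 * real (n * k2) * energy x" by simp
qed

text \<open>The components of the solution attached to \<open>(z - A) L = t1 G0\<close>.\<close>
definition w1 :: "complex \<Rightarrow> pmat \<Rightarrow> pmat \<Rightarrow> real \<Rightarrow> pmat" where
  "w1 z G0 L x = exp (\<i> * z * of_real x) *\<^sub>c (G0 + \<i> *\<^sub>c (adj t1 * Pi x * L))"
definition w2 :: "complex \<Rightarrow> pmat \<Rightarrow> real \<Rightarrow> pmat" where
  "w2 z L x = exp (\<i> * z * of_real x) *\<^sub>c ((- \<i>) *\<^sub>c (adj (E x) * L))"

lemma exp_has_vector_derivative:
  "((\<lambda>x. exp (\<i> * z * of_real x)) has_vector_derivative \<i> * z * exp (\<i> * z * of_real x)) (at x within W)"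
proof -
  have "((\<lambda>x. exp (\<i> * z * of_real x)) has_vector_derivative (\<i> * z * 1) * exp (\<i> * z * of_real x)) (at x)"
    by (rule field_vector_diff_chain_at[of "\<lambda>x. \<i> * z * of_real x" "\<i> * z * 1" x exp, unfolded o_def])
      (auto intro!: derivative_eq_intros)
  then show ?thesis using has_vector_derivative_at_within by simp
qed

lemma w_shape:
  assumes "0 \<le> x"
  shows "w1 z G0 L x = exp (\<i> * z * of_real x) *\<^sub>c G0 + \<i> *\<^sub>c (adj (L1 x) * T x * (exp (\<i> * z * of_real x) *\<^sub>c (e x * L)))"
    "w2 z L x = 0 - \<i> *\<^sub>c (adj (L2 x) * T x * (exp (\<i> * z * of_real x) *\<^sub>c (e x * L)))"
  using assms by (simp_all add: w1_def w2_def Pi_def E_def L1_e cscale_distribs mult.assoc mult.commute)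

text \<open>An instance of \<open>solution\<close>: the free solution is
  \<open>e^(ixz) [G0; 0]\<close>, and the auxiliary vector is \<open>l = e^(ixz) e(x) L\<close>,
  whose equations follow from \<open>(z - A) L = t1 G0\<close> because \<open>A\<close> commutes
  with its exponential.\<close>

lemma w_solution:
  assumes L: "z *\<^sub>c L - A * L = t1 * G0" and x: "0 \<le> x"
  shows "(w1 z G0 L has_vector_derivative \<i> *\<^sub>c (z *\<^sub>c w1 z G0 L x + v x * w2 z L x)) (at x within {0..})"
    "(w2 z L has_vector_derivative (- \<i>) *\<^sub>c (z *\<^sub>c w2 z L x + adj (v x) * w1 z G0 L x)) (at x within {0..})"
proof -
  define g where "g = (\<lambda>x. exp (\<i> * z * of_real x))"
  define q where "q = (\<lambda>x. g x *\<^sub>c G0)"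
  define l where "l = (\<lambda>x. g x *\<^sub>c (e x * L))"
  have g': "(g has_vector_derivative \<i> * z * g y) (at y within {0..})" for y
    unfolding g_def by (rule exp_has_vector_derivative)
  have cs: "((\<lambda>x. g x *\<^sub>c f x) has_vector_derivative g y *\<^sub>c f' + (\<i> * z * g y) *\<^sub>c f y) (at y within {0..})"
    if "(f has_vector_derivative f') (at y within {0..})" for f f' y
    by (rule bounded_bilinear.has_vector_derivative[OF bounded_bilinear_cscale g' that])
  have q': "(q has_vector_derivative (\<i> * z) *\<^sub>c q y) (at y within {0..})" for y
    using cs[OF has_vector_derivative_const[of G0]] by (simp add: q_def)
  have eq: "z *\<^sub>c l y - A * l y = L1 y * q y + L2 y * 0" for y
  proof -
    have "z *\<^sub>c l y - A * l y = g y *\<^sub>c (e y * (z *\<^sub>c L - A * L))"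
      by (simp add: l_def algebra_simps cscale_distribs) (simp add: mult.assoc[symmetric] e_commute)
    then show ?thesis unfolding L by (simp add: L1_e q_def mult.assoc)
  qed
  have l': "(l has_vector_derivative \<i> *\<^sub>c (L1 y * q y - L2 y * 0)) (at y within {0..})" for y
  proof -
    have "((\<lambda>x. e x * L) has_vector_derivative e y * 0 + (- \<i>) *\<^sub>c (A * e y) * L) (at y within {0..})"
      by (intro has_vector_derivative_mult e_deriv has_vector_derivative_const)
    from cs[OF this] have "(l has_vector_derivative \<i> *\<^sub>c (z *\<^sub>c l y - A * l y)) (at y within {0..})"
      by (simp add: l_def algebra_simps cscale_distribs)
    then show ?thesis unfolding eq by simp
  qed
  have sh': "w1 z G0 L y = q y + \<i> *\<^sub>c (adj (L1 y) * T y * l y)" "w2 z L y = 0 - \<i> *\<^sub>c (adj (L2 y) * T y * l y)" if "0 \<le> y" for y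
    using w_shape[OF that] by (simp_all add: g_def l_def q_def)
  have "((\<lambda>x. q x + \<i> *\<^sub>c (adj (L1 x) * T x * l x)) has_vector_derivative
     \<i> *\<^sub>c (z *\<^sub>c (q x + \<i> *\<^sub>c (adj (L1 x) * T x * l x)) + v x * (0 - \<i> *\<^sub>c (adj (L2 x) * T x * l x)))) (at x within {0..})"
    by (rule solution[of q z l "\<lambda>_. 0"]) (use q' l' eq x in auto)
  then have "((\<lambda>x. q x + \<i> *\<^sub>c (adj (L1 x) * T x * l x)) has_vector_derivative
     \<i> *\<^sub>c (z *\<^sub>c w1 z G0 L x + v x * w2 z L x)) (at x within {0..})" by (simp only: sh'[OF x])
  then show "(w1 z G0 L has_vector_derivative \<i> *\<^sub>c (z *\<^sub>c w1 z G0 L x + v x * w2 z L x)) (at x within {0..})"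
    by (rule has_vector_derivative_transform[rotated 2]) (use x sh' in auto)
  \<comment> \<open>The second block row is the first row of the exchanged data, with
    \<open>z\<close> replaced by \<open>- z\<close>, \<open>l\<close> by \<open>- l\<close> and
    \<open>v\<close> by minus its adjoint.\<close>
  interpret sw: gbdt n k2 k1 "- A" t2 t1 S by (rule swap)
  note ss = swap_simps
  have nl: "((\<lambda>x. - l x) has_vector_derivative \<i> *\<^sub>c (L2 y * 0 - L1 y * q y)) (at y within {0..})" for y
    using has_vector_derivative_minus[OF l'[of y]] by (simp add: cscale_distribs)
  have main: "((\<lambda>x. 0 + \<i> *\<^sub>c (adj (sw.L1 x) * sw.T x * (- l x))) has_vector_derivative
     \<i> *\<^sub>c ((- z) *\<^sub>c (0 + \<i> *\<^sub>c (adj (sw.L1 x) * sw.T x * (- l x))) + sw.v x * (q x - \<i> *\<^sub>c (adj (sw.L2 x) * sw.T x * (- l x))))) (at x within {0..})"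
  proof (rule sw.solution[of "\<lambda>_. 0" "- z" "\<lambda>x. - l x" q])
    fix y :: real assume y: "0 \<le> y"
    show "((\<lambda>x. - l x) has_vector_derivative \<i> *\<^sub>c (sw.L1 y * 0 - sw.L2 y * q y)) (at y within {0..})"
      using nl[of y] by (simp add: ss[OF y])
    show "(- z) *\<^sub>c (- l y) - (- A) * (- l y) = sw.L1 y * 0 + sw.L2 y * q y"
      using eq[of y] by (simp add: ss[OF y])
  qed (use x in auto)
  have b: "0 + \<i> *\<^sub>c (adj (sw.L1 y) * sw.T y * (- l y)) = w2 z L y"
    "q y - \<i> *\<^sub>c (adj (sw.L2 y) * sw.T y * (- l y)) = w1 z G0 L y" if "0 \<le> y" for y
    using sh'[OF that] by (simp_all add: ss[OF that] cscale_distribs)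
  have "((\<lambda>x. 0 + \<i> *\<^sub>c (adj (sw.L1 x) * sw.T x * (- l x))) has_vector_derivative
     \<i> *\<^sub>c ((- z) *\<^sub>c w2 z L x + (- adj (v x)) * w1 z G0 L x)) (at x within {0..})"
    using main unfolding b[OF x] ss(3)[OF x] .
  moreover have "\<i> *\<^sub>c ((- z) *\<^sub>c w2 z L x + (- adj (v x)) * w1 z G0 L x) = (- \<i>) *\<^sub>c (z *\<^sub>c w2 z L x + adj (v x) * w1 z G0 L x)"
    by (intro pmat_eqI) (simp add: algebra_simps)
  ultimately have "((\<lambda>x. 0 + \<i> *\<^sub>c (adj (sw.L1 x) * sw.T x * (- l x))) has_vector_derivative
     (- \<i>) *\<^sub>c (z *\<^sub>c w2 z L x + adj (v x) * w1 z G0 L x)) (at x within {0..})" by simp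
  then show "(w2 z L has_vector_derivative (- \<i>) *\<^sub>c (z *\<^sub>c w2 z L x + adj (v x) * w1 z G0 L x)) (at x within {0..})"
    by (rule has_vector_derivative_transform[rotated 2]) (use x sh' in \<open>auto simp: ss cscale_distribs\<close>)
qed

end

section \<open>Existence for linear differential equations\<close>

text \<open>The iterated integrals \<open>u N\<close> are bounded by
  \<open>norm U0 * (K x)^N / N!\<close>. Hence their series, and the series of their derivatives,
  converge uniformly on bounded intervals, and the sum may be differentiated term by term.\<close>

lemma picard:
  fixes M :: "real \<Rightarrow> pmat"
  assumes Mc: "continuous_on {0..} M" and Mcar: "\<And>x. 0 \<le> x \<Longrightarrow> M x \<in> carr m m"
    and Mb: "\<And>x. 0 \<le> x \<Longrightarrow> norm (M x) \<le> K" and U0: "U0 \<in> carr m k"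
  shows "\<exists>U. (\<forall>x. U x \<in> carr m k) \<and> U 0 = U0 \<and> (\<forall>x\<ge>0. (U has_vector_derivative M x * U x) (at x within {0..}))"
proof -
  define u where "u = rec_nat (\<lambda>_. U0) (\<lambda>_ f. primitive m k (\<lambda>t. M t * f t))"
  have u0: "u 0 = (\<lambda>_. U0)" and uS: "\<And>N. u (Suc N) = primitive m k (\<lambda>t. M t * u N t)" by (simp_all add: u_def)
  have ucar: "u N x \<in> carr m k" for N x by (cases N) (auto simp: u0 uS U0)
  have MuC: "M x * u N x \<in> carr m k" if "0 \<le> x" for N x by (blast intro: carr_intros Mcar ucar that)
  have K: "0 \<le> K" using Mb[of 0] norm_ge_zero order.trans by blast
  have ucont: "continuous_on {0..} (u N)" for N
  proof (induction N)
    case (Suc N)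
    then show ?case unfolding uS
      by (intro has_vector_derivative_imp_continuous_on[OF primitive_has_vector_derivative] continuous_intros Mc MuC)
  qed (simp add: u0)
  \<comment> \<open>The derivatives of the terms. The index shift is what makes their sum equal to
    \<open>M\<close> times the sum of the terms.\<close>
  define d where "d = (\<lambda>N x. case N of 0 \<Rightarrow> 0 | Suc N \<Rightarrow> M x * u N x)"
  have du: "(u N has_vector_derivative d N x) (at x within {0..})" if "0 \<le> x" for N x
  proof (cases N)
    case (Suc N')
    then show ?thesis unfolding Suc uS d_def nat.case
      by (intro primitive_has_vector_derivative continuous_intros Mc ucont MuC that)
  qed (simp add: u0 d_def)
  have ub: "norm (u N x) \<le> norm U0 * ((K * x) ^ N / fact N)" if "0 \<le> x" for N x
    using that
  proof (induction N arbitrary: x)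
    case 0
    then show ?case by (simp add: u0)
  next
    case (Suc N)
    have "norm (u (Suc N) x - u (Suc N) 0) \<le> norm U0 * ((K * x) ^ Suc N / fact (Suc N)) - norm U0 * ((K * 0) ^ Suc N / fact (Suc N))"
    proof (cases "x = 0")
      case False
      show ?thesis
      proof (rule differentiable_bound_general[where f = "u (Suc N)" and f' = "d (Suc N)" and \<phi> = "\<lambda>x. norm U0 * ((K * x) ^ Suc N / fact (Suc N))"
          and \<phi>' = "\<lambda>x. norm U0 * (K * ((K * x) ^ N / fact N))"])
        show "0 < x" using False Suc.prems by simp
        show "continuous_on {0..x} (u (Suc N))" using ucont by (rule continuous_on_subset) auto
        show "continuous_on {0..x} (\<lambda>x. norm U0 * ((K * x) ^ Suc N / fact (Suc N)))" by (intro continuous_intros) auto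
        fix y assume y: "0 < y" "y < x"
        have "(u (Suc N) has_vector_derivative d (Suc N) y) (at y within {0<..})"
          by (rule has_vector_derivative_within_subset[OF du]) (use y in auto)
        then show "(u (Suc N) has_vector_derivative d (Suc N) y) (at y)"
          using at_within_open[of y "{0<..}"] y by simp
        show "((\<lambda>x. norm U0 * ((K * x) ^ Suc N / fact (Suc N))) has_vector_derivative norm U0 * (K * ((K * y) ^ N / fact N))) (at y)"
        proof -
          have "((\<lambda>x. norm U0 * ((K * x) ^ Suc N / fact (Suc N))) has_real_derivative
              norm U0 * ((1 + of_nat N) * (K * (K * y) ^ N) / fact (Suc N))) (at y)"
            by (intro DERIV_cmult DERIV_cdivide DERIV_power_Suc) (auto intro!: derivative_eq_intros)
          moreover have "(1 + of_nat N) * (K * (K * y) ^ N) / fact (Suc N) = K * ((K * y) ^ N / fact N)"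
          proof -
            have "(1 + real N) / fact (Suc N) = 1 / fact N" by (simp add: divide_simps)
            then show ?thesis by (metis (no_types, opaque_lifting) mult.commute times_divide_eq_left times_divide_eq_right mult.right_neutral)
          qed
          ultimately show ?thesis by (simp only: has_real_derivative_iff_has_vector_derivative)
        qed
        have "norm (d (Suc N) y) \<le> norm (M y) * norm (u N y)" by (simp add: d_def norm_mult_ineq)
        also have "\<dots> \<le> K * (norm U0 * ((K * y) ^ N / fact N))"
          using y Suc.IH[of y] Mb[of y] K by (intro mult_mono) auto
        finally show "norm (d (Suc N) y) \<le> norm U0 * (K * ((K * y) ^ N / fact N))" by (simp add: mult_ac)
      qed
    qed simp
    then show ?case by (simp add: uS)
  qed
  define U where "U = (\<lambda>x. trunc m k (\<lambda>i j. \<Sum>N. ent (u N x) i j))"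
  have exps: "summable (\<lambda>N. C * ((K * x) ^ N / fact N))" for C x
    using summable_exp[of "K * x"] by (intro summable_mult) (simp add: divide_inverse mult.commute)
  have usum: "(\<lambda>N. ent (u N x) i j) sums ent (U x) i j" if "0 \<le> x" for x i j
  proof (cases "i < m \<and> j < k")
    case True
    have "summable (\<lambda>N. ent (u N x) i j)"
      by (rule summable_comparison_test'[OF exps[of "norm U0" x]]) (use ub[OF that] norm_ent_le order.trans in blast)
    then show ?thesis using True by (simp add: U_def trunc.rep_eq summable_sums)
  next
    case False
    then have "ent (u N x) i j = 0" for N using ucar carrD[of "u N x" m k i j] by (auto simp: not_less)
    then show ?thesis using False by (auto simp: U_def trunc.rep_eq)
  qed
  have Ucar: "U x \<in> carr m k" for x by (simp add: U_def)
  have dsum: "(\<lambda>N. ent (d N x) i j) sums ent (M x * U x) i j" if x: "0 \<le> x" for x i j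
  proof -
    have "(\<lambda>N. \<Sum>l<m. ent (M x) i l * ent (u N x) l j) sums (\<Sum>l<m. ent (M x) i l * ent (U x) l j)"
      by (intro sums_sum sums_mult usum x)
    then have "(\<lambda>N. ent (M x * u N x) i j) sums ent (M x * U x) i j"
      by (simp add: ent_times_carr[OF disjI1[OF Mcar[OF x]]])
    then have "(\<lambda>N. ent (d (Suc N) x) i j) sums ent (M x * U x) i j" by (simp add: d_def)
    then show ?thesis by (subst (asm) sums_Suc_iff) (simp add: d_def)
  qed
  have "(U has_vector_derivative M x * U x) (at x within {0..})" if x: "0 \<le> x" for x
  proof (rule has_vector_derivative_pmat[OF Ucar])
    show "M x * U x \<in> carr m k" by (blast intro: carr_intros Mcar Ucar x)
    fix i j assume ij: "i < m" "j < k"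
    \<comment> \<open>Uniform convergence is available on bounded intervals only; reaching beyond
      \<open>x\<close> keeps the derivative within \<open>{0..b}\<close> the same as within the
      half-line.\<close>
    define b where "b = x + 1"
    let ?S = "{0..b}"
    have unif: "uniform_limit ?S (\<lambda>N t. \<Sum>l<N. ent (d l t) i j) (\<lambda>t. \<Sum>l. ent (d l t) i j) sequentially"
    proof (rule Weierstrass_m_test)
      fix N t assume t: "t \<in> ?S"
      show "norm (ent (d N t) i j) \<le> (case N of 0 \<Rightarrow> 0 | Suc N \<Rightarrow> K * norm U0 * ((K * b) ^ N / fact N))"
      proof (cases N)
        case (Suc N')
        have "norm (ent (d N t) i j) \<le> norm (M t) * norm (u N' t)"
          using norm_ent_le[of "M t * u N' t" i j] norm_mult_ineq[of "M t" "u N' t"] by (simp add: Suc d_def)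
        also have "\<dots> \<le> K * (norm U0 * ((K * t) ^ N' / fact N'))"
          using t ub Mb K by (intro mult_mono) auto
        also have "\<dots> \<le> K * (norm U0 * ((K * b) ^ N' / fact N'))"
          using t K by (intro mult_left_mono divide_right_mono power_mono) auto
        finally show ?thesis by (simp add: Suc mult.assoc)
      qed (simp add: d_def)
    next
      have "summable (\<lambda>N. case Suc N of 0 \<Rightarrow> 0 | Suc N \<Rightarrow> K * norm U0 * ((K * b) ^ N / fact N))"
        using exps[of "K * norm U0" b] by simp
      then show "summable (\<lambda>N. case N of 0 \<Rightarrow> 0 | Suc N \<Rightarrow> K * norm U0 * ((K * b) ^ N / fact N))"
        by (subst (asm) summable_Suc_iff)
    qed
    have "\<exists>g. \<forall>t\<in>?S. (\<lambda>N. ent (u N t) i j) sums g t \<and>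
        (g has_derivative (\<lambda>h. h *\<^sub>R (\<Sum>l. ent (d l t) i j))) (at t within ?S)"
    proof (rule has_derivative_series[where f' = "\<lambda>N t h. h *\<^sub>R ent (d N t) i j"])
      show "convex ?S" by simp
      show "0 \<in> ?S" using x by (simp add: b_def)
      show "(\<lambda>N. ent (u N 0) i j) sums ent (U 0) i j" by (rule usum) simp
      fix N t assume t: "t \<in> ?S"
      have "((\<lambda>x. ent (u N x) i j) has_vector_derivative ent (d N t) i j) (at t within ?S)"
        by (rule has_vector_derivative_within_subset[OF ent_has_vector_derivative[OF du]]) (use t in auto)
      then show "((\<lambda>x. ent (u N x) i j) has_derivative (\<lambda>h. h *\<^sub>R ent (d N t) i j)) (at t within ?S)"
        by (simp add: has_vector_derivative_def)
    next
      fix \<epsilon> :: real assume "\<epsilon> > 0"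
      then have "\<forall>\<^sub>F N in sequentially. \<forall>t\<in>?S. dist (\<Sum>l<N. ent (d l t) i j) (\<Sum>l. ent (d l t) i j) < \<epsilon>"
        using unif by (simp add: uniform_limit_iff)
      then show "\<forall>\<^sub>F N in sequentially. \<forall>t\<in>?S. \<forall>h. norm ((\<Sum>l<N. h *\<^sub>R ent (d l t) i j) - h *\<^sub>R (\<Sum>l. ent (d l t) i j)) \<le> \<epsilon> * norm h"
      proof eventually_elim
        case (elim N)
        show ?case
        proof (intro ballI allI)
          fix t h assume "t \<in> ?S"
          then have "norm ((\<Sum>l<N. ent (d l t) i j) - (\<Sum>l. ent (d l t) i j)) \<le> \<epsilon>"
            using elim by (fastforce simp: dist_norm)
          then have "\<bar>h\<bar> * norm ((\<Sum>l<N. ent (d l t) i j) - (\<Sum>l. ent (d l t) i j)) \<le> \<bar>h\<bar> * \<epsilon>"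
            by (rule mult_left_mono) simp
          moreover have "(\<Sum>l<N. h *\<^sub>R ent (d l t) i j) - h *\<^sub>R (\<Sum>l. ent (d l t) i j) =
              h *\<^sub>R ((\<Sum>l<N. ent (d l t) i j) - (\<Sum>l. ent (d l t) i j))"
            by (simp add: scaleR_sum_right scaleR_diff_right)
          ultimately show "norm ((\<Sum>l<N. h *\<^sub>R ent (d l t) i j) - h *\<^sub>R (\<Sum>l. ent (d l t) i j)) \<le> \<epsilon> * norm h"
            by (simp add: mult.commute)
        qed
      qed
    qed
    then obtain g where g: "\<And>t. t \<in> ?S \<Longrightarrow> (\<lambda>N. ent (u N t) i j) sums g t"
      "\<And>t. t \<in> ?S \<Longrightarrow> (g has_derivative (\<lambda>h. h *\<^sub>R (\<Sum>l. ent (d l t) i j))) (at t within ?S)" by blast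
    have gU: "g t = ent (U t) i j" if "t \<in> ?S" for t using g(1)[OF that] usum[of t i j] that sums_unique2 by force
    have xS: "x \<in> ?S" using x by (simp add: b_def)
    have "(g has_vector_derivative ent (M x * U x) i j) (at x within ?S)"
      using g(2)[OF xS] sums_unique[OF dsum[OF x, of i j]] by (simp add: has_vector_derivative_def)
    then have "((\<lambda>x. ent (U x) i j) has_vector_derivative ent (M x * U x) i j) (at x within ?S)"
      by (rule has_vector_derivative_transform[rotated 2]) (use xS gU in auto)
    then show "((\<lambda>x. ent (U x) i j) has_vector_derivative ent (M x * U x) i j) (at x within {0..})"
      using at_within_atLeast[OF x, of b] by (simp add: b_def)
  qed
  moreover have "U 0 = U0"
  proof (rule carr_eqI[OF Ucar U0])
    fix i j
    have "(\<lambda>N. ent (u N 0) i j) = (\<lambda>N. if N = 0 then ent U0 i j else 0)"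
    proof
      fix N show "ent (u N 0) i j = (if N = 0 then ent U0 i j else 0)" by (cases N) (auto simp: u0 uS)
    qed
    then show "ent (U 0) i j = ent U0 i j"
      using usum[of 0 i j] sums_single[of 0 "\<lambda>_. ent U0 i j"] sums_unique2 by force
  qed
  ultimately show ?thesis using Ucar by blast
qed

section \<open>Dirac systems in block form\<close>

lemma ent_shift_mult: assumes "W \<in> carr q k"
  shows "ent (shift p q * W) i l = (if p \<le> i then ent W (i - p) l else 0)"
proof -
  have "ent (shift p q * W) i l = (\<Sum>r<q. ent (shift p q) i r * ent W r l)"
    by (rule ent_times_carr) (use assms in auto)
  also have "\<dots> = (\<Sum>r<q. if r = i - p then (if p \<le> i then ent W (i - p) l else 0) else 0)"
    by (intro sum.cong) (auto simp: shift.rep_eq)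
  also have "\<dots> = (if p \<le> i then ent W (i - p) l else 0)" using carrD[OF assms] by auto
  finally show ?thesis .
qed

lemma ent_mult_adj_shift: assumes "X \<in> carr r q"
  shows "ent (X * adj (shift p q)) i j = (if p \<le> j then ent X i (j - p) else 0)"
proof -
  have "ent (X * adj (shift p q)) i j = cnj (ent (shift p q * adj X) j i)"
    by (metis adj_adj adj_mult ent_adj)
  also have "\<dots> = (if p \<le> j then ent X i (j - p) else 0)"
    using assms by (subst ent_shift_mult[of _ q r]) auto
  finally show ?thesis .
qed

text \<open>The expression \<open>X + shift p q * W\<close> is the block column
  \<open>[X; W]\<close>; this is how block columns are written from here on.\<close>

lemma ent_stack: assumes "X \<in> carr p k" "W \<in> carr q k"
  shows "ent (X + shift p q * W) i l = (if i < p then ent X i l else ent W (i - p) l)"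
  using assms by (auto simp: ent_shift_mult carrD)

lemma stack_carr: assumes "X \<in> carr p k" "W \<in> carr q k" shows "X + shift p q * W \<in> carr (p + q) k"
proof -
  have "X \<in> carr (p + q) k" using assms(1) by (auto simp: carr_def)
  then show ?thesis by (blast intro: carr_intros shift_carr assms)
qed

lemma emb_four_block:
  assumes "A \<in> carrier_mat a b" "B \<in> carrier_mat a d" "C \<in> carrier_mat c b" "D \<in> carrier_mat c d"
  shows "emb (four_block_mat A B C D) = (emb A + shift a c * emb C) + (emb B + shift a c * emb D) * adj (shift b d)"
proof (rule pmat_eqI)
  fix i j
  have "emb B + shift a c * emb D \<in> carr (a + c) d" using assms by (intro stack_carr) auto
  then show "ent (emb (four_block_mat A B C D)) i j =
      ent ((emb A + shift a c * emb C) + (emb B + shift a c * emb D) * adj (shift b d)) i j"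
    using assms
    by (simp add: ent_mult_adj_shift[of _ "a + c"] ent_shift_mult[OF emb_carr[OF assms(3)]] ent_shift_mult[OF emb_carr[OF assms(4)]])
      (auto simp: ent_emb)
qed

lemma emb_append_rows: assumes "A \<in> carrier_mat a k" "B \<in> carrier_mat b k"
  shows "emb (A @\<^sub>r B) = emb A + shift a b * emb B"
  using emb_four_block[of A a k "0\<^sub>m a 0" 0 B b "0\<^sub>m b 0"] assms by (simp add: append_rows_def)

lemma emb_append_cols: assumes "A \<in> carrier_mat r a" "B \<in> carrier_mat r b"
  shows "emb (append_cols A B) = emb A + emb B * adj (shift a b)"
  using emb_four_block[of A r a B b "0\<^sub>m 0 a" 0 "0\<^sub>m 0 b"] assms by (simp add: append_cols_def)

lemma append_rows_carrier: "A \<in> carrier_mat a k \<Longrightarrow> B \<in> carrier_mat b k \<Longrightarrow> A @\<^sub>r B \<in> carrier_mat (a + b) k"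
  by (auto simp: append_rows_def)

lemma dirac_j_carrier: "dirac_j m1 m2 \<in> carrier_mat (m1 + m2) (m1 + m2)"
  by (auto simp: dirac_j_def)

lemma emb_dirac_j: "emb (dirac_j m1 m2) = idm m1 - shift m1 m2 * adj (shift m1 m2)"
  unfolding dirac_j_def using mult_idm[OF shift_carr]
  by (subst emb_four_block[of _ m1 m1 _ m2 _ m2]) auto

lemma dirac_V_carrier: "v \<in> carrier_mat m1 m2 \<Longrightarrow> dirac_V m1 m2 v \<in> carrier_mat (m1 + m2) (m1 + m2)"
  by (auto simp: dirac_V_def mat_adjoint_def)

lemma emb_dirac_V: "v \<in> carrier_mat m1 m2 \<Longrightarrow>
    emb (dirac_V m1 m2 v) = shift m1 m2 * adj (emb v) + emb v * adj (shift m1 m2)"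
  unfolding dirac_V_def by (subst emb_four_block[of _ m1 m1 _ m2 _ m2]) auto

lemma emb_dirac_rhs:
  fixes z :: complex
  assumes v: "v \<in> carrier_mat m1 m2" and Y: "Y \<in> carrier_mat (m1 + m2) k"
    and eq: "emb Y = X + shift m1 m2 * W" and XW: "X \<in> carr m1 k" "W \<in> carr m2 k"
  defines "D \<equiv> \<i> \<cdot>\<^sub>m ((z \<cdot>\<^sub>m dirac_j m1 m2 + dirac_j m1 m2 * dirac_V m1 m2 v) * Y)"
  shows "emb D = \<i> *\<^sub>c (z *\<^sub>c X + emb v * W) + shift m1 m2 * ((- \<i>) *\<^sub>c (z *\<^sub>c W + adj (emb v) * X))"
    "D \<in> carrier_mat (m1 + m2) k"
proof -
  let ?m = "m1 + m2"
  let ?s = "shift m1 m2"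
  note j = dirac_j_carrier[of m1 m2] and V = dirac_V_carrier[OF v]
  have jV: "dirac_j m1 m2 * dirac_V m1 m2 v \<in> carrier_mat ?m ?m" using mult_carrier_mat[OF j V] .
  have zj: "z \<cdot>\<^sub>m dirac_j m1 m2 \<in> carrier_mat ?m ?m" using j by simp
  have sum: "z \<cdot>\<^sub>m dirac_j m1 m2 + dirac_j m1 m2 * dirac_V m1 m2 v \<in> carrier_mat ?m ?m" using jV by simp
  show "D \<in> carrier_mat ?m k" unfolding D_def using mult_carrier_mat[OF sum Y] by simp
  have v': "emb v \<in> carr m1 m2" using v by simp
  have r: "adj ?s * (?s * Q) = Q" if "Q \<in> carr m2 q" for Q q
    using that by (simp add: mult.assoc[symmetric] adj_shift_mult_shift)
  have r2: "adj ?s * (X * Q) = 0" "adj ?s * X = 0" "idm m1 * (?s * Q) = 0" "adj ?s * (emb v * Q) = 0" "adj (emb v) * (?s * Q) = 0" for Q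
    using shift_mult[OF XW(1)] shift_mult[OF v'] idm_mult_shift[of m1 m2] mult_shift[OF carr_simps(7)[OF v']]
    by (simp_all add: mult.assoc[symmetric]) (metis adj_0 adj_adj adj_mult shift_mult[OF v'])?
  have jVe: "emb (dirac_j m1 m2) * emb (dirac_V m1 m2 v) = emb v * adj ?s - ?s * adj (emb v)"
  proof -
    have "emb (dirac_j m1 m2) * emb (dirac_V m1 m2 v) =
       (idm m1 * ?s) * adj (emb v) + (idm m1 * emb v) * adj ?s - ?s * (adj ?s * ?s) * adj (emb v) - ?s * (adj ?s * emb v) * adj ?s"
      unfolding emb_dirac_j emb_dirac_V[OF v] by (simp add: algebra_simps)
    also have "\<dots> = emb v * adj ?s - ?s * adj (emb v)"
      using v' mult_idm[OF shift_carr, of m1 m2] by (simp add: idm_mult_shift adj_shift_mult_shift shift_mult[OF v'])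
    finally show ?thesis .
  qed
  have "emb D = \<i> *\<^sub>c ((z *\<^sub>c (idm m1 - ?s * adj ?s) + (emb v * adj ?s - ?s * adj (emb v))) * (X + ?s * W))"
    by (simp only: D_def emb_smult emb_mult[OF sum Y] emb_add[OF zj jV] emb_mult[OF j V] jVe eq) (simp only: emb_dirac_j)
  also have "\<dots> = \<i> *\<^sub>c (z *\<^sub>c X + emb v * W) + ?s * ((- \<i>) *\<^sub>c (z *\<^sub>c W + adj (emb v) * X))"
  proof -
    have "(idm m1 - ?s * adj ?s) * (X + ?s * W) = X - ?s * W"
      using XW r[OF XW(2)] r2 by (simp add: algebra_simps)
    moreover have "(emb v * adj ?s - ?s * adj (emb v)) * (X + ?s * W) = emb v * W - ?s * (adj (emb v) * X)"
      using r[OF XW(2)] r2 by (simp add: algebra_simps)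
    ultimately have "(z *\<^sub>c (idm m1 - ?s * adj ?s) + (emb v * adj ?s - ?s * adj (emb v))) * (X + ?s * W) =
        z *\<^sub>c (X - ?s * W) + (emb v * W - ?s * (adj (emb v) * X))"
      by (simp add: distrib_right)
    then show ?thesis by (intro pmat_eqI) (simp add: algebra_simps)
  qed
  finally show "emb D = \<i> *\<^sub>c (z *\<^sub>c X + emb v * W) + ?s * ((- \<i>) *\<^sub>c (z *\<^sub>c W + adj (emb v) * X))" .
qed

text \<open>The Dirac system split into its two block rows. No sizes occur, so sums and right
  multiples of solutions are solutions without further conditions.\<close>

definition psol :: "(real \<Rightarrow> pmat) \<Rightarrow> complex \<Rightarrow> (real \<Rightarrow> pmat) \<Rightarrow> (real \<Rightarrow> pmat) \<Rightarrow> bool" where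
  "psol v z y1 y2 \<longleftrightarrow> (\<forall>x\<ge>0.
     (y1 has_vector_derivative \<i> *\<^sub>c (z *\<^sub>c y1 x + v x * y2 x)) (at x within {0..}) \<and>
     (y2 has_vector_derivative (- \<i>) *\<^sub>c (z *\<^sub>c y2 x + adj (v x) * y1 x)) (at x within {0..}))"

lemma psolD: assumes "psol v z y1 y2" "0 \<le> x"
  shows "(y1 has_vector_derivative \<i> *\<^sub>c (z *\<^sub>c y1 x + v x * y2 x)) (at x within {0..})"
    "(y2 has_vector_derivative (- \<i>) *\<^sub>c (z *\<^sub>c y2 x + adj (v x) * y1 x)) (at x within {0..})"
  using assms by (auto simp: psol_def)

lemma psol_add: assumes "psol v z y1 y2" "psol v z u1 u2" shows "psol v z (\<lambda>x. y1 x + u1 x) (\<lambda>x. y2 x + u2 x)"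
  unfolding psol_def
proof (intro allI impI)
  fix x :: real assume x: "0 \<le> x"
  show "((\<lambda>x. y1 x + u1 x) has_vector_derivative \<i> *\<^sub>c (z *\<^sub>c (y1 x + u1 x) + v x * (y2 x + u2 x))) (at x within {0..}) \<and>
     ((\<lambda>x. y2 x + u2 x) has_vector_derivative (- \<i>) *\<^sub>c (z *\<^sub>c (y2 x + u2 x) + adj (v x) * (y1 x + u1 x))) (at x within {0..})"
    using has_vector_derivative_add[OF psolD(1)[OF assms(1) x] psolD(1)[OF assms(2) x]]
      has_vector_derivative_add[OF psolD(2)[OF assms(1) x] psolD(2)[OF assms(2) x]]
    by (simp add: algebra_simps cscale_distribs)
qed

lemma psol_mult: assumes "psol v z y1 y2" shows "psol v z (\<lambda>x. y1 x * Q) (\<lambda>x. y2 x * Q)"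
  unfolding psol_def
proof (intro allI impI)
  fix x :: real assume x: "0 \<le> x"
  show "((\<lambda>x. y1 x * Q) has_vector_derivative \<i> *\<^sub>c (z *\<^sub>c (y1 x * Q) + v x * (y2 x * Q))) (at x within {0..}) \<and>
     ((\<lambda>x. y2 x * Q) has_vector_derivative (- \<i>) *\<^sub>c (z *\<^sub>c (y2 x * Q) + adj (v x) * (y1 x * Q))) (at x within {0..})"
    using has_vector_derivative_mult[OF psolD(1)[OF assms(1) x] has_vector_derivative_const[of Q]]
      has_vector_derivative_mult[OF psolD(2)[OF assms(1) x] has_vector_derivative_const[of Q]]
    by (simp add: algebra_simps cscale_distribs)
qed

lemma psol_minus: assumes "psol v z y1 y2" shows "psol v z (\<lambda>x. - y1 x) (\<lambda>x. - y2 x)"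
  unfolding psol_def
proof (intro allI impI)
  fix x :: real assume x: "0 \<le> x"
  show "((\<lambda>x. - y1 x) has_vector_derivative \<i> *\<^sub>c (z *\<^sub>c (- y1 x) + v x * (- y2 x))) (at x within {0..}) \<and>
     ((\<lambda>x. - y2 x) has_vector_derivative (- \<i>) *\<^sub>c (z *\<^sub>c (- y2 x) + adj (v x) * (- y1 x))) (at x within {0..})"
    using has_vector_derivative_minus[OF psolD(1)[OF assms(1) x]] has_vector_derivative_minus[OF psolD(2)[OF assms(1) x]]
    by (simp add: algebra_simps cscale_distribs)
qed

lemma psol_diff: assumes "psol v z y1 y2" "psol v z u1 u2" shows "psol v z (\<lambda>x. y1 x - u1 x) (\<lambda>x. y2 x - u2 x)"
  using psol_add[OF assms(1) psol_minus[OF assms(2)]] by simp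

lemma psol_cong: assumes "\<And>x. 0 \<le> x \<Longrightarrow> v x = v' x" shows "psol v z y1 y2 = psol v' z y1 y2"
  using assms by (simp add: psol_def)

lemma psol_cont: assumes "psol v z y1 y2" shows "continuous_on {0..} y1" "continuous_on {0..} y2"
  by (rule has_vector_derivative_imp_continuous_on[OF psolD(1)[OF assms]] has_vector_derivative_imp_continuous_on[OF psolD(2)[OF assms]], simp)+

lemma psol_dirac:
  assumes v: "\<And>x. 0 \<le> x \<Longrightarrow> v x \<in> carrier_mat m1 m2"
    and car: "\<And>x. 0 \<le> x \<Longrightarrow> y1 x \<in> carr m1 k" "\<And>x. 0 \<le> x \<Longrightarrow> y2 x \<in> carr m2 k"
    and sol: "psol (\<lambda>x. emb (v x)) z y1 y2"
  shows "dirac_solution m1 m2 v z k (\<lambda>x. unemb (m1 + m2) k (y1 x + shift m1 m2 * y2 x))"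
  unfolding dirac_solution_def
proof (intro conjI allI impI)
  fix x :: real and i l assume x: "0 \<le> x" and il: "i < m1 + m2" "l < k"
  let ?y = "\<lambda>x. unemb (m1 + m2) k (y1 x + shift m1 m2 * y2 x)"
  let ?D = "\<i> \<cdot>\<^sub>m ((z \<cdot>\<^sub>m dirac_j m1 m2 + dirac_j m1 m2 * dirac_V m1 m2 (v x)) * ?y x)"
  let ?a = "\<i> *\<^sub>c (z *\<^sub>c y1 x + emb (v x) * y2 x)"
  let ?b = "(- \<i>) *\<^sub>c (z *\<^sub>c y2 x + adj (emb (v x)) * y1 x)"
  have ab: "?a \<in> carr m1 k" "?b \<in> carr m2 k" by (blast intro: carr_intros emb_carr v[OF x] car x)+
  note D = emb_dirac_rhs[OF v[OF x] unemb_carrier(1) emb_unemb[OF stack_carr[OF car[OF x]]] car[OF x], of z]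
  have Dil: "?D $$ (i, l) = (if i < m1 then ent ?a i l else ent ?b (i - m1) l)"
    using ent_emb_carrier[OF D(2) il] unfolding D(1) by (simp only: ent_stack[OF ab])
  have yil: "?y t $$ (i, l) = (if i < m1 then ent (y1 t) i l else ent (y2 t) (i - m1) l)" if "0 \<le> t" for t
    using il ent_stack[OF car[OF that], of i l] by simp
  have "((\<lambda>t. if i < m1 then ent (y1 t) i l else ent (y2 t) (i - m1) l) has_vector_derivative ?D $$ (i, l)) (at x within {0..})"
    unfolding Dil using ent_has_vector_derivative[OF psolD(1)[OF sol x]] ent_has_vector_derivative[OF psolD(2)[OF sol x]] by simp
  then show "((\<lambda>t. ?y t $$ (i, l)) has_vector_derivative ?D $$ (i, l)) (at x within {0..})"
    by (rule has_vector_derivative_transform[rotated 2]) (use x yil in auto)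
qed simp

lemma dirac_psol:
  assumes v: "\<And>x. 0 \<le> x \<Longrightarrow> v x \<in> carrier_mat m1 m2" and sol: "dirac_solution m1 m2 v z k y"
  shows "\<exists>y1 y2. (\<forall>x. y1 x \<in> carr m1 k) \<and> (\<forall>x. y2 x \<in> carr m2 k) \<and> psol (\<lambda>x. emb (v x)) z y1 y2 \<and>
    (\<forall>x\<ge>0. emb (y x) = y1 x + shift m1 m2 * y2 x)"
proof -
  define y1 where "y1 = (\<lambda>x. trunc m1 k (\<lambda>i j. y x $$ (i, j)))"
  define y2 where "y2 = (\<lambda>x. trunc m2 k (\<lambda>i j. y x $$ (i + m1, j)))"
  have car: "y1 x \<in> carr m1 k" "y2 x \<in> carr m2 k" for x by (simp_all add: y1_def y2_def)
  have ycar: "y x \<in> carrier_mat (m1 + m2) k" if "0 \<le> x" for x using sol that by (simp add: dirac_solution_def)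
  have eq: "emb (y x) = y1 x + shift m1 m2 * y2 x" if "0 \<le> x" for x
  proof (rule pmat_eqI)
    fix i j show "ent (emb (y x)) i j = ent (y1 x + shift m1 m2 * y2 x) i j"
      unfolding ent_stack[OF car] using ycar[OF that] by (auto simp: ent_emb y1_def y2_def trunc.rep_eq)
  qed
  have "psol (\<lambda>x. emb (v x)) z y1 y2"
    unfolding psol_def
  proof (intro allI impI)
    fix x :: real assume x: "0 \<le> x"
    let ?D = "\<i> \<cdot>\<^sub>m ((z \<cdot>\<^sub>m dirac_j m1 m2 + dirac_j m1 m2 * dirac_V m1 m2 (v x)) * y x)"
    let ?a = "\<i> *\<^sub>c (z *\<^sub>c y1 x + emb (v x) * y2 x)"
    let ?b = "(- \<i>) *\<^sub>c (z *\<^sub>c y2 x + adj (emb (v x)) * y1 x)"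
    have ab: "?a \<in> carr m1 k" "?b \<in> carr m2 k" by (blast intro: carr_intros emb_carr v[OF x] car)+
    note D = emb_dirac_rhs[OF v[OF x] ycar[OF x] eq[OF x] car, of z]
    have Dil: "?D $$ (i, l) = (if i < m1 then ent ?a i l else ent ?b (i - m1) l)" if "i < m1 + m2" "l < k" for i l
      using ent_emb_carrier[OF D(2) that] unfolding D(1) by (simp only: ent_stack[OF ab])
    have d: "((\<lambda>t. y t $$ (i, l)) has_vector_derivative ?D $$ (i, l)) (at x within {0..})" if "i < m1 + m2" "l < k" for i l
      using sol x that unfolding dirac_solution_def by blast
    show "(y1 has_vector_derivative ?a) (at x within {0..}) \<and> (y2 has_vector_derivative ?b) (at x within {0..})"
    proof
      show "(y1 has_vector_derivative ?a) (at x within {0..})"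
      proof (rule has_vector_derivative_pmat[OF car(1) ab(1)])
        fix i l assume "i < m1" "l < k"
        then show "((\<lambda>x. ent (y1 x) i l) has_vector_derivative ent ?a i l) (at x within {0..})"
          using d[of i l] Dil[of i l] by (simp add: y1_def trunc.rep_eq)
      qed
      show "(y2 has_vector_derivative ?b) (at x within {0..})"
      proof (rule has_vector_derivative_pmat[OF car(2) ab(2)])
        fix i l assume "i < m2" "l < k"
        then show "((\<lambda>x. ent (y2 x) i l) has_vector_derivative ent ?b i l) (at x within {0..})"
          using d[of "i + m1" l] Dil[of "i + m1" l] by (simp add: y2_def trunc.rep_eq)
      qed
    qed
  qed
  then show ?thesis using car eq by blast
qed

lemma stack_inj:
  assumes "X + shift p q * W = X' + shift p q * W'" "X \<in> carr p k" "X' \<in> carr p k" "W \<in> carr q k" "W' \<in> carr q k"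
  shows "X = X'" "W = W'"
proof -
  have e: "(if i < p then ent X i l else ent W (i - p) l) = (if i < p then ent X' i l else ent W' (i - p) l)" for i l
    using assms(1) ent_stack[OF assms(2,4)] ent_stack[OF assms(3,5)] by metis
  show "X = X'" using e assms by (intro carr_eqI[of _ p k]) metis+
  show "W = W'"
  proof (rule carr_eqI[OF assms(4,5)])
    fix i j show "ent W i j = ent W' i j" using e[of "i + p" j] by simp
  qed
qed

lemma emb_blocks:
  assumes "Y \<in> carrier_mat (m1 + m2) k" "emb Y = X + shift m1 m2 * W" "X \<in> carr m1 k" "W \<in> carr m2 k"
  shows "emb (upper_block m1 Y) = X" "emb (lower_block m1 Y) = W"
    "upper_block m1 Y \<in> carrier_mat m1 k" "lower_block m1 Y \<in> carrier_mat m2 k"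
proof -
  show car: "upper_block m1 Y \<in> carrier_mat m1 k" "lower_block m1 Y \<in> carrier_mat m2 k"
    using assms(1) by (auto simp: upper_block_def lower_block_def)
  have Y: "Y $$ (i, j) = (if i < m1 then ent X i j else ent W (i - m1) j)" if "i < m1 + m2" "j < k" for i j
    using ent_emb_carrier[OF assms(1) that] unfolding assms(2) ent_stack[OF assms(3,4)] by simp
  show "emb (upper_block m1 Y) = X"
  proof (rule carr_eqI[OF emb_carr[OF car(1)] assms(3)])
    fix i j assume "i < m1" "j < k"
    then show "ent (emb (upper_block m1 Y)) i j = ent X i j"
      using Y[of i j] assms(1) by (simp add: ent_emb_carrier[OF car(1)]) (simp add: upper_block_def)
  qed
  show "emb (lower_block m1 Y) = W"
  proof (rule carr_eqI[OF emb_carr[OF car(2)] assms(4)])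
    fix i j assume "i < m2" "j < k"
    then show "ent (emb (lower_block m1 Y)) i j = ent W i j"
      using Y[of "i + m1" j] assms(1) by (simp add: ent_emb_carrier[OF car(2)]) (simp add: lower_block_def)
  qed
qed

lemma adj_stack_mult:
  assumes "X \<in> carr p k" "W \<in> carr q k" "X' \<in> carr p l" "W' \<in> carr q l"
  shows "adj (X + shift p q * W) * (X' + shift p q * W') = adj X * X' + adj W * W'"
proof -
  have "adj (X + shift p q * W) * (X' + shift p q * W') =
     adj X * X' + (adj X * shift p q) * W' + adj W * (adj (shift p q) * X') + adj W * (adj (shift p q) * shift p q) * W'"
    by (simp add: algebra_simps)
  then show ?thesis
    using assms mult_shift[OF carr_simps(7)[OF assms(1)]] shift_mult[OF assms(3)]
    by (simp add: adj_shift_mult_shift mult.assoc)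
qed

text \<open>Supplies the columns with initial value \<open>[0; I]\<close>, which complete the
  explicit decaying solution to a fundamental matrix. The two block rows are joined into one
  coefficient matrix \<open>M\<close> for Picard iteration and separated again afterwards.\<close>

lemma dirac_fundamental:
  assumes vc: "continuous_on {0..} v" and vcar: "\<And>x. 0 \<le> x \<Longrightarrow> v x \<in> carr m1 m2"
    and vb: "\<And>x. 0 \<le> x \<Longrightarrow> norm (v x) \<le> K" and U0: "U1 \<in> carr m1 k" "U2 \<in> carr m2 k"
  shows "\<exists>y1 y2. (\<forall>x. y1 x \<in> carr m1 k) \<and> (\<forall>x. y2 x \<in> carr m2 k) \<and> psol v z y1 y2 \<and> y1 0 = U1 \<and> y2 0 = U2"
proof -
  let ?s = "shift m1 m2"
  let ?m = "m1 + m2"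
  define M where "M = (\<lambda>x. (\<i> * z) *\<^sub>c idm m1 + \<i> *\<^sub>c (v x * adj ?s) - \<i> *\<^sub>c (?s * adj (v x)) - (\<i> * z) *\<^sub>c (?s * adj ?s))"
  have sub: "P \<in> carr m1 q \<Longrightarrow> P \<in> carr ?m q" "P \<in> carr q m1 \<Longrightarrow> P \<in> carr q ?m" for P q by (auto simp: carr_def)
  have Mcar: "M x \<in> carr ?m ?m" if "0 \<le> x" for x
  proof -
    have "idm m1 \<in> carr ?m ?m" by (auto simp: carr_def idm.rep_eq)
    moreover have "v x * adj ?s \<in> carr ?m ?m" by (rule sub(1)) (blast intro: carr_intros shift_carr vcar that)
    moreover have "?s * adj (v x) \<in> carr ?m ?m" by (rule sub(2)) (blast intro: carr_intros shift_carr vcar that)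
    moreover have "?s * adj ?s \<in> carr ?m ?m" by (blast intro: carr_intros shift_carr)
    ultimately show ?thesis unfolding M_def by (intro carr_simps)
  qed
  have Mc: "continuous_on {0..} M" unfolding M_def
    by (intro continuous_intros vc bounded_linear.continuous_on[OF bounded_linear_adj]
        bounded_linear.continuous_on[OF bounded_bilinear.bounded_linear_right[OF bounded_bilinear_cscale]])
  define KM where "KM = cmod z * norm (idm m1) + K * norm ?s + norm ?s * K + cmod z * norm (?s * adj ?s)"
  have Mb: "norm (M x) \<le> KM" if x: "0 \<le> x" for x
  proof -
    have "norm (v x * adj ?s) \<le> K * norm ?s" "norm (?s * adj (v x)) \<le> norm ?s * K"
      using norm_mult_ineq[of "v x" "adj ?s"] norm_mult_ineq[of ?s "adj (v x)"] mult_right_mono[OF vb[OF x], of "norm ?s"]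
        mult_left_mono[OF vb[OF x], of "norm ?s"] by auto
    then show ?thesis unfolding M_def KM_def
      by (intro order.trans[OF norm_triangle_ineq4] add_mono order.trans[OF norm_triangle_ineq]) (auto simp: norm_mult)
  qed
  obtain U where U: "\<And>x. U x \<in> carr ?m k" "U 0 = U1 + ?s * U2"
    "\<And>x. 0 \<le> x \<Longrightarrow> (U has_vector_derivative M x * U x) (at x within {0..})"
    using picard[OF Mc Mcar Mb stack_carr[OF U0]] by blast
  have idm': "idm m1 \<in> carr m1 ?m" by (auto simp: carr_def idm.rep_eq)
  have as: "adj ?s \<in> carr m2 ?m" using shift_carr by simp
  define y1 where "y1 = (\<lambda>x. idm m1 * U x)"
  define y2 where "y2 = (\<lambda>x. adj ?s * U x)"
  have car: "y1 x \<in> carr m1 k" "y2 x \<in> carr m2 k" for x unfolding y1_def y2_def by (blast intro: carr_intros idm' as U)+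
  have as_idm: "adj ?s * idm m1 = 0" using arg_cong[OF idm_mult_shift[of m1 m2], of adj] by simp
  have d1: "idm m1 * (M x * U x) = \<i> *\<^sub>c (z *\<^sub>c y1 x + v x * y2 x)" if x: "0 \<le> x" for x
  proof -
    have "idm m1 * (M x * U x) = (\<i> * z) *\<^sub>c (idm m1 * idm m1 * U x) + \<i> *\<^sub>c ((idm m1 * v x) * (adj ?s * U x))
       - \<i> *\<^sub>c ((idm m1 * ?s) * adj (v x) * U x) - (\<i> * z) *\<^sub>c ((idm m1 * ?s) * adj ?s * U x)"
      by (simp add: M_def algebra_simps)
    then show ?thesis using vcar[OF x] idm_mult[OF carr_simps(8), of m1]
      by (simp only: idm_mult_shift) (simp add: y1_def y2_def cscale_distribs)
  qed
  have d2: "adj ?s * (M x * U x) = (- \<i>) *\<^sub>c (z *\<^sub>c y2 x + adj (v x) * y1 x)" if x: "0 \<le> x" for x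
  proof -
    have "adj ?s * (M x * U x) = (\<i> * z) *\<^sub>c ((adj ?s * idm m1) * U x) + \<i> *\<^sub>c ((adj ?s * v x) * (adj ?s * U x))
       - \<i> *\<^sub>c ((adj ?s * ?s) * adj (v x) * U x) - (\<i> * z) *\<^sub>c ((adj ?s * ?s) * adj ?s * U x)"
      by (simp add: M_def algebra_simps)
    also have "\<dots> = - (\<i> *\<^sub>c (adj (v x) * U x)) - (\<i> * z) *\<^sub>c (adj ?s * U x)"
      using vcar[OF x] as by (simp add: as_idm shift_mult[OF vcar[OF x]] adj_shift_mult_shift)
    also have "adj (v x) * U x = adj (v x) * y1 x" using vcar[OF x] by (simp add: y1_def)
    also have "- (\<i> *\<^sub>c (adj (v x) * y1 x)) - (\<i> * z) *\<^sub>c (adj ?s * U x) = (- \<i>) *\<^sub>c (z *\<^sub>c y2 x + adj (v x) * y1 x)"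
      by (intro pmat_eqI) (simp add: y2_def algebra_simps)
    finally show ?thesis .
  qed
  have "psol v z y1 y2" unfolding psol_def
  proof (intro allI impI conjI)
    fix x :: real assume x: "0 \<le> x"
    have "(y1 has_vector_derivative idm m1 * (M x * U x) + 0 * U x) (at x within {0..})"
      unfolding y1_def by (intro has_vector_derivative_mult has_vector_derivative_const U(3) x)
    then show "(y1 has_vector_derivative \<i> *\<^sub>c (z *\<^sub>c y1 x + v x * y2 x)) (at x within {0..})"
      by (simp only: d1[OF x] mult_zero_left add_0_right)
    have "(y2 has_vector_derivative adj ?s * (M x * U x) + 0 * U x) (at x within {0..})"
      unfolding y2_def by (intro has_vector_derivative_mult has_vector_derivative_const U(3) x)
    then show "(y2 has_vector_derivative (- \<i>) *\<^sub>c (z *\<^sub>c y2 x + adj (v x) * y1 x)) (at x within {0..})"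
      by (simp only: d2[OF x] mult_zero_left add_0_right)
  qed
  moreover have "y1 0 = U1" "y2 0 = U2"
    using U0 by (simp_all add: y1_def y2_def U(2) distrib_left mult.assoc[symmetric] idm_mult_shift
        adj_shift_mult_shift shift_mult[OF U0(1)])
  ultimately show ?thesis using car by blast
qed

lemma continuous_tendsto_bounded:
  fixes f :: "real \<Rightarrow> pmat"
  assumes "continuous_on {0..} f" "(f \<longlongrightarrow> l) at_top"
  shows "\<exists>K. \<forall>x\<ge>0. norm (f x) \<le> K"
proof -
  have "((\<lambda>x. norm (f x)) \<longlongrightarrow> norm l) at_top" by (intro tendsto_intros assms)
  then have "\<forall>\<^sub>F x in at_top. norm (f x) < norm l + 1" by (rule order_tendstoD) simp
  then obtain b where b: "\<And>x. b \<le> x \<Longrightarrow> norm (f x) < norm l + 1" by (auto simp: eventually_at_top_linorder)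
  have "compact ((\<lambda>x. norm (f x)) ` {0..b})"
    by (intro compact_continuous_image continuous_intros continuous_on_subset[OF assms(1)]) auto
  then have "bdd_above ((\<lambda>x. norm (f x)) ` {0..b})" by (intro bounded_imp_bdd_above compact_imp_bounded)
  then obtain K where K: "\<And>x. x \<in> {0..b} \<Longrightarrow> norm (f x) \<le> K" unfolding bdd_above_def by blast
  have "norm (f x) \<le> max K (norm l + 1)" if "0 \<le> x" for x
    using K[of x] b[of x] that by (cases "x \<le> b") auto
  then show ?thesis by blast
qed

section \<open>Jost solutions\<close>

context gbdt
begin

lemma w_psol: "z *\<^sub>c L - A * L = t1 * G0 \<Longrightarrow> psol v z (w1 z G0 L) (w2 z L)"
  using w_solution by (simp add: psol_def)

lemma w_car: assumes "0 \<le> x" "L \<in> carr n q" "G0 \<in> carr k1 q"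
  shows "w1 z G0 L x \<in> carr k1 q" "w2 z L x \<in> carr k2 q"
  unfolding w1_def w2_def by (blast intro: carr_intros t1 Pi_car E_car assms)+

lemma Pi_cont: "continuous_on {0..} Pi" by (rule has_vector_derivative_imp_continuous_on[OF Pi_deriv])

lemma w_eq:
  assumes "z *\<^sub>c L - A * L = t1 * G0"
  shows "z *\<^sub>c (g *\<^sub>c (e x * L)) - A * (g *\<^sub>c (e x * L)) = L1 x * (g *\<^sub>c G0) + L2 x * 0"
proof -
  have "z *\<^sub>c (g *\<^sub>c (e x * L)) - A * (g *\<^sub>c (e x * L)) = g *\<^sub>c (e x * (z *\<^sub>c L - A * L))"
    by (simp add: algebra_simps cscale_distribs) (simp add: mult.assoc[symmetric] e_commute)
  then show ?thesis unfolding assms by (simp add: L1_e mult.assoc)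
qed

lemma exp_unit: "cnj (exp (\<i> * complex_of_real z * complex_of_real x)) * exp (\<i> * complex_of_real z * complex_of_real x) = 1"
  by (simp add: exp_cnj mult_exp_exp)

lemma w_j_form:
  assumes "complex_of_real z *\<^sub>c L - A * L = t1 * G0" "0 \<le> x"
  shows "adj (w1 z G0 L x) * w1 z G0 L x - adj (w2 z L x) * w2 z L x = adj G0 * G0"
proof -
  define h where "h = exp (\<i> * complex_of_real z * of_real x)"
  have u: "h * cnj h = 1" using exp_unit[of z x] by (simp add: h_def mult.commute)
  show ?thesis
    using j_form[OF assms(2) w_eq[OF assms(1)] w_eq[OF assms(1)], of h h]
    unfolding w_shape[OF assms(2)] h_def[symmetric] by (simp add: u mult.commute)
qed

lemma w_tendsto:
  "\<exists>P. P \<in> carr n n \<and> (\<forall>z G0 L. ((\<lambda>x. exp (- (\<i> * z * of_real x)) *\<^sub>c w1 z G0 L x) \<longlongrightarrow> G0 + \<i> *\<^sub>c (adj t1 * P * L)) at_top)"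
proof -
  obtain P where P: "P \<in> carr n n" "(Pi \<longlongrightarrow> P) at_top" using Pi_tendsto by blast
  have "exp (- (\<i> * z * of_real x)) *\<^sub>c w1 z G0 L x = G0 + \<i> *\<^sub>c (adj t1 * Pi x * L)" for z G0 L x
    by (simp add: w1_def mult_exp_exp)
  then show ?thesis using P by (intro exI[of _ P]) (auto intro!: tendsto_intros)
qed

lemma w2_tendsto: "((\<lambda>x. norm (w2 (complex_of_real z) L x)) \<longlongrightarrow> 0) at_top"
proof -
  have "((\<lambda>x. norm (adj (E x) * L)) \<longlongrightarrow> norm (adj 0 * L)) at_top" by (intro tendsto_intros E_tendsto)
  then show ?thesis using tendsto_mult_right_zero[of "\<lambda>x. norm (adj (E x) * L)"] by (simp add: w2_def norm_mult)
qed

text \<open>For real \<open>z\<close> the difference of the squares of \<open>w1\<close> and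
  \<open>w2\<close> stays equal to the identity, and \<open>w2\<close> tends to 0. The limit
  \<open>c\<close> is therefore an isometry, and being square it is unitary.\<close>

lemma w_limit_unitary:
  assumes L: "complex_of_real z *\<^sub>c L - A * L = t1 * idm k1" and Lc: "L \<in> carr n k1" and P: "P \<in> carr n n"
    and lim: "((\<lambda>x. exp (- (\<i> * complex_of_real z * of_real x)) *\<^sub>c w1 (complex_of_real z) (idm k1) L x) \<longlongrightarrow> idm k1 + \<i> *\<^sub>c (adj t1 * P * L)) at_top"
  defines "c \<equiv> idm k1 + \<i> *\<^sub>c (adj t1 * P * L)"
  shows "inv_of k1 c (adj c)"
proof -
  let ?N = "\<lambda>x. exp (- (\<i> * complex_of_real z * of_real x)) *\<^sub>c w1 (complex_of_real z) (idm k1) L x"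
  have u: "cnj (exp (- (\<i> * complex_of_real z * of_real x))) * exp (- (\<i> * complex_of_real z * of_real x)) = 1" for x :: real
    by (simp add: exp_cnj mult_exp_exp)
  have eq: "adj (?N x) * ?N x - adj (w2 z L x) * w2 z L x = idm k1" if "0 \<le> x" for x
  proof -
    define h where "h = exp (- (\<i> * complex_of_real z * of_real x))"
    have h: "h * cnj h = 1" using u[of x] by (simp add: h_def mult.commute)
    show ?thesis using w_j_form[OF L that] unfolding h_def[symmetric] by (simp add: h mult.commute idm_mult[OF carr_simps(8)])
  qed
  have w2: "(w2 (complex_of_real z) L \<longlongrightarrow> 0) at_top" using w2_tendsto tendsto_norm_zero_iff by blast
  have "((\<lambda>x. adj (?N x) * ?N x - adj (w2 z L x) * w2 z L x) \<longlongrightarrow> adj c * c - adj 0 * 0) at_top"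
    unfolding c_def by (intro tendsto_intros lim w2)
  moreover have "\<forall>\<^sub>F x in at_top. adj (?N x) * ?N x - adj (w2 z L x) * w2 z L x = idm k1"
    using eventually_ge_at_top[of 0] by eventually_elim (rule eq)
  ultimately have "((\<lambda>x::real. idm k1) \<longlongrightarrow> adj c * c - adj 0 * 0) at_top" by (rule Lim_transform_eventually)
  then have cc: "adj c * c = idm k1" by (simp add: tendsto_const_iff)
  have c: "c \<in> carr k1 k1" unfolding c_def by (blast intro: carr_intros t1 P Lc)
  have "\<exists>B. inv_of k1 c B"
  proof (rule inv_of_exists[OF c])
    fix w assume w: "w \<in> colv k1" "c * w = 0"
    have "adj c * (c * w) = w" using w(1) by (simp add: mult.assoc[symmetric] cc)
    then show "w = 0" using w(2) by simp
  qed
  then obtain B where B: "inv_of k1 c B" ..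
  have "adj c = adj c * (c * B)" using inv_ofD[OF B] c by simp
  also have "\<dots> = adj c * c * B" by (simp only: mult.assoc)
  also have "\<dots> = B" unfolding cc using inv_ofD[OF B] by simp
  finally show ?thesis using B by simp
qed

text \<open>The left block column comes from the data themselves, the right one from the exchanged
  data at \<open>- z\<close>. Each is normalized at infinity by the adjoint of its unitary limit.
  The three \<open>j\<close> relations carry the invertibility of the whole solution.\<close>

lemma jost_blocks:
  fixes z :: real
  assumes G: "inv_of n (complex_of_real z *\<^sub>c idm n - A) G"
  obtains f11 f12 f21 f22 c d where "psol v z f11 f21" "psol v z f12 f22" "inv_of k1 d c"
    "\<And>x. 0 \<le> x \<Longrightarrow> f11 x \<in> carr k1 k1" "\<And>x. 0 \<le> x \<Longrightarrow> f21 x \<in> carr k2 k1"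
    "\<And>x. 0 \<le> x \<Longrightarrow> f12 x \<in> carr k1 k2" "\<And>x. 0 \<le> x \<Longrightarrow> f22 x \<in> carr k2 k2"
    "\<And>x. 0 \<le> x \<Longrightarrow> adj (f11 x) * f11 x - adj (f21 x) * f21 x = idm k1"
    "\<And>x. 0 \<le> x \<Longrightarrow> adj (f11 x) * f12 x - adj (f21 x) * f22 x = 0"
    "\<And>x. 0 \<le> x \<Longrightarrow> adj (f22 x) * f22 x - adj (f12 x) * f12 x = idm k2"
    "f11 0 = (idm k1 + \<i> *\<^sub>c (adj t1 * T 0 * (G * t1))) * c" "f21 0 = ((- \<i>) *\<^sub>c (adj (E 0) * (G * t1))) * c"
    "((\<lambda>x. exp (- (\<i> * z * of_real x)) *\<^sub>c f11 x) \<longlongrightarrow> idm k1) at_top" "(f21 \<longlongrightarrow> 0) at_top"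
    "(f12 \<longlongrightarrow> 0) at_top" "((\<lambda>x. exp (\<i> * z * of_real x) *\<^sub>c f22 x) \<longlongrightarrow> idm k2) at_top"
proof -
  interpret sw: gbdt n k2 k1 "- A" t2 t1 S by (rule swap)
  note g = inv_ofD[OF G]
  define L where "L = G * t1"
  \<comment> \<open>The inverse of \<open>- z - (- A)\<close> is \<open>- G\<close>, hence the
    sign.\<close>
  define M where "M = - (G * t2)"
  have Lc: "L \<in> carr n k1" and Mc: "M \<in> carr n k2" unfolding L_def M_def by (blast intro: carr_intros g t1 t2)+
  have L: "complex_of_real z *\<^sub>c L - A * L = t1 * idm k1"
    using inv_of_cancel(1)[OF G t1] g t1 by (simp add: L_def left_diff_distrib)
  have M: "complex_of_real (- z) *\<^sub>c M - (- A) * M = t2 * idm k2"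
    using inv_of_cancel(1)[OF G t2] g t2 by (simp add: M_def left_diff_distrib cscale_distribs)
  obtain P where P: "P \<in> carr n n" "\<And>z G0 L. ((\<lambda>x. exp (- (\<i> * z * of_real x)) *\<^sub>c w1 z G0 L x) \<longlongrightarrow> G0 + \<i> *\<^sub>c (adj t1 * P * L)) at_top"
    using w_tendsto by blast
  obtain P' where P': "P' \<in> carr n n" "\<And>z G0 L. ((\<lambda>x. exp (- (\<i> * z * of_real x)) *\<^sub>c sw.w1 z G0 L x) \<longlongrightarrow> G0 + \<i> *\<^sub>c (adj t2 * P' * L)) at_top"
    using sw.w_tendsto by blast
  define d where "d = idm k1 + \<i> *\<^sub>c (adj t1 * P * L)"
  define d' where "d' = idm k2 + \<i> *\<^sub>c (adj t2 * P' * M)"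
  have d: "inv_of k1 d (adj d)" unfolding d_def by (rule w_limit_unitary[OF L Lc P(1) P(2)])
  have d': "inv_of k2 d' (adj d')" unfolding d'_def by (rule sw.w_limit_unitary[OF M Mc P'(1) P'(2)])
  note dd = inv_ofD[OF d] inv_ofD[OF d']
  define f11 where "f11 = (\<lambda>x. w1 z (idm k1) L x * adj d)"
  define f21 where "f21 = (\<lambda>x. w2 z L x * adj d)"
  define f22 where "f22 = (\<lambda>x. sw.w1 (complex_of_real (- z)) (idm k2) M x * adj d')"
  define f12 where "f12 = (\<lambda>x. sw.w2 (complex_of_real (- z)) M x * adj d')"
  have sol1: "psol v z f11 f21" unfolding f11_def f21_def by (rule psol_mult[OF w_psol[OF L]])
  have "psol v z (sw.w2 (complex_of_real (- z)) M) (sw.w1 (complex_of_real (- z)) (idm k2) M)"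
    unfolding psol_def
  proof (intro allI impI conjI)
    fix x :: real assume x: "0 \<le> x"
    note s = sw.w_solution[OF M x] swap_simps(3)[OF x]
    show "(sw.w2 (complex_of_real (- z)) M has_vector_derivative
      \<i> *\<^sub>c (z *\<^sub>c sw.w2 (complex_of_real (- z)) M x + v x * sw.w1 (complex_of_real (- z)) (idm k2) M x)) (at x within {0..})"
      using s(2) unfolding s(3) by (simp add: cscale_distribs)
    show "(sw.w1 (complex_of_real (- z)) (idm k2) M has_vector_derivative
      (- \<i>) *\<^sub>c (z *\<^sub>c sw.w1 (complex_of_real (- z)) (idm k2) M x + adj (v x) * sw.w2 (complex_of_real (- z)) M x)) (at x within {0..})"
      using s(1) unfolding s(3) by (simp add: cscale_distribs)
  qed
  then have sol2: "psol v z f12 f22" unfolding f12_def f22_def by (rule psol_mult)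
  have car: "f11 x \<in> carr k1 k1 \<and> f21 x \<in> carr k2 k1 \<and> f12 x \<in> carr k1 k2 \<and> f22 x \<in> carr k2 k2" if x: "0 \<le> x" for x
    unfolding f11_def f12_def f21_def f22_def
    using w_car[OF x Lc carr_simps(8)] sw.w_car[OF x Mc carr_simps(8)] dd by (blast intro: carr_intros)
  have j: "adj (f11 x) * f11 x - adj (f21 x) * f21 x = idm k1 \<and> adj (f11 x) * f12 x - adj (f21 x) * f22 x = 0 \<and>
       adj (f22 x) * f22 x - adj (f12 x) * f12 x = idm k2" if x: "0 \<le> x" for x
  proof (intro conjI)
    have "adj (f11 x) * f11 x - adj (f21 x) * f21 x = d * (adj (w1 z (idm k1) L x) * w1 z (idm k1) L x - adj (w2 z L x) * w2 z L x) * adj d"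
      by (simp add: f11_def f21_def algebra_simps)
    also have "\<dots> = idm k1" unfolding w_j_form[OF L x] using dd by simp
    finally show "adj (f11 x) * f11 x - adj (f21 x) * f21 x = idm k1" .
    have "adj (f22 x) * f22 x - adj (f12 x) * f12 x = d' * (adj (sw.w1 (complex_of_real (- z)) (idm k2) M x) * sw.w1 (complex_of_real (- z)) (idm k2) M x
        - adj (sw.w2 (complex_of_real (- z)) M x) * sw.w2 (complex_of_real (- z)) M x) * adj d'"
      by (simp add: f12_def f22_def algebra_simps)
    also have "\<dots> = idm k2" unfolding sw.w_j_form[OF M x] using dd by simp
    finally show "adj (f22 x) * f22 x - adj (f12 x) * f12 x = idm k2" .
    let ?h = "exp (\<i> * complex_of_real (- z) * of_real x)"
    \<comment> \<open>The exchanged solution is read as a solution for the original data with free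
      part \<open>[0; h I]\<close>, so that both arguments of \<open>j_form\<close> refer to the
      same data.\<close>
    let ?m = "- (?h *\<^sub>c (sw.e x * M))"
    have m: "complex_of_real z *\<^sub>c ?m - A * ?m = L1 x * 0 + L2 x * (?h *\<^sub>c idm k2)"
      using sw.w_eq[OF M, of ?h x] unfolding swap_simps(1,2)[OF x] by (simp add: cscale_uminus)
    have "adj (w1 z (idm k1) L x) * sw.w2 (complex_of_real (- z)) M x - adj (w2 z L x) * sw.w1 (complex_of_real (- z)) (idm k2) M x = 0"
    proof -
      have 1: "sw.w2 (complex_of_real (- z)) M x = 0 + \<i> *\<^sub>c (adj (L1 x) * T x * ?m)"
        "sw.w1 (complex_of_real (- z)) (idm k2) M x = ?h *\<^sub>c idm k2 - \<i> *\<^sub>c (adj (L2 x) * T x * ?m)"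
        unfolding sw.w_shape[OF x] swap_simps(1,2)[OF x] by (simp_all add: cscale_uminus)
      show ?thesis unfolding 1 w_shape[OF x]
        unfolding j_form[OF x w_eq[OF L, of "exp (\<i> * complex_of_real z * of_real x)"] m] by simp
    qed
    moreover have "adj (f11 x) * f12 x - adj (f21 x) * f22 x =
       d * (adj (w1 z (idm k1) L x) * sw.w2 (complex_of_real (- z)) M x - adj (w2 z L x) * sw.w1 (complex_of_real (- z)) (idm k2) M x) * adj d'"
      by (simp add: f11_def f21_def f12_def f22_def algebra_simps)
    ultimately show "adj (f11 x) * f12 x - adj (f21 x) * f22 x = 0" by simp
  qed
  have "((\<lambda>x. (exp (- (\<i> * z * of_real x)) *\<^sub>c w1 z (idm k1) L x) * adj d) \<longlongrightarrow> d * adj d) at_top"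
    unfolding d_def by (intro tendsto_intros P(2))
  then have l11: "((\<lambda>x. exp (- (\<i> * z * of_real x)) *\<^sub>c f11 x) \<longlongrightarrow> idm k1) at_top"
    using dd by (simp add: f11_def)
  have "((\<lambda>x. (exp (- (\<i> * complex_of_real (- z) * of_real x)) *\<^sub>c sw.w1 (complex_of_real (- z)) (idm k2) M x) * adj d') \<longlongrightarrow> d' * adj d') at_top"
    unfolding d'_def by (intro tendsto_intros P'(2))
  then have l22: "((\<lambda>x. exp (\<i> * z * of_real x) *\<^sub>c f22 x) \<longlongrightarrow> idm k2) at_top"
    using dd by (simp add: f22_def)
  have "(w2 (complex_of_real z) L \<longlongrightarrow> 0) at_top" "(sw.w2 (complex_of_real (- z)) M \<longlongrightarrow> 0) at_top"
    using w2_tendsto sw.w2_tendsto tendsto_norm_zero_iff by blast+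
  then have l0: "(f21 \<longlongrightarrow> 0) at_top" "(f12 \<longlongrightarrow> 0) at_top"
    unfolding f21_def f12_def using tendsto_mult[OF _ tendsto_const] by force+
  have "Pi 0 = T 0" using T_car[of 0] by (simp add: Pi_def e_0)
  then have init: "f11 0 = (idm k1 + \<i> *\<^sub>c (adj t1 * T 0 * (G * t1))) * adj d" "f21 0 = ((- \<i>) *\<^sub>c (adj (E 0) * (G * t1))) * adj d"
    by (simp_all add: f11_def f21_def w1_def w2_def L_def)
  show thesis
    by (rule that[OF sol1 sol2 d]) (use car j init l11 l0 l22 in \<open>simp_all only: conj_assoc\<close>)
qed

end

section \<open>The recovered system\<close>

text \<open>\<open>j\<close> is the difference of two complementary projections, so the powers of
  \<open>t j\<close> are \<open>t^k\<close> on one range and \<open>(- t)^k\<close> on the other,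
  and the exponential series separates.\<close>

lemma emb_mat_exp_dirac_j:
  "emb (mat_exp (t \<cdot>\<^sub>m dirac_j m1 m2)) = exp t *\<^sub>c idm m1 + exp (- t) *\<^sub>c (shift m1 m2 * adj (shift m1 m2))"
  "mat_exp (t \<cdot>\<^sub>m dirac_j m1 m2) \<in> carrier_mat (m1 + m2) (m1 + m2)"
proof -
  let ?m = "m1 + m2"
  let ?s = "shift m1 m2"
  let ?J = "idm m1 - ?s * adj ?s"
  have M: "t \<cdot>\<^sub>m dirac_j m1 m2 \<in> carrier_mat ?m ?m" using dirac_j_carrier by simp
  show "mat_exp (t \<cdot>\<^sub>m dirac_j m1 m2) \<in> carrier_mat ?m ?m" by (rule emb_mat_exp(2)[OF M])
  have JJ: "?J * (x *\<^sub>c idm m1 + y *\<^sub>c (?s * adj ?s)) = x *\<^sub>c idm m1 - y *\<^sub>c (?s * adj ?s)" for x y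
  proof -
    have *: "(P - Q) * (x *\<^sub>c P + y *\<^sub>c Q) = x *\<^sub>c (P * P) + y *\<^sub>c (P * Q) - x *\<^sub>c (Q * P) - y *\<^sub>c (Q * Q)" for P Q :: pmat
      by (simp add: algebra_simps cscale_distribs)
    show ?thesis unfolding * shift_projections(1-4) by simp
  qed
  have pow: "papply (t *\<^sub>c ?J) k (idm ?m) = t ^ k *\<^sub>c idm m1 + (- t) ^ k *\<^sub>c (?s * adj ?s)" for k
  proof (induction k)
    case 0
    then show ?case by (simp add: shift_mult_adj_shift)
  next
    case (Suc k)
    have "papply (t *\<^sub>c ?J) (Suc k) (idm ?m) = t *\<^sub>c (?J * (t ^ k *\<^sub>c idm m1 + (- t) ^ k *\<^sub>c (?s * adj ?s)))"
      unfolding Suc[symmetric] by simp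
    then show ?case unfolding JJ by (simp add: cscale_distribs)
  qed
  have J: "t *\<^sub>c ?J \<in> carr ?m ?m" using emb_carr[OF M] by (simp add: emb_dirac_j)
  show "emb (mat_exp (t \<cdot>\<^sub>m dirac_j m1 m2)) = exp t *\<^sub>c idm m1 + exp (- t) *\<^sub>c (?s * adj ?s)"
  proof (rule pmat_eqI)
    fix i j
    have "(\<lambda>k. ent (papply (t *\<^sub>c ?J) k (idm ?m)) i j / fact k) sums ent (pexp ?m (t *\<^sub>c ?J) * idm ?m) i j"
      by (rule pexp_sums[OF J carr_simps(8)])
    then have 1: "(\<lambda>k. (t ^ k * ent (idm m1) i j + (- t) ^ k * ent (?s * adj ?s) i j) / fact k) sums ent (pexp ?m (t *\<^sub>c ?J)) i j"
      unfolding pow by simp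
    have "(\<lambda>k. (t ^ k /\<^sub>R fact k) * ent (idm m1) i j + ((- t) ^ k /\<^sub>R fact k) * ent (?s * adj ?s) i j) sums
        (exp t * ent (idm m1) i j + exp (- t) * ent (?s * adj ?s) i j)"
      by (intro sums_add sums_mult2 exp_converges)
    then have "(\<lambda>k. (t ^ k * ent (idm m1) i j + (- t) ^ k * ent (?s * adj ?s) i j) / fact k) sums
        (exp t * ent (idm m1) i j + exp (- t) * ent (?s * adj ?s) i j)"
      by (simp add: scaleR_conv_of_real divide_inverse distrib_right distrib_left mult_ac)
    with 1 have "ent (pexp ?m (t *\<^sub>c ?J)) i j = exp t * ent (idm m1) i j + exp (- t) * ent (?s * adj ?s) i j"
      using sums_unique2 by blast
    then show "ent (emb (mat_exp (t \<cdot>\<^sub>m dirac_j m1 m2))) i j = ent (exp t *\<^sub>c idm m1 + exp (- t) *\<^sub>c (?s * adj ?s)) i j"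
      using emb_mat_exp(1)[OF M] by (simp add: emb_dirac_j)
  qed
qed

lemma not_integrable_if_bounded_below:
  fixes f :: "real \<Rightarrow> real"
  assumes f: "f integrable_on {0..}" and nonneg: "\<And>x. 0 \<le> x \<Longrightarrow> 0 \<le> f x"
    and c: "0 < c" and lb: "\<And>x. b \<le> x \<Longrightarrow> c \<le> f x" and b: "0 \<le> b"
  shows False
proof -
  have le: "real k * c \<le> integral {0..} f" for k
  proof -
    have fi: "f integrable_on {b..b + real k}" by (rule integrable_on_subinterval[OF f]) (use b in auto)
    have "real k * c = integral {b..b + real k} (\<lambda>_. c)" by simp
    also have "\<dots> \<le> integral {b..b + real k} f" using lb fi by (intro integral_le) auto
    also have "\<dots> \<le> integral {0..} f" using b nonneg fi f by (intro integral_subset_le) auto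
    finally show ?thesis .
  qed
  obtain k :: nat where "integral {0..} f / c < real k" using reals_Archimedean2 by blast
  then show False using le[of k] c by (simp add: field_simps)
qed

section \<open>The system attached to a realization and a positive solution of the Riccati
  equation\<close>

locale recovered =
  fixes m1 m2 n :: nat and R :: "complex \<Rightarrow> complex mat" and Am B C X :: "complex mat"
  assumes R: "\<And>z. R z \<in> carrier_mat m2 m1" and re: "preal m2 m1 R n (emb Am) (emb B) (emb C)"
    and Am: "Am \<in> carrier_mat n n" and B: "B \<in> carrier_mat n m1" and C: "C \<in> carrier_mat m2 n"
    and X: "mat_pos_def n X" and ric: "riccati Am B C X = 0\<^sub>m n n"
begin

abbreviation "a \<equiv> emb Am"
abbreviation "b \<equiv> emb B"
abbreviation "c \<equiv> emb C"
abbreviation "x0 \<equiv> emb X"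
definition AA :: "complex mat" where "AA = Am + \<i> \<cdot>\<^sub>m (B * mat_adjoint B * mat_inv X)"
definition th2 :: "complex mat" where "th2 = (- \<i>) \<cdot>\<^sub>m (X * mat_adjoint C)"
definition y0 :: pmat where "y0 = emb (mat_inv X)"

lemmas re' = prealD[OF re]

lemma Xc: "X \<in> carrier_mat n n" using X by (simp add: mat_pos_def_def)
lemma x0_pd: "pd n x0" using mat_pos_def_iff[OF Xc] X by simp
lemma x0_c: "x0 \<in> carr n n" using Xc by simp
lemma y0: "inv_of n x0 y0" and y0_mat: "mat_inv X \<in> carrier_mat n n"
  using pd_inv_of_exists[OF x0_pd] emb_mat_inv_eq[OF Xc] by (auto simp: y0_def)
lemma y0_c: "y0 \<in> carr n n" using inv_ofD(2)[OF y0] .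
lemma adj_y0: "adj y0 = y0" using pdD(2)[OF inv_of_pd[OF x0_pd y0]] .
lemma adj_x0: "adj x0 = x0" using pdD(2)[OF x0_pd] .

lemma AA: "AA \<in> carrier_mat n n" "emb AA = a + \<i> *\<^sub>c (b * adj b * y0)"
proof -
  have BB: "B * mat_adjoint B \<in> carrier_mat n n" using mult_carrier_mat[OF B mat_adjoint_carrier'[OF B]] .
  have BBX: "B * mat_adjoint B * mat_inv X \<in> carrier_mat n n" using mult_carrier_mat[OF BB y0_mat] .
  show "AA \<in> carrier_mat n n" unfolding AA_def using BBX by simp
  show "emb AA = a + \<i> *\<^sub>c (b * adj b * y0)"
    unfolding AA_def using BBX Am emb_add[of Am n n "\<i> \<cdot>\<^sub>m (B * mat_adjoint B * mat_inv X)"]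
      emb_mult[OF BB y0_mat] emb_mult[OF B mat_adjoint_carrier'[OF B]] by (simp add: y0_def)
qed

lemma th2: "th2 \<in> carrier_mat n m2" "emb th2 = (- \<i>) *\<^sub>c (x0 * adj c)"
  using mult_carrier_mat[OF Xc mat_adjoint_carrier'[OF C]] emb_mult[OF Xc mat_adjoint_carrier'[OF C]]
  by (simp_all add: th2_def)

lemma ric': "x0 * adj c * c * x0 + b * adj b = \<i> *\<^sub>c (a * x0 - x0 * adj a)"
proof -
  have "x0 * adj c * c * x0 - \<i> *\<^sub>c (a * x0 - x0 * adj a) + b * adj b = 0"
    using emb_riccati(1)[OF Am B C Xc] ric by simp
  then show ?thesis by (simp add: algebra_simps)
qed

lemma lam:
  "gbdt_Lambda AA B th2 x \<in> carrier_mat n (m1 + m2)"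
  "emb (gbdt_Lambda AA B th2 x * mat_adjoint (gbdt_Lambda AA B th2 x)) =
    (pexp n ((- \<i> * of_real x) *\<^sub>c emb AA) * b) * adj (pexp n ((- \<i> * of_real x) *\<^sub>c emb AA) * b) +
    (pexp n ((\<i> * of_real x) *\<^sub>c emb AA) * emb th2) * adj (pexp n ((\<i> * of_real x) *\<^sub>c emb AA) * emb th2)"
  "gbdt_Lambda AA B th2 x * mat_adjoint (gbdt_Lambda AA B th2 x) \<in> carrier_mat n n"
proof -
  have ex: "mat_exp (s \<cdot>\<^sub>m AA) \<in> carrier_mat n n" "emb (mat_exp (s \<cdot>\<^sub>m AA)) = pexp n (s *\<^sub>c emb AA)" for s
    using emb_mat_exp[of "s \<cdot>\<^sub>m AA" n] AA(1) by simp_all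
  let ?A = "mat_exp ((- \<i> * of_real x) \<cdot>\<^sub>m AA) * B"
  let ?B = "mat_exp ((\<i> * of_real x) \<cdot>\<^sub>m AA) * th2"
  let ?s = "shift m1 m2"
  have car: "?A \<in> carrier_mat n m1" "?B \<in> carrier_mat n m2"
    using mult_carrier_mat[OF ex(1) B] mult_carrier_mat[OF ex(1) th2(1)] by auto
  show L: "gbdt_Lambda AA B th2 x \<in> carrier_mat n (m1 + m2)"
    using four_block_carrier_mat[OF car(1), of "0\<^sub>m 0 (dim_col ?B)" 0 m2] car unfolding gbdt_Lambda_def append_cols_def by auto
  show "gbdt_Lambda AA B th2 x * mat_adjoint (gbdt_Lambda AA B th2 x) \<in> carrier_mat n n"
    using mult_carrier_mat[OF L mat_adjoint_carrier'[OF L]] .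
  have eL: "emb (gbdt_Lambda AA B th2 x) = emb ?A + emb ?B * adj ?s"
    unfolding gbdt_Lambda_def by (rule emb_append_cols[OF car])
  have "emb (gbdt_Lambda AA B th2 x * mat_adjoint (gbdt_Lambda AA B th2 x)) =
     (emb ?A + emb ?B * adj ?s) * adj (emb ?A + emb ?B * adj ?s)"
    using emb_mult[OF L mat_adjoint_carrier'[OF L]] eL by simp
  also have "\<dots> = emb ?A * adj (emb ?A) + (emb ?A * ?s) * adj (emb ?B) + emb ?B * (adj ?s * adj (emb ?A))
      + emb ?B * (adj ?s * ?s) * adj (emb ?B)" by (simp add: algebra_simps)
  also have "\<dots> = emb ?A * adj (emb ?A) + emb ?B * adj (emb ?B)"
    using mult_shift[OF emb_carr[OF car(1)]] shift_mult[OF carr_simps(7)[OF emb_carr[OF car(1)]]] mult_idm[OF emb_carr[OF car(2)]]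
    by (simp only: adj_shift_mult_shift) simp
  finally show "emb (gbdt_Lambda AA B th2 x * mat_adjoint (gbdt_Lambda AA B th2 x)) =
    (pexp n ((- \<i> * of_real x) *\<^sub>c emb AA) * b) * adj (pexp n ((- \<i> * of_real x) *\<^sub>c emb AA) * b) +
    (pexp n ((\<i> * of_real x) *\<^sub>c emb AA) * emb th2) * adj (pexp n ((\<i> * of_real x) *\<^sub>c emb AA) * emb th2)"
    unfolding emb_mult[OF ex(1) B] emb_mult[OF ex(1) th2(1)] ex(2) .
qed

definition SS :: "real \<Rightarrow> pmat" where "SS x = emb (gbdt_S AA X B th2 x)"

lemma S_mat: "gbdt_S AA X B th2 x \<in> carrier_mat n n" using Xc by (simp add: gbdt_S_def)

lemma SS_eq: "SS x = x0 + primitive n n (\<lambda>t. emb (gbdt_Lambda AA B th2 t * mat_adjoint (gbdt_Lambda AA B th2 t))) x"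
proof (rule carr_eqI[of _ n n])
  fix i j assume ij: "i < n" "j < n"
  have "ent (SS x) i j = gbdt_S AA X B th2 x $$ (i, j)" unfolding SS_def by (rule ent_emb_carrier[OF S_mat ij])
  also have "\<dots> = X $$ (i, j) + integral {0..x} (\<lambda>t. (gbdt_Lambda AA B th2 t * mat_adjoint (gbdt_Lambda AA B th2 t)) $$ (i, j))"
    using Xc ij by (simp add: gbdt_S_def)
  finally show "ent (SS x) i j = ent (x0 + primitive n n (\<lambda>t. emb (gbdt_Lambda AA B th2 t * mat_adjoint (gbdt_Lambda AA B th2 t))) x) i j"
    using ij Xc by (simp add: primitive_def trunc.rep_eq ent_emb_carrier[OF lam(3)])
qed (use S_mat x0_c in \<open>auto simp: SS_def\<close>)

text \<open>The Riccati equation gives \<open>a X - X (adj a)\<close> as \<open>- i\<close> times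
  the sum of \<open>b (adj b)\<close> and \<open>th2 (adj th2)\<close>. The feedback in
  \<open>AA\<close> adds \<open>2 i b (adj b)\<close> and so flips the sign of the first term: this
  is the identity required at \<open>x = 0\<close>.\<close>

sublocale gbdt n m1 m2 "emb AA" b "emb th2" SS
proof
  have c': "b \<in> carr n m1" "c \<in> carr m2 n" "a \<in> carr n n" using B C Am by auto
  show "emb AA \<in> carr n n" "b \<in> carr n m1" "emb th2 \<in> carr n m2" using AA(1) B th2(1) by auto
  show "SS x \<in> carr n n" for x using S_mat by (simp add: SS_def)
  have S0: "SS 0 = x0" by (simp add: SS_eq)
  show "pd n (SS 0)" using S0 x0_pd by simp
  have bb: "b * adj b * y0 * x0 = b * adj b"
    using inv_ofD[OF y0] c' by (simp add: mult.assoc)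
  have bb': "x0 * (y0 * (b * adj b)) = b * adj b"
    using inv_of_cancel(1)[OF y0, of "b * adj b" n] by (auto intro: carr_intros c')
  have 1: "emb AA * x0 = a * x0 + \<i> *\<^sub>c (b * adj b)" unfolding AA(2) by (simp add: distrib_right bb)
  have 2: "x0 * adj (emb AA) = x0 * adj a - \<i> *\<^sub>c (b * adj b)"
    unfolding AA(2) using bb' by (simp add: distrib_left right_diff_distrib adj_y0 cscale_uminus)
  have 3: "a * x0 - x0 * adj a = (- \<i>) *\<^sub>c (x0 * adj c * c * x0 + b * adj b)"
    unfolding ric' by simp
  have "emb AA * SS 0 - SS 0 * adj (emb AA) = (a * x0 - x0 * adj a) + (2 * \<i>) *\<^sub>c (b * adj b)"
    unfolding S0 1 2 by (intro pmat_eqI) (simp add: algebra_simps)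
  also have "\<dots> = \<i> *\<^sub>c (b * adj b - emb th2 * adj (emb th2))"
    unfolding 3 th2(2) by (intro pmat_eqI) (simp add: adj_x0 algebra_simps)
  finally show "emb AA * SS 0 - SS 0 * adj (emb AA) = \<i> *\<^sub>c (b * adj b - emb th2 * adj (emb th2))" .
  fix x :: real assume x: "0 \<le> x"
  let ?f = "\<lambda>t. emb (gbdt_Lambda AA B th2 t * mat_adjoint (gbdt_Lambda AA B th2 t))"
  have pc: "continuous_on {0..} (\<lambda>x. pexp n ((s * of_real x) *\<^sub>c emb AA))" for s
    by (rule has_vector_derivative_imp_continuous_on[OF pexp_has_vector_derivative]) (use AA(1) in auto)
  have fc: "continuous_on {0..} ?f"
    unfolding lam(2) by (intro continuous_intros pc bounded_linear.continuous_on[OF bounded_linear_adj])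
  have "(SS has_vector_derivative 0 + ?f x) (at x within {0..})"
    unfolding SS_eq[abs_def] by (intro has_vector_derivative_add has_vector_derivative_const
      primitive_has_vector_derivative fc emb_carr lam(3) x)
  then show "(SS has_vector_derivative
      (pexp n ((- \<i> * of_real x) *\<^sub>c emb AA) * b) * adj (pexp n ((- \<i> * of_real x) *\<^sub>c emb AA) * b) +
      (pexp n ((\<i> * of_real x) *\<^sub>c emb AA) * emb th2) * adj (pexp n ((\<i> * of_real x) *\<^sub>c emb AA) * emb th2)) (at x within {0..})"
    unfolding lam(2) by simp
qed

abbreviation V :: "real \<Rightarrow> complex mat" where "V \<equiv> gbdt_v AA X B th2"

lemma T_0: "T 0 = y0"
proof -
  have "SS 0 = x0" by (simp add: SS_eq)
  then show ?thesis using inv_of_unique[OF y0] T[of 0] by simp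
qed

lemma E_0: "E 0 = (- \<i>) *\<^sub>c adj c"
proof -
  have "E 0 = y0 * emb th2" using y0_c th2(1) by (simp add: E_def e_0 T_0 L2_0)
  also have "\<dots> = (- \<i>) *\<^sub>c (y0 * (x0 * adj c))" unfolding th2(2) by simp
  also have "y0 * (x0 * adj c) = adj c" by (rule inv_of_cancel(2)[OF y0, of _ m2]) (use C in auto)
  finally show ?thesis .
qed

lemma S_invertible: "0 \<le> x \<Longrightarrow> invertible_mat (gbdt_S AA X B th2 x)"
  using inv_of_imp_invertible_mat[OF S_mat] T[of x] by (simp add: SS_def)

lemma V: assumes x: "0 \<le> x" shows "emb (V x) = v x" "V x \<in> carrier_mat m1 m2"
proof -
  have ex: "mat_exp (s \<cdot>\<^sub>m AA) \<in> carrier_mat n n" "emb (mat_exp (s \<cdot>\<^sub>m AA)) = pexp n (s *\<^sub>c emb AA)" for s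
    using emb_mat_exp[of "s \<cdot>\<^sub>m AA" n] AA(1) by simp_all
  have ex': "mat_exp (s \<cdot>\<^sub>m mat_adjoint AA) \<in> carrier_mat n n" "emb (mat_exp (s \<cdot>\<^sub>m mat_adjoint AA)) = pexp n (s *\<^sub>c adj (emb AA))" for s
    using emb_mat_exp[of "s \<cdot>\<^sub>m mat_adjoint AA" n] mat_adjoint_carrier'[OF AA(1)] by simp_all
  have Ti: "mat_inv (gbdt_S AA X B th2 x) \<in> carrier_mat n n" "emb (mat_inv (gbdt_S AA X B th2 x)) = T x"
    using emb_mat_inv_eq[OF S_mat] T[OF x] by (auto simp: SS_def)
  let ?B = "mat_adjoint B"
  let ?E1 = "mat_exp ((\<i> * of_real x) \<cdot>\<^sub>m mat_adjoint AA)"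
  let ?T = "mat_inv (gbdt_S AA X B th2 x)"
  let ?E2 = "mat_exp ((\<i> * of_real x) \<cdot>\<^sub>m AA)"
  note m = mult_carrier_mat
  have 1: "?B * ?E1 \<in> carrier_mat m1 n" using m[OF mat_adjoint_carrier'[OF B] ex'(1)] .
  have 2: "?B * ?E1 * ?T \<in> carrier_mat m1 n" using m[OF 1 Ti(1)] .
  have 3: "?B * ?E1 * ?T * ?E2 \<in> carrier_mat m1 n" using m[OF 2 ex(1)] .
  have 4: "?B * ?E1 * ?T * ?E2 * th2 \<in> carrier_mat m1 m2" using m[OF 3 th2(1)] .
  show "V x \<in> carrier_mat m1 m2" unfolding gbdt_v_def using 4 by simp
  have "pexp n ((\<i> * of_real x) *\<^sub>c adj (emb AA)) = adj (pexp n ((- \<i> * of_real x) *\<^sub>c emb AA))"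
    using AA(1) by (subst adj_pexp) auto
  then show "emb (V x) = v x"
    unfolding gbdt_v_def emb_smult emb_mult[OF 3 th2(1)] emb_mult[OF 2 ex(1)] emb_mult[OF 1 Ti(1)]
      emb_mult[OF mat_adjoint_carrier'[OF B] ex'(1)] Ti(2) ex(2) ex'(2) v_def L1_def L2_def
    by (simp add: mult.assoc)
qed

lemma V_entries: "0 \<le> x \<Longrightarrow> i < m1 \<Longrightarrow> j < m2 \<Longrightarrow> V x $$ (i, j) = ent (v x) i j"
  using ent_emb_carrier[OF V(2)] V(1) by metis

lemma V_L2: "L2_mat_fun m1 m2 V"
  unfolding L2_mat_fun_def
proof (intro conjI allI impI V(2))
  fix i j assume ij: "i < m1" "j < m2"
  have eq: "V x $$ (i, j) = ent (v x) i j" if "x \<in> {0..}" for x using V_entries that ij by simp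
  have "continuous_on {0..} (\<lambda>x. V x $$ (i, j))"
    using continuous_on_ent[OF v_cont] by (subst continuous_on_cong[OF refl eq]) auto
  then have "set_borel_measurable borel {0..} (\<lambda>x. V x $$ (i, j))"
    by (intro set_measurable_continuous_on) auto
  then show "set_borel_measurable lebesgue {0..} (\<lambda>x. V x $$ (i, j))"
    unfolding set_borel_measurable_def by (intro measurable_completion) simp
  show "set_integrable lebesgue {0..} (\<lambda>x. (cmod (V x $$ (i, j)))\<^sup>2)"
    using v_square_integrable[of i j] eq by (subst set_integrable_cong[OF refl refl]) auto
qed

lemma V_tendsto: assumes "i < m1" "j < m2" shows "((\<lambda>x. V x $$ (i, j)) \<longlongrightarrow> 0) at_top"
proof -
  have "((\<lambda>x. ent (v x) i j) \<longlongrightarrow> ent 0 i j) at_top" by (rule tendsto_ent[OF v_tendsto])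
  moreover have "\<forall>\<^sub>F x in at_top. ent (v x) i j = V x $$ (i, j)"
    using eventually_ge_at_top[of 0] by eventually_elim (use V_entries assms in simp)
  ultimately show ?thesis by (simp add: Lim_transform_eventually)
qed

lemma psol_V: "psol (\<lambda>x. emb (V x)) z y1 y2 = psol v z y1 y2"
  by (rule psol_cong) (rule V(1))

text \<open>Read off the Riccati equation: for an eigenvector \<open>w\<close> of
  \<open>adj a\<close> at the conjugate of \<open>z\<close>, one side of its quadratic form is a sum
  of squares, the other is \<open>- 2 Im z\<close> times the positive number
  \<open>ip w (X w)\<close>.\<close>

lemma resolvent: assumes "0 < Im z" shows "\<exists>G. inv_of n (z *\<^sub>c idm n - a) G"
proof -
  have ac: "adj a \<in> carr n n" using re'(1) by simp
  have no: False if w: "w \<in> colv n" "w \<noteq> 0" "adj a * w = cnj z *\<^sub>c w" for w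
  proof -
    have "ip w ((x0 * adj c * c * x0 + b * adj b) * w) = ip (c * (x0 * w)) (c * (x0 * w)) + ip (adj b * w) (adj b * w)"
      by (simp add: distrib_right mult.assoc ip_adj adj_x0)
    moreover have cc: "c * (x0 * w) \<in> colv m2" "adj b * w \<in> colv m1" by (blast intro: carr_intros re' x0_c w)+
    ultimately have "0 \<le> Re (ip w ((x0 * adj c * c * x0 + b * adj b) * w))"
      using ip_self_nonneg[OF cc(1)] ip_self_nonneg[OF cc(2)] by simp
    also have "ip w ((x0 * adj c * c * x0 + b * adj b) * w) = \<i> * (ip (adj a * w) (x0 * w) - ip w (x0 * (adj a * w)))"
      unfolding ric' by (simp add: left_diff_distrib mult.assoc ip_adj)
    also have "\<dots> = \<i> * ((z - cnj z) * ip w (x0 * w))" unfolding w(3) by (simp add: algebra_simps)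
    also have "\<dots> = - (2 * Im z) * ip w (x0 * w)" by (simp add: complex_diff_cnj mult.assoc[symmetric])
    finally have "0 \<le> - (2 * Im z) * Re (ip w (x0 * w))" by simp
    moreover have "0 < Re (ip w (x0 * w))" by (rule pdD(3)[OF x0_pd w(1,2)])
    ultimately show False using assms by (simp add: mult_le_0_iff zero_le_mult_iff)
  qed
  obtain G where "inv_of n (cnj z *\<^sub>c idm n - adj a) G" using eigen_or_inv[OF ac, of "cnj z"] no by blast
  then have "inv_of n (z *\<^sub>c idm n - a) (adj G)" using inv_of_adj by fastforce
  then show ?thesis ..
qed

text \<open>The feedback turns \<open>(z - a) L = b\<close> into \<open>(z - AA) L = b G0\<close>,
  which fixes \<open>G0\<close>. Since \<open>Pi 0 = X^-1\<close>, the same \<open>G0\<close> makes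
  the first block start at the identity; since \<open>E 0 = - i (adj c)\<close>, the second starts
  at \<open>c (z - a)^-1 b\<close>.\<close>

lemma weyl_solution:
  assumes G: "inv_of n (z *\<^sub>c idm n - a) G"
  defines "L \<equiv> G * b" and "G0 \<equiv> idm m1 - \<i> *\<^sub>c (adj b * y0 * (G * b))"
  shows "psol v z (w1 z G0 L) (w2 z L)" "w1 z G0 L 0 = idm m1" "w2 z L 0 = emb (R z)"
    "L \<in> carr n m1" "G0 \<in> carr m1 m1"
proof -
  note g = inv_ofD[OF G]
  show L: "L \<in> carr n m1" and G0: "G0 \<in> carr m1 m1" unfolding L_def G0_def by (blast intro: carr_intros g re' y0_c)+
  have "(z *\<^sub>c idm n - a) * L = b" unfolding L_def by (rule inv_of_cancel(1)[OF G re'(2)])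
  then have "z *\<^sub>c L - a * L = b" using L by (simp add: left_diff_distrib)
  moreover have "z *\<^sub>c L - emb AA * L = (z *\<^sub>c L - a * L) - \<i> *\<^sub>c (b * adj b * y0 * L)"
    unfolding AA(2) by (simp add: distrib_right)
  ultimately have "z *\<^sub>c L - emb AA * L = b * G0"
    using re'(2) by (simp add: G0_def L_def right_diff_distrib mult.assoc)
  then show "psol v z (w1 z G0 L) (w2 z L)" by (rule w_psol)
  have "Pi 0 = y0" using y0_c by (simp add: Pi_def e_0 T_0)
  then show "w1 z G0 L 0 = idm m1" by (simp add: w1_def G0_def L_def)
  show "w2 z L 0 = emb (R z)" using re'(4)[OF G] by (simp add: w2_def E_0 L_def mult.assoc)
qed

text \<open>The scalar exponential supplies the rate; the remaining factors are bounded because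
  \<open>Pi\<close> and \<open>E\<close> converge at infinity.\<close>

lemma w_decay:
  assumes z: "0 < Im z"
  shows "\<exists>K\<ge>0. \<forall>x\<ge>0. norm (w1 z G0 L x) \<le> K * exp (- Im z * x) \<and> norm (w2 z L x) \<le> K * exp (- Im z * x)"
proof -
  obtain P where "(Pi \<longlongrightarrow> P) at_top" using Pi_tendsto by blast
  then have "((\<lambda>x. G0 + \<i> *\<^sub>c (adj b * Pi x * L)) \<longlongrightarrow> G0 + \<i> *\<^sub>c (adj b * P * L)) at_top" by (intro tendsto_intros)
  moreover have "continuous_on {0..} (\<lambda>x. G0 + \<i> *\<^sub>c (adj b * Pi x * L))"
    by (intro continuous_intros Pi_cont bounded_linear.continuous_on[OF bounded_bilinear.bounded_linear_right[OF bounded_bilinear_cscale]])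
  ultimately obtain K1 where K1: "\<And>x. 0 \<le> x \<Longrightarrow> norm (G0 + \<i> *\<^sub>c (adj b * Pi x * L)) \<le> K1"
    using continuous_tendsto_bounded by blast
  have "((\<lambda>x. adj (E x) * L) \<longlongrightarrow> adj 0 * L) at_top" by (intro tendsto_intros E_tendsto)
  moreover have "continuous_on {0..} (\<lambda>x. adj (E x) * L)"
    by (intro continuous_intros E_cont bounded_linear.continuous_on[OF bounded_linear_adj])
  ultimately obtain K2 where K2: "\<And>x. 0 \<le> x \<Longrightarrow> norm (adj (E x) * L) \<le> K2"
    using continuous_tendsto_bounded by blast
  have ex: "cmod (exp (\<i> * z * of_real x)) = exp (- Im z * x)" for x :: real by simp
  have "norm (w1 z G0 L x) \<le> max K1 K2 * exp (- Im z * x) \<and> norm (w2 z L x) \<le> max K1 K2 * exp (- Im z * x)" if "0 \<le> x" for x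
    using mult_right_mono[OF order.trans[OF K1[OF that] max.cobounded1[of K1 K2]], of "exp (- Im z * x)"]
      mult_right_mono[OF order.trans[OF K2[OF that] max.cobounded2[of K2 K1]], of "exp (- Im z * x)"]
    unfolding w1_def w2_def norm_cscale ex by (simp add: mult.commute)
  moreover have "0 \<le> max K1 K2" using order.trans[OF norm_ge_zero K1[of 0]] by simp
  ultimately show ?thesis by blast
qed

lemma V_car': "0 \<le> x \<Longrightarrow> V x \<in> carrier_mat m1 m2" by (rule V(2))

lemma weyl_integrand:
  assumes U: "U \<in> carrier_mat (m1 + m2) (m1 + m2)" and eU: "emb U = u1 + shift m1 m2 * u2"
    and u: "u1 \<in> carr m1 (m1 + m2)" "u2 \<in> carr m2 (m1 + m2)" and W: "W \<in> carrier_mat (m1 + m2) k"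
  shows "emb (mat_adjoint W * mat_adjoint U * U * W) = adj (u1 * emb W) * (u1 * emb W) + adj (u2 * emb W) * (u2 * emb W)"
    "mat_adjoint W * mat_adjoint U * U * W \<in> carrier_mat k k"
proof -
  note aW = mat_adjoint_carrier'[OF W] and aU = mat_adjoint_carrier'[OF U]
  note 1 = mult_carrier_mat[OF aW aU]
  note 2 = mult_carrier_mat[OF 1 U]
  show "mat_adjoint W * mat_adjoint U * U * W \<in> carrier_mat k k" using mult_carrier_mat[OF 2 W] .
  have "emb (mat_adjoint W * mat_adjoint U * U * W) = adj (emb W) * (adj (emb U) * emb U) * emb W"
    unfolding emb_mult[OF 2 W] emb_mult[OF 1 U] emb_mult[OF aW aU] by (simp add: mult.assoc)
  also have "adj (emb U) * emb U = adj u1 * u1 + adj u2 * u2"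
    unfolding eU by (rule adj_stack_mult[OF u u])
  finally show "emb (mat_adjoint W * mat_adjoint U * U * W) = adj (u1 * emb W) * (u1 * emb W) + adj (u2 * emb W) * (u2 * emb W)"
    by (simp add: algebra_simps)
qed

text \<open>Applied to \<open>[I; R]\<close>, the fundamental matrix must give the explicit solution
  with that initial value, so the integrand is a sum of two squares bounded by a multiple of
  \<open>exp (- 2 Im z x)\<close>.\<close>

lemma R_is_weyl: "weyl_function m1 m2 V R"
  unfolding weyl_function_def
proof (intro allI impI conjI R)
  fix z :: complex assume z: "Im z > 0"
  let ?m = "m1 + m2"
  let ?s = "shift m1 m2"
  obtain G where G: "inv_of n (z *\<^sub>c idm n - a) G" using resolvent[OF z] ..
  define L where "L = G * b"
  define G0 where "G0 = idm m1 - \<i> *\<^sub>c (adj b * y0 * L)"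
  note ws = weyl_solution[OF G, folded L_def, folded G0_def]
  let ?r = "emb (R z)"
  have r: "?r \<in> carr m2 m1" using R by simp
  obtain Kv where Kv: "\<And>x. 0 \<le> x \<Longrightarrow> norm (v x) \<le> Kv" using continuous_tendsto_bounded[OF v_cont v_tendsto] by blast
  obtain p q where pq: "\<And>x. p x \<in> carr m1 m2" "\<And>x. q x \<in> carr m2 m2" "psol v z p q" "p 0 = 0" "q 0 = idm m2"
    using dirac_fundamental[OF v_cont v_car Kv, of 0 m2 "idm m2" z] by auto
  \<comment> \<open>The fundamental matrix has right block column \<open>[p; q]\<close> and left
    block column \<open>w - [p; q] R\<close>: the initial values \<open>[I; R]\<close> and
    \<open>[0; I]\<close> then combine to the identity.\<close>
  define u1 where "u1 = (\<lambda>x. (w1 z G0 L x - p x * ?r) + p x * adj ?s)"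
  define u2 where "u2 = (\<lambda>x. (w2 z L x - q x * ?r) + q x * adj ?s)"
  have sol: "psol v z u1 u2" unfolding u1_def u2_def
    by (intro psol_add psol_diff psol_mult pq ws)
  have sub: "P \<in> carr k m1 \<Longrightarrow> P \<in> carr k ?m" for P k by (auto simp: carr_def)
  have ucar: "u1 x \<in> carr m1 ?m" "u2 x \<in> carr m2 ?m" if x: "0 \<le> x" for x
  proof -
    have "w1 z G0 L x - p x * ?r \<in> carr m1 m1" "w2 z L x - q x * ?r \<in> carr m2 m1"
      using w_car[OF x ws(4,5)] by (blast intro: carr_intros pq r)+
    moreover have "p x * adj ?s \<in> carr m1 ?m" "q x * adj ?s \<in> carr m2 ?m"
      by (blast intro: carr_intros pq shift_carr)+
    ultimately show "u1 x \<in> carr m1 ?m" "u2 x \<in> carr m2 ?m" unfolding u1_def u2_def using sub by (blast intro: carr_simps)+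
  qed
  define U where "U = (\<lambda>x. unemb ?m ?m (u1 x + ?s * u2 x))"
  have Usol: "dirac_solution m1 m2 V z ?m U"
    unfolding U_def by (rule psol_dirac[OF V_car' ucar]) (simp_all add: psol_V sol)
  have U0: "U 0 = 1\<^sub>m ?m"
  proof (rule emb_inj[of _ ?m ?m])
    have "emb (U 0) = u1 0 + ?s * u2 0" using stack_carr[OF ucar] by (simp add: U_def)
    also have "\<dots> = emb (1\<^sub>m ?m)" by (simp add: u1_def u2_def pq ws shift_mult_adj_shift)
       (use r shift_carr[of m1 m2] in \<open>simp add: shift_mult_adj_shift\<close>)?
    finally show "emb (U 0) = emb (1\<^sub>m ?m)" .
  qed (simp_all add: U_def)
  let ?W = "1\<^sub>m m1 @\<^sub>r R z"
  have W: "?W \<in> carrier_mat ?m m1" "emb ?W = idm m1 + ?s * ?r"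
    using append_rows_carrier[of "1\<^sub>m m1" m1 m1 "R z" m2] emb_append_rows[of "1\<^sub>m m1" m1 m1 "R z" m2] R by auto
  have uW: "u1 x * emb ?W = w1 z G0 L x" "u2 x * emb ?W = w2 z L x" if x: "0 \<le> x" for x
  proof -
    have as: "adj ?s * idm m1 = 0" using arg_cong[OF idm_mult_shift[of m1 m2], of adj] by simp
    have *: "((P - Q * ?r) + Q * adj ?s) * (idm m1 + ?s * ?r) = P" if P: "P \<in> carr k m1" and Q: "Q \<in> carr k m2" for P Q k
    proof -
      have Pr: "P - Q * ?r \<in> carr k m1" by (blast intro: carr_intros P Q r)
      have "((P - Q * ?r) + Q * adj ?s) * (idm m1 + ?s * ?r) = (P - Q * ?r) * idm m1 + ((P - Q * ?r) * ?s) * ?r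
        + Q * (adj ?s * idm m1) + Q * (adj ?s * ?s) * ?r" by (simp only: distrib_left distrib_right mult.assoc add_ac)
      also have "\<dots> = P" unfolding as adj_shift_mult_shift mult_shift[OF Pr] mult_idm[OF Pr] using Q by simp
      finally show ?thesis .
    qed
    show "u1 x * emb ?W = w1 z G0 L x" "u2 x * emb ?W = w2 z L x"
      unfolding W u1_def u2_def using w_car[OF x ws(4,5)] pq by (blast intro: *)+
  qed
  obtain K where K: "0 \<le> K" "\<And>x. 0 \<le> x \<Longrightarrow> norm (w1 z G0 L x) \<le> K * exp (- Im z * x)" "\<And>x. 0 \<le> x \<Longrightarrow> norm (w2 z L x) \<le> K * exp (- Im z * x)"
    using w_decay[OF z] by blast
  let ?I = "\<lambda>x. adj (w1 z G0 L x) * w1 z G0 L x + adj (w2 z L x) * w2 z L x"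
  have bnd: "norm (?I x) \<le> 2 * K\<^sup>2 * exp (- (2 * Im z) * x)" if x: "0 \<le> x" for x
  proof -
    have sq: "norm (adj P * P) \<le> K\<^sup>2 * exp (- (2 * Im z) * x)" if "norm P \<le> K * exp (- Im z * x)" for P
    proof -
      have "norm (adj P * P) \<le> norm P * norm P" using norm_mult_ineq[of "adj P" P] by simp
      also have "\<dots> \<le> (K * exp (- Im z * x)) * (K * exp (- Im z * x))" using that K(1) by (intro mult_mono) auto
      also have "\<dots> = K\<^sup>2 * exp (- (2 * Im z) * x)" by (simp add: power2_eq_square mult_exp_exp mult_ac)
      finally show ?thesis .
    qed
    show ?thesis using norm_triangle_ineq[of "adj (w1 z G0 L x) * w1 z G0 L x" "adj (w2 z L x) * w2 z L x"]
        sq[OF K(2)[OF x]] sq[OF K(3)[OF x]] by linarith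
  qed
  have int: "(\<lambda>x. 2 * K\<^sup>2 * exp (- (2 * Im z) * x)) integrable_on {0..}"
  proof (rule integrable_of_antiderivative)
    fix x :: real
    show "((\<lambda>x. - (2 * K\<^sup>2 / (2 * Im z)) * exp (- (2 * Im z) * x)) has_vector_derivative 2 * K\<^sup>2 * exp (- (2 * Im z) * x)) (at x within {0..})"
      unfolding has_real_derivative_iff_has_vector_derivative[symmetric] using z by (auto intro!: derivative_eq_intros)
    have "((\<lambda>x. exp (- (2 * Im z) * x)) \<longlongrightarrow> 0) at_top" using z by real_asymp
    from tendsto_mult[OF tendsto_const this]
    show "((\<lambda>x. - (2 * K\<^sup>2 / (2 * Im z)) * exp (- (2 * Im z) * x)) \<longlongrightarrow> - (2 * K\<^sup>2 / (2 * Im z)) * 0) at_top" .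
  qed simp
  show "\<exists>u. dirac_solution m1 m2 V z ?m u \<and> u 0 = 1\<^sub>m ?m \<and>
     (\<forall>i<m1. \<forall>l<m1. set_integrable lebesgue {0..} (\<lambda>x. (mat_adjoint ?W * mat_adjoint (u x) * u x * ?W) $$ (i, l)))"
  proof (intro exI[of _ U] conjI allI impI Usol U0)
    fix i l assume il: "i < m1" "l < m1"
    have eq: "(mat_adjoint ?W * mat_adjoint (U x) * U x * ?W) $$ (i, l) = ent (?I x) i l" if "x \<in> {0..}" for x
    proof -
      have x: "0 \<le> x" using that by simp
      have Uc: "U x \<in> carrier_mat ?m ?m" "emb (U x) = u1 x + ?s * u2 x" using stack_carr[OF ucar[OF x]] by (auto simp: U_def)
      note wi = weyl_integrand[OF Uc ucar[OF x] W(1)]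
      show ?thesis using ent_emb_carrier[OF wi(2) il] unfolding wi(1) uW[OF x] by simp
    qed
    have "set_integrable lebesgue {0..} (\<lambda>x. ent (?I x) i l)"
    proof (rule continuous_bound_set_integrable[OF _ int])
      show "continuous_on {0..} (\<lambda>x. ent (?I x) i l)"
        by (intro continuous_on_ent continuous_intros psol_cont[OF ws(1)] bounded_linear.continuous_on[OF bounded_linear_adj])
      show "norm (ent (?I x) i l) \<le> 2 * K\<^sup>2 * exp (- (2 * Im z) * x)" if "0 \<le> x" for x
        using norm_ent_le bnd[OF that] order.trans by blast
    qed
    then show "set_integrable lebesgue {0..} (\<lambda>x. (mat_adjoint ?W * mat_adjoint (U x) * U x * ?W) $$ (i, l))"
      using eq by (subst set_integrable_cong[OF refl refl]) auto
  qed
qed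

end

lemma ip_self_norm_le: "Re (ip w w) \<le> (norm w)\<^sup>2"
  using norm_ip_le[of w w] complex_Re_le_cmod[of "ip w w"] by (simp add: power2_eq_square)

text \<open>The potential cancels in the derivative of the difference of squares, which equals
  \<open>- 2 Im z\<close> times the sum of squares.\<close>

lemma psol_energy_mono:
  assumes sol: "psol v z d1 d2" and z: "0 < Im z" and x: "0 \<le> x"
    and car: "\<And>x. 0 \<le> x \<Longrightarrow> d1 x \<in> colv m1" "\<And>x. 0 \<le> x \<Longrightarrow> d2 x \<in> colv m2"
  shows "Re (ip (d1 x) (d1 x)) - Re (ip (d2 x) (d2 x)) \<le> Re (ip (d1 0) (d1 0)) - Re (ip (d2 0) (d2 0))"
proof -
  let ?h = "\<lambda>x. Re (ent (adj (d1 x) * d1 x - adj (d2 x) * d2 x) 0 0)"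
  let ?h' = "\<lambda>x. - (2 * Im z) * (Re (ip (d1 x) (d1 x)) + Re (ip (d2 x) (d2 x)))"
  have D: "(?h has_vector_derivative ?h' t) (at t within {0..})" if t: "0 \<le> t" for t
  proof -
    note d = psolD[OF sol t]
    have "((\<lambda>x. adj (d1 x) * d1 x - adj (d2 x) * d2 x) has_vector_derivative
        (adj (d1 t) * (\<i> *\<^sub>c (z *\<^sub>c d1 t + v t * d2 t)) + adj (\<i> *\<^sub>c (z *\<^sub>c d1 t + v t * d2 t)) * d1 t) -
        (adj (d2 t) * ((- \<i>) *\<^sub>c (z *\<^sub>c d2 t + adj (v t) * d1 t)) + adj ((- \<i>) *\<^sub>c (z *\<^sub>c d2 t + adj (v t) * d1 t)) * d2 t)) (at t within {0..})"
      by (intro has_vector_derivative_diff has_vector_derivative_mult adj_has_vector_derivative d)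
    also have "(adj (d1 t) * (\<i> *\<^sub>c (z *\<^sub>c d1 t + v t * d2 t)) + adj (\<i> *\<^sub>c (z *\<^sub>c d1 t + v t * d2 t)) * d1 t) -
        (adj (d2 t) * ((- \<i>) *\<^sub>c (z *\<^sub>c d2 t + adj (v t) * d1 t)) + adj ((- \<i>) *\<^sub>c (z *\<^sub>c d2 t + adj (v t) * d1 t)) * d2 t)
        = (\<i> * (z - cnj z)) *\<^sub>c (adj (d1 t) * d1 t + adj (d2 t) * d2 t)"
      by (intro pmat_eqI) (simp add: algebra_simps)
    also have "\<i> * (z - cnj z) = of_real (- (2 * Im z))" by (simp add: complex_eq_iff)
    finally have "((\<lambda>x. ent (adj (d1 x) * d1 x - adj (d2 x) * d2 x) 0 0) has_vector_derivative
       ent (of_real (- (2 * Im z)) *\<^sub>c (adj (d1 t) * d1 t + adj (d2 t) * d2 t)) 0 0) (at t within {0..})"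
      by (rule ent_has_vector_derivative)
    then have "(?h has_vector_derivative Re (ent (of_real (- (2 * Im z)) *\<^sub>c (adj (d1 t) * d1 t + adj (d2 t) * d2 t)) 0 0)) (at t within {0..})"
      by (rule bounded_linear.has_vector_derivative[OF bounded_linear_Re])
    then show ?thesis by (simp add: ip_def)
  qed
  have "- ?h 0 \<le> - ?h x"
  proof (rule nonneg_deriv_mono[of "\<lambda>x. - ?h x" "\<lambda>x. - ?h' x"])
    show "((\<lambda>x. - ?h x) has_vector_derivative - ?h' t) (at t within {0..})" if "0 \<le> t" for t
      by (rule has_vector_derivative_minus[OF D[OF that]])
    show "0 \<le> - ?h' t" if "0 \<le> t" for t
      using ip_self_nonneg[OF car(1)[OF that]] ip_self_nonneg[OF car(2)[OF that]] z by simp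
  qed (use x in simp_all)
  then show ?thesis by (simp add: ip_def)
qed

context recovered
begin

text \<open>Compare a column of the solution belonging to \<phi> with the explicit decaying one.
  Their difference starts at \<open>[0; (phi - R) g]\<close>, and the monotone difference of squares
  keeps its second block at least as long as initially. As the explicit solution decays, the other
  one stays away from 0 and is not square integrable unless the initial value vanishes.\<close>

lemma weyl_unique:
  assumes phi: "weyl_function m1 m2 V \<phi>" and z: "Im z > 0"
  shows "\<phi> z = R z"
proof -
  let ?m = "m1 + m2"
  let ?s = "shift m1 m2"
  let ?W = "1\<^sub>m m1 @\<^sub>r \<phi> z"
  note w = phi[unfolded weyl_function_def, THEN spec, THEN mp, OF z]
  have fc: "\<phi> z \<in> carrier_mat m2 m1" by (rule conjunct1[OF w])
  obtain u where u': "dirac_solution m1 m2 V z ?m u \<and> u 0 = 1\<^sub>m ?m \<and>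
      (\<forall>i<m1. \<forall>l<m1. set_integrable lebesgue {0..} (\<lambda>x. (mat_adjoint ?W * mat_adjoint (u x) * u x * ?W) $$ (i, l)))"
    using conjunct2[OF w] by (rule exE)
  note u = u'[THEN conjunct1] u'[THEN conjunct2, THEN conjunct1]
  note int = u'[THEN conjunct2, THEN conjunct2, rule_format]
  let ?f = "emb (\<phi> z)"
  have f: "?f \<in> carr m2 m1" using fc by simp
  obtain u1 u2 where uc: "\<And>x. u1 x \<in> carr m1 ?m" "\<And>x. u2 x \<in> carr m2 ?m"
    and us: "psol (\<lambda>x. emb (V x)) z u1 u2" and ue: "\<And>x. 0 \<le> x \<Longrightarrow> emb (u x) = u1 x + ?s * u2 x"
    using dirac_psol[OF V_car' u(1)] by blast
  have us': "psol v z u1 u2" using us unfolding psol_V .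
  have W: "?W \<in> carrier_mat ?m m1" "emb ?W = idm m1 + ?s * ?f"
    using append_rows_carrier[of "1\<^sub>m m1" m1 m1 "\<phi> z" m2] emb_append_rows[of "1\<^sub>m m1" m1 m1 "\<phi> z" m2] fc by auto
  have Wc: "emb ?W \<in> carr ?m m1" using W(1) by simp
  have "u1 0 + ?s * u2 0 = idm m1 + ?s * adj ?s" using ue[of 0] u(2) by (simp add: shift_mult_adj_shift)
  moreover have "idm m1 \<in> carr m1 ?m" by (auto simp: carr_def idm.rep_eq)
  ultimately have u0: "u1 0 = idm m1" "u2 0 = adj ?s"
    using stack_inj[of "u1 0" m1 m2 "u2 0" "idm m1" "adj ?s" ?m] uc carr_simps(7)[OF shift_carr] by auto
  have as: "adj ?s * idm m1 = 0" by (rule shift_mult[OF carr_simps(8)])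
  have i0: "u1 0 * emb ?W = idm m1" "u2 0 * emb ?W = ?f"
  proof -
    have "idm m1 * (?s * ?f) = 0" by (simp add: mult.assoc[symmetric] idm_mult_shift)
    then show "u1 0 * emb ?W = idm m1" unfolding u0 W(2) by (simp add: distrib_left shift_projections(1))
    have "adj ?s * (?s * ?f) = ?f" using f by (simp add: mult.assoc[symmetric] adj_shift_mult_shift)
    then show "u2 0 * emb ?W = ?f" unfolding u0 W(2) by (simp add: distrib_left as)
  qed
  obtain G where G: "inv_of n (z *\<^sub>c idm n - a) G" using resolvent[OF z] ..
  define L where "L = G * b"
  define G0 where "G0 = idm m1 - \<i> *\<^sub>c (adj b * y0 * L)"
  note ws = weyl_solution[OF G, folded L_def, folded G0_def]
  obtain K where K: "0 \<le> K" "\<And>x. 0 \<le> x \<Longrightarrow> norm (w2 z L x) \<le> K * exp (- Im z * x)"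
    using w_decay[OF z] by blast
  have col: "(?f - emb (R z)) * unit_pmat l 0 = 0" if l: "l < m1" for l
  proof (rule ccontr)
    assume ne: "(?f - emb (R z)) * unit_pmat l 0 \<noteq> 0"
    let ?g = "unit_pmat l 0"
    have g: "?g \<in> colv m1" by (rule unit_colv[OF l])
    define y1 where "y1 = (\<lambda>x. u1 x * emb ?W * ?g)"
    define y2 where "y2 = (\<lambda>x. u2 x * emb ?W * ?g)"
    define d1 where "d1 = (\<lambda>x. y1 x - w1 z G0 L x * ?g)"
    define d2 where "d2 = (\<lambda>x. y2 x - w2 z L x * ?g)"
    have yc: "y1 x \<in> colv m1" "y2 x \<in> colv m2" for x unfolding y1_def y2_def by (blast intro: carr_intros uc Wc g)+
    have wc: "w2 z L x * ?g \<in> colv m2" "w1 z G0 L x * ?g \<in> colv m1" if "0 \<le> x" for x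
      using w_car[OF that ws(4,5)] by (blast intro: carr_intros g)+
    have dc: "d1 x \<in> colv m1" "d2 x \<in> colv m2" if "0 \<le> x" for x
      unfolding d1_def d2_def using yc wc[OF that] by simp_all
    have sol: "psol v z d1 d2" unfolding d1_def d2_def y1_def y2_def
      by (intro psol_diff psol_mult us' ws)
    have d0: "d1 0 = 0" "d2 0 = (?f - emb (R z)) * ?g"
      by (simp_all add: d1_def d2_def y1_def y2_def i0 ws left_diff_distrib)
    define \<delta> where "\<delta> = Re (ip (d2 0) (d2 0))"
    have \<delta>: "0 < \<delta>" using ip_self_nonneg[OF dc(2), of 0] ip_self_eq_0[OF dc(2), of 0] ne unfolding \<delta>_def d0 by fastforce
    have lb: "\<delta> \<le> Re (ip (d2 x) (d2 x))" if x: "0 \<le> x" for x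
      using psol_energy_mono[OF sol z x dc] ip_self_nonneg[OF dc(1)[OF x]] by (simp add: \<delta>_def d0(1))
    have "((\<lambda>x. (K * exp (- Im z * x) * norm ?g)\<^sup>2) \<longlongrightarrow> (K * 0 * norm ?g)\<^sup>2) at_top"
    proof (intro tendsto_intros)
      show "((\<lambda>x. exp (- Im z * x)) \<longlongrightarrow> 0) at_top" using z by real_asymp
    qed
    then have "\<forall>\<^sub>F x in at_top. (K * exp (- Im z * x) * norm ?g)\<^sup>2 < \<delta> / 4"
      by (rule order_tendstoD) (use \<delta> in simp)
    then obtain B where B: "\<And>x. B \<le> x \<Longrightarrow> (K * exp (- Im z * x) * norm ?g)\<^sup>2 < \<delta> / 4"
      by (auto simp: eventually_at_top_linorder)
    have low: "\<delta> / 4 \<le> Re (ip (y2 x) (y2 x))" if x: "max 0 B \<le> x" for x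
    proof -
      have x0: "0 \<le> x" using x by simp
      let ?w = "w2 z L x * ?g"
      have "norm ?w \<le> K * exp (- Im z * x) * norm ?g"
        using norm_mult_ineq[of "w2 z L x" ?g] mult_right_mono[OF K(2)[OF x0] norm_ge_zero[of ?g]] by linarith
      then have "(norm ?w)\<^sup>2 \<le> (K * exp (- Im z * x) * norm ?g)\<^sup>2" by (intro power_mono) auto
      then have w: "Re (ip ?w ?w) \<le> \<delta> / 4" using ip_self_norm_le[of ?w] B[of x] x by simp
      \<comment> \<open>Parallelogram law: the squares of \<open>y2 - w\<close> and
        \<open>y2 + w\<close> sum to at least \<delta>, the square of \<open>w\<close> is at most a
        quarter of \<delta>, and so is left for \<open>y2\<close> at least \<open>1/2 - 1/4\<close>
        of \<delta>.\<close>
      have "0 \<le> Re (ip (y2 x + ?w) (y2 x + ?w))" using yc(2)[of x] wc(1)[OF x0] by (intro ip_self_nonneg[of _ m2]) simp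
      moreover have "\<delta> \<le> Re (ip (y2 x - ?w) (y2 x - ?w))" using lb[OF x0] by (simp only: d2_def)
      ultimately show ?thesis using w by simp
    qed
    let ?F = "\<lambda>x. Re ((mat_adjoint ?W * mat_adjoint (u x) * u x * ?W) $$ (l, l))"
    have "(\<lambda>x. (mat_adjoint ?W * mat_adjoint (u x) * u x * ?W) $$ (l, l)) integrable_on {0..}"
      by (rule set_lebesgue_integral_eq_integral(1)[OF int[OF l l]])
    then have Fi: "?F integrable_on {0..}" using integrable_linear[OF _ bounded_linear_Re] by (simp add: o_def)
    have F: "?F x = Re (ip (y1 x) (y1 x)) + Re (ip (y2 x) (y2 x))" if x: "0 \<le> x" for x
    proof -
      have uxc: "u x \<in> carrier_mat ?m ?m" using u(1) x by (simp add: dirac_solution_def)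
      note wi = weyl_integrand[OF uxc ue[OF x] uc W(1)]
      let ?I = "adj (u1 x * emb ?W) * (u1 x * emb ?W) + adj (u2 x * emb ?W) * (u2 x * emb ?W)"
      have Ic: "?I \<in> carr m1 m1" using wi emb_carr by metis
      have "(mat_adjoint ?W * mat_adjoint (u x) * u x * ?W) $$ (l, l) = ent ?I l l"
        using ent_emb_carrier[OF wi(2) l l] unfolding wi(1) by simp
      also have "\<dots> = ip ?g (?I * ?g)" using ip_unit[OF Ic l l] by simp
      also have "\<dots> = ip (y1 x) (y1 x) + ip (y2 x) (y2 x)"
        by (simp add: y1_def y2_def ip_def algebra_simps)
      finally show ?thesis by simp
    qed
    show False
    proof (rule not_integrable_if_bounded_below[OF Fi])
      show "0 \<le> ?F x" if "0 \<le> x" for x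
        using F[OF that] ip_self_nonneg[OF yc(1)[of x]] ip_self_nonneg[OF yc(2)[of x]] by simp
      show "0 < \<delta> / 4" using \<delta> by simp
      show "\<delta> / 4 \<le> ?F x" if "max 0 B \<le> x" for x
        using F[of x] low[OF that] ip_self_nonneg[OF yc(1)[of x]] that by simp
      show "0 \<le> max 0 B" by simp
    qed
  qed
  show ?thesis
  proof (rule emb_inj[OF fc R])
    have "?f - emb (R z) = 0"
    proof (rule carr_eqI[of _ m2 m1])
      fix i j assume ij: "i < m2" "j < m1"
      have "ent ((?f - emb (R z)) * unit_pmat j 0) i 0 = ent (?f - emb (R z)) i j"
        by (rule ent_mult_unit[of _ m2 m1]) (use f R ij in auto)
      then show "ent (?f - emb (R z)) i j = ent 0 i j" unfolding col[OF ij(2)] by simp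
    qed (use f R in auto)
    then show "?f = emb (R z)" by simp
  qed
qed

text \<open>The second resolvent identity for the feedback perturbation \<open>AA - a = b Q\<close>;
  it makes \<open>I + Q H b\<close> and \<open>I - Q G b\<close> inverse to each other.\<close>

lemma resolvent_identity:
  assumes G: "inv_of n (z *\<^sub>c idm n - a) G" and H: "inv_of n (z *\<^sub>c idm n - emb AA) H"
  defines "Q \<equiv> \<i> *\<^sub>c (adj b * y0)"
  shows "H * (b * (Q * G)) = H - G" "G * (b * (Q * H)) = H - G"
proof -
  have e: "(z *\<^sub>c idm n - a) - (z *\<^sub>c idm n - emb AA) = b * Q"
    unfolding AA(2) Q_def by (simp add: mult.assoc)
  note g = inv_ofD[OF G] and h = inv_ofD[OF H]
  have "H * (((z *\<^sub>c idm n - a) - (z *\<^sub>c idm n - emb AA)) * G) = H * ((z *\<^sub>c idm n - a) * G) - H * ((z *\<^sub>c idm n - emb AA) * G)"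
    by (simp only: left_diff_distrib right_diff_distrib)
  also have "\<dots> = H - G" unfolding g(3) inv_of_cancel(2)[OF H g(2)] using h by simp
  finally show "H * (b * (Q * G)) = H - G" unfolding e by (simp add: mult.assoc)
  have "G * (((z *\<^sub>c idm n - a) - (z *\<^sub>c idm n - emb AA)) * H) = G * ((z *\<^sub>c idm n - a) * H) - G * ((z *\<^sub>c idm n - emb AA) * H)"
    by (simp only: left_diff_distrib right_diff_distrib)
  also have "\<dots> = H - G" unfolding h(3) inv_of_cancel(2)[OF G h(2)] using g by simp
  finally show "G * (b * (Q * H)) = H - G" unfolding e by (simp add: mult.assoc)
qed

text \<open>At \<open>x = 0\<close> the first block column is \<open>[N h; c H b h]\<close> with
  \<open>N = I + Q H b\<close> and \<open>h\<close> invertible. The factor \<open>h\<close> cancels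
  in the quotient, and \<open>c H b (I - Q G b) = c (H - (H - G)) b = c G b\<close>. The exceptional
  set consists of the real eigenvalues of \<open>a\<close> and of \<open>AA\<close>.\<close>

lemma R_is_reflection: "reflection_coefficient m1 m2 V R"
proof -
  let ?Z = "\<lambda>A. {z :: real. \<not> (\<exists>B. inv_of n (complex_of_real z *\<^sub>c idm n - A) B)}"
  have fin: "finite (?Z A)" if "A \<in> carr n n" for A
    using finite_vimageI[OF finite_not_inv[OF that], of complex_of_real] by (auto simp: inj_on_def vimage_def)
  let ?m = "m1 + m2"
  let ?s = "shift m1 m2"
  let ?p = "idm m1"
  let ?q = "?s * adj ?s"
  note pq = shift_projections(1)[of m1] shift_projections(2-5)[of m1 m2]
  have main: "\<exists>F. jost_solution m1 m2 V z F \<and>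
           (let Y0 = F 0 * (1\<^sub>m m1 @\<^sub>r 0\<^sub>m m2 m1);
                Y1 = upper_block m1 Y0;
                Y2 = lower_block m1 Y0
            in invertible_mat Y1 \<and> R (of_real z) = Y2 * mat_inv Y1)"
    if G: "inv_of n (complex_of_real z *\<^sub>c idm n - a) G" and H: "inv_of n (complex_of_real z *\<^sub>c idm n - emb AA) H" for z G H
  proof -
    obtain f11 f12 f21 f22 h d where sol1: "psol v z f11 f21" and sol2: "psol v z f12 f22" and dh: "inv_of m1 d h"
      and car: "\<And>x. 0 \<le> x \<Longrightarrow> f11 x \<in> carr m1 m1" "\<And>x. 0 \<le> x \<Longrightarrow> f21 x \<in> carr m2 m1"
        "\<And>x. 0 \<le> x \<Longrightarrow> f12 x \<in> carr m1 m2" "\<And>x. 0 \<le> x \<Longrightarrow> f22 x \<in> carr m2 m2"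
      and j: "\<And>x. 0 \<le> x \<Longrightarrow> adj (f11 x) * f11 x - adj (f21 x) * f21 x = idm m1"
        "\<And>x. 0 \<le> x \<Longrightarrow> adj (f11 x) * f12 x - adj (f21 x) * f22 x = 0"
        "\<And>x. 0 \<le> x \<Longrightarrow> adj (f22 x) * f22 x - adj (f12 x) * f12 x = idm m2"
      and init: "f11 0 = (idm m1 + \<i> *\<^sub>c (adj b * y0 * (H * b))) * h" "f21 0 = ((- \<i>) *\<^sub>c (adj ((- \<i>) *\<^sub>c adj c) * (H * b))) * h"
      and lim: "((\<lambda>x. exp (- (\<i> * z * of_real x)) *\<^sub>c f11 x) \<longlongrightarrow> idm m1) at_top" "(f21 \<longlongrightarrow> 0) at_top"
        "(f12 \<longlongrightarrow> 0) at_top" "((\<lambda>x. exp (\<i> * z * of_real x) *\<^sub>c f22 x) \<longlongrightarrow> idm m2) at_top"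
      by (rule jost_blocks[OF H, unfolded T_0 E_0]) (rule that)
    define y1 where "y1 = (\<lambda>x. f11 x + f12 x * adj ?s)"
    define y2 where "y2 = (\<lambda>x. f21 x + f22 x * adj ?s)"
    have sub: "P \<in> carr k m1 \<Longrightarrow> P \<in> carr k ?m" for P k by (auto simp: carr_def)
    have yc: "y1 x \<in> carr m1 ?m" "y2 x \<in> carr m2 ?m" if x: "0 \<le> x" for x
    proof -
      have "f12 x * adj ?s \<in> carr m1 ?m" "f22 x * adj ?s \<in> carr m2 ?m"
        by (blast intro: carr_intros car[OF x] shift_carr)+
      then show "y1 x \<in> carr m1 ?m" "y2 x \<in> carr m2 ?m" unfolding y1_def y2_def
        using sub[OF car(1)[OF x]] sub[OF car(2)[OF x]] by simp_all
    qed
    define F where "F = (\<lambda>x. unemb ?m ?m (y1 x + ?s * y2 x))"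
    have Fc: "F x \<in> carrier_mat ?m ?m" for x by (simp add: F_def)
    have eF: "emb (F x) = y1 x + ?s * y2 x" if "0 \<le> x" for x
      using stack_carr[OF yc[OF that]] by (simp add: F_def)
    have "psol v z y1 y2" unfolding y1_def y2_def by (intro psol_add psol_mult sol1 sol2)
    then have ds: "dirac_solution m1 m2 V z ?m F"
      unfolding F_def by (intro psol_dirac[OF V_car' yc]) (simp_all add: psol_V)
    have Finv: "invertible_mat (F x)" if x: "0 \<le> x" for x
    proof -
      have Fe: "emb (F x) \<in> carr ?m ?m" using Fc by simp
      \<comment> \<open>The left factor is the adjoint of \<open>j F\<close>. By the
        \<open>j\<close> relations the product is \<open>j\<close>, whose square is the identity, so
        \<open>F\<close> has trivial kernel.\<close>
      have "adj (y1 x + ?s * (- y2 x)) * emb (F x) = adj (y1 x) * y1 x + adj (- y2 x) * y2 x"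
        unfolding eF[OF x] by (rule adj_stack_mult[OF yc(1)[OF x] _ yc[OF x]]) (use yc(2)[OF x] in simp)
      also have "\<dots> = (adj (f11 x) * f11 x - adj (f21 x) * f21 x) + (adj (f11 x) * f12 x - adj (f21 x) * f22 x) * adj ?s
        + ?s * adj (adj (f11 x) * f12 x - adj (f21 x) * f22 x) - ?s * (adj (f22 x) * f22 x - adj (f12 x) * f12 x) * adj ?s"
        by (simp add: y1_def y2_def algebra_simps)
      also have "\<dots> = ?p - ?q" unfolding j[OF x] using mult_idm[OF shift_carr, of m1 m2] by simp
      finally have J: "adj (y1 x + ?s * (- y2 x)) * emb (F x) = ?p - ?q" .
      have "\<exists>B. inv_of ?m (emb (F x)) B"
      proof (rule inv_of_exists[OF Fe])
        fix w assume w: "w \<in> colv ?m" "emb (F x) * w = 0"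
        have "(?p - ?q) * w = 0" unfolding J[symmetric] by (simp add: mult.assoc w(2))
        moreover have "(?p - ?q) * ((?p - ?q) * w) = (?p * ?p - ?p * ?q - ?q * ?p + ?q * ?q) * w"
          by (simp only: left_diff_distrib right_diff_distrib distrib_right mult.assoc) (simp add: algebra_simps)
        moreover have "(?p * ?p - ?p * ?q - ?q * ?p + ?q * ?q) * w = w" unfolding pq(1-4) using pq(5) w(1) by simp
        ultimately show "w = 0" by simp
      qed
      then show ?thesis using inv_of_imp_invertible_mat[OF Fc] by blast
    qed
    \<comment> \<open>This is \<open>exp (- i x z j)\<close>, the inverse of the normalizing
      exponential; hence the remainder \<open>D\<close> is \<open>ei F - I\<close>.\<close>
    define ei where "ei = (\<lambda>x :: real. exp (- (\<i> * z * of_real x)) *\<^sub>c ?p + exp (\<i> * z * of_real x) *\<^sub>c ?q)"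
    define D where "D = (\<lambda>x. unemb ?m ?m (ei x * emb (F x) - idm ?m))"
    have eic: "ei x \<in> carr ?m ?m" for x
    proof -
      have "idm m1 \<in> carr ?m ?m" by (auto simp: carr_def idm.rep_eq)
      moreover have "?q \<in> carr ?m ?m" by (blast intro: carr_intros shift_carr)
      ultimately show ?thesis by (simp add: ei_def)
    qed
    have Dc: "ei x * emb (F x) - idm ?m \<in> carr ?m ?m" for x
      using carr_mult[OF eic emb_carr[OF Fc]] by simp
    have lim0: "((\<lambda>x. ei x * emb (F x) - idm ?m) \<longlongrightarrow> 0) at_top"
    proof -
      have small: "((\<lambda>x. exp (s * (\<i> * z * of_real x)) *\<^sub>c f x) \<longlongrightarrow> 0) at_top" if "(f \<longlongrightarrow> 0) at_top" "s = 1 \<or> s = -1" for f :: "real \<Rightarrow> pmat" and s :: complex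
      proof -
        have "((\<lambda>x. norm (f x)) \<longlongrightarrow> 0) at_top" using that(1) by (rule tendsto_norm_zero)
        then have "((\<lambda>x. norm (exp (s * (\<i> * z * of_real x)) *\<^sub>c f x)) \<longlongrightarrow> 0) at_top" using that(2) by auto
        then show ?thesis by (rule tendsto_norm_zero_cancel)
      qed
      have s12: "((\<lambda>x. exp (- (\<i> * z * of_real x)) *\<^sub>c f12 x) \<longlongrightarrow> 0) at_top" using small[OF lim(3), of "-1"] by simp
      have s21: "((\<lambda>x. exp (\<i> * z * of_real x) *\<^sub>c f21 x) \<longlongrightarrow> 0) at_top" using small[OF lim(2), of 1] by simp
      have "((\<lambda>x. (exp (- (\<i> * z * of_real x)) *\<^sub>c f11 x + (exp (- (\<i> * z * of_real x)) *\<^sub>c f12 x) * adj ?s)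
          + ?s * (exp (\<i> * z * of_real x) *\<^sub>c f21 x + (exp (\<i> * z * of_real x) *\<^sub>c f22 x) * adj ?s) - idm ?m)
        \<longlongrightarrow> (idm m1 + 0 * adj ?s) + ?s * (0 + idm m2 * adj ?s) - idm ?m) at_top"
        by (intro tendsto_intros s12 s21 lim)
      moreover have "(idm m1 + 0 * adj ?s) + ?s * (0 + idm m2 * adj ?s) - idm ?m = 0"
        using idm_adj(1)[OF shift_carr[of m1 m2]] by (simp add: shift_mult_adj_shift)
      moreover have "\<forall>\<^sub>F x in at_top. (exp (- (\<i> * z * of_real x)) *\<^sub>c f11 x + (exp (- (\<i> * z * of_real x)) *\<^sub>c f12 x) * adj ?s)
          + ?s * (exp (\<i> * z * of_real x) *\<^sub>c f21 x + (exp (\<i> * z * of_real x) *\<^sub>c f22 x) * adj ?s) - idm ?m = ei x * emb (F x) - idm ?m"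
        using eventually_ge_at_top[of 0]
      proof eventually_elim
        case (elim x)
        have 1: "?p * y1 x = y1 x" by (rule idm_mult[OF yc(1)[OF elim]])
        have 2: "?p * (?s * y2 x) = 0" by (simp add: mult.assoc[symmetric] idm_mult_shift)
        have 3: "?q * y1 x = 0" using shift_mult[OF yc(1)[OF elim]] by (simp add: mult.assoc)
        have 4: "?q * (?s * y2 x) = ?s * y2 x"
        proof -
          have "?q * (?s * y2 x) = ?s * ((adj ?s * ?s) * y2 x)" by (simp only: mult.assoc)
          then show ?thesis unfolding adj_shift_mult_shift using yc(2)[OF elim] by simp
        qed
        have "ei x * emb (F x) = exp (- (\<i> * z * of_real x)) *\<^sub>c (?p * y1 x + ?p * (?s * y2 x)) + exp (\<i> * z * of_real x) *\<^sub>c (?q * y1 x + ?q * (?s * y2 x))"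
          unfolding ei_def eF[OF elim] by (simp only: distrib_left distrib_right cscale_mult_left cscale_add add_ac)
        then show ?case unfolding 1 2 3 4 by (simp add: y1_def y2_def distrib_left cscale_distribs)
      qed
      ultimately show ?thesis by (simp add: Lim_transform_eventually)
    qed
    have Dl: "((\<lambda>x. D x $$ (i, l)) \<longlongrightarrow> 0) at_top" if "i < ?m" "l < ?m" for i l
      using tendsto_ent[OF lim0, of i l] that by (simp add: D_def)
    have FD: "F x = mat_exp ((\<i> * of_real x * of_real z) \<cdot>\<^sub>m dirac_j m1 m2) * (1\<^sub>m ?m + D x)" if x: "0 \<le> x" for x
    proof (rule emb_inj[OF Fc])
      let ?t = "\<i> * of_real x * of_real z"
      have D1: "1\<^sub>m ?m + D x \<in> carrier_mat ?m ?m" by (simp add: D_def)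
      have t: "ei x = exp (- ?t) *\<^sub>c ?p + exp ?t *\<^sub>c ?q" by (simp add: ei_def mult_ac)
      show "mat_exp (?t \<cdot>\<^sub>m dirac_j m1 m2) * (1\<^sub>m ?m + D x) \<in> carrier_mat ?m ?m"
        using mult_carrier_mat[OF emb_mat_exp_dirac_j(2) D1] .
      have "emb (1\<^sub>m ?m + D x) = ei x * emb (F x)" using emb_add[of "1\<^sub>m ?m" ?m ?m "D x"] Dc[of x] by (simp add: D_def)
      then have "emb (mat_exp (?t \<cdot>\<^sub>m dirac_j m1 m2) * (1\<^sub>m ?m + D x)) = (exp ?t *\<^sub>c ?p + exp (- ?t) *\<^sub>c ?q) * (ei x * emb (F x))"
        unfolding emb_mult[OF emb_mat_exp_dirac_j(2) D1] emb_mat_exp_dirac_j(1) by simp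
      also have "\<dots> = ((exp ?t *\<^sub>c ?p + exp (- ?t) *\<^sub>c ?q) * ei x) * emb (F x)" by (simp only: mult.assoc)
      also have "(exp ?t *\<^sub>c ?p + exp (- ?t) *\<^sub>c ?q) * ei x = idm ?m"
      proof -
        have *: "(g *\<^sub>c P + h *\<^sub>c Q) * (h *\<^sub>c P + g *\<^sub>c Q) = (g * h) *\<^sub>c (P * P) + (g * g) *\<^sub>c (P * Q) + (h * h) *\<^sub>c (Q * P) + (g * h) *\<^sub>c (Q * Q)" for P Q :: pmat and g h
          by (intro pmat_eqI) (simp add: algebra_simps)
        have "exp ?t * exp (- ?t) = 1" by (simp add: mult_exp_exp)
        then show ?thesis unfolding t * pq(1-4) using pq(5) by simp
      qed
      also have "idm ?m * emb (F x) = emb (F x)" by (rule idm_mult[OF emb_carr[OF Fc]])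
      finally show "emb (F x) = emb (mat_exp (?t \<cdot>\<^sub>m dirac_j m1 m2) * (1\<^sub>m ?m + D x))" ..
    qed
    have jost: "jost_solution m1 m2 V z F"
      unfolding jost_solution_def
    proof (intro conjI exI[of _ D] allI impI ds)
      show "D x \<in> carrier_mat ?m ?m" for x by (simp add: D_def)
    qed (fact Finv Dl FD)+
    let ?W = "1\<^sub>m m1 @\<^sub>r 0\<^sub>m m2 m1"
    have W: "?W \<in> carrier_mat ?m m1" "emb ?W = idm m1"
      using append_rows_carrier[of "1\<^sub>m m1" m1 m1 "0\<^sub>m m2 m1" m2] emb_append_rows[of "1\<^sub>m m1" m1 m1 "0\<^sub>m m2 m1" m2] by auto
    let ?Y = "F 0 * ?W"
    have Yc: "?Y \<in> carrier_mat ?m m1" by (rule mult_carrier_mat[OF Fc W(1)])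
    note c0 = car(1)[of 0, OF order_refl] car(2)[of 0, OF order_refl]
    have eY: "emb ?Y = f11 0 + ?s * f21 0"
    proof -
      have as: "adj ?s * idm m1 = 0" by (rule shift_mult[OF carr_simps(8)])
      have "emb ?Y = (y1 0 + ?s * y2 0) * idm m1" unfolding emb_mult[OF Fc W(1)] W(2) eF[OF order_refl] ..
      also have "\<dots> = (f11 0 * idm m1 + f12 0 * (adj ?s * idm m1)) + ?s * (f21 0 * idm m1 + f22 0 * (adj ?s * idm m1))"
        by (simp only: y1_def y2_def distrib_right distrib_left mult.assoc)
      finally show ?thesis unfolding as mult_idm[OF c0(1)] mult_idm[OF c0(2)] by simp
    qed
    note bl = emb_blocks[OF Yc eY c0]
    let ?Q = "\<i> *\<^sub>c (adj b * y0)"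
    let ?N = "idm m1 + ?Q * (H * b)"
    let ?M = "idm m1 - ?Q * (G * b)"
    note g = inv_ofD[OF G] and hh = inv_ofD[OF H] and ri = resolvent_identity[OF G H] and dhd = inv_ofD[OF dh]
    have NM: "inv_of m1 ?N ?M"
      unfolding inv_of_def
    proof (intro conjI)
      have Qc: "?Q \<in> carr m1 n" by (blast intro: carr_intros re' y0_c)
      have qc: "?Q * (H * b) \<in> carr m1 m1" "?Q * (G * b) \<in> carr m1 m1" by (blast intro: carr_intros Qc re' g hh)+
      show "?N \<in> carr m1 m1" "?M \<in> carr m1 m1" using qc by simp_all
      have "?N * ?M = idm m1 * idm m1 + ?Q * (H * b) * idm m1 - idm m1 * (?Q * (G * b)) - ?Q * ((H * (b * (?Q * G))) * b)"
        by (simp only: distrib_left distrib_right left_diff_distrib right_diff_distrib mult.assoc) (simp add: algebra_simps)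
      also have "\<dots> = idm m1" unfolding ri mult_idm[OF qc(1)] idm_mult[OF qc(2)] pq(1) by (simp add: left_diff_distrib right_diff_distrib)
      finally show "?N * ?M = idm m1" .
      have "?M * ?N = idm m1 * idm m1 + idm m1 * (?Q * (H * b)) - (?Q * (G * b)) * idm m1 - ?Q * ((G * (b * (?Q * H))) * b)"
        by (simp only: distrib_left distrib_right left_diff_distrib right_diff_distrib mult.assoc) (simp add: algebra_simps)
      also have "\<dots> = idm m1" unfolding ri mult_idm[OF qc(2)] idm_mult[OF qc(1)] pq(1) by (simp add: left_diff_distrib right_diff_distrib)
      finally show "?M * ?N = idm m1" .
    qed
    have f110: "f11 0 = ?N * h" unfolding init by (simp add: mult.assoc)
    have f210: "f21 0 = c * (H * b) * h" unfolding init by simp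
    have inv: "inv_of m1 (emb (upper_block m1 ?Y)) (d * ?M)"
      unfolding bl(1) f110 by (rule inv_of_mult[OF NM inv_of_sym[OF dh]])
    have Y1: "invertible_mat (upper_block m1 ?Y)" by (rule inv_of_imp_invertible_mat[OF bl(3) inv])
    note mi = emb_mat_inv_eq[OF bl(3) inv]
    have "R (of_real z) = lower_block m1 ?Y * mat_inv (upper_block m1 ?Y)"
    proof (rule emb_inj[OF R mult_carrier_mat[OF bl(4) mi(2)]])
      have "emb (lower_block m1 ?Y * mat_inv (upper_block m1 ?Y)) = c * (H * b) * (h * d) * ?M"
        unfolding emb_mult[OF bl(4) mi(2)] mi(1) bl(2) f210 by (simp only: mult.assoc)
      also have "\<dots> = c * (H * b) * idm m1 * idm m1 - c * ((H * (b * (?Q * G))) * b)"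
        unfolding dhd(4) using re'(2) hh(2) by (simp add: right_diff_distrib mult.assoc)
      also have "\<dots> = c * G * b" unfolding ri using re'(2) hh(2) by (simp add: left_diff_distrib right_diff_distrib mult.assoc)
      finally show "emb (R (of_real z)) = emb (lower_block m1 ?Y * mat_inv (upper_block m1 ?Y))"
        using re'(4)[OF G] by simp
    qed
    then show ?thesis using jost Y1 by (intro exI[of _ F]) (simp add: Let_def)
  qed
  show ?thesis unfolding reflection_coefficient_def
  proof (intro exI[of _ "?Z a \<union> ?Z (emb AA)"] conjI allI impI)
    show "finite (?Z a \<union> ?Z (emb AA))" using fin re'(1) AA(1) by simp
  qed (use main in auto)
qed

end

text \<open>All minimal realizations and all positive solutions \<open>X\<close> are covered, so the
  recovery holds for every choice made on the way. Invertibility of \<open>S(x)\<close> is asserted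
  because \<open>mat_inv\<close> is unspecified on singular matrices, and the last clause justifies
  speaking of the Weyl function.\<close>

theorem theorem3p7:
  fixes m1 m2 :: nat and R :: "complex \<Rightarrow> complex mat"
  assumes "0 < m1" and "0 < m2"
    and "rational_mat_fun m2 m1 R"
    and "strictly_proper m2 m1 R"
    and "\<And>x :: real. contractive_at m1 R (of_real x)"
    and "\<And>z. Im z > 0 \<Longrightarrow> \<not> mat_fun_pole m2 m1 R z"
  shows "(\<exists>n \<A> \<B> \<C>. minimal_realization m2 m1 R n \<A> \<B> \<C>) \<and>
    (\<forall>n \<A> \<B> \<C>. minimal_realization m2 m1 R n \<A> \<B> \<C> \<longrightarrow>
      (\<exists>X. mat_pos_def n X \<and> riccati \<A> \<B> \<C> X = 0\<^sub>m n n) \<and>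
      (\<forall>X. mat_pos_def n X \<and> riccati \<A> \<B> \<C> X = 0\<^sub>m n n \<longrightarrow>
        (let A = \<A> + \<i> \<cdot>\<^sub>m (\<B> * mat_adjoint \<B> * mat_inv X);
             \<theta>1 = \<B>;
             \<theta>2 = (- \<i>) \<cdot>\<^sub>m (X * mat_adjoint \<C>);
             v = gbdt_v A X \<theta>1 \<theta>2
         in (\<forall>x\<ge>0. invertible_mat (gbdt_S A X \<theta>1 \<theta>2 x)) \<and>
            reflection_coefficient m1 m2 v R \<and>
            L2_mat_fun m1 m2 v \<and>
            (\<forall>i<m1. \<forall>j<m2. ((\<lambda>x. v x $$ (i, j)) \<longlongrightarrow> 0) at_top) \<and>
            weyl_function m1 m2 v R \<and>
            (\<forall>\<phi>. weyl_function m1 m2 v \<phi> \<longrightarrow> (\<forall>z. Im z > 0 \<longrightarrow> \<phi> z = R z)))))"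
proof (intro conjI allI impI)
  show "\<exists>n \<A> \<B> \<C>. minimal_realization m2 m1 R n \<A> \<B> \<C>"
    by (rule exists_minimal_realization[OF assms(3,4,1)])
next
  fix n \<A> \<B> \<C> assume "minimal_realization m2 m1 R n \<A> \<B> \<C>"
  then show "\<exists>X. mat_pos_def n X \<and> riccati \<A> \<B> \<C> X = 0\<^sub>m n n"
    using exists_riccati_solution[OF assms(3,5)] assms(6) by blast
next
  fix n \<A> \<B> \<C> X
  assume min: "minimal_realization m2 m1 R n \<A> \<B> \<C>" and X: "mat_pos_def n X \<and> riccati \<A> \<B> \<C> X = 0\<^sub>m n n"
  have Rc: "R z \<in> carrier_mat m2 m1" for z using assms(3) by (simp add: rational_mat_fun_def)
  have re: "realization m2 m1 R n \<A> \<B> \<C>" using min by (simp add: minimal_realization_def)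
  interpret recovered m1 m2 n R \<A> \<B> \<C> X
    using re X unfolding realization_iff[of R m2 m1, OF Rc] by unfold_locales (auto simp: Rc)
  show "let A = \<A> + \<i> \<cdot>\<^sub>m (\<B> * mat_adjoint \<B> * mat_inv X);
             \<theta>1 = \<B>;
             \<theta>2 = (- \<i>) \<cdot>\<^sub>m (X * mat_adjoint \<C>);
             v = gbdt_v A X \<theta>1 \<theta>2
         in (\<forall>x\<ge>0. invertible_mat (gbdt_S A X \<theta>1 \<theta>2 x)) \<and>
            reflection_coefficient m1 m2 v R \<and>
            L2_mat_fun m1 m2 v \<and>
            (\<forall>i<m1. \<forall>j<m2. ((\<lambda>x. v x $$ (i, j)) \<longlongrightarrow> 0) at_top) \<and>
            weyl_function m1 m2 v R \<and>
            (\<forall>\<phi>. weyl_function m1 m2 v \<phi> \<longrightarrow> (\<forall>z. Im z > 0 \<longrightarrow> \<phi> z = R z))"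
    unfolding Let_def AA_def[symmetric] th2_def[symmetric]
    using S_invertible R_is_reflection V_L2 V_tendsto R_is_weyl weyl_unique by blast
qed

end
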